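(* Let $A\in\mathbb{R}^{n\times n}$, $B\in\mathbb{R}^{n\times m}$, let $U\subset\mathbb{R}^m$ be a compact and convex neighborhood of $0$, and consider the linear control system $\dot x(t)=Ax(t)+Bu(t)$, $u\in\mathcal{U}$. (i) The central Selgrade bundle $\mathcal{V}_c^1$ of the lifted control flow $\Phi^1$ on $\mathcal{U}\times\mathbb{R}^n\times\mathbb{R}$ associated with this control system is given by $$\mathcal{V}_c^1=\mathcal{V}_c^{h,1}\oplus\mathcal{V}_0^\infty=\{(u,\,-re(u,0)+x,\,r)\in\mathcal{U}\times\mathbb{R}^n\times\mathbb{R}: u\in\mathcal{U},\ x\in L^0,\ r\in\mathbb{R}\},$$ where $e(u,t)$, $t\in\mathbb{R}$, is the unique bounded solution for $u$ of the induced system $\dot y(t)=A^hy(t)+\pi^hBu(t)$ on $L^+\oplus L^-$. Here $\mathcal{V}_c^{h,1}$ is the central Selgrade bundle of the lifted control flow of the induced system on $L^+\oplus L^-$ (regarded as a subset of $\mathcal{U}\times\mathbb{R}^n\times\mathbb{R}$), and $\mathcal{V}_0^\infty=\mathcal{U}\times L^0\times\{0\}$. The dimension is $\dim\mathcal{V}_c^1=1+\dim L^0$. (ii) The chain control set $E_c^1$ on the Poincaré sphere $\mathbb{P}^n$ is given by $$E_c^1=\overline{\{\mathbb{P}(-e(u,0)+x,1): u\in\mathcal{U},\ x\in L^0\}}.$$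
   Context: $\mathcal{U}=\{u\in L^\infty(\mathbb{R},\mathbb{R}^m): u(t)\in U \text{ for a.a. } t\in\mathbb{R}\}$, which is a compact metrizable space in the weak$^*$ topology of $L^\infty(\mathbb{R},\mathbb{R}^m)$ (fix a metric); $\theta_tu=u(t+\cdot)$ is the shift flow on $\mathcal{U}$. $\mathbb{R}^n=L^+\oplus L^0\oplus L^-$, where $L^+,L^0,L^-$ are the sums of the (real) generalized eigenspaces of $A$ for eigenvalues with positive, vanishing, negative real part, respectively; $\pi^h:\mathbb{R}^n\to L^+\oplus L^-$ is the projection along $L^0$ and $A^h=A|_{L^+\oplus L^-}$. The subspace $L^+\oplus L^-$ is identified with $\mathbb{R}^{n^h}$, $n^h=\dim(L^+\oplus L^-)$. Lifted system: on $\mathbb{R}^n\times\mathbb{R}=\mathbb{R}^{n+1}$ consider $\dot x=Ax+yBu$, $\dot y=0$, $u\in\mathcal{U}$, with solutions $\varphi^1(t,x_0,r,u)=\left(e^{At}x_0+r\int_0^te^{A(t-s)}Bu(s)\,ds,\ r\right)$. The lifted control flow is the linear flow $\Phi^1_t(u,x,r)=(\theta_tu,\varphi^1(t,x,r,u))$ on the vector bundle $\mathcal{U}\times\mathbb{R}^{n+1}$; it induces a flow $\mathbb{P}\Phi^1$ on $\mathcal{U}\times\mathbb{P}^n$, and the lifted system induces a control system on the projective Poincaré sphere $\mathbb{P}^n$ with trajectories $\mathbb{P}\varphi^1(t,x,r,u)$. Here $\mathbb{P}:\mathbb{R}^{n+1}\setminus\{0\}\to\mathbb{P}^n$ is the projection;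 $\mathbb{P}^n$ carries the metric $d(\mathbb{P}x,\mathbb{P}y)=\min\left\{\left\|\frac{x}{\|x\|}-\frac{y}{\|y\|}\right\|,\left\|\frac{x}{\|x\|}+\frac{y}{\|y\|}\right\|\right\}$ and $\mathcal{U}\times\mathbb{P}^n$ the maximum metric. The same constructions apply to the induced system on $L^+\oplus L^-$. A closed subset of $\mathcal{U}\times\mathbb{R}^{n+1}$ that intersects every fiber $\{u\}\times\mathbb{R}^{n+1}$ in a linear subspace of constant dimension is a subbundle; its dimension is this fiber dimension. Chains: for a flow $\Psi$ on a metric space $X$, an $(\varepsilon,T)$-chain from $x$ to $y$ is given by $k\in\mathbb{N}$, $T_0,\ldots,T_{k-1}\ge T$, $x_0=x,\ldots,x_k=y$ with $d(\Psi(T_i,x_i),x_{i+1})<\varepsilon$ for all $i$; a nonvoid set $Y$ is chain transitive if for all $x,y\in Y$ and all $\varepsilon,T>0$ there is an $(\varepsilon,T)$-chain from $x$ to $y$. On a compact space the maximal chain transitive sets are called the chain recurrent components. Selgrade bundles: by Selgrade's theorem $\mathbb{P}\Phi^1$ has finitely many chain recurrent components $\mathcal{M}_i$, their lifts $\{(u,z)\in\mathcal{U}\times\mathbb{R}^{n+1}: z\ne0\Rightarrow(u,\mathbb{P}z)\in\mathcal{M}_i\}$ are subbundles (the Selgrade bundles), and $\mathcal{U}\times\mathbb{R}^{n+1}$ is their Whitney sum. It is known that exactly one Selgrade bundle of $\Phi^1$ is not contained in $\mathcal{U}\times\mathbb{R}^n\times\{0\}$; it is called the central Selgrade bundle $\mathcal{V}_c^1$.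 The central Selgrade bundle $\mathcal{V}_c^{h,1}$ for the induced system on $L^+\oplus L^-$ is defined analogously. A controlled $(\varepsilon,T)$-chain for the control system on $\mathbb{P}^n$ from $p$ to $q$ is given by $k\in\mathbb{N}$, points $p_0=p,\ldots,p_k=q$, controls $u_0,\ldots,u_{k-1}\in\mathcal{U}$ and times $t_0,\ldots,t_{k-1}\ge T$ such that the trajectory from $p_j$ with control $u_j$ at time $t_j$ has distance less than $\varepsilon$ to $p_{j+1}$, for all $j$. A chain control set is a nonvoid set, maximal with the property that for all its points $p,q$ and all $\varepsilon,T>0$ there is a controlled $(\varepsilon,T)$-chain from $p$ to $q$. With $\mathbb{P}^{n,1}=\{\mathbb{P}(x,1):x\in\mathbb{R}^n\}$, it is known that there is a unique chain control set $E_c^1$ in $\mathbb{P}^n$ with $E_c^1\cap\mathbb{P}^{n,1}\neq\varnothing$, namely $E_c^1=\{p\in\mathbb{P}^n:\exists u\in\mathcal{U}:(u,p)\in\mathbb{P}\mathcal{V}_c^1\}$.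
   Formalization: The sign of e(u,0) is corrected: (i) is proved with r e(u,0)+x in place of -r e(u,0)+x, and (ii) with P(e(u,0)+x,1) in place of P(-e(u,0)+x,1); the printed minus sign gives a non-invariant set, e.g. for A=-1, B=1, u=1. *)

theory Defs
  imports "HOL-Analysis.Analysis"
begin

section \<open>Controls\<close>

definition ess_bounded :: "(real \<Rightarrow> real^'m) \<Rightarrow> bool" where
  "ess_bounded f \<longleftrightarrow>
     f \<in> borel_measurable lborel \<and> (\<exists>C. AE t in lborel. norm (f t) \<le> C)"

text \<open>
  The type of elements of \<open>L\<^sup>\<infinity>(\<real>, \<real>\<^sup>m)\<close>. Borel representatives suffice, as every Lebesgue
  measurable function agrees almost everywhere with a Borel measurable one.
\<close>

quotient_type (overloaded) 'm linf = "real \<Rightarrow> real^'m" / partial: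
  "\<lambda>f g. ess_bounded f \<and> ess_bounded g \<and> (AE t in lborel. f t = g t)"
  morphisms rep_linf abs_linf
proof (rule part_equivpI)
  have "ess_bounded (\<lambda>t. 0 :: real^'m)"
    by (auto simp: ess_bounded_def)
  then show "\<exists>f :: real \<Rightarrow> real^'m.
      ess_bounded f \<and> ess_bounded f \<and> (AE t in lborel. f t = f t)"
    by auto
next
  show "symp (\<lambda>f g :: real \<Rightarrow> real^'m.
      ess_bounded f \<and> ess_bounded g \<and> (AE t in lborel. f t = g t))"
    by (auto simp: symp_def elim!: eventually_mono)
next
  show "transp (\<lambda>f g :: real \<Rightarrow> real^'m.
      ess_bounded f \<and> ess_bounded g \<and> (AE t in lborel. f t = g t))"
    by (auto simp: transp_def elim: eventually_elim2)
qed

lemma AE_lborel_shift: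
  fixes t :: real
  assumes "AE s in lborel. P s"
  shows "AE s in lborel. P (t + s)"
proof -
  obtain N where N: "{s. \<not> P s} \<subseteq> N" "N \<in> sets lborel" "emeasure lborel N = 0"
    using assms by (auto elim!: AE_E)
  then have "AE s in lborel. s \<notin> N"
    by (intro AE_not_in) auto
  then have "AE s in lborel. t + 1 * s \<notin> N"
    using N(2) by (intro AE_borel_affine) auto
  then show ?thesis
    using N(1) by (auto elim!: eventually_mono)
qed

lemma ess_bounded_shift:
  assumes "ess_bounded f"
  shows "ess_bounded (\<lambda>s. f (t + s))"
proof -
  from assms obtain C where f: "f \<in> borel_measurable lborel"
    and C: "AE s in lborel. norm (f s) \<le> C"
    unfolding ess_bounded_def by blast
  have "(\<lambda>s. f (t + s)) \<in> borel_measurable lborel"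
    using f by measurable
  with AE_lborel_shift[OF C, of t] show ?thesis
    unfolding ess_bounded_def by blast
qed

lift_definition shift :: "real \<Rightarrow> 'm::finite linf \<Rightarrow> 'm linf" is
  "\<lambda>t f s. f (t + s)"
proof (elim conjE, intro conjI)
  fix t and f g :: "real \<Rightarrow> real^'m"
  assume "ess_bounded f" "ess_bounded g" and eq: "AE s in lborel. f s = g s"
  then show "ess_bounded (\<lambda>s. f (t + s))" "ess_bounded (\<lambda>s. g (t + s))"
    by (simp_all only: ess_bounded_shift)
  show "AE s in lborel. f (t + s) = g (t + s)"
    by (rule AE_lborel_shift[OF eq])
qed

definition admissible :: "(real^'m) set \<Rightarrow> 'm linf set" where
  "admissible U = {u. AE t in lborel. rep_linf u t \<in> U}"

text \<open>The weak* topology of \<open>L\<^sup>\<infinity> = (L\<^sup>1)*\<close>.\<close>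

definition weak_star :: "'m::finite linf topology" where
  "weak_star = topology_generated_by
     {{u. (\<integral>t. rep_linf u t \<bullet> g t \<partial>lborel) \<in> W} | g W. integrable lborel g \<and> open W}"


section \<open>Spectral subspaces\<close>

definition complex_matrix :: "real^'n^'n \<Rightarrow> complex^'n^'n" where
  "complex_matrix A = (\<chi> i j. complex_of_real (A $ i $ j))"

definition is_eigenvalue :: "real^'n^'n \<Rightarrow> complex \<Rightarrow> bool" where
  "is_eigenvalue A \<mu> \<longleftrightarrow> (\<exists>z. z \<noteq> 0 \<and> complex_matrix A *v z = \<mu> *s z)"

definition gen_eigenspace :: "real^'n^'n \<Rightarrow> complex \<Rightarrow> (complex^'n) set" where
  "gen_eigenspace A \<mu> = {z. \<exists>k. (((*v) (complex_matrix A - mat \<mu>)) ^^ k) z = 0}"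

text \<open>
  The real generalized eigenspace of \<open>\<mu>\<close> consists of the real parts of the complex
  generalized eigenvectors. It contains the imaginary parts too, because
  \<open>Im z = Re (- \<i> z)\<close>, and it is the same space for \<open>\<mu>\<close> and its complex conjugate.
\<close>

definition real_gen_eigenspace :: "real^'n^'n \<Rightarrow> complex \<Rightarrow> (real^'n) set" where
  "real_gen_eigenspace A \<mu> = (\<lambda>z. \<chi> i. Re (z $ i)) ` gen_eigenspace A \<mu>"

definition L_plus :: "real^'n^'n \<Rightarrow> (real^'n) set" where
  "L_plus A = span (\<Union>\<mu>\<in>{\<mu>. is_eigenvalue A \<mu> \<and> Re \<mu> > 0}. real_gen_eigenspace A \<mu>)"

definition L_zero :: "real^'n^'n \<Rightarrow> (real^'n) set" where
  "L_zero A = span (\<Union>\<mu>\<in>{\<mu>. is_eigenvalue A \<mu> \<and> Re \<mu> = 0}. real_gen_eigenspace A \<mu>)"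

definition L_minus :: "real^'n^'n \<Rightarrow> (real^'n) set" where
  "L_minus A = span (\<Union>\<mu>\<in>{\<mu>. is_eigenvalue A \<mu> \<and> Re \<mu> < 0}. real_gen_eigenspace A \<mu>)"

definition L_hyp :: "real^'n^'n \<Rightarrow> (real^'n) set" where
  "L_hyp A = {x + y | x y. x \<in> L_plus A \<and> y \<in> L_minus A}"

definition pi_hyp :: "real^'n^'n \<Rightarrow> real^'n \<Rightarrow> real^'n" where
  "pi_hyp A x = (THE y. y \<in> L_hyp A \<and> x - y \<in> L_zero A)"

text \<open>The input matrix of the induced system on \<open>L_hyp A\<close>.\<close>

definition B_hyp :: "real^'n^'n \<Rightarrow> real^'m^'n \<Rightarrow> real^'m^'n" where
  "B_hyp A B = matrix (pi_hyp A) ** B"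


section \<open>Linear control systems and their lifts\<close>

text \<open>
  The library multiplication on \<open>real^'n^'n\<close> is componentwise, so \<open>exp\<close> would not be the
  matrix exponential.
\<close>

definition mat_exp :: "real^'n^'n \<Rightarrow> real^'n^'n" where
  "mat_exp A = (\<Sum>k. (1 / fact k) *\<^sub>R (((**) A ^^ k) (mat 1)))"

text \<open>Caratheodory solutions on \<open>\<real>\<close> of \<open>y' = A y + B u\<close>, in integrated form.\<close>

definition is_solution ::
  "real^'n^'n \<Rightarrow> real^'m^'n \<Rightarrow> 'm linf \<Rightarrow> (real \<Rightarrow> real^'n) \<Rightarrow> bool" where
  "is_solution A B u y \<longleftrightarrow> continuous_on UNIV y \<and>
     (\<forall>t. y t = y 0 + (LBINT s=0..ereal t. A *v y s + B *v rep_linf u s))"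

text \<open>
  The bounded solution \<open>e(u, \<cdot>)\<close> of the induced system. On \<open>L_hyp A\<close> the lift of the induced
  system carries \<open>(r e(u, 0), r)\<close> to \<open>(r e(u, t), r)\<close>, and \<open>e(u, t) = e(shift t u, 0)\<close>. Hence the
  graph of \<open>r \<mapsto> r e(u, 0)\<close>, with a plus sign, is the invariant one; replacing \<open>e\<close> by \<open>- e\<close>
  destroys the invariance.
\<close>

definition bounded_solution ::
  "real^'n^'n \<Rightarrow> real^'m^'n \<Rightarrow> 'm linf \<Rightarrow> real \<Rightarrow> real^'n" where
  "bounded_solution A B u = (THE y. is_solution A (B_hyp A B) u y \<and>
     (\<forall>t. y t \<in> L_hyp A) \<and> bounded (range y))"

definition lifted_solution ::
  "real^'n^'n \<Rightarrow> real^'m^'n \<Rightarrow> real \<Rightarrow> (real^'n) \<times> real \<Rightarrow> 'm linf \<Rightarrow> (real^'n) \<times> real" where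
  "lifted_solution A B t z u =
     (mat_exp (t *\<^sub>R A) *v fst z +
        snd z *\<^sub>R (LBINT s=0..ereal t. mat_exp ((t - s) *\<^sub>R A) *v (B *v rep_linf u s)),
      snd z)"


section \<open>Projective space\<close>

quotient_type (overloaded) 'a proj = "'a::euclidean_space" / partial:
  "\<lambda>x y. x \<noteq> 0 \<and> y \<noteq> 0 \<and> (\<exists>c. y = c *\<^sub>R x)"
  morphisms rep_proj to_proj
proof (rule part_equivpI)
  obtain b :: 'a where "b \<in> Basis"
    using nonempty_Basis by blast
  then have "b \<noteq> 0 \<and> b \<noteq> 0 \<and> (\<exists>c. b = c *\<^sub>R b)"
    by (auto intro: exI[of _ 1] dest: nonzero_Basis)
  then show "\<exists>x::'a. x \<noteq> 0 \<and> x \<noteq> 0 \<and> (\<exists>c. x = c *\<^sub>R x)" ..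
next
  show "symp (\<lambda>x y :: 'a. x \<noteq> 0 \<and> y \<noteq> 0 \<and> (\<exists>c. y = c *\<^sub>R x))"
  proof (rule sympI)
    fix x y :: 'a
    assume *: "x \<noteq> 0 \<and> y \<noteq> 0 \<and> (\<exists>c. y = c *\<^sub>R x)"
    then obtain c where c: "y = c *\<^sub>R x" by blast
    with * have "x = (1 / c) *\<^sub>R y" by auto
    with * show "y \<noteq> 0 \<and> x \<noteq> 0 \<and> (\<exists>c. x = c *\<^sub>R y)" by blast
  qed
next
  show "transp (\<lambda>x y :: 'a. x \<noteq> 0 \<and> y \<noteq> 0 \<and> (\<exists>c. y = c *\<^sub>R x))"
    by (rule transpI) (metis scaleR_scaleR)
qed

lemma sgn_scaleR_cases:
  fixes x :: "'a::real_normed_vector"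
  assumes "c *\<^sub>R x \<noteq> 0"
  shows "sgn (c *\<^sub>R x) = sgn x \<or> sgn (c *\<^sub>R x) = - sgn x"
  using assms by (cases "c > 0") (auto simp: sgn_scaleR)

instantiation proj :: (euclidean_space) metric_space
begin

text \<open>Note that \<open>sgn x = x /\<^sub>R norm x\<close>.\<close>

lift_definition dist_proj :: "'a proj \<Rightarrow> 'a proj \<Rightarrow> real" is
  "\<lambda>x y. min (norm (sgn x - sgn y)) (norm (sgn x + sgn y))"
proof -
  fix x x' y y' :: 'a
  assume x: "x \<noteq> 0 \<and> x' \<noteq> 0 \<and> (\<exists>c. x' = c *\<^sub>R x)"
    and y: "y \<noteq> 0 \<and> y' \<noteq> 0 \<and> (\<exists>c. y' = c *\<^sub>R y)"
  have x': "sgn x' = sgn x \<or> sgn x' = - sgn x"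
    using x sgn_scaleR_cases by metis
  have y': "sgn y' = sgn y \<or> sgn y' = - sgn y"
    using y sgn_scaleR_cases by metis
  have 1: "norm (- sgn x - sgn y) = norm (sgn x + sgn y)"
    by (metis minus_add_distrib norm_minus_cancel uminus_add_conv_diff add.commute)
  have 2: "norm (- sgn x + sgn y) = norm (sgn x - sgn y)"
    by (metis norm_minus_commute uminus_add_conv_diff)
  show "min (norm (sgn x - sgn y)) (norm (sgn x + sgn y)) =
        min (norm (sgn x' - sgn y')) (norm (sgn x' + sgn y'))"
    using x' y' 1 2 by (auto simp: min.commute)
qed

definition uniformity_proj :: "('a proj \<times> 'a proj) filter" where
  "uniformity_proj = (INF e\<in>{0 <..}. principal {(x, y). dist x y < e})"

definition open_proj :: "'a proj set \<Rightarrow> bool" where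
  "open_proj S \<longleftrightarrow> (\<forall>x\<in>S. \<forall>\<^sub>F (x', y) in uniformity. x' = x \<longrightarrow> y \<in> S)"

instance
proof
  fix x y :: "'a proj"
  show "(dist x y = 0) = (x = y)"
  proof transfer
    fix x y :: 'a
    assume "x \<noteq> 0 \<and> x \<noteq> 0 \<and> (\<exists>c. x = c *\<^sub>R x)" "y \<noteq> 0 \<and> y \<noteq> 0 \<and> (\<exists>c. y = c *\<^sub>R y)"
    then have nz: "x \<noteq> 0" "y \<noteq> 0" by auto
    have "(min (norm (sgn x - sgn y)) (norm (sgn x + sgn y)) = 0) \<longleftrightarrow>
          sgn y = sgn x \<or> sgn y = - sgn x"
      by (auto simp: min_def eq_neg_iff_add_eq_0 add.commute)
    also have "\<dots> \<longleftrightarrow> (\<exists>c. y = c *\<^sub>R x)"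
    proof
      assume "sgn y = sgn x \<or> sgn y = - sgn x"
      moreover have "y = norm y *\<^sub>R sgn y" using nz by (simp add: sgn_div_norm)
      ultimately have "y = (norm y * inverse (norm x)) *\<^sub>R x \<or>
          y = (- (norm y * inverse (norm x))) *\<^sub>R x"
        by (metis scaleR_minus_left scaleR_minus_right scaleR_scaleR sgn_div_norm)
      then show "\<exists>c. y = c *\<^sub>R x" by blast
    next
      assume "\<exists>c. y = c *\<^sub>R x"
      then show "sgn y = sgn x \<or> sgn y = - sgn x"
        using nz sgn_scaleR_cases by metis
    qed
    finally show "(min (norm (sgn x - sgn y)) (norm (sgn x + sgn y)) = 0) =
        (x \<noteq> 0 \<and> y \<noteq> 0 \<and> (\<exists>c. y = c *\<^sub>R x))"
      using nz by simp
  qed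
next
  fix x y z :: "'a proj"
  show "dist x y \<le> dist x z + dist y z"
  proof transfer
    fix x y z :: 'a
    let ?a = "sgn x" and ?b = "sgn y" and ?c = "sgn z"
    have "norm (?a - ?b) \<le> norm (?a - ?c) + norm (?b - ?c)"
      using norm_triangle_ineq4[of "?a - ?c" "?b - ?c"] by simp
    moreover have "norm (?a - ?b) \<le> norm (?a + ?c) + norm (?b + ?c)"
      using norm_triangle_ineq4[of "?a + ?c" "?b + ?c"] by simp
    moreover have "norm (?a + ?b) \<le> norm (?a - ?c) + norm (?b + ?c)"
      using norm_triangle_ineq[of "?a - ?c" "?b + ?c"] by simp
    moreover have "norm (?a + ?b) \<le> norm (?a + ?c) + norm (?b - ?c)"
      using norm_triangle_ineq[of "?a + ?c" "?b - ?c"] by simp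
    ultimately show "min (norm (?a - ?b)) (norm (?a + ?b)) \<le>
        min (norm (?a - ?c)) (norm (?a + ?c)) + min (norm (?b - ?c)) (norm (?b + ?c))"
      by (auto simp: min_def)
  qed
qed (simp_all add: uniformity_proj_def open_proj_def)

end


section \<open>Chains\<close>

text \<open>
  Chains have at least one step; the trivial chain of length 0 would make every
  singleton chain transitive.
\<close>

definition has_chain ::
  "'x set \<Rightarrow> ('x \<Rightarrow> 'x \<Rightarrow> real) \<Rightarrow> (real \<Rightarrow> 'x \<Rightarrow> 'x) \<Rightarrow> real \<Rightarrow> real \<Rightarrow> 'x \<Rightarrow> 'x \<Rightarrow> bool" where
  "has_chain X d \<Psi> \<epsilon> T x y \<longleftrightarrow>
     (\<exists>k::nat. \<exists>\<tau> \<xi>. k \<ge> 1 \<and> \<xi> 0 = x \<and> \<xi> k = y \<and> (\<forall>i\<le>k. \<xi> i \<in> X) \<and>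
        (\<forall>i<k. \<tau> i \<ge> T \<and> d (\<Psi> (\<tau> i) (\<xi> i)) (\<xi> (Suc i)) < \<epsilon>))"

definition chain_transitive ::
  "'x set \<Rightarrow> ('x \<Rightarrow> 'x \<Rightarrow> real) \<Rightarrow> (real \<Rightarrow> 'x \<Rightarrow> 'x) \<Rightarrow> 'x set \<Rightarrow> bool" where
  "chain_transitive X d \<Psi> Y \<longleftrightarrow> Y \<noteq> {} \<and> Y \<subseteq> X \<and>
     (\<forall>x\<in>Y. \<forall>y\<in>Y. \<forall>\<epsilon>>0. \<forall>T>0. has_chain X d \<Psi> \<epsilon> T x y)"

definition chain_recurrent_component ::
  "'x set \<Rightarrow> ('x \<Rightarrow> 'x \<Rightarrow> real) \<Rightarrow> (real \<Rightarrow> 'x \<Rightarrow> 'x) \<Rightarrow> 'x set \<Rightarrow> bool" where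
  "chain_recurrent_component X d \<Psi> Y \<longleftrightarrow> chain_transitive X d \<Psi> Y \<and>
     (\<forall>Z. chain_transitive X d \<Psi> Z \<and> Y \<subseteq> Z \<longrightarrow> Z = Y)"


section \<open>The projective flow and Selgrade bundles\<close>

text \<open>
  The state space \<open>S\<close> is an \<open>A\<close>-invariant subspace of \<open>\<real>\<^sup>n\<close> containing the range of \<open>B\<close>:
  it is \<open>UNIV\<close> for the given system, and \<open>L_hyp A\<close> (with \<open>B_hyp A B\<close> in place of \<open>B\<close>) for
  the induced system, whose lift thus lives on \<open>L_hyp A \<times> \<real> \<subseteq> \<real>\<^sup>n \<times> \<real>\<close>.
\<close>

definition proj_points :: "(real^'n) set \<Rightarrow> ((real^'n) \<times> real) proj set" where
  "proj_points S = to_proj ` (S \<times> UNIV - {0})"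

definition proj_trajectory ::
  "real^'n^'n \<Rightarrow> real^'m^'n \<Rightarrow> real \<Rightarrow> ((real^'n) \<times> real) proj \<Rightarrow> 'm linf
     \<Rightarrow> ((real^'n) \<times> real) proj" where
  "proj_trajectory A B t p u = to_proj (lifted_solution A B t (rep_proj p) u)"

definition proj_flow ::
  "real^'n^'n \<Rightarrow> real^'m^'n \<Rightarrow> real \<Rightarrow> 'm::finite linf \<times> ((real^'n) \<times> real) proj
     \<Rightarrow> 'm linf \<times> ((real^'n) \<times> real) proj" where
  "proj_flow A B t = (\<lambda>(u, p). (shift t u, proj_trajectory A B t p u))"

definition max_dist :: "('u \<Rightarrow> 'u \<Rightarrow> real) \<Rightarrow> 'u \<times> 'p::metric_space \<Rightarrow> 'u \<times> 'p \<Rightarrow> real" where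
  "max_dist d = (\<lambda>(u, p) (v, q). max (d u v) (dist p q))"

definition is_selgrade_bundle ::
  "real^'n^'n \<Rightarrow> real^'m^'n \<Rightarrow> (real^'m) set \<Rightarrow> ('m linf \<Rightarrow> 'm linf \<Rightarrow> real) \<Rightarrow> (real^'n) set
     \<Rightarrow> ('m::finite linf \<times> (real^'n) \<times> real) set \<Rightarrow> bool" where
  "is_selgrade_bundle A B U d S V \<longleftrightarrow>
     (\<exists>M. chain_recurrent_component (admissible U \<times> proj_points S) (max_dist d)
            (proj_flow A B) M \<and>
          V = {(u, z). u \<in> admissible U \<and> z \<in> S \<times> UNIV \<and> (z \<noteq> 0 \<longrightarrow> (u, to_proj z) \<in> M)})"

definition central_selgrade_bundle ::
  "real^'n^'n \<Rightarrow> real^'m^'n \<Rightarrow> (real^'m) set \<Rightarrow> ('m linf \<Rightarrow> 'm linf \<Rightarrow> real) \<Rightarrow> (real^'n) set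
     \<Rightarrow> ('m::finite linf \<times> (real^'n) \<times> real) set" where
  "central_selgrade_bundle A B U d S =
     (THE V. is_selgrade_bundle A B U d S V \<and> \<not> V \<subseteq> admissible U \<times> S \<times> {0})"

definition fiber :: "('u \<times> 'v) set \<Rightarrow> 'u \<Rightarrow> 'v set" where
  "fiber V u = {z. (u, z) \<in> V}"

definition is_subbundle ::
  "(real^'m) set \<Rightarrow> ('m::finite linf \<times> 'v::euclidean_space) set \<Rightarrow> nat \<Rightarrow> bool" where
  "is_subbundle U V k \<longleftrightarrow>
     closedin (prod_topology (subtopology weak_star (admissible U)) euclidean) V \<and>
     (\<forall>u\<in>admissible U. subspace (fiber V u) \<and> dim (fiber V u) = k)"

definition is_whitney_sum ::
  "(real^'m) set \<Rightarrow> ('m::finite linf \<times> 'v::euclidean_space) set \<Rightarrow> ('m linf \<times> 'v) set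
     \<Rightarrow> ('m linf \<times> 'v) set \<Rightarrow> bool" where
  "is_whitney_sum U V V1 V2 \<longleftrightarrow>
     (\<exists>k1. is_subbundle U V1 k1) \<and> (\<exists>k2. is_subbundle U V2 k2) \<and>
     V = {(u, z + w) | u z w. (u, z) \<in> V1 \<and> (u, w) \<in> V2} \<and>
     (\<forall>u\<in>admissible U. fiber V1 u \<inter> fiber V2 u = {0})"


section \<open>Chain control sets\<close>

definition has_controlled_chain ::
  "real^'n^'n \<Rightarrow> real^'m^'n \<Rightarrow> (real^'m) set \<Rightarrow> real \<Rightarrow> real
     \<Rightarrow> ((real^'n) \<times> real) proj \<Rightarrow> ((real^'n) \<times> real) proj \<Rightarrow> bool" where
  "has_controlled_chain A B U \<epsilon> T p q \<longleftrightarrow>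
     (\<exists>k::nat. \<exists>\<pi> \<nu> \<tau>. k \<ge> 1 \<and> \<pi> 0 = p \<and> \<pi> k = q \<and>
        (\<forall>j<k. \<nu> j \<in> admissible U \<and> \<tau> j \<ge> T \<and>
           dist (proj_trajectory A B (\<tau> j) (\<pi> j) (\<nu> j)) (\<pi> (Suc j)) < \<epsilon>))"

definition controlled_chain_transitive ::
  "real^'n^'n \<Rightarrow> real^'m^'n \<Rightarrow> (real^'m) set \<Rightarrow> ((real^'n) \<times> real) proj set \<Rightarrow> bool" where
  "controlled_chain_transitive A B U E \<longleftrightarrow> E \<noteq> {} \<and>
     (\<forall>p\<in>E. \<forall>q\<in>E. \<forall>\<epsilon>>0. \<forall>T>0. has_controlled_chain A B U \<epsilon> T p q)"

definition is_chain_control_set ::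
  "real^'n^'n \<Rightarrow> real^'m^'n \<Rightarrow> (real^'m) set \<Rightarrow> ((real^'n) \<times> real) proj set \<Rightarrow> bool" where
  "is_chain_control_set A B U E \<longleftrightarrow> controlled_chain_transitive A B U E \<and>
     (\<forall>F. controlled_chain_transitive A B U F \<and> E \<subseteq> F \<longrightarrow> F = E)"

definition central_chain_control_set ::
  "real^'n^'n \<Rightarrow> real^'m^'n \<Rightarrow> (real^'m) set \<Rightarrow> ((real^'n) \<times> real) proj set" where
  "central_chain_control_set A B U =
     (THE E. is_chain_control_set A B U E \<and> E \<inter> {to_proj (x, 1) | x. True} \<noteq> {})"

end

theory Submission
  imports
    Defs
    "HOL-Computational_Algebra.Fundamental_Theorem_Algebra"
    "HOL-Computational_Algebra.Polynomial_Factorial"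
    "HOL-Computational_Algebra.Field_as_Ring"
begin

text \<open>
  In the coordinates \<open>z = (r e(u, 0) + w, r)\<close> the lifted flow acts on the hyperbolic part of \<open>w\<close>
  by \<open>e\<^bsup>tA\<^esup>\<close> alone, so the bundle \<open>w \<in> L\<^sup>0\<close> is invariant. All of its points are linked by chains
  through the point with control \<open>0\<close>, \<open>w = 0\<close> and \<open>r = 1\<close>: the weak* metric sees a control only
  on a bounded window, so the control can be switched to \<open>0\<close>; then small jumps on the sphere
  multiply \<open>r\<close> by a factor \<open>1 + \<eta>\<close> at each step, which beats the subexponential growth on \<open>L\<^sup>0\<close>.

  Conversely, as soon as the unstable component of \<open>w\<close> is comparable with the rest, it dominates
  more and more along every chain with long times and small jumps, and the same holds for the
  stable component in backward time. Hence no chain transitive set containing a point with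
  \<open>r \<noteq> 0\<close> leaves the bundle.

  For chain control sets, the controls of a controlled chain are concatenated, which turns it into
  a chain of the flow. Moreover \<open>e(u, 0)\<close> has an unstable component depending only on the future
  of \<open>u\<close> and a stable one depending only on the past, and so a point outside the projected bundle
  has a nonzero unstable component for all controls or a nonzero stable one for all controls.
\<close>

section \<open>The matrix exponential\<close>

text \<open>Both central objects are definite descriptions. Each is resolved by one explicit set: it
  is chain transitive and contains every chain transitive set that has a point with r \<noteq> 0.
  Three obstacles shape the estimates. A projective point has no norm and each jump may change the
  representative, so growth is visible only in ratios of functions homogeneous on the fibers, such
  as the unstable part of w against everything else. On L^0 there is in general no bounded solution
  to subtract; the forcing stays there and is bounded only subexponentially, so the hyperbolic rates
  must leave a gap that absorbs it. Finally \<open>d\<close> is merely some metric for the weak*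
  topology, so nothing expressed in \<open>d\<close> can be computed: uniform continuity of u
  \<mapsto> e(u, 0) and the blindness of \<open>d\<close> to distant times come from compactness of
  the set of controls. That compactness is Banach-Alaoglu combined with the representation of
  functionals on L^1 by bounded functions, where the constraint u(t) \<in> U is carried through as a
  family of half-space inequalities.\<close>

text \<open>
  A copy of the square matrices that carries the operator norm and the matrix product: there
  \<open>exp\<close> of the library is the matrix exponential.
\<close>

typedef (overloaded) 'n sqmat = "UNIV :: (real^'n^'n) set"
  morphisms of_sqmat to_sqmat ..

setup_lifting type_definition_sqmat

instantiation sqmat :: (finite) real_normed_algebra_1
begin

lift_definition zero_sqmat :: "'a sqmat" is 0 .
lift_definition one_sqmat :: "'a sqmat" is "mat 1" .
lift_definition plus_sqmat :: "'a sqmat \<Rightarrow> 'a sqmat \<Rightarrow> 'a sqmat" is "(+)" .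
lift_definition minus_sqmat :: "'a sqmat \<Rightarrow> 'a sqmat \<Rightarrow> 'a sqmat" is "(-)" .
lift_definition uminus_sqmat :: "'a sqmat \<Rightarrow> 'a sqmat" is uminus .
lift_definition times_sqmat :: "'a sqmat \<Rightarrow> 'a sqmat \<Rightarrow> 'a sqmat" is "(**)" .
lift_definition scaleR_sqmat :: "real \<Rightarrow> 'a sqmat \<Rightarrow> 'a sqmat" is "(*\<^sub>R)" .
lift_definition norm_sqmat :: "'a sqmat \<Rightarrow> real" is "\<lambda>A. onorm ((*v) A)" .

definition dist_sqmat :: "'a sqmat \<Rightarrow> 'a sqmat \<Rightarrow> real" where
  "dist_sqmat A B = norm (A - B)"
definition sgn_sqmat :: "'a sqmat \<Rightarrow> 'a sqmat" where
  "sgn_sqmat A = scaleR (inverse (norm A)) A"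
definition uniformity_sqmat :: "('a sqmat \<times> 'a sqmat) filter" where
  "uniformity_sqmat = (INF e\<in>{0 <..}. principal {(x, y). dist x y < e})"
definition open_sqmat :: "'a sqmat set \<Rightarrow> bool" where
  "open_sqmat S \<longleftrightarrow> (\<forall>x\<in>S. \<forall>\<^sub>F (x', y) in uniformity. x' = x \<longrightarrow> y \<in> S)"

instance
proof
  fix A B C :: "'a sqmat" and a b :: real
  show "A + B + C = A + (B + C)" by transfer (rule add.assoc)
  show "A + B = B + A" by transfer (rule add.commute)
  show "0 + A = A" by transfer simp
  show "- A + A = 0" by transfer simp
  show "A - B = A + - B" by transfer simp
  show "a *\<^sub>R (A + B) = a *\<^sub>R A + a *\<^sub>R B" by transfer (rule scaleR_right_distrib)
  show "(a + b) *\<^sub>R A = a *\<^sub>R A + b *\<^sub>R A" by transfer (rule scaleR_left_distrib)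
  show "a *\<^sub>R b *\<^sub>R A = (a * b) *\<^sub>R A" by transfer simp
  show "1 *\<^sub>R A = A" by transfer simp
  show "A * B * C = A * (B * C)" by transfer (rule matrix_mul_assoc[symmetric])
  show "(A + B) * C = A * C + B * C" by transfer (simp add: matrix_matrix_mult_def vec_eq_iff algebra_simps sum.distrib)
  show "A * (B + C) = A * B + A * C" by transfer (rule matrix_add_ldistrib)
  show "a *\<^sub>R A * B = a *\<^sub>R (A * B)" by transfer (simp add: matrix_matrix_mult_def vec_eq_iff sum_distrib_left mult_ac)
  show "A * a *\<^sub>R B = a *\<^sub>R (A * B)" by transfer (simp add: matrix_matrix_mult_def vec_eq_iff sum_distrib_left mult_ac)
  show "1 * A = A" by transfer simp
  show "A * 1 = A" by transfer simp
  show "(0 :: 'a sqmat) \<noteq> 1"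
    by transfer (simp add: vec_eq_iff mat_def)
  show "dist A B = norm (A - B)" by (rule dist_sqmat_def)
  show "sgn A = scaleR (inverse (norm A)) A" by (rule sgn_sqmat_def)
  show "uniformity = (INF e\<in>{0 <..}. principal {(x :: 'a sqmat, y). dist x y < e})"
    by (rule uniformity_sqmat_def)
  show "\<And>S :: 'a sqmat set. open S \<longleftrightarrow> (\<forall>x\<in>S. \<forall>\<^sub>F (x', y) in uniformity. x' = x \<longrightarrow> y \<in> S)"
    by (rule open_sqmat_def)
  show "norm A = 0 \<longleftrightarrow> A = 0"
    by transfer (auto simp: onorm_eq_0 matrix_eq)
  show "norm (A + B) \<le> norm A + norm B"
  proof transfer
    fix A B :: "real^'a^'a"
    have "(*v) (A + B) = (\<lambda>x. A *v x + B *v x)"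
      by (simp add: fun_eq_iff matrix_vector_mult_add_rdistrib)
    then show "onorm ((*v) (A + B)) \<le> onorm ((*v) A) + onorm ((*v) B)"
      by (simp add: onorm_triangle)
  qed
  show "norm (a *\<^sub>R A) = \<bar>a\<bar> * norm A"
  proof transfer
    fix a and A :: "real^'a^'a"
    have "(*v) (a *\<^sub>R A) = (\<lambda>x. a *\<^sub>R (A *v x))"
      by (simp add: fun_eq_iff scaleR_matrix_vector_assoc)
    then show "onorm ((*v) (a *\<^sub>R A)) = \<bar>a\<bar> * onorm ((*v) A)"
      by (simp add: onorm_scaleR)
  qed
  show "norm (A * B) \<le> norm A * norm B"
  proof transfer
    fix A B :: "real^'a^'a"
    have "(*v) (A ** B) = (*v) A \<circ> (*v) B"
      by (simp add: fun_eq_iff matrix_vector_mul_assoc)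
    then show "onorm ((*v) (A ** B)) \<le> onorm ((*v) A) * onorm ((*v) B)"
      by (metis onorm_compose matrix_vector_mul_bounded_linear)
  qed
  show "norm (1 :: 'a sqmat) = 1"
  proof transfer
    have "(*v) (mat 1) = (\<lambda>x. x :: real^'a)" by (simp add: fun_eq_iff)
    then show "onorm ((*v) (mat 1) :: real^'a \<Rightarrow> real^'a) = 1"
      by (metis onorm_id norm_axis_1 norm_zero zero_neq_one UNIV_not_singleton[of "0 :: real^'a"])
  qed
qed

end

lemma bounded_linear_of_sqmat: "bounded_linear (of_sqmat :: 'n::finite sqmat \<Rightarrow> real^'n^'n)"
proof (rule bounded_linear_intro[where K = "real CARD('n) * real CARD('n)"])
  fix A B :: "'n sqmat" and r :: real
  show "of_sqmat (A + B) = of_sqmat A + of_sqmat B" by (rule plus_sqmat.rep_eq)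
  show "of_sqmat (r *\<^sub>R A) = r *\<^sub>R of_sqmat A" by (rule scaleR_sqmat.rep_eq)
  have "norm (of_sqmat A) \<le> (\<Sum>i\<in>UNIV. norm (of_sqmat A $ i))"
    by (simp add: norm_vec_def L2_set_le_sum)
  also have "\<dots> \<le> (\<Sum>i\<in>(UNIV::'n set). \<Sum>j\<in>(UNIV::'n set). norm (of_sqmat A $ i $ j))"
    by (intro sum_mono) (simp add: norm_vec_def L2_set_le_sum)
  also have "\<dots> \<le> (\<Sum>i\<in>(UNIV::'n set). \<Sum>j\<in>(UNIV::'n set). norm A)"
    unfolding norm_sqmat.rep_eq real_norm_def
    by (intro sum_mono matrix_component_le_onorm)
  finally show "norm (of_sqmat A) \<le> norm A * (real CARD('n) * real CARD('n))"
    by (simp add: mult_ac)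
qed

lemma bounded_linear_to_sqmat: "bounded_linear (to_sqmat :: real^'n^'n \<Rightarrow> 'n::finite sqmat)"
proof (rule bounded_linear_intro[where K = "real CARD('n) * real CARD('n)"])
  fix A B :: "real^'n^'n" and r :: real
  show "to_sqmat (A + B) = to_sqmat A + to_sqmat B"
    by (simp add: plus_sqmat.abs_eq)
  show "to_sqmat (r *\<^sub>R A) = r *\<^sub>R to_sqmat A"
    by (simp add: scaleR_sqmat.abs_eq)
  have "norm (to_sqmat A) \<le> (\<Sum>i\<in>(UNIV::'n set). \<Sum>j\<in>(UNIV::'n set). \<bar>A $ i $ j\<bar>)"
    by (simp add: norm_sqmat.abs_eq onorm_le_matrix_component_sum)
  also have "\<dots> \<le> (\<Sum>i\<in>(UNIV::'n set). \<Sum>j\<in>(UNIV::'n set). norm A)"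
    by (intro sum_mono order_trans[OF component_le_norm_cart Finite_Cartesian_Product.norm_nth_le])
  finally show "norm (to_sqmat A) \<le> norm A * (real CARD('n) * real CARD('n))"
    by (simp add: mult_ac)
qed

instance sqmat :: (finite) banach
proof
  fix X :: "nat \<Rightarrow> 'a sqmat"
  assume "Cauchy X"
  then have "Cauchy (\<lambda>n. of_sqmat (X n))"
    by (rule bounded_linear.Cauchy[OF bounded_linear_of_sqmat])
  then obtain L where "(\<lambda>n. of_sqmat (X n)) \<longlonglongrightarrow> L"
    by (auto simp: Cauchy_convergent_iff convergent_def)
  from bounded_linear.tendsto[OF bounded_linear_to_sqmat this] show "convergent X"
    by (auto simp: convergent_def of_sqmat_inverse)
qed

lemma of_sqmat_power: "of_sqmat (X ^ k) = ((**) (of_sqmat X) ^^ k) (mat 1)"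
  by (induction k) (simp_all add: one_sqmat.rep_eq times_sqmat.rep_eq)

lemma mat_exp_eq: "mat_exp A = of_sqmat (exp (to_sqmat A))"
proof -
  have "(\<lambda>k. of_sqmat (to_sqmat A ^ k /\<^sub>R fact k)) sums of_sqmat (exp (to_sqmat A))"
    by (intro bounded_linear.sums[OF bounded_linear_of_sqmat]) (rule exp_converges)
  then show ?thesis
    by (simp add: mat_exp_def sums_iff scaleR_sqmat.rep_eq of_sqmat_power to_sqmat_inverse
        inverse_eq_divide)
qed

lemma mat_exp_eq_scaleR: "mat_exp (t *\<^sub>R A) = of_sqmat (exp (t *\<^sub>R to_sqmat A))"
  by (simp add: mat_exp_eq scaleR_sqmat.abs_eq)

lemma mat_exp_0 [simp]: "mat_exp (0 :: real^'n^'n) = mat 1"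
  by (simp add: mat_exp_eq one_sqmat.rep_eq flip: zero_sqmat.abs_eq)

lemma mat_exp_add: "mat_exp ((s + t) *\<^sub>R A) = mat_exp (s *\<^sub>R A) ** mat_exp (t *\<^sub>R A)"
proof -
  have "exp ((s + t) *\<^sub>R to_sqmat A) = exp (s *\<^sub>R to_sqmat A) * exp (t *\<^sub>R to_sqmat A)"
    unfolding scaleR_left_distrib by (rule exp_add_commuting) simp
  then show ?thesis
    by (simp add: mat_exp_eq_scaleR times_sqmat.rep_eq)
qed

lemma mat_exp_commute: "A ** mat_exp (t *\<^sub>R A) = mat_exp (t *\<^sub>R A) ** A"
proof -
  have "to_sqmat A * exp (t *\<^sub>R to_sqmat A) = exp (t *\<^sub>R to_sqmat A) * to_sqmat A"
    by (metis exp_times_scaleR_commute)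
  from arg_cong[OF this, of of_sqmat] show ?thesis
    by (simp add: mat_exp_eq_scaleR times_sqmat.rep_eq to_sqmat_inverse)
qed

lemma mat_exp_has_vector_derivative:
  "((\<lambda>t. mat_exp (t *\<^sub>R A)) has_vector_derivative A ** mat_exp (t *\<^sub>R A)) (at t within S)"
proof -
  have "((\<lambda>t. of_sqmat (exp (t *\<^sub>R to_sqmat A))) has_vector_derivative
      of_sqmat (to_sqmat A * exp (t *\<^sub>R to_sqmat A))) (at t)"
    by (intro bounded_linear.has_vector_derivative[OF bounded_linear_of_sqmat]
        exp_scaleR_has_vector_derivative_left)
  then show ?thesis
    by (simp add: mat_exp_eq_scaleR times_sqmat.rep_eq to_sqmat_inverse
        has_vector_derivative_at_within)
qed

section \<open>The linear flow generated by A\<close>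

abbreviation flow :: "real^'n^'n \<Rightarrow> real \<Rightarrow> real^'n \<Rightarrow> real^'n" where
  "flow A t x \<equiv> mat_exp (t *\<^sub>R A) *v x"

lemma bounded_bilinear_matrix_vector_mult:
  "bounded_bilinear ((*v) :: real^'n^'m \<Rightarrow> real^'n \<Rightarrow> real^'m)"
  by (intro bilinear_conv_bounded_bilinear[THEN iffD1])
    (auto simp: bilinear_def linear_iff matrix_vector_mult_add_rdistrib matrix_vector_right_distrib
      scaleR_matrix_vector_assoc matrix_vector_mult_scaleR)

lemma flow_add: "flow A (s + t) x = flow A s (flow A t x)"
  by (simp add: mat_exp_add matrix_vector_mul_assoc)

lemma flow_minus [simp]:
  "mat_exp (- (t *\<^sub>R A)) *v flow A t x = x" "flow A t (mat_exp (- (t *\<^sub>R A)) *v x) = x"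
  using flow_add[of "- t" t A x] flow_add[of t "- t" A x] by auto

lemma flow_has_vector_derivative:
  "((\<lambda>t. flow A t x) has_vector_derivative A *v flow A t x) (at t within S)"
proof -
  have "bounded_linear (\<lambda>M. M *v x)"
    by (rule bounded_bilinear.bounded_linear_left[OF bounded_bilinear_matrix_vector_mult])
  from bounded_linear.has_vector_derivative[OF this mat_exp_has_vector_derivative[where A = A and t = t and S = S]]
  show ?thesis by (simp add: matrix_vector_mul_assoc)
qed

lemma continuous_on_mat_exp: "continuous_on S (\<lambda>t. mat_exp (t *\<^sub>R A))"
  by (rule continuous_on_vector_derivative) (rule mat_exp_has_vector_derivative)

lemma continuous_on_flow [continuous_intros]:
  assumes "continuous_on S f" "continuous_on S g"
  shows "continuous_on S (\<lambda>s. flow A (f s) (g s))"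
proof (rule bounded_bilinear.continuous_on[OF bounded_bilinear_matrix_vector_mult _ assms(2)])
  show "continuous_on S (\<lambda>s. mat_exp (f s *\<^sub>R A))"
    using continuous_on_compose2[OF continuous_on_mat_exp assms(1)] by blast
qed

section \<open>Spectral decomposition\<close>

text \<open>Horner's scheme for p(M) z. Polynomials act on single vectors only, so no polynomial
  calculus of matrices has to be set up; \<open>papp_mult\<close> makes this a module
  action.\<close>

definition papp :: "complex^'n^'n \<Rightarrow> complex poly \<Rightarrow> complex^'n \<Rightarrow> complex^'n" where
  "papp M p z = fold_coeffs (\<lambda>a w. a *s z + M *v w) p 0"

lemma papp_0 [simp]: "papp M 0 z = 0"
  by (simp add: papp_def)

lemma papp_pCons [simp]: "papp M (pCons a p) z = a *s z + M *v papp M p z"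
  by (cases "p = 0 \<and> a = 0") (auto simp: papp_def)

lemma papp_add: "papp M (p + q) z = papp M p z + papp M q z"
proof (induction p arbitrary: q)
  case (pCons a p)
  then show ?case
    by (cases q) (simp add: matrix_vector_right_distrib vector_sadd_rdistrib add_ac)
qed simp

lemma papp_smult: "papp M (smult c p) z = c *s papp M p z"
  by (induction p)
    (simp_all add: vector_scalar_commute vector_add_ldistrib vector_smult_assoc)

lemma papp_mult: "papp M (p * q) z = papp M p (papp M q z)"
  by (induction p) (simp_all add: papp_add papp_smult)

lemma papp_zero_right [simp]: "papp M p 0 = 0"
  by (induction p) simp_all

lemma papp_sum: "finite I \<Longrightarrow> papp M (\<Sum>i\<in>I. p i) z = (\<Sum>i\<in>I. papp M (p i) z)"
  by (induction I rule: finite_induct) (simp_all add: papp_add)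

lemma papp_monom: "papp M (monom a i) z = a *s (((*v) M ^^ i) z)"
  by (induction i) (simp_all add: monom_0 monom_Suc vector_scalar_commute)

lemma papp_linear_power:
  "papp M ([:- \<mu>, 1:] ^ k) z = (((*v) (M - mat \<mu>)) ^^ k) z"
proof (induction k)
  case 0
  show ?case by (simp add: one_pCons)
next
  case (Suc k)
  have "mat \<mu> *v w = \<mu> *s w" for w :: "complex^'a"
    by (simp add: vec_eq_iff mat_def matrix_vector_mult_def if_distrib[of "\<lambda>a. a * _"] cong: if_cong)
  with Suc show ?case
    by (simp add: papp_mult matrix_vector_mult_diff_rdistrib del: mult_pCons_left)
qed

text \<open>The vectors z, M z, ..., M^N z are one more than the real dimension N of the space,
  hence dependent over the reals; the coefficients of the dependence form the polynomial.\<close>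

lemma exists_annihilating_poly: "\<exists>p. p \<noteq> 0 \<and> papp M p z = 0"
proof -
  define N where "N = DIM(complex^'a)"
  define v where "v = (\<lambda>i. ((*v) M ^^ i) z)"
  have "\<exists>c :: nat \<Rightarrow> real. (\<exists>i\<le>N. c i \<noteq> 0) \<and> (\<Sum>i\<le>N. c i *\<^sub>R v i) = 0"
  proof (cases "inj_on v {..N}")
    case True
    then have "card (v ` {..N}) > N"
      by (simp add: card_image)
    then have "dependent (v ` {..N})"
      unfolding N_def by (intro dependent_biggerset) auto
    then obtain u where "\<exists>w\<in>v ` {..N}. u w \<noteq> 0" "(\<Sum>w\<in>v ` {..N}. u w *\<^sub>R w) = 0"
      by (auto simp: dependent_finite)
    then show ?thesis
      by (intro exI[of _ "u \<circ> v"]) (auto simp: sum.reindex[OF True])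
  next
    \<comment> \<open>Dependence is a notion for sets, so a repeated vector is handled as a family:
      coefficients 1 and -1 at the two indices.\<close>
    case False
    then obtain i j where ij: "i \<le> N" "j \<le> N" "i \<noteq> j" "v i = v j"
      by (auto simp: inj_on_def)
    let ?c = "\<lambda>k. (if k = i then 1 else 0) - (if k = j then 1 else 0 :: real)"
    have "(\<Sum>k\<le>N. ?c k *\<^sub>R v k) = (\<Sum>k\<le>N. (if k = i then v k else 0) - (if k = j then v k else 0))"
      by (intro sum.cong) auto
    also have "\<dots> = 0"
      using ij by (simp add: sum_subtractf)
    finally show ?thesis
      using ij by (intro exI[of _ ?c]) auto
  qed
  then obtain c :: "nat \<Rightarrow> real" and i where c: "i \<le> N" "c i \<noteq> 0" "(\<Sum>i\<le>N. c i *\<^sub>R v i) = 0"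
    by blast
  let ?p = "\<Sum>i\<le>N. monom (complex_of_real (c i)) i"
  have "coeff ?p i = c i"
    using c by (simp add: coeff_sum)
  then have "?p \<noteq> 0"
    using c by (metis coeff_0 of_real_eq_0_iff)
  moreover have "complex_of_real r *s w = r *\<^sub>R w" for r and w :: "complex^'a"
    unfolding vec_eq_iff vector_smult_component vector_scaleR_component
    by (simp add: scaleR_conv_of_real)
  then have "papp M ?p z = 0"
    using c by (simp add: papp_sum papp_monom v_def)
  ultimately show ?thesis by blast
qed

text \<open>Induction on the degree. A root \<mu> is split off with its full order k; the Bezout
  identity for (X - \<mu>)^k and the cofactor q writes z as a vector killed by (M - \<mu>)^k plus
  one killed by q, which has smaller degree.\<close>

lemma mem_span_gen_eigenspaces:
  assumes "papp M p z = 0" "p \<noteq> 0"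
  shows "z \<in> span (\<Union>\<mu>. {w. \<exists>k. (((*v) (M - mat \<mu>)) ^^ k) w = 0})"
  using assms
proof (induction "degree p" arbitrary: p z rule: less_induct)
  case less
  show ?case
  proof (cases "degree p = 0")
    case True
    then obtain a where "p = [:a:]" "a \<noteq> 0"
      using less.prems by (metis degree_eq_zeroE pCons_eq_0_iff)
    with less.prems have "z = 0"
      by (metis add.right_neutral matrix_vector_mult_0_right papp_0 papp_pCons vector_mul_eq_0)
    then show ?thesis by (simp add: span_zero)
  next
    case False
    then obtain \<mu> where "poly p \<mu> = 0"
      using fundamental_theorem_of_algebra constant_degree by metis
    let ?q = "[:- \<mu>, 1:]"
    obtain q where p: "p = ?q ^ order \<mu> p * q" and q: "\<not> ?q dvd q"
      using order_decomp[OF less.prems(2)] by blast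
    define k where "k = order \<mu> p"
    have "k > 0"
      using \<open>poly p \<mu> = 0\<close> less.prems(2) unfolding k_def by (simp add: order_root)
    have "q \<noteq> 0" using q by auto
    have "coprime ?q q"
      by (rule prime_elem_imp_coprime[OF prime_elem_linear_field_poly q]) simp
    then have "coprime (?q ^ k) q" by simp
    then obtain a b where ab: "a * ?q ^ k + b * q = 1"
      by (metis bezout_coefficients_fst_snd coprime_iff_gcd_eq_1)
    let ?z1 = "papp M (a * ?q ^ k) z" and ?z2 = "papp M (b * q) z"
    have z: "z = ?z1 + ?z2"
      using arg_cong[OF ab, of "\<lambda>p. papp M p z"] by (simp add: papp_add one_pCons)
    have "q * (a * ?q ^ k) = a * p" "?q ^ k * (b * q) = b * p"
      using p unfolding k_def by (metis mult.assoc mult.commute)+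
    then have q0: "papp M q ?z1 = 0" "papp M (?q ^ k) ?z2 = 0"
      using less.prems(1) by (metis papp_mult papp_zero_right)+
    have "degree q < degree p"
    proof -
      have "degree p = degree (?q ^ k) + degree q"
        using p \<open>q \<noteq> 0\<close> unfolding k_def[symmetric] by (metis degree_mult_eq less.prems(2) mult_eq_0_iff)
      then show ?thesis using \<open>k > 0\<close> by (simp add: degree_linear_power)
    qed
    with q0(1) have 1: "?z1 \<in> span (\<Union>\<mu>. {w. \<exists>k. (((*v) (M - mat \<mu>)) ^^ k) w = 0})"
      using less.hyps \<open>q \<noteq> 0\<close> by blast
    have "(((*v) (M - mat \<mu>)) ^^ k) ?z2 = 0"
      using q0(2) unfolding papp_linear_power .
    then have 2: "?z2 \<in> span (\<Union>\<mu>. {w. \<exists>k. (((*v) (M - mat \<mu>)) ^^ k) w = 0})"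
      by (intro span_base) blast
    show ?thesis
      by (subst z) (rule span_add[OF 1 2])
  qed
qed

abbreviation Re_vec :: "complex^'n \<Rightarrow> real^'n" where
  "Re_vec z \<equiv> \<chi> i. Re (z $ i)"

lemma linear_Re_vec: "linear (Re_vec :: complex^'n \<Rightarrow> real^'n)"
  by (intro linearI) (simp_all add: vec_eq_iff)

lemma Re_vec_complex_matrix: "Re_vec (complex_matrix M *v z) = M *v Re_vec z"
  by (simp add: vec_eq_iff complex_matrix_def matrix_vector_mult_def Re_sum)

lemma complex_matrix_mult: "complex_matrix (M ** N) = complex_matrix M ** complex_matrix N"
  by (simp add: vec_eq_iff complex_matrix_def matrix_matrix_mult_def)

lemma norm_Re_vec_le: "norm (Re_vec z) \<le> norm z"
  by (simp add: norm_vec_def L2_set_mono abs_Re_le_cmod)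

lemma gen_eigenspace_eq_0:
  assumes "\<not> is_eigenvalue A \<mu>"
  shows "gen_eigenspace A \<mu> = {0}"
proof -
  have mat: "mat \<mu> *v w = \<mu> *s w" for w :: "complex^'a"
    by (simp add: vec_eq_iff mat_def matrix_vector_mult_def if_distrib[of "\<lambda>a. a * _"] cong: if_cong)
  have inj: "(complex_matrix A - mat \<mu>) *v w = 0 \<Longrightarrow> w = 0" for w
    using assms by (auto simp: is_eigenvalue_def matrix_vector_mult_diff_rdistrib mat)
  have "(((*v) (complex_matrix A - mat \<mu>)) ^^ k) z = 0 \<Longrightarrow> z = 0" for k z
    by (induction k) (auto dest: inj)
  then show ?thesis
    unfolding gen_eigenspace_def by (auto intro: exI[of _ 0])
qed

text \<open>The complexified vector is a sum of generalized eigenvectors, and taking real parts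
  carries this back to the reals. Directness of the sum comes later, from growth rates.\<close>

lemma mem_sum_L: "\<exists>a\<in>L_plus A. \<exists>b\<in>L_zero A. \<exists>c\<in>L_minus A. x = a + b + c"
proof -
  let ?z = "\<chi> i. complex_of_real (x $ i)"
  have "?z \<in> span (\<Union>\<mu>. gen_eigenspace A \<mu>)"
    using exists_annihilating_poly[of "complex_matrix A" ?z] mem_span_gen_eigenspaces
    unfolding gen_eigenspace_def by blast
  then have "Re_vec ?z \<in> span (Re_vec ` (\<Union>\<mu>. gen_eigenspace A \<mu>))"
    using linear_span_image[OF linear_Re_vec] by blast
  moreover have "Re_vec ?z = x" by (simp add: vec_eq_iff)
  moreover have "Re_vec ` (\<Union>\<mu>. gen_eigenspace A \<mu>) = (\<Union>\<mu>. real_gen_eigenspace A \<mu>)"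
    by (auto simp: real_gen_eigenspace_def)
  ultimately have x: "x \<in> span (\<Union>\<mu>. real_gen_eigenspace A \<mu>)"
    by simp
  define E where "E = (\<lambda>P. \<Union>\<mu>\<in>{\<mu>. is_eigenvalue A \<mu> \<and> P (Re \<mu>)}. real_gen_eigenspace A \<mu>)"
  \<comment> \<open>The union runs over all complex \<mu>. Those that are not eigenvalues contribute
    0 only, hence the \<open>insert 0\<close>.\<close>
  have sub: "(\<Union>\<mu>. real_gen_eigenspace A \<mu>) \<subseteq>
      insert 0 (E (\<lambda>r. r > 0) \<union> E (\<lambda>r. r = 0) \<union> E (\<lambda>r. r < 0))"
  proof (rule UN_least)
    fix \<mu>
    show "real_gen_eigenspace A \<mu> \<subseteq>
        insert 0 (E (\<lambda>r. r > 0) \<union> E (\<lambda>r. r = 0) \<union> E (\<lambda>r. r < 0))"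
    proof (cases "is_eigenvalue A \<mu>")
      case True
      then have "real_gen_eigenspace A \<mu> \<subseteq> E P" if "P (Re \<mu>)" for P
        using that unfolding E_def by blast
      from this[of "\<lambda>r. r > 0"] this[of "\<lambda>r. r = 0"] this[of "\<lambda>r. r < 0"] show ?thesis
        using less_linear[of "Re \<mu>" 0] by blast
    next
      case False
      then show ?thesis
        by (simp add: real_gen_eigenspace_def gen_eigenspace_eq_0 vec_eq_iff)
    qed
  qed
  from subsetD[OF span_mono[OF sub] x]
  have "x \<in> span ((E (\<lambda>r. r > 0) \<union> E (\<lambda>r. r = 0)) \<union> E (\<lambda>r. r < 0))"
    unfolding span_insert_0 .
  then obtain y c where y: "y \<in> span (E (\<lambda>r. r > 0) \<union> E (\<lambda>r. r = 0))"
    and c: "c \<in> span (E (\<lambda>r. r < 0))" and "x = y + c"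
    by (subst (asm) span_Un) auto
  moreover from y obtain a b where "a \<in> span (E (\<lambda>r. r > 0))" "b \<in> span (E (\<lambda>r. r = 0))" "y = a + b"
    by (subst (asm) span_Un) auto
  ultimately show ?thesis
    unfolding L_plus_def L_zero_def L_minus_def E_def by blast
qed

section \<open>Growth on the spectral subspaces\<close>

lemma norm_vector_scalar_mult: "norm (c *s z) = norm c * norm (z :: complex^'n)"
  by (simp add: norm_vec_def norm_mult L2_set_right_distrib)

lemma bounded_bilinear_vector_scalar_mult:
  "bounded_bilinear ((*s) :: complex \<Rightarrow> complex^'n \<Rightarrow> complex^'n)"
proof (rule bounded_bilinear.intro)
  show "\<exists>K. \<forall>a b. norm (a *s b) \<le> norm a * norm (b :: complex^'n) * K"
    by (intro exI[of _ 1]) (simp add: norm_vector_scalar_mult)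
qed (simp_all add: vec_eq_iff algebra_simps scaleR_conv_of_real[where 'a = complex])

abbreviation cflow :: "real^'n^'n \<Rightarrow> real \<Rightarrow> complex^'n \<Rightarrow> complex^'n" where
  "cflow A t z \<equiv> complex_matrix (mat_exp (t *\<^sub>R A)) *v z"

lemma cflow_has_vector_derivative:
  "((\<lambda>t. cflow A t z) has_vector_derivative cflow A t (complex_matrix A *v z)) (at t)"
proof -
  have "linear (\<lambda>P. complex_matrix P *v z)"
    by (intro linearI) (simp_all add: vec_eq_iff complex_matrix_def matrix_vector_mult_def
        algebra_simps sum.distrib scaleR_conv_of_real[where 'a = complex] sum_distrib_left)
  then have "bounded_linear (\<lambda>P. complex_matrix P *v z)"
    by (simp add: linear_conv_bounded_linear)
  from bounded_linear.has_vector_derivative[OF this mat_exp_has_vector_derivative[where A = A and t = t and S = UNIV]]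
  show ?thesis
    by (simp add: mat_exp_commute complex_matrix_mult flip: matrix_vector_mul_assoc)
qed

lemma mat_vector_mult: "mat c *v z = c *s (z :: 'a::comm_semiring_1^'n)"
  by (simp add: vec_eq_iff mat_def matrix_vector_mult_def if_distrib[of "\<lambda>a. a * _"] cong: if_cong)

text \<open>Scaling by e^{-\<mu> t} turns A into A - \<mu> in the derivative, the operator that is
  nilpotent on the generalized eigenspace.\<close>

lemma cflow_scaled_has_vector_derivative:
  "((\<lambda>t. exp (- \<mu> * of_real t) *s cflow A t z) has_vector_derivative
    exp (- \<mu> * of_real t) *s cflow A t ((complex_matrix A - mat \<mu>) *v z)) (at t)"
proof -
  have e: "((\<lambda>t. exp (- \<mu> * complex_of_real t)) has_vector_derivative - \<mu> * exp (- \<mu> * of_real t)) (at t)"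
    by (auto intro!: derivative_eq_intros has_vector_derivative_real_field)
  have "((\<lambda>t. exp (- \<mu> * of_real t) *s cflow A t z) has_vector_derivative
    (exp (- \<mu> * of_real t) *s cflow A t (complex_matrix A *v z) +
      (- \<mu> * exp (- \<mu> * of_real t)) *s cflow A t z)) (at t)"
    using bounded_bilinear.FDERIV[OF bounded_bilinear_vector_scalar_mult
        e[unfolded has_vector_derivative_def] cflow_has_vector_derivative[unfolded has_vector_derivative_def]]
    unfolding has_vector_derivative_def
    by (rule has_derivative_eq_rhs)
      (simp add: fun_eq_iff vec_eq_iff algebra_simps scaleR_conv_of_real[where 'a = complex])
  then show ?thesis
    by (simp add: matrix_vector_mult_diff_rdistrib mat_vector_mult matrix_vector_mult_diff_distrib
        vector_scalar_commute vec_eq_iff algebra_simps)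
qed

text \<open>Induction on the nilpotency order. The derivative of the scaled orbit of z is the scaled
  orbit of (A - \<mu>) z, which has smaller order and gets the exponent \<delta>/2; the mean value
  inequality adds a factor |t|, which the other \<delta>/2 absorbs.\<close>

lemma gen_eigenspace_growth:
  assumes "(((*v) (complex_matrix A - mat \<mu>)) ^^ k) z = 0" "\<delta> > 0"
  shows "\<exists>C. \<forall>t. norm (cflow A t z) \<le> C * exp (Re \<mu> * t + \<delta> * \<bar>t\<bar>)"
  using assms
proof (induction k arbitrary: z \<delta>)
  case 0
  then show ?case by (intro exI[of _ 0]) simp
next
  case (Suc k)
  define w where "w = (complex_matrix A - mat \<mu>) *v z"
  define h where "h = (\<lambda>t :: real. exp (- \<mu> * of_real t) *s cflow A t z)"
  have norm_h: "norm (exp (- \<mu> * of_real t) *s v) = exp (- Re \<mu> * t) * norm v" for t and v :: "complex^'a"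
    by (simp add: norm_vector_scalar_mult)
  have "(((*v) (complex_matrix A - mat \<mu>)) ^^ k) w = 0"
    using Suc.prems(1) by (simp add: w_def funpow_swap1)
  then obtain C where C: "norm (cflow A t w) \<le> C * exp (Re \<mu> * t + \<delta> / 2 * \<bar>t\<bar>)" for t
    using Suc.IH[of w "\<delta> / 2"] Suc.prems(2) by auto
  have "C \<ge> 0"
    using order_trans[OF norm_ge_zero C[of 0]] by simp
  have diff_h: "norm (h t - h 0) \<le> C * exp (\<delta> / 2 * \<bar>t\<bar>) * norm (t - 0)" for t
  proof (rule differentiable_bound)
    show "convex {- \<bar>t\<bar>..\<bar>t\<bar>}" by simp
    show "t \<in> {- \<bar>t\<bar>..\<bar>t\<bar>}" "0 \<in> {- \<bar>t\<bar>..\<bar>t\<bar>}" by auto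
    fix s assume s: "s \<in> {- \<bar>t\<bar>..\<bar>t\<bar>}"
    show "(h has_derivative (\<lambda>x. x *\<^sub>R (exp (- \<mu> * of_real s) *s cflow A s w))) (at s within {- \<bar>t\<bar>..\<bar>t\<bar>})"
      using cflow_scaled_has_vector_derivative[of \<mu> A z s]
      unfolding h_def w_def has_vector_derivative_def by (rule has_derivative_at_withinI)
    show "onorm (\<lambda>x. x *\<^sub>R (exp (- \<mu> * of_real s) *s cflow A s w)) \<le> C * exp (\<delta> / 2 * \<bar>t\<bar>)"
    proof (rule onorm_le)
      fix x
      have "exp (- Re \<mu> * s) * norm (cflow A s w) \<le> exp (- Re \<mu> * s) * (C * exp (Re \<mu> * s + \<delta> / 2 * \<bar>s\<bar>))"
        by (intro mult_left_mono C) simp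
      also have "\<dots> = C * exp (\<delta> / 2 * \<bar>s\<bar>)"
        by (simp add: mult_ac flip: exp_add)
      also have "\<dots> \<le> C * exp (\<delta> / 2 * \<bar>t\<bar>)"
        using s \<open>\<delta> > 0\<close> \<open>C \<ge> 0\<close> by (intro mult_left_mono) auto
      finally show "norm (x *\<^sub>R (exp (- \<mu> * of_real s) *s cflow A s w)) \<le> C * exp (\<delta> / 2 * \<bar>t\<bar>) * norm x"
        unfolding norm_scaleR norm_h by (simp add: mult.commute mult_left_mono)
    qed
  qed
  have h: "norm (h t) \<le> norm z + C * exp (\<delta> / 2 * \<bar>t\<bar>) * \<bar>t\<bar>" for t
  proof -
    have "complex_matrix (mat 1 :: real^'a^'a) = mat 1"
      by (simp add: vec_eq_iff complex_matrix_def mat_def)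
    then have "h 0 = z" by (simp add: h_def)
    with diff_h[of t] norm_triangle_sub[of "h t" z] show ?thesis
      by simp
  qed
  show ?case
  proof (intro exI[of _ "norm z + C * (2 / \<delta>)"] allI)
    fix t
    have "\<bar>t\<bar> \<le> 2 / \<delta> * exp (\<delta> / 2 * \<bar>t\<bar>)"
      using exp_ge_add_one_self[of "\<delta> / 2 * \<bar>t\<bar>"] \<open>\<delta> > 0\<close> by (simp add: field_simps)
    then have "C * exp (\<delta> / 2 * \<bar>t\<bar>) * \<bar>t\<bar> \<le> C * exp (\<delta> / 2 * \<bar>t\<bar>) * (2 / \<delta> * exp (\<delta> / 2 * \<bar>t\<bar>))"
      using \<open>C \<ge> 0\<close> by (intro mult_left_mono) auto
    also have "\<dots> = C * (2 / \<delta>) * exp (\<delta> * \<bar>t\<bar>)"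
      by (simp add: mult_ac flip: exp_add)
    finally have "norm (h t) \<le> norm z + C * (2 / \<delta>) * exp (\<delta> * \<bar>t\<bar>)"
      using h[of t] by linarith
    also have "norm z \<le> norm z * exp (\<delta> * \<bar>t\<bar>)"
      using \<open>\<delta> > 0\<close> by (simp add: mult_le_cancel_left1)
    finally have "norm (h t) \<le> (norm z + C * (2 / \<delta>)) * exp (\<delta> * \<bar>t\<bar>)"
      by (simp add: algebra_simps)
    then have "exp (Re \<mu> * t) * (exp (- Re \<mu> * t) * norm (cflow A t z)) \<le>
        exp (Re \<mu> * t) * ((norm z + C * (2 / \<delta>)) * exp (\<delta> * \<bar>t\<bar>))"
      unfolding h_def norm_h by (intro mult_left_mono) simp_all
    also have "exp (Re \<mu> * t) * (exp (- Re \<mu> * t) * norm (cflow A t z)) = norm (cflow A t z)"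
      by (simp flip: mult.assoc exp_add)
    finally show "norm (cflow A t z) \<le> (norm z + C * (2 / \<delta>)) * exp (Re \<mu> * t + \<delta> * \<bar>t\<bar>)"
      by (simp add: exp_add mult_ac)
  qed
qed

lemma real_gen_eigenspace_growth:
  assumes "x \<in> real_gen_eigenspace A \<mu>" "\<delta> > 0"
  shows "\<exists>C. \<forall>t. norm (flow A t x) \<le> C * exp (Re \<mu> * t + \<delta> * \<bar>t\<bar>)"
proof -
  obtain z k where z: "x = Re_vec z" "(((*v) (complex_matrix A - mat \<mu>)) ^^ k) z = 0"
    using assms(1) by (auto simp: real_gen_eigenspace_def gen_eigenspace_def)
  obtain C where C: "norm (cflow A t z) \<le> C * exp (Re \<mu> * t + \<delta> * \<bar>t\<bar>)" for t
    using gen_eigenspace_growth[OF z(2) assms(2)] by blast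
  have "norm (flow A t x) \<le> norm (cflow A t z)" for t
    using norm_Re_vec_le[of "cflow A t z"] by (simp add: z Re_vec_complex_matrix)
  with C show ?thesis
    by (meson order_trans)
qed

lemma flow_mem_real_gen_eigenspace:
  assumes "x \<in> real_gen_eigenspace A \<mu>"
  shows "flow A t x \<in> real_gen_eigenspace A \<mu>"
proof -
  obtain z k where z: "x = Re_vec z" "(((*v) (complex_matrix A - mat \<mu>)) ^^ k) z = 0"
    using assms by (auto simp: real_gen_eigenspace_def gen_eigenspace_def)
  have comm: "(complex_matrix A - mat \<mu>) *v cflow A t w = cflow A t ((complex_matrix A - mat \<mu>) *v w)" for w
  proof -
    have "complex_matrix A *v cflow A t w = cflow A t (complex_matrix A *v w)"
      by (simp add: matrix_vector_mul_assoc mat_exp_commute flip: complex_matrix_mult)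
    then show ?thesis
      by (simp add: matrix_vector_mult_diff_rdistrib mat_vector_mult matrix_vector_mult_diff_distrib
          vector_scalar_commute)
  qed
  have "(((*v) (complex_matrix A - mat \<mu>)) ^^ j) (cflow A t z) =
      cflow A t ((((*v) (complex_matrix A - mat \<mu>)) ^^ j) z)" for j
    by (induction j) (simp_all only: comm funpow.simps id_apply o_apply)
  with z have "cflow A t z \<in> gen_eigenspace A \<mu>"
    unfolding gen_eigenspace_def by (auto intro: exI[of _ k])
  then show ?thesis
    unfolding real_gen_eigenspace_def z(1) Re_vec_complex_matrix[symmetric] by blast
qed

lemma flow_mem_span:
  assumes "\<And>x. x \<in> X \<Longrightarrow> flow A t x \<in> span X" "x \<in> span X"
  shows "flow A t x \<in> span X"
  using assms(2)
proof (induction rule: span_induct)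
  case base
  show ?case
    by (auto simp: subspace_def span_zero span_add span_scale matrix_vector_right_distrib
        matrix_vector_mult_scaleR)
qed (rule assms(1))

lemma flow_mem_L:
  "x \<in> L_plus A \<Longrightarrow> flow A t x \<in> L_plus A"
  "x \<in> L_zero A \<Longrightarrow> flow A t x \<in> L_zero A"
  "x \<in> L_minus A \<Longrightarrow> flow A t x \<in> L_minus A"
  unfolding L_plus_def L_zero_def L_minus_def
  by (erule flow_mem_span[rotated], blast intro: span_base flow_mem_real_gen_eigenspace)+

lemma subspace_L: "subspace (L_plus A)" "subspace (L_zero A)" "subspace (L_minus A)"
  by (simp_all add: L_plus_def L_zero_def L_minus_def)

lemma growth_span:
  fixes f :: "'i \<Rightarrow> 'a::real_vector \<Rightarrow> 'b::real_normed_vector"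
  assumes lin: "\<And>i. linear (f i)"
    and X: "\<And>x. x \<in> X \<Longrightarrow> \<exists>C. \<forall>i\<in>I. norm (f i x) \<le> C * w i"
    and "x \<in> span X"
  shows "\<exists>C. \<forall>i\<in>I. norm (f i x) \<le> C * w i"
  using assms(3)
proof (induction rule: span_induct)
  case base
  show ?case
  proof (intro subspaceI; unfold mem_Collect_eq)
    show "\<exists>C. \<forall>i\<in>I. norm (f i 0) \<le> C * w i"
      by (rule exI[of _ 0]) (simp add: linear_0[OF lin])
  next
    fix x y
    assume "\<exists>C. \<forall>i\<in>I. norm (f i x) \<le> C * w i" "\<exists>C. \<forall>i\<in>I. norm (f i y) \<le> C * w i"
    then obtain C D where *: "\<And>i. i \<in> I \<Longrightarrow> norm (f i x) \<le> C * w i"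
      "\<And>i. i \<in> I \<Longrightarrow> norm (f i y) \<le> D * w i"
      by blast
    have "norm (f i (x + y)) \<le> (C + D) * w i" if "i \<in> I" for i
      using norm_triangle_ineq[of "f i x" "f i y"] *[OF that]
      by (simp add: linear_add[OF lin] distrib_right)
    then show "\<exists>C. \<forall>i\<in>I. norm (f i (x + y)) \<le> C * w i" by blast
  next
    fix c x
    assume "\<exists>C. \<forall>i\<in>I. norm (f i x) \<le> C * w i"
    then obtain C where *: "\<And>i. i \<in> I \<Longrightarrow> norm (f i x) \<le> C * w i" by blast
    have "norm (f i (c *\<^sub>R x)) \<le> \<bar>c\<bar> * C * w i" if "i \<in> I" for i
      using *[OF that] by (simp add: linear_scale[OF lin] mult.assoc mult_left_mono)
    then show "\<exists>C. \<forall>i\<in>I. norm (f i (c *\<^sub>R x)) \<le> C * w i" by blast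
  qed
qed (rule X)

text \<open>Bounds on the finitely many vectors of an orthonormal basis add up to an operator bound.
  The weight \<open>w\<close> is left free because both exponential decay and slow exponential
  growth are needed.\<close>

lemma uniform_growth:
  fixes f :: "'i \<Rightarrow> 'a::euclidean_space \<Rightarrow> 'b::real_normed_vector"
  assumes S: "subspace S" and lin: "\<And>i. i \<in> I \<Longrightarrow> linear (f i)"
    and bd: "\<And>x. x \<in> S \<Longrightarrow> \<exists>C. \<forall>i\<in>I. norm (f i x) \<le> C * w i"
    and w: "\<And>i. i \<in> I \<Longrightarrow> w i > 0"
  shows "\<exists>C>0. \<forall>x\<in>S. \<forall>i\<in>I. norm (f i x) \<le> C * w i * norm x"
proof -
  obtain B where B: "B \<subseteq> S" "pairwise orthogonal B" "\<And>x. x \<in> B \<Longrightarrow> norm x = 1"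
    "independent B" "span B = S"
    using orthonormal_basis_subspace[OF S] by metis
  have fin: "finite B" using B(4) by (rule independent_imp_finite)
  obtain C where C: "\<And>b i. b \<in> B \<Longrightarrow> i \<in> I \<Longrightarrow> norm (f i b) \<le> C b * w i"
    using bd B(1) by (metis subset_iff)
  have "norm (f i x) \<le> ((\<Sum>b\<in>B. \<bar>C b\<bar>) + 1) * w i * norm x" if "x \<in> S" "i \<in> I" for x i
  proof -
    have "f i x = f i (\<Sum>b\<in>B. (x \<bullet> b) *\<^sub>R b)"
      using orthonormal_basis_expand[OF B(2,3) _ fin] B(5) that by simp
    also have "\<dots> = (\<Sum>b\<in>B. (x \<bullet> b) *\<^sub>R f i b)"
      using lin[OF that(2)] by (simp add: linear_sum linear_scale)
    also have "norm \<dots> \<le> (\<Sum>b\<in>B. norm x * (\<bar>C b\<bar> * w i))"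
    proof (rule sum_norm_le)
      fix b assume b: "b \<in> B"
      have "\<bar>x \<bullet> b\<bar> \<le> norm x"
        using Cauchy_Schwarz_ineq2[of x b] B(3)[OF b] by simp
      moreover have "norm (f i b) \<le> \<bar>C b\<bar> * w i"
        by (rule order_trans[OF C[OF b that(2)]]) (use w[OF that(2)] in \<open>simp add: mult_right_mono\<close>)
      ultimately show "norm ((x \<bullet> b) *\<^sub>R f i b) \<le> norm x * (\<bar>C b\<bar> * w i)"
        by (simp add: mult_mono)
    qed
    also have "\<dots> = (\<Sum>b\<in>B. \<bar>C b\<bar>) * w i * norm x"
      by (simp add: sum_distrib_left sum_distrib_right mult_ac)
    also have "\<dots> \<le> ((\<Sum>b\<in>B. \<bar>C b\<bar>) + 1) * w i * norm x"
      using w[OF that(2)] by (intro mult_right_mono) auto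
    finally show ?thesis .
  qed
  moreover have "(\<Sum>b\<in>B. \<bar>C b\<bar>) + 1 > 0"
    by (simp add: add_nonneg_pos sum_nonneg)
  ultimately show ?thesis by blast
qed

lemma uniform_growth_span:
  fixes f :: "'i \<Rightarrow> 'a::euclidean_space \<Rightarrow> 'b::real_normed_vector"
  assumes "\<And>i. linear (f i)" "\<And>x. x \<in> X \<Longrightarrow> \<exists>C. \<forall>i\<in>I. norm (f i x) \<le> C * w i"
    "\<And>i. i \<in> I \<Longrightarrow> w i > 0"
  shows "\<exists>C>0. \<forall>x\<in>span X. \<forall>i\<in>I. norm (f i x) \<le> C * w i * norm x"
  by (rule uniform_growth[OF subspace_span assms(1) growth_span[of f, OF assms(1,2)] assms(3)])

text \<open>The generators may be infinitely many and decay at different rates, so a finite basis is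
  selected among them and the smallest of its rates is taken.\<close>

lemma uniform_decay_span:
  fixes f :: "real \<Rightarrow> 'a::euclidean_space \<Rightarrow> 'b::real_normed_vector"
  assumes lin: "\<And>t. linear (f t)"
    and X: "\<And>x. x \<in> X \<Longrightarrow> \<exists>\<alpha>>0. \<exists>C. \<forall>t\<ge>0. norm (f t x) \<le> C * exp (- \<alpha> * t)"
  shows "\<exists>\<alpha>>0. \<exists>C>0. \<forall>x\<in>span X. \<forall>t\<ge>0. norm (f t x) \<le> C * exp (- \<alpha> * t) * norm x"
proof -
  obtain B where B: "B \<subseteq> X" "independent B" "X \<subseteq> span B"
    using maximal_independent_subset[of X] by blast
  have fin: "finite B" using B(2) by (rule independent_imp_finite)
  obtain \<alpha> C where \<alpha>: "\<And>b. b \<in> B \<Longrightarrow> \<alpha> b > 0"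
    and C: "\<And>b t. b \<in> B \<Longrightarrow> t \<ge> 0 \<Longrightarrow> norm (f t b) \<le> C b * exp (- \<alpha> b * t)"
    using X B(1) by (metis subset_iff)
  \<comment> \<open>The inserted 1 keeps the minimum defined and positive when the basis is
    empty.\<close>
  define \<beta> where "\<beta> = Min (insert 1 (\<alpha> ` B))"
  have \<beta>: "\<beta> > 0" "\<And>b. b \<in> B \<Longrightarrow> \<beta> \<le> \<alpha> b"
    using fin \<alpha> by (auto simp: \<beta>_def)
  have "norm (f t b) \<le> \<bar>C b\<bar> * exp (- \<beta> * t)" if "b \<in> B" "t \<ge> 0" for b t
  proof -
    have "C b * exp (- \<alpha> b * t) \<le> \<bar>C b\<bar> * exp (- \<beta> * t)"
      using \<beta>(2)[OF that(1)] that(2) by (intro mult_mono) (auto simp: mult_right_mono)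
    with C[OF that] show ?thesis by linarith
  qed
  then have "\<exists>C>0. \<forall>x\<in>span B. \<forall>t\<in>{0..}. norm (f t x) \<le> C * exp (- \<beta> * t) * norm x"
    by (intro uniform_growth_span lin) auto
  moreover have "span X \<subseteq> span B"
    using span_mono[OF B(3)] unfolding span_span .
  ultimately obtain C where C: "C > 0"
    "\<And>x t. x \<in> span X \<Longrightarrow> t \<ge> 0 \<Longrightarrow> norm (f t x) \<le> C * exp (- \<beta> * t) * norm x"
    unfolding Ball_def atLeast_iff by (metis subsetD)
  show ?thesis
    using \<beta>(1) C by (intro exI[of _ \<beta>] conjI exI[of _ C]) auto
qed

text \<open>An eigenvalue contributes half of its real part as rate; the other half pays for the
  polynomial factors of its Jordan blocks.\<close>

lemma L_plus_decay:
  "\<exists>\<alpha>>0. \<exists>C>0. \<forall>x\<in>L_plus A. \<forall>t\<ge>0. norm (flow A (- t) x) \<le> C * exp (- \<alpha> * t) * norm x"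
  unfolding L_plus_def
proof (rule uniform_decay_span)
  fix x
  assume "x \<in> (\<Union>\<mu>\<in>{\<mu>. is_eigenvalue A \<mu> \<and> Re \<mu> > 0}. real_gen_eigenspace A \<mu>)"
  then obtain \<mu> where \<mu>: "Re \<mu> > 0" "x \<in> real_gen_eigenspace A \<mu>" by blast
  then obtain C where C: "norm (flow A t x) \<le> C * exp (Re \<mu> * t + Re \<mu> / 2 * \<bar>t\<bar>)" for t
    using real_gen_eigenspace_growth[of x A \<mu> "Re \<mu> / 2"] by auto
  have "norm (flow A (- t) x) \<le> C * exp (- (Re \<mu> / 2) * t)" if "t \<ge> 0" for t
    using C[of "- t"] that by (simp add: algebra_simps)
  with \<mu> show "\<exists>\<alpha>>0. \<exists>C. \<forall>t\<ge>0. norm (flow A (- t) x) \<le> C * exp (- \<alpha> * t)"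
    by (intro exI[of _ "Re \<mu> / 2"]) auto
qed simp

lemma L_minus_decay:
  "\<exists>\<alpha>>0. \<exists>C>0. \<forall>x\<in>L_minus A. \<forall>t\<ge>0. norm (flow A t x) \<le> C * exp (- \<alpha> * t) * norm x"
  unfolding L_minus_def
proof (rule uniform_decay_span)
  fix x
  assume "x \<in> (\<Union>\<mu>\<in>{\<mu>. is_eigenvalue A \<mu> \<and> Re \<mu> < 0}. real_gen_eigenspace A \<mu>)"
  then obtain \<mu> where \<mu>: "Re \<mu> < 0" "x \<in> real_gen_eigenspace A \<mu>" by blast
  then obtain C where C: "norm (flow A t x) \<le> C * exp (Re \<mu> * t + - Re \<mu> / 2 * \<bar>t\<bar>)" for t
    using real_gen_eigenspace_growth[of x A \<mu> "- Re \<mu> / 2"] by auto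
  have "norm (flow A t x) \<le> C * exp (- (- Re \<mu> / 2) * t)" if "t \<ge> 0" for t
    using C[of t] that by (simp add: algebra_simps)
  with \<mu> show "\<exists>\<alpha>>0. \<exists>C. \<forall>t\<ge>0. norm (flow A t x) \<le> C * exp (- \<alpha> * t)"
    by (intro exI[of _ "- Re \<mu> / 2"]) auto
qed simp

lemma L_zero_growth:
  assumes "\<delta> > 0"
  shows "\<exists>C>0. \<forall>x\<in>L_zero A. \<forall>t. norm (flow A t x) \<le> C * exp (\<delta> * \<bar>t\<bar>) * norm x"
proof -
  have "\<exists>C>0. \<forall>x\<in>L_zero A. \<forall>t\<in>UNIV. norm (flow A t x) \<le> C * exp (\<delta> * \<bar>t\<bar>) * norm x"
    unfolding L_zero_def
  proof (rule uniform_growth_span)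
    fix x
    assume "x \<in> (\<Union>\<mu>\<in>{\<mu>. is_eigenvalue A \<mu> \<and> Re \<mu> = 0}. real_gen_eigenspace A \<mu>)"
    then obtain \<mu> where "Re \<mu> = 0" "x \<in> real_gen_eigenspace A \<mu>" by blast
    then show "\<exists>C. \<forall>t\<in>UNIV. norm (flow A t x) \<le> C * exp (\<delta> * \<bar>t\<bar>)"
      using real_gen_eigenspace_growth[OF _ assms, of x A \<mu>] by auto
  qed simp_all
  then show ?thesis by simp
qed

section \<open>Directness of the spectral decomposition\<close>

text \<open>
  If \<open>x\<close> decays exponentially in backward time while forward growth on \<open>S\<close> is slower than
  any exponential, then \<open>x\<close>, which is recovered from \<open>flow A (- t) x\<close>, is arbitrarily small.
\<close>

lemma growth_separation:
  assumes S: "subspace S" and inv: "\<And>t x. x \<in> S \<Longrightarrow> flow A t x \<in> S"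
    and sub: "\<And>x \<delta>. x \<in> S \<Longrightarrow> \<delta> > 0 \<Longrightarrow> \<exists>C. \<forall>t\<ge>0. norm (flow A t x) \<le> C * exp (\<delta> * t)"
    and "x \<in> S" and "\<exists>\<alpha>>0. \<exists>C. \<forall>t\<ge>0. norm (flow A (- t) x) \<le> C * exp (- \<alpha> * t)"
  shows "x = 0"
proof (rule ccontr)
  assume "x \<noteq> 0"
  obtain \<alpha> C where \<alpha>: "\<alpha> > 0" and C: "\<And>t. t \<ge> 0 \<Longrightarrow> norm (flow A (- t) x) \<le> C * exp (- \<alpha> * t)"
    using assms(5) by blast
  have "\<exists>D>0. \<forall>y\<in>S. \<forall>t\<in>{0..}. norm (flow A t y) \<le> D * exp (\<alpha> / 2 * t) * norm y"
  proof (rule uniform_growth[OF S])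
    show "\<exists>C. \<forall>t\<in>{0..}. norm (flow A t y) \<le> C * exp (\<alpha> / 2 * t)" if "y \<in> S" for y
      using sub[OF that, of "\<alpha> / 2"] \<alpha> by (simp add: Ball_def)
  qed simp_all
  then obtain D where D: "D > 0"
    "\<And>y t. y \<in> S \<Longrightarrow> t \<ge> 0 \<Longrightarrow> norm (flow A t y) \<le> D * exp (\<alpha> / 2 * t) * norm y"
    by auto
  have le: "norm x \<le> D * C * exp (- (\<alpha> / 2) * t)" if "t \<ge> 0" for t
  proof -
    have "norm x = norm (flow A t (flow A (- t) x))" by simp
    also have "\<dots> \<le> D * exp (\<alpha> / 2 * t) * norm (flow A (- t) x)"
      by (intro D inv assms(4) that)
    also have "\<dots> \<le> D * exp (\<alpha> / 2 * t) * (C * exp (- \<alpha> * t))"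
      using D(1) by (intro mult_left_mono C that) simp
    also have "\<dots> = D * C * exp (- (\<alpha> / 2) * t)"
      by (simp add: mult_ac flip: exp_add)
    finally show ?thesis .
  qed
  have "((\<lambda>t. D * C * exp (- (\<alpha> / 2) * t)) \<longlongrightarrow> D * C * 0) at_top"
    using \<alpha> by (intro tendsto_mult_left filterlim_compose[OF exp_at_bot]
      filterlim_tendsto_neg_mult_at_bot[OF tendsto_const _ filterlim_ident]) simp
  then have "norm x \<le> D * C * 0"
    by (rule tendsto_lowerbound) (rule eventually_at_top_linorderI[of 0], use le in auto)
  with \<open>x \<noteq> 0\<close> show False by simp
qed

lemma decay_imp_growth:
  fixes f :: "real \<Rightarrow> real"
  assumes "\<exists>\<alpha>>0. \<exists>C. \<forall>t\<ge>0. f t \<le> C * exp (- \<alpha> * t)" "\<delta> > 0"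
  shows "\<exists>C. \<forall>t\<ge>0. f t \<le> C * exp (\<delta> * t)"
proof -
  obtain \<alpha> C where *: "\<alpha> > 0" "\<And>t. t \<ge> 0 \<Longrightarrow> f t \<le> C * exp (- \<alpha> * t)"
    using assms(1) by blast
  have "f t \<le> \<bar>C\<bar> * exp (\<delta> * t)" if t: "t \<ge> 0" for t
  proof -
    have "0 \<le> \<alpha> * t" "0 \<le> \<delta> * t" using * t \<open>\<delta> > 0\<close> by auto
    then have "- \<alpha> * t \<le> \<delta> * t" by simp
    then have "C * exp (- \<alpha> * t) \<le> \<bar>C\<bar> * exp (\<delta> * t)"
      by (intro mult_mono) auto
    with *(2)[OF t] show ?thesis by linarith
  qed
  then show ?thesis by blast
qed

lemma L_plus_decay_pointwise:
  "x \<in> L_plus A \<Longrightarrow> \<exists>\<alpha>>0. \<exists>C. \<forall>t\<ge>0. norm (flow A (- t) x) \<le> C * exp (- \<alpha> * t)"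
proof -
  assume x: "x \<in> L_plus A"
  obtain \<alpha> C where "\<alpha> > 0"
    "\<And>x t. x \<in> L_plus A \<Longrightarrow> t \<ge> 0 \<Longrightarrow> norm (flow A (- t) x) \<le> C * exp (- \<alpha> * t) * norm x"
    using L_plus_decay[of A] by blast
  with x show ?thesis
    by (intro exI[of _ \<alpha>] conjI exI[of _ "C * norm x"]) (simp_all add: mult_ac)
qed

lemma L_minus_decay_pointwise:
  "x \<in> L_minus A \<Longrightarrow> \<exists>\<alpha>>0. \<exists>C. \<forall>t\<ge>0. norm (flow A t x) \<le> C * exp (- \<alpha> * t)"
proof -
  assume x: "x \<in> L_minus A"
  obtain \<alpha> C where "\<alpha> > 0"
    "\<And>x t. x \<in> L_minus A \<Longrightarrow> t \<ge> 0 \<Longrightarrow> norm (flow A (t) x) \<le> C * exp (- \<alpha> * t) * norm x"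
    using L_minus_decay[of A] by blast
  with x show ?thesis
    by (intro exI[of _ \<alpha>] conjI exI[of _ "C * norm x"]) (simp_all add: mult_ac)
qed

lemma L_zero_growth_pointwise:
  "x \<in> L_zero A \<Longrightarrow> \<delta> > 0 \<Longrightarrow> \<exists>C. \<forall>t. norm (flow A t x) \<le> C * exp (\<delta> * \<bar>t\<bar>)"
proof -
  assume x: "x \<in> L_zero A" "\<delta> > 0"
  obtain C where "\<And>x t. x \<in> L_zero A \<Longrightarrow> norm (flow A t x) \<le> C * exp (\<delta> * \<bar>t\<bar>) * norm x"
    using L_zero_growth[of \<delta> A] x by blast
  with x show ?thesis
    by (intro exI[of _ "C * norm x"]) (simp add: mult_ac)
qed

lemma growth_add:
  fixes f g :: "real \<Rightarrow> 'a::real_normed_vector"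
  assumes "\<exists>C. \<forall>t\<ge>0. norm (f t) \<le> C * w t" "\<exists>C. \<forall>t\<ge>0. norm (g t) \<le> C * (w t :: real)"
  shows "\<exists>C. \<forall>t\<ge>0. norm (f t + g t) \<le> C * w t"
proof -
  obtain C D where "\<And>t. t \<ge> 0 \<Longrightarrow> norm (f t) \<le> C * w t" "\<And>t. t \<ge> 0 \<Longrightarrow> norm (g t) \<le> D * w t"
    using assms by blast
  then have "norm (f t + g t) \<le> (C + D) * w t" if "t \<ge> 0" for t
    unfolding distrib_right using that by (intro norm_triangle_le add_mono)
  then show ?thesis by blast
qed

abbreviation subspace_sum :: "'a::real_vector set \<Rightarrow> 'a set \<Rightarrow> 'a set" where
  "subspace_sum S T \<equiv> {x + y | x y. x \<in> S \<and> y \<in> T}"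

lemma flow_mem_subspace_sum:
  assumes "\<And>x. x \<in> S \<Longrightarrow> flow A t x \<in> S" "\<And>x. x \<in> T \<Longrightarrow> flow A t x \<in> T" "x \<in> subspace_sum S T"
  shows "flow A t x \<in> subspace_sum S T"
proof -
  obtain y z where "y \<in> S" "z \<in> T" "x = y + z" using assms(3) by blast
  then have "flow A t x = flow A t y + flow A t z" "flow A t y \<in> S" "flow A t z \<in> T"
    by (simp_all add: assms matrix_vector_right_distrib)
  then show ?thesis by blast
qed

text \<open>Backward exponential decay on L^+ meets forward growth slower than any exponential on
  L^0 + L^-, so \<open>growth_separation\<close> leaves only 0.\<close>

lemma L_plus_Int: "L_plus A \<inter> subspace_sum (L_zero A) (L_minus A) = {0}"
proof -
  have "x = 0" if x: "x \<in> L_plus A" "x \<in> subspace_sum (L_zero A) (L_minus A)" for x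
  proof (rule growth_separation[OF _ _ _ x(2) L_plus_decay_pointwise[OF x(1)]])
    show "subspace (subspace_sum (L_zero A) (L_minus A))"
      by (intro subspace_sums subspace_L)
    show "flow A t x \<in> subspace_sum (L_zero A) (L_minus A)"
      if "x \<in> subspace_sum (L_zero A) (L_minus A)" for t x
      by (rule flow_mem_subspace_sum[OF flow_mem_L(2) flow_mem_L(3) that])
    show "\<exists>C. \<forall>t\<ge>0. norm (flow A t x) \<le> C * exp (\<delta> * t)"
      if x: "x \<in> subspace_sum (L_zero A) (L_minus A)" and "\<delta> > 0" for x \<delta>
    proof -
      obtain y z where yz: "y \<in> L_zero A" "z \<in> L_minus A" "x = y + z" using x by blast
      obtain C where "\<And>t. norm (flow A t y) \<le> C * exp (\<delta> * \<bar>t\<bar>)"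
        using L_zero_growth_pointwise[OF yz(1) \<open>\<delta> > 0\<close>] by blast
      then have "\<forall>t\<ge>0. norm (flow A t y) \<le> C * exp (\<delta> * t)"
        by (metis abs_of_nonneg)
      with decay_imp_growth[OF L_minus_decay_pointwise[OF yz(2)] \<open>\<delta> > 0\<close>]
      have "\<exists>C. \<forall>t\<ge>0. norm (flow A t y + flow A t z) \<le> C * exp (\<delta> * t)"
        by (intro growth_add) blast+
      then show ?thesis by (simp add: yz(3) matrix_vector_right_distrib)
    qed
  qed
  moreover have "0 \<in> subspace_sum (L_zero A) (L_minus A)"
    by (intro subspace_0 subspace_sums subspace_L)
  ultimately show ?thesis
    using subspace_0[OF subspace_L(1)] by blast
qed

text \<open>Time reversal of the previous argument: the forward flow of -A is the backward flow of
  A, so \<open>growth_separation\<close> is applied to -A.\<close>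

lemma L_minus_Int: "L_minus A \<inter> subspace_sum (L_plus A) (L_zero A) = {0}"
proof -
  have neg: "flow (- A) t x = flow A (- t) x" for t x by simp
  have "x = 0" if x: "x \<in> L_minus A" "x \<in> subspace_sum (L_plus A) (L_zero A)" for x
  proof (rule growth_separation[OF _ _ _ x(2)])
    show "subspace (subspace_sum (L_plus A) (L_zero A))"
      by (intro subspace_sums subspace_L)
    show "\<exists>\<alpha>>0. \<exists>C. \<forall>t\<ge>0. norm (flow (- A) (- t) x) \<le> C * exp (- \<alpha> * t)"
      using L_minus_decay_pointwise[OF x(1)] by simp
    show "flow (- A) t x \<in> subspace_sum (L_plus A) (L_zero A)"
      if "x \<in> subspace_sum (L_plus A) (L_zero A)" for t x
      unfolding neg by (rule flow_mem_subspace_sum[OF flow_mem_L(1) flow_mem_L(2) that])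
    show "\<exists>C. \<forall>t\<ge>0. norm (flow (- A) t x) \<le> C * exp (\<delta> * t)"
      if x: "x \<in> subspace_sum (L_plus A) (L_zero A)" and "\<delta> > 0" for x \<delta>
    proof -
      obtain y z where yz: "y \<in> L_plus A" "z \<in> L_zero A" "x = y + z" using x by blast
      obtain C where "\<And>t. norm (flow A t z) \<le> C * exp (\<delta> * \<bar>t\<bar>)"
        using L_zero_growth_pointwise[OF yz(2) \<open>\<delta> > 0\<close>] by blast
      then have "\<forall>t\<ge>0. norm (flow A (- t) z) \<le> C * exp (\<delta> * t)"
        by (metis abs_minus abs_of_nonneg)
      with decay_imp_growth[OF L_plus_decay_pointwise[OF yz(1)] \<open>\<delta> > 0\<close>]
      have "\<exists>C. \<forall>t\<ge>0. norm (flow A (- t) y + flow A (- t) z) \<le> C * exp (\<delta> * t)"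
        by (intro growth_add) blast+
      then show ?thesis by (simp add: yz(3) matrix_vector_right_distrib)
    qed
  qed
  moreover have "0 \<in> subspace_sum (L_plus A) (L_zero A)"
    by (intro subspace_0 subspace_sums subspace_L)
  ultimately show ?thesis
    using subspace_0[OF subspace_L(3)] by blast
qed

lemma L_zero_Int_L_hyp: "L_zero A \<inter> L_hyp A = {0}"
proof -
  have "x = 0" if x: "x \<in> L_zero A" "x \<in> L_hyp A" for x
  proof -
    obtain y z where yz: "y \<in> L_plus A" "z \<in> L_minus A" "x = y + z"
      using x(2) unfolding L_hyp_def by blast
    have "y = x + (- z)" using yz(3) by simp
    then have "y \<in> subspace_sum (L_zero A) (L_minus A)"
      using x(1) yz(2) subspace_neg[OF subspace_L(3)] by blast
    then have y: "y = 0" using yz(1) L_plus_Int by blast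
    then have "z = 0 + x" using yz(3) by simp
    then have "z \<in> subspace_sum (L_plus A) (L_zero A)"
      using x(1) subspace_0[OF subspace_L(1)] by blast
    then have "z = 0" using yz(2) L_minus_Int by blast
    with y yz(3) show ?thesis by simp
  qed
  then show ?thesis
    using subspace_0[OF subspace_L(2), of A] subspace_0[OF subspace_sums[OF subspace_L(1,3)], of A]
    unfolding L_hyp_def by blast
qed

section \<open>Spectral projections\<close>

definition proj_along :: "'a::real_vector set \<Rightarrow> 'a set \<Rightarrow> 'a \<Rightarrow> 'a" where
  "proj_along S T x = (THE y. y \<in> S \<and> x - y \<in> T)"

locale direct_sum =
  fixes S T :: "'a::real_vector set"
  assumes subspaces: "subspace S" "subspace T"
    and Int: "S \<inter> T = {0}" and sum: "\<And>x. \<exists>y\<in>S. x - y \<in> T"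
begin

lemma proj_along_eqI:
  assumes "y \<in> S" "x - y \<in> T"
  shows "proj_along S T x = y"
  unfolding proj_along_def
proof (rule the_equality)
  fix z assume z: "z \<in> S \<and> x - z \<in> T"
  have "z - y \<in> S" using subspace_diff[OF subspaces(1)] z assms by blast
  moreover have "(x - y) - (x - z) \<in> T" using subspace_diff[OF subspaces(2)] z assms by blast
  ultimately have "z - y \<in> S \<inter> T" by (simp add: algebra_simps)
  then show "z = y" using Int by simp
qed (use assms in blast)

lemma proj_along_mem: "proj_along S T x \<in> S" "x - proj_along S T x \<in> T"
  using sum[of x] proj_along_eqI by auto

lemma linear_proj_along: "linear (proj_along S T)"
proof (rule linearI)
  fix x y :: 'a and c :: real
  show "proj_along S T (x + y) = proj_along S T x + proj_along S T y"
    using subspace_add[OF subspaces(1)] subspace_add[OF subspaces(2) proj_along_mem(2)[of x] proj_along_mem(2)[of y]]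
    by (intro proj_along_eqI) (auto simp: proj_along_mem algebra_simps)
  show "proj_along S T (c *\<^sub>R x) = c *\<^sub>R proj_along S T x"
    using subspace_scale[OF subspaces(1)] subspace_scale[OF subspaces(2) proj_along_mem(2)[of x], of c]
    by (intro proj_along_eqI) (auto simp: proj_along_mem algebra_simps)
qed

end

lemma direct_sum_plus: "direct_sum (L_plus A) (subspace_sum (L_zero A) (L_minus A))"
proof (unfold_locales)
  fix x
  obtain a b c where abc: "a \<in> L_plus A" "b \<in> L_zero A" "c \<in> L_minus A" "x = a + b + c"
    using mem_sum_L[of A x] by blast
  then have "x - a = b + c" by simp
  then show "\<exists>y\<in>L_plus A. x - y \<in> subspace_sum (L_zero A) (L_minus A)"
    using abc by blast
qed (intro subspace_L subspace_sums L_plus_Int)+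

lemma direct_sum_minus: "direct_sum (L_minus A) (subspace_sum (L_plus A) (L_zero A))"
proof (unfold_locales)
  fix x
  obtain a b c where abc: "a \<in> L_plus A" "b \<in> L_zero A" "c \<in> L_minus A" "x = a + b + c"
    using mem_sum_L[of A x] by blast
  then have "x - c = a + b" by simp
  then show "\<exists>y\<in>L_minus A. x - y \<in> subspace_sum (L_plus A) (L_zero A)"
    using abc by blast
qed (intro subspace_L subspace_sums L_minus_Int)+

lemma subspace_L_hyp: "subspace (L_hyp A)"
  unfolding L_hyp_def by (intro subspace_sums subspace_L)

lemma direct_sum_hyp: "direct_sum (L_hyp A) (L_zero A)"
proof (unfold_locales)
  fix x
  obtain a b c where abc: "a \<in> L_plus A" "b \<in> L_zero A" "c \<in> L_minus A" "x = a + b + c"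
    using mem_sum_L[of A x] by blast
  then have "x - (a + c) = b" "a + c \<in> L_hyp A" unfolding L_hyp_def by auto
  then show "\<exists>y\<in>L_hyp A. x - y \<in> L_zero A"
    using abc by blast
qed (use L_zero_Int_L_hyp in \<open>auto intro: subspace_L subspace_L_hyp\<close>)

abbreviation pi_plus :: "real^'n^'n \<Rightarrow> real^'n \<Rightarrow> real^'n" where
  "pi_plus A \<equiv> proj_along (L_plus A) (subspace_sum (L_zero A) (L_minus A))"

abbreviation pi_minus :: "real^'n^'n \<Rightarrow> real^'n \<Rightarrow> real^'n" where
  "pi_minus A \<equiv> proj_along (L_minus A) (subspace_sum (L_plus A) (L_zero A))"

definition pi_zero :: "real^'n^'n \<Rightarrow> real^'n \<Rightarrow> real^'n" where
  "pi_zero A x = x - pi_hyp A x"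

lemma pi_hyp_eq_proj_along: "pi_hyp A = proj_along (L_hyp A) (L_zero A)"
  by (simp add: fun_eq_iff pi_hyp_def proj_along_def)

lemma pi_mem: "pi_plus A x \<in> L_plus A" "pi_minus A x \<in> L_minus A" "pi_zero A x \<in> L_zero A"
  "pi_hyp A x \<in> L_hyp A"
  unfolding pi_zero_def pi_hyp_eq_proj_along
  by (rule direct_sum.proj_along_mem[OF direct_sum_plus] direct_sum.proj_along_mem[OF direct_sum_minus]
      direct_sum.proj_along_mem[OF direct_sum_hyp])+

lemma pi_eqI:
  assumes "a \<in> L_plus A" "b \<in> L_zero A" "c \<in> L_minus A" "x = a + b + c"
  shows "pi_plus A x = a" "pi_zero A x = b" "pi_minus A x = c" "pi_hyp A x = a + c"
proof -
  have "x - a = b + c" "x - c = a + b" "x - (a + c) = b" using assms(4) by auto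
  moreover have "a + c \<in> L_hyp A" using assms unfolding L_hyp_def by blast
  ultimately show "pi_plus A x = a" "pi_minus A x = c" and *: "pi_hyp A x = a + c"
    unfolding pi_hyp_eq_proj_along
    by (intro direct_sum.proj_along_eqI[OF direct_sum_plus] direct_sum.proj_along_eqI[OF direct_sum_minus]
      direct_sum.proj_along_eqI[OF direct_sum_hyp]; use assms in auto)+
  show "pi_zero A x = b"
    unfolding pi_zero_def * using assms(4) by simp
qed

lemma linear_pi: "linear (pi_plus A)" "linear (pi_minus A)" "linear (pi_hyp A)" "linear (pi_zero A)"
proof -
  show "linear (pi_plus A)" "linear (pi_minus A)" "linear (pi_hyp A)"
    unfolding pi_hyp_eq_proj_along
    by (rule direct_sum.linear_proj_along[OF direct_sum_plus] direct_sum.linear_proj_along[OF direct_sum_minus]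
        direct_sum.linear_proj_along[OF direct_sum_hyp])+
  then show "linear (pi_zero A)"
    unfolding pi_zero_def by (intro linear_compose_sub linear_ident)
qed

lemma pi_sum: "pi_plus A x + pi_zero A x + pi_minus A x = x"
proof -
  obtain a b c where abc: "a \<in> L_plus A" "b \<in> L_zero A" "c \<in> L_minus A" "x = a + b + c"
    using mem_sum_L[of A x] by blast
  then show ?thesis
    using pi_eqI(1-3)[OF abc] by simp
qed

lemma pi_hyp_eq: "pi_hyp A x = pi_plus A x + pi_minus A x"
  using pi_sum[of A x] by (simp add: pi_zero_def algebra_simps)

lemma pi_flow:
  "pi_plus A (flow A t x) = flow A t (pi_plus A x)"
  "pi_zero A (flow A t x) = flow A t (pi_zero A x)"
  "pi_minus A (flow A t x) = flow A t (pi_minus A x)"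
  "pi_hyp A (flow A t x) = flow A t (pi_hyp A x)"
proof -
  have "flow A t x = flow A t (pi_plus A x) + flow A t (pi_zero A x) + flow A t (pi_minus A x)"
    by (simp add: pi_sum flip: matrix_vector_right_distrib)
  from pi_eqI[OF _ _ _ this] show
    "pi_plus A (flow A t x) = flow A t (pi_plus A x)"
    "pi_zero A (flow A t x) = flow A t (pi_zero A x)"
    "pi_minus A (flow A t x) = flow A t (pi_minus A x)"
    "pi_hyp A (flow A t x) = flow A t (pi_hyp A x)"
    by (simp_all add: flow_mem_L pi_mem pi_hyp_eq matrix_vector_right_distrib)
qed

lemma pi_on_L_plus: "x \<in> L_plus A \<Longrightarrow> pi_plus A x = x \<and> pi_zero A x = 0 \<and> pi_minus A x = 0"
  using pi_eqI[of x A 0 0 x] subspace_L[of A] by (auto simp: subspace_0)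

lemma pi_on_L_zero: "x \<in> L_zero A \<Longrightarrow> pi_plus A x = 0 \<and> pi_zero A x = x \<and> pi_minus A x = 0"
  using pi_eqI[of 0 A x 0 x] subspace_L[of A] by (auto simp: subspace_0)

lemma pi_on_L_minus: "x \<in> L_minus A \<Longrightarrow> pi_plus A x = 0 \<and> pi_zero A x = 0 \<and> pi_minus A x = x"
  using pi_eqI[of 0 A 0 x x] subspace_L[of A] by (auto simp: subspace_0)

lemma pi_on_L_hyp: "x \<in> L_hyp A \<Longrightarrow> pi_hyp A x = x \<and> pi_zero A x = 0"
  using pi_eqI[of _ A 0 _ x] subspace_L[of A] unfolding L_hyp_def by (force simp: subspace_0)

lemma B_hyp_mult: "B_hyp A B *v v = pi_hyp A (B *v v)"
  by (simp add: B_hyp_def matrix_works[OF linear_pi(3)[unfolded linear_matrix_vector_mul_eq[symmetric]]] flip: matrix_vector_mul_assoc)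

section \<open>Weak* compactness of the control functions\<close>

lemma AE_le_if_set_integral_le:
  fixes f g :: "'a \<Rightarrow> real"
  assumes f: "integrable M f" and g: "integrable M g"
    and le: "\<And>E. E \<in> sets M \<Longrightarrow> (\<integral>x. indicator E x * f x \<partial>M) \<le> (\<integral>x. indicator E x * g x \<partial>M)"
  shows "AE x in M. f x \<le> g x"
proof -
  have [measurable]: "f \<in> borel_measurable M" "g \<in> borel_measurable M"
    using f g by auto
  \<comment> \<open>The exceptional set itself serves as test set: f - g is positive on it, yet its
    integral over it is at most 0.\<close>
  define E where "E = {x \<in> space M. g x < f x}"
  have E: "E \<in> sets M" unfolding E_def by measurable
  have int: "integrable M (\<lambda>x. indicator E x * f x)" "integrable M (\<lambda>x. indicator E x * g x)"
    using integrable_mult_indicator[OF E f] integrable_mult_indicator[OF E g] by simp_all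
  have nonneg: "0 \<le> indicator E x * f x - indicator E x * g x" for x
    by (auto simp: indicator_def E_def)
  have "(\<integral>x. indicator E x * f x - indicator E x * g x \<partial>M) = 0"
  proof (rule antisym)
    show "(\<integral>x. indicator E x * f x - indicator E x * g x \<partial>M) \<le> 0"
      using le[OF E] int by (simp add: Bochner_Integration.integral_diff)
  qed (rule Bochner_Integration.integral_nonneg, rule nonneg)
  then have "AE x in M. indicator E x * f x - indicator E x * g x = 0"
    using int nonneg by (subst (asm) integral_nonneg_eq_0_iff_AE) auto
  then show ?thesis
    by (rule AE_mp) (auto simp: E_def indicator_def intro!: AE_I2 split: if_splits)
qed

text \<open>A bounded functional on L^1 of a sigma-finite measure, written on functions instead of
  classes; \<open>bound\<close> makes \<phi> blind to changes on null sets.\<close>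

locale L1_functional = sigma_finite_measure +
  fixes \<phi> :: "('a \<Rightarrow> real) \<Rightarrow> real" and C :: real
  assumes add: "\<And>f g. integrable M f \<Longrightarrow> integrable M g \<Longrightarrow> \<phi> (\<lambda>x. f x + g x) = \<phi> f + \<phi> g"
    and scale: "\<And>f c. integrable M f \<Longrightarrow> \<phi> (\<lambda>x. c * f x) = c * \<phi> f"
    and bound: "\<And>f. integrable M f \<Longrightarrow> \<bar>\<phi> f\<bar> \<le> C * (\<integral>x. \<bar>f x\<bar> \<partial>M)"
begin

lemma diff: "integrable M f \<Longrightarrow> integrable M g \<Longrightarrow> \<phi> (\<lambda>x. f x - g x) = \<phi> f - \<phi> g"
  using add[of f "\<lambda>x. - 1 * g x"] scale[of g "- 1"] by simp

lemma sum:
  assumes "finite I" "\<And>i. i \<in> I \<Longrightarrow> integrable M (f i)"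
  shows "\<phi> (\<lambda>x. \<Sum>i\<in>I. f i x) = (\<Sum>i\<in>I. \<phi> (f i))"
  using assms
proof (induction I rule: finite_induct)
  case empty
  show ?case using scale[of "\<lambda>_. 0" 0] by simp
next
  case (insert i I)
  then show ?case by (simp add: add)
qed

text \<open>Dominated convergence passes through \<phi>, because \<open>bound\<close> controls
  \<phi> by the L^1 norm of the difference. It serves twice below: for countable additivity and for
  the limit step of the representation.\<close>

lemma tendsto_functional:
  assumes [measurable]: "f \<in> borel_measurable M" "\<And>n. s n \<in> borel_measurable M"
    and w: "integrable M w" and lim: "AE x in M. (\<lambda>n. s n x) \<longlonglongrightarrow> f x"
    and le: "\<And>n. AE x in M. \<bar>s n x\<bar> \<le> w x"
  shows "(\<lambda>n. \<phi> (s n)) \<longlonglongrightarrow> \<phi> f"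
proof -
  have int: "integrable M f" "\<And>n. integrable M (s n)"
    using le by (auto intro!: integrable_dominated_convergence[OF _ _ w lim]
      integrable_dominated_convergence2[OF _ _ w lim])
  have "(\<lambda>n. \<integral>x. \<bar>s n x - f x\<bar> \<partial>M) \<longlonglongrightarrow> (\<integral>x. 0 \<partial>M)"
  proof (rule integral_dominated_convergence)
    show "integrable M (\<lambda>x. w x + \<bar>f x\<bar>)" using w int by auto
    show "AE x in M. norm (\<bar>s n x - f x\<bar>) \<le> w x + \<bar>f x\<bar>" for n
      using le[of n] by eventually_elim auto
    show "AE x in M. (\<lambda>n. \<bar>s n x - f x\<bar>) \<longlonglongrightarrow> 0"
      using lim by eventually_elim (auto intro: tendsto_rabs_zero simp: LIM_zero_iff)
  qed auto
  then have "(\<lambda>n. C * (\<integral>x. \<bar>s n x - f x\<bar> \<partial>M)) \<longlonglongrightarrow> 0"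
    using tendsto_mult_left[of _ 0 _ C] by simp
  moreover have "\<bar>\<phi> (s n) - \<phi> f\<bar> \<le> C * (\<integral>x. \<bar>s n x - f x\<bar> \<partial>M)" for n
    using bound[of "\<lambda>x. s n x - f x"] diff[of "s n" f] int by simp
  ultimately have "(\<lambda>n. \<phi> (s n) - \<phi> f) \<longlonglongrightarrow> 0"
    by (intro Lim_null_comparison[of "\<lambda>n. \<phi> (s n) - \<phi> f"]) auto
  then show ?thesis by (simp add: LIM_zero_iff)
qed

text \<open>
  With a positive integrable weight \<open>w\<close>, the set function \<open>E \<mapsto> \<phi> (1\<^sub>E w) + C \<integral>\<^sub>E w\<close> is a
  finite measure; its Radon--Nikodym density with respect to \<open>w dM\<close>, lowered by \<open>C\<close>,
  represents \<open>\<phi>\<close>.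
\<close>

lemma representation:
  "\<exists>u\<in>borel_measurable M. (AE x in M. \<bar>u x\<bar> \<le> C) \<and> (\<forall>f. integrable M f \<longrightarrow> \<phi> f = (\<integral>x. u x * f x \<partial>M))"
proof -
  obtain w :: "'a \<Rightarrow> real" where w[measurable]: "w \<in> borel_measurable M" and wpos: "\<And>x. w x > 0"
    and wint: "integrable M w"
    by (rule obtain_positive_integrable_function) blast
  have iw: "integrable M (\<lambda>x. indicator E x * w x)" if "E \<in> sets M" for E
    using integrable_mult_indicator[OF that wint] by simp
  \<comment> \<open>By \<open>bound\<close>, the added multiple of the weighted measure keeps
    \<open>m\<close> nonnegative, so it is a measure and not merely a signed one.\<close>
  define m where "m E = \<phi> (\<lambda>x. indicator E x * w x) + C * (\<integral>x. indicator E x * w x \<partial>M)" for E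
  have bd: "\<bar>\<phi> (\<lambda>x. indicator E x * w x)\<bar> \<le> C * (\<integral>x. indicator E x * w x \<partial>M)" if "E \<in> sets M" for E
    using bound[OF iw[OF that]] wpos by (simp add: abs_mult less_imp_le)
  have m_nonneg: "m E \<ge> 0" if "E \<in> sets M" for E
    using bd[OF that] by (simp add: m_def)
  define \<nu> where "\<nu> = density M w"
  define N where "N = measure_of (space M) (sets M) (\<lambda>E. ennreal (m E))"
  have sets_N: "sets N = sets M" and space_N: "space N = space M"
    by (simp_all add: N_def)
  have ca: "countably_additive (sets M) (\<lambda>E. ennreal (m E))"
    unfolding countably_additive_def
  proof (intro allI impI)
    fix A :: "nat \<Rightarrow> 'a set"
    assume A: "range A \<subseteq> sets M" "disjoint_family A" "(\<Union>i. A i) \<in> sets M"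
    have Ai[measurable]: "A i \<in> sets M" for i using A(1) by auto
    have ind: "indicator (\<Union>i<n. A i) x * w x = (\<Sum>i<n. indicator (A i) x * w x)" for n x
    proof -
      have "indicator (\<Union>i<n. A i) x = (\<Sum>i<n. indicator (A i) x :: real)"
        using A(2) by (intro indicator_UN_disjoint) (auto simp: disjoint_family_on_def)
      then show ?thesis by (simp only: sum_distrib_right)
    qed
    have sum_m: "(\<Sum>i<n. m (A i)) = m (\<Union>i<n. A i)" for n
      unfolding m_def ind
      by (subst sum, simp, rule iw, simp, subst Bochner_Integration.integral_sum, rule iw, simp)
        (simp add: sum.distrib sum_distrib_left)
    have lim: "AE x in M. (\<lambda>n. indicator (\<Union>i<n. A i) x * w x) \<longlonglongrightarrow> indicator (\<Union>i. A i) x * w x"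
      by (intro AE_I2 tendsto_mult_right LIMSEQ_indicator_UN)
    have dom: "AE x in M. \<bar>indicator (\<Union>i<n. A i) x * w x\<bar> \<le> w x" for n
      using wpos by (intro AE_I2) (auto simp: indicator_def less_imp_le)
    have "(\<lambda>n. m (\<Union>i<n. A i)) \<longlonglongrightarrow> m (\<Union>i. A i)"
      unfolding m_def
      by (intro tendsto_add tendsto_mult_left tendsto_functional[OF _ _ wint lim dom]
          integral_dominated_convergence[OF _ _ wint lim]) (use dom in auto)
    then have "(\<lambda>i. m (A i)) sums m (\<Union>i. A i)"
      by (simp add: sums_def sum_m)
    then show "(\<Sum>i. ennreal (m (A i))) = ennreal (m (\<Union>i. A i))"
      by (intro suminf_ennreal_eq m_nonneg) auto
  qed
  have "m {} = 0"
    using scale[of "\<lambda>_. 0" 0] by (simp add: m_def)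
  then have emeasure_N: "emeasure N E = ennreal (m E)" if "E \<in> sets M" for E
    unfolding N_def using that sets.space_closed ca
    by (intro emeasure_measure_of[OF N_def[unfolded N_def]]) (auto simp: positive_def N_def)
  have fin: "finite_measure \<nu>"
    unfolding \<nu>_def using wint wpos
    by (intro finite_measureI) (simp add: emeasure_density nn_integral_eq_integral less_imp_le cong: nn_integral_cong)
  interpret nu: finite_measure \<nu> by fact
  have int_nu: "integrable \<nu> f \<longleftrightarrow> integrable M (\<lambda>x. w x * f x)" if "f \<in> borel_measurable M" for f :: "'a \<Rightarrow> real"
    unfolding \<nu>_def using wpos that by (subst integrable_density) (auto simp: less_imp_le)
  have integral_nu: "integral\<^sup>L \<nu> f = (\<integral>x. w x * f x \<partial>M)" if "f \<in> borel_measurable M" for f :: "'a \<Rightarrow> real"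
    unfolding \<nu>_def using wpos that by (subst integral_density) (auto simp: less_imp_le)
  have AE_nu: "(AE x in \<nu>. P x) \<longleftrightarrow> (AE x in M. P x)" for P
    unfolding \<nu>_def using wpos by (subst AE_density) auto
  have "absolutely_continuous \<nu> N"
    unfolding absolutely_continuous_def
  proof
    fix E assume "E \<in> null_sets \<nu>"
    then have E: "E \<in> sets M" "E \<in> null_sets M"
      using AE_nu[of "\<lambda>x. x \<notin> E"] by (auto simp: AE_iff_null_sets[symmetric] \<nu>_def null_sets_def)
    then have "AE x in M. indicator E x * w x = 0"
      by (auto simp: AE_iff_null_sets indicator_def elim!: eventually_mono dest!: AE_not_in)
    then have "(\<integral>x. indicator E x * w x \<partial>M) = 0"
      by (rule integral_eq_zero_AE)
    with bd[OF E(1)] have "m E = 0" by (simp add: m_def)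
    with E show "E \<in> null_sets N"
      by (simp add: null_sets_def sets_N emeasure_N)
  qed
  then obtain f where f[measurable]: "f \<in> borel_measurable \<nu>" and N: "density \<nu> f = N"
    using nu.Radon_Nikodym[of N] by (auto simp: sets_N \<nu>_def)
  have f_M[measurable]: "f \<in> borel_measurable M" using f by (simp add: \<nu>_def)
  define g where "g = enn2real \<circ> f"
  have g[measurable]: "g \<in> borel_measurable M" unfolding g_def comp_def by measurable
  have int_f: "(\<integral>\<^sup>+x. f x * indicator E x \<partial>\<nu>) = ennreal (m E)" if "E \<in> sets M" for E
    using emeasure_N[OF that] that by (simp add: emeasure_density \<nu>_def flip: N)
  have "(\<integral>\<^sup>+x. f x \<partial>\<nu>) = (\<integral>\<^sup>+x. f x * indicator (space M) x \<partial>\<nu>)"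
    by (intro nn_integral_cong) (simp add: \<nu>_def)
  then have "(\<integral>\<^sup>+x. f x \<partial>\<nu>) = ennreal (m (space M))"
    using int_f[of "space M"] by simp
  then have "AE x in \<nu>. f x \<noteq> \<infinity>"
    by (intro nn_integral_noteq_infinite) (auto)
  then have fg: "AE x in \<nu>. f x = ennreal (g x)"
    by eventually_elim (simp add: g_def less_top)
  have ig: "(\<integral>\<^sup>+x. ennreal (indicator E x * g x) \<partial>\<nu>) = ennreal (m E)" if "E \<in> sets M" for E
  proof -
    have "(\<integral>\<^sup>+x. ennreal (indicator E x * g x) \<partial>\<nu>) = (\<integral>\<^sup>+x. f x * indicator E x \<partial>\<nu>)"
      using fg by (intro nn_integral_cong_AE) (auto simp: indicator_def elim!: eventually_mono)
    then show ?thesis using int_f[OF that] by simp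
  qed
  have gE: "has_bochner_integral \<nu> (\<lambda>x. indicator E x * g x) (m E)" if [measurable]: "E \<in> sets M" for E
    by (intro has_bochner_integral_nn_integral ig that m_nonneg)
      (auto simp: \<nu>_def g_def)
  define u where "u x = g x - C" for x
  have u[measurable]: "u \<in> borel_measurable M" unfolding u_def by measurable
  have "integrable \<nu> (\<lambda>x. indicator (space M) x * g x)"
    using gE[of "space M"] by (simp add: has_bochner_integral_iff)
  then have g_int: "integrable \<nu> g"
    by (rule Bochner_Integration.integrable_cong[THEN iffD1, rotated 2]) (auto simp: \<nu>_def)
  then have u_int: "integrable \<nu> u" unfolding u_def by auto
  have iE: "integrable \<nu> (\<lambda>x. indicator E x * c)" if [measurable]: "E \<in> sets M" for E and c :: real
    using integrable_mult_right[OF iw[OF that], of c] by (subst int_nu) (auto simp: mult_ac)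
  have uE: "(\<integral>x. indicator E x * u x \<partial>\<nu>) = \<phi> (\<lambda>x. indicator E x * w x)" if E[measurable]: "E \<in> sets M" for E
  proof -
    have "(\<integral>x. indicator E x * u x \<partial>\<nu>) = (\<integral>x. indicator E x * g x - indicator E x * C \<partial>\<nu>)"
      by (simp add: u_def algebra_simps)
    also have "\<dots> = m E - (\<integral>x. indicator E x * C \<partial>\<nu>)"
      using gE[OF E] iE[OF E, of C]
      by (subst Bochner_Integration.integral_diff) (auto simp: has_bochner_integral_iff)
    also have "(\<integral>x. indicator E x * C \<partial>\<nu>) = C * (\<integral>x. indicator E x * w x \<partial>M)"
      by (subst integral_nu) (simp_all add: mult_ac flip: integral_mult_right_zero)
    finally show ?thesis by (simp add: m_def)
  qed
  \<comment> \<open>On measurable sets the bounds -C \<le> u \<le> C are the estimate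
    \<open>bd\<close>; testing on all such sets gives them almost everywhere.\<close>
  have C_E: "(\<integral>x. indicator E x * c \<partial>\<nu>) = c * (\<integral>x. indicator E x * w x \<partial>M)" if "E \<in> sets M" for c E
    using that by (subst integral_nu) (simp_all add: mult_ac flip: integral_mult_right_zero)
  have "AE x in \<nu>. u x \<le> C"
  proof (rule AE_le_if_set_integral_le[OF u_int nu.integrable_const])
    fix E assume "E \<in> sets \<nu>"
    then have E: "E \<in> sets M" by (simp add: \<nu>_def)
    show "(\<integral>x. indicator E x * u x \<partial>\<nu>) \<le> (\<integral>x. indicator E x * C \<partial>\<nu>)"
      unfolding uE[OF E] C_E[OF E] using bd[OF E] by linarith
  qed
  moreover have "AE x in \<nu>. - C \<le> u x"
  proof (rule AE_le_if_set_integral_le[OF nu.integrable_const u_int])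
    fix E assume "E \<in> sets \<nu>"
    then have E: "E \<in> sets M" by (simp add: \<nu>_def)
    show "(\<integral>x. indicator E x * - C \<partial>\<nu>) \<le> (\<integral>x. indicator E x * u x \<partial>\<nu>)"
      unfolding uE[OF E] C_E[OF E] using bd[OF E] by simp
  qed
  ultimately have u_le: "AE x in \<nu>. \<bar>u x\<bar> \<le> C"
    by eventually_elim auto
  note \<phi>_add = add
  \<comment> \<open>From indicators to all \<nu>-integrable k. Since \<nu> has density w, the
    products w k are exactly the M-integrable functions, and division by w > 0 recovers an arbitrary
    one at the end.\<close>
  have rep: "\<phi> (\<lambda>x. w x * k x) = (\<integral>x. u x * k x \<partial>\<nu>)" if "integrable \<nu> k" for k
    using that
  proof (induction rule: integrable_induct)
    case (base E c)
    then have "E \<in> sets M" by (simp add: \<nu>_def)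
    have "\<phi> (\<lambda>x. w x * (indicator E x *\<^sub>R c)) = c * \<phi> (\<lambda>x. indicator E x * w x)"
      using scale[OF iw[OF \<open>E \<in> sets M\<close>], of c] by (simp add: mult_ac)
    also have "\<dots> = (\<integral>x. c * (indicator E x * u x) \<partial>\<nu>)"
      using uE[OF \<open>E \<in> sets M\<close>] by simp
    also have "\<dots> = (\<integral>x. u x * (indicator E x *\<^sub>R c) \<partial>\<nu>)"
      by (rule Bochner_Integration.integral_cong) (simp_all add: mult_ac)
    finally show ?case .
  next
    case (add k l)
    then have [measurable]: "k \<in> borel_measurable M" "l \<in> borel_measurable M" by (auto simp: \<nu>_def)
    have "\<phi> (\<lambda>x. w x * (k x + l x)) = \<phi> (\<lambda>x. w x * k x) + \<phi> (\<lambda>x. w x * l x)"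
      using \<phi>_add[of "\<lambda>x. w x * k x" "\<lambda>x. w x * l x"] add int_nu by (simp add: distrib_left)
    moreover have "integrable \<nu> (\<lambda>x. u x * k x)" if "integrable \<nu> k" for k
      using u_le that by (intro Bochner_Integration.integrable_bound[OF integrable_mult_right[OF that, of C]])
        (auto simp: \<nu>_def abs_mult elim!: eventually_mono intro!: mult_right_mono)
    ultimately show ?case
      using add by (simp add: distrib_left)
  next
    case (lim k s)
    then have [measurable]: "k \<in> borel_measurable M" "\<And>i. s i \<in> borel_measurable M" by (auto simp: \<nu>_def)
    have 1: "(\<lambda>i. \<phi> (\<lambda>x. w x * s i x)) \<longlonglongrightarrow> \<phi> (\<lambda>x. w x * k x)"
    proof (rule tendsto_functional)
      show "integrable M (\<lambda>x. w x * (2 * \<bar>k x\<bar>))"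
        using lim(4) by (subst int_nu[symmetric]) auto
      show "AE x in M. (\<lambda>i. w x * s i x) \<longlonglongrightarrow> w x * k x"
        using lim by (intro AE_I2 tendsto_mult_left) (auto simp: \<nu>_def)
      show "AE x in M. \<bar>w x * s i x\<bar> \<le> w x * (2 * \<bar>k x\<bar>)" for i
        using lim(3)[of _ i] wpos by (intro AE_I2) (auto simp: abs_mult \<nu>_def less_imp_le intro!: mult_left_mono)
    qed auto
    have 2: "(\<lambda>i. \<integral>x. u x * s i x \<partial>\<nu>) \<longlonglongrightarrow> (\<integral>x. u x * k x \<partial>\<nu>)"
    proof (rule integral_dominated_convergence)
      show "integrable \<nu> (\<lambda>x. C * (2 * \<bar>k x\<bar>))" using lim(4) by auto
      show "AE x in \<nu>. (\<lambda>i. u x * s i x) \<longlonglongrightarrow> u x * k x"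
        using lim by (intro AE_I2 tendsto_mult_left) auto
      show "AE x in \<nu>. norm (u x * s i x) \<le> C * (2 * \<bar>k x\<bar>)" for i
        using u_le AE_space by eventually_elim (use lim(3)[of _ i] in \<open>auto simp: abs_mult intro!: mult_mono\<close>)
    qed (auto simp: \<nu>_def)
    show ?case
      using 1 2 lim(5) by (simp add: LIMSEQ_unique)
  qed
  have "\<phi> h = (\<integral>x. u x * h x \<partial>M)" if h: "integrable M h" for h
  proof -
    have [measurable]: "h \<in> borel_measurable M" using h by auto
    have w0: "w x \<noteq> 0" for x using wpos[of x] by simp
    have "integrable \<nu> (\<lambda>x. h x / w x)"
      using h w0 by (subst int_nu) auto
    from rep[OF this] show ?thesis
      using w0 by (simp add: integral_nu)
  qed
  with u u_le show ?thesis
    unfolding AE_nu by blast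
qed

end

section \<open>The weak* topology through its pairings\<close>

lemma rep_linf_ess_bounded: "ess_bounded (rep_linf u)"
  using Quotient_rep_reflp[OF Quotient_linf, of u] by blast

lemma rep_linf_measurable [measurable]: "rep_linf u \<in> borel_measurable borel"
  using rep_linf_ess_bounded[of u] by (simp add: ess_bounded_def)

lemma rep_abs_linf: "ess_bounded f \<Longrightarrow> AE t in lborel. rep_linf (abs_linf f) t = f t"
  using Quotient_rep_abs[OF Quotient_linf, of f] by blast

lemma linf_eqI: "AE t in lborel. rep_linf u t = rep_linf v t \<Longrightarrow> u = v"
  using Quotient_rel_rep[OF Quotient_linf, of u v] rep_linf_ess_bounded by blast

lemma rep_linf_shift: "AE s in lborel. rep_linf (shift t u) s = rep_linf u (t + s)"
  unfolding shift_def map_fun_def comp_def id_def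
  by (rule rep_abs_linf[OF ess_bounded_shift[OF rep_linf_ess_bounded]])

abbreviation pairing :: "'m::finite linf \<Rightarrow> (real \<Rightarrow> real^'m) \<Rightarrow> real" where
  "pairing u g \<equiv> (\<integral>t. rep_linf u t \<bullet> g t \<partial>lborel)"

lemma integrable_pairing:
  assumes "integrable lborel g"
  shows "integrable lborel (\<lambda>t. rep_linf u t \<bullet> g t)"
proof -
  obtain C where C: "AE t in lborel. norm (rep_linf u t) \<le> C"
    using rep_linf_ess_bounded[of u] by (auto simp: ess_bounded_def)
  show ?thesis
  proof (rule Bochner_Integration.integrable_bound)
    show "integrable lborel (\<lambda>t. C * norm (g t))" using assms by auto
    show "AE t in lborel. norm (rep_linf u t \<bullet> g t) \<le> norm (C * norm (g t))"
      using C
    proof eventually_elim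
      case (elim t)
      have "norm (rep_linf u t \<bullet> g t) \<le> norm (rep_linf u t) * norm (g t)"
        by (simp add: Cauchy_Schwarz_ineq2)
      also have "\<dots> \<le> C * norm (g t)" using elim by (intro mult_right_mono) auto
      finally show ?case by simp
    qed
  qed (use assms in auto)
qed

lemma topspace_weak_star [simp]: "topspace weak_star = UNIV"
proof -
  have "UNIV \<in> {{u :: 'm::finite linf. pairing u g \<in> W} | g W. integrable lborel g \<and> open W}"
    by (intro CollectI exI[of _ "\<lambda>_. 0"] exI[of _ UNIV]) auto
  then show ?thesis
    unfolding weak_star_def topology_generated_by_topspace by blast
qed

lemma continuous_map_pairing:
  assumes "integrable lborel g"
  shows "continuous_map weak_star euclideanreal (\<lambda>u. pairing u g)"
  unfolding continuous_map_def
proof (intro conjI allI impI)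
  fix W :: "real set" assume "openin euclideanreal W"
  with assms show "openin weak_star {u \<in> topspace weak_star. pairing u g \<in> W}"
    unfolding weak_star_def topspace_weak_star[unfolded weak_star_def]
    by (intro topology_generated_by_Basis) auto
qed simp

lemma continuous_map_into_weak_star:
  fixes f :: "'a \<Rightarrow> 'm::finite linf"
  assumes "\<And>g. integrable lborel g \<Longrightarrow> continuous_map X euclideanreal (\<lambda>x. pairing (f x) g)"
  shows "continuous_map X weak_star f"
  unfolding weak_star_def continuous_on_generated_topo_iff
proof (intro conjI allI impI)
  fix V assume "V \<in> {{u :: 'm linf. pairing u g \<in> W} | g W. integrable lborel g \<and> open W}"
  then obtain g W where V: "V = {u :: 'm linf. pairing u g \<in> W}" "integrable lborel g" "open W" by blast
  have "openin X {x \<in> topspace X. pairing (f x) g \<in> W}"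
    by (rule openin_continuous_map_preimage[OF assms[OF V(2)]]) (use V in simp)
  also have "{x \<in> topspace X. pairing (f x) g \<in> W} = f -` V \<inter> topspace X"
    unfolding V by blast
  finally show "openin X (f -` V \<inter> topspace X)" .
next
  show "f ` topspace X \<subseteq> \<Union> {{u :: 'm linf. pairing u g \<in> W} | g W. integrable lborel g \<and> open W}"
    using topspace_weak_star unfolding weak_star_def topology_generated_by_topspace by blast
qed

lemma limitin_weak_star:
  assumes "\<And>g. integrable lborel g \<Longrightarrow> (\<lambda>n. pairing (\<sigma> n) g) \<longlonglongrightarrow> pairing l g"
  shows "limitin weak_star \<sigma> l sequentially"
  unfolding limitin_def
proof (intro conjI allI impI)
  fix V assume "openin weak_star V \<and> l \<in> V"
  then have "generate_topology_on {{u. pairing u g \<in> W} | g W. integrable lborel g \<and> open W} V" "l \<in> V"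
    unfolding weak_star_def openin_topology_generated_by_iff by auto
  then show "\<forall>\<^sub>F n in sequentially. \<sigma> n \<in> V"
  proof induction
    case (Basis V)
    then obtain g W where V: "V = {u. pairing u g \<in> W}" "integrable lborel g" "open W" by blast
    with Basis topological_tendstoD[OF assms[OF V(2)] V(3)] show ?case by simp
  next
    case (Int a b)
    then show ?case by (simp add: eventually_conj)
  next
    case (UN K)
    then obtain k where k: "k \<in> K" "l \<in> k" by blast
    from UN.IH[OF this] show ?case
      by eventually_elim (use k in blast)
  qed simp
qed simp

lemma obtain_weight:
  obtains w :: "real \<Rightarrow> real" where "w \<in> borel_measurable borel" "\<And>t. w t > 0" "integrable lborel w"
proof -
  obtain w :: "real \<Rightarrow> real" where "w \<in> borel_measurable lborel" "\<And>t. w t > 0" "integrable lborel w"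
    using sigma_finite_measure.obtain_positive_integrable_function[OF sigma_finite_lborel] by metis
  then show ?thesis by (intro that) simp_all
qed

text \<open>Test functions of the form indicator times weight times unit vector separate the
  controls; the positive integrable weight makes the indicator of every measurable set
  integrable.\<close>

lemma pairing_eq_imp_eq:
  assumes "\<And>g. integrable lborel g \<Longrightarrow> pairing u g = pairing v g"
  shows "u = v"
proof -
  obtain w :: "real \<Rightarrow> real" where w[measurable]: "w \<in> borel_measurable borel" and wpos: "\<And>t. w t > 0"
    and wint: "integrable lborel w"
    using obtain_weight by blast
  have iE: "integrable lborel (\<lambda>t. (indicator E t * w t) *\<^sub>R axis i 1)" if "E \<in> sets lborel" for E i
    using integrable_mult_indicator[OF that wint] by simp
  have int: "integrable lborel (\<lambda>t. w t * (rep_linf u t $ i))" for u :: "'a linf" and i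
    using integrable_pairing[of "\<lambda>t. w t *\<^sub>R axis i 1" u] wint by (simp add: inner_axis)
  have le: "AE t in lborel. w t * (rep_linf u t $ i) \<le> w t * (rep_linf v t $ i)"
    if "\<And>g. integrable lborel g \<Longrightarrow> pairing u g = pairing v g" for u v :: "'a linf" and i
  proof (rule AE_le_if_set_integral_le[OF int int])
    fix E :: "real set" assume E: "E \<in> sets lborel"
    show "(\<integral>t. indicator E t * (w t * (rep_linf u t $ i)) \<partial>lborel)
        \<le> (\<integral>t. indicator E t * (w t * (rep_linf v t $ i)) \<partial>lborel)"
      using that[OF iE[OF E, of i]] by (simp add: inner_axis mult_ac)
  qed
  have "AE t in lborel. \<forall>i\<in>UNIV. rep_linf u t $ i = rep_linf v t $ i"
  proof (rule AE_finite_allI)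
    fix i
    have "AE t in lborel. w t * (rep_linf u t $ i) \<le> w t * (rep_linf v t $ i)"
      by (rule le) (rule assms)
    moreover have "AE t in lborel. w t * (rep_linf v t $ i) \<le> w t * (rep_linf u t $ i)"
      by (rule le) (rule assms[symmetric])
    ultimately show "AE t in lborel. rep_linf u t $ i = rep_linf v t $ i"
    proof eventually_elim
      case (elim t)
      then have "w t * (rep_linf u t $ i) = w t * (rep_linf v t $ i)" by simp
      then show ?case using wpos[of t] by simp
    qed
  qed simp
  then show ?thesis
    by (intro linf_eqI) (simp add: vec_eq_iff)
qed

text \<open>The functionals that come from admissible controls, when U is closed, convex and bounded
  by C. The last clause is the weak form of u(t) \<in> U almost everywhere, through the half-spaces
  containing U. The value 0 off L^1 places the functionals in a product over all functions
  g.\<close>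

definition L1_functionals :: "(real^'m) set \<Rightarrow> real \<Rightarrow> ((real \<Rightarrow> real^'m) \<Rightarrow> real) set" where
  "L1_functionals U C = {\<phi>.
    (\<forall>g. \<not> integrable lborel g \<longrightarrow> \<phi> g = 0) \<and>
    (\<forall>g. integrable lborel g \<longrightarrow> \<bar>\<phi> g\<bar> \<le> C * (\<integral>t. norm (g t) \<partial>lborel)) \<and>
    (\<forall>f g. integrable lborel f \<and> integrable lborel g \<longrightarrow> \<phi> (\<lambda>t. f t + g t) = \<phi> f + \<phi> g) \<and>
    (\<forall>c f. integrable lborel f \<longrightarrow> \<phi> (\<lambda>t. c *\<^sub>R f t) = c * \<phi> f) \<and>
    (\<forall>a b h. (\<forall>x\<in>U. a \<bullet> x \<le> b) \<and> integrable lborel h \<and> (\<forall>t. h t \<ge> 0) \<longrightarrow>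
      \<phi> (\<lambda>t. h t *\<^sub>R a) \<le> b * (\<integral>t. h t \<partial>lborel))}"

text \<open>Banach-Alaoglu by Tychonoff: the set lies in a product of compact intervals and is
  closed there, because each of its conditions involves finitely many coordinates.\<close>

lemma compact_L1_functionals: "compact (L1_functionals U C :: ((real \<Rightarrow> real^'m) \<Rightarrow> real) set)"
proof -
  define B where "B g = (if integrable lborel g then C * (\<integral>t. norm (g t) \<partial>lborel) else 0)" for g :: "real \<Rightarrow> real^'m"
  have "compactin (product_topology (\<lambda>_. euclideanreal) UNIV) (PiE UNIV (\<lambda>g. {- B g..B g}))"
    by (simp add: compactin_PiE)
  then have K: "compact (PiE UNIV (\<lambda>g. {- B g..B g}))"
    by (simp add: euclidean_product_topology)
  have imp: "closed {x. P \<longrightarrow> Q x}" if "closed {x. Q x}" for P and Q :: "((real \<Rightarrow> real^'m) \<Rightarrow> real) \<Rightarrow> bool"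
    using that by (cases P) auto
  have "closed (L1_functionals U C)"
    unfolding L1_functionals_def
    by (intro closed_Collect_conj closed_Collect_all imp closed_Collect_eq closed_Collect_le
        continuous_intros continuous_on_product_coordinates)
  moreover have "L1_functionals U C \<subseteq> PiE UNIV (\<lambda>g. {- B g..B g})"
    by (auto simp: L1_functionals_def B_def PiE_def Pi_def abs_le_iff)
  ultimately show ?thesis
    using K by (metis closed_Int_compact inf.absorb_iff2 Int_commute)
qed

lemma admissible_shift: "u \<in> admissible U \<Longrightarrow> shift t u \<in> admissible U"
proof -
  assume "u \<in> admissible U"
  then have "AE s in lborel. rep_linf u (t + s) \<in> U"
    unfolding admissible_def mem_Collect_eq by (rule AE_lborel_shift)
  with rep_linf_shift[of t u] have "AE s in lborel. rep_linf (shift t u) s \<in> U"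
    by eventually_elim simp
  then show ?thesis by (simp add: admissible_def)
qed

lemma pairing_mem_L1_functionals:
  assumes u: "u \<in> admissible U" and C: "\<And>x. x \<in> U \<Longrightarrow> norm x \<le> C"
  shows "(\<lambda>g. if integrable lborel g then pairing u g else 0) \<in> L1_functionals U C"
  unfolding L1_functionals_def mem_Collect_eq
proof (intro conjI allI impI)
  have U: "AE t in lborel. rep_linf u t \<in> U" using u by (simp add: admissible_def)
  fix g :: "real \<Rightarrow> real^'a" assume g: "integrable lborel g"
  have "\<bar>pairing u g\<bar> \<le> (\<integral>t. \<bar>rep_linf u t \<bullet> g t\<bar> \<partial>lborel)"
    by (rule integral_abs_bound)
  also have "\<dots> \<le> (\<integral>t. C * norm (g t) \<partial>lborel)"
  proof (rule integral_mono_AE)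
    show "AE t in lborel. \<bar>rep_linf u t \<bullet> g t\<bar> \<le> C * norm (g t)"
      using U
    proof eventually_elim
      case (elim t)
      have "\<bar>rep_linf u t \<bullet> g t\<bar> \<le> norm (rep_linf u t) * norm (g t)" by (rule Cauchy_Schwarz_ineq2)
      also have "\<dots> \<le> C * norm (g t)" using C[OF elim] by (rule mult_right_mono) simp
      finally show ?case .
    qed
  qed (use g integrable_pairing[OF g, of u] in auto)
  finally show "\<bar>if integrable lborel g then pairing u g else 0\<bar> \<le> C * (\<integral>t. norm (g t) \<partial>lborel)"
    using g by simp
next
  fix f g :: "real \<Rightarrow> real^'a" assume "integrable lborel f \<and> integrable lborel g"
  then show "(if integrable lborel (\<lambda>t. f t + g t) then pairing u (\<lambda>t. f t + g t) else 0) =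
      (if integrable lborel f then pairing u f else 0) + (if integrable lborel g then pairing u g else 0)"
    by (simp add: inner_add_right integrable_pairing)
next
  fix c and f :: "real \<Rightarrow> real^'a" assume "integrable lborel f"
  then show "(if integrable lborel (\<lambda>t. c *\<^sub>R f t) then pairing u (\<lambda>t. c *\<^sub>R f t) else 0) =
      c * (if integrable lborel f then pairing u f else 0)"
    by simp
next
  fix a b and h :: "real \<Rightarrow> real"
  assume h: "(\<forall>x\<in>U. a \<bullet> x \<le> b) \<and> integrable lborel h \<and> (\<forall>t. 0 \<le> h t)"
  have "pairing u (\<lambda>t. h t *\<^sub>R a) \<le> (\<integral>t. b * h t \<partial>lborel)"
  proof (rule integral_mono_AE)
    have "AE t in lborel. rep_linf u t \<in> U" using u by (simp add: admissible_def)
    then show "AE t in lborel. rep_linf u t \<bullet> h t *\<^sub>R a \<le> b * h t"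
    proof eventually_elim
      case (elim t)
      then have "h t * (a \<bullet> rep_linf u t) \<le> h t * b" using h by (intro mult_left_mono) auto
      then show ?case by (simp add: inner_commute mult.commute)
    qed
  qed (use h integrable_pairing[of "\<lambda>t. h t *\<^sub>R a" u] in auto)
  then show "(if integrable lborel (\<lambda>t. h t *\<^sub>R a) then pairing u (\<lambda>t. h t *\<^sub>R a) else 0) \<le> b * (\<integral>t. h t \<partial>lborel)"
    using h by simp
qed auto

text \<open>Each half-space will yield an inequality for almost every t, and only countably many of
  these can be combined. The complement of U is a union of open half-spaces, so the Lindelof
  property supplies countably many.\<close>

lemma closed_convex_countable_halfspaces:
  fixes U :: "'a::euclidean_space set"
  assumes "closed U" "convex U"
  obtains H :: "('a \<times> real) set" where "countable H" "\<And>a b x. (a, b) \<in> H \<Longrightarrow> x \<in> U \<Longrightarrow> a \<bullet> x \<le> b"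
    "\<And>x. (\<And>a b. (a, b) \<in> H \<Longrightarrow> a \<bullet> x \<le> b) \<Longrightarrow> x \<in> U"
proof -
  define F where "F = (\<lambda>(a, b). {x :: 'a. a \<bullet> x > b}) ` {(a, b). \<forall>x\<in>U. a \<bullet> x \<le> b}"
  have "open S" if "S \<in> F" for S
    using that by (auto simp: F_def open_halfspace_gt)
  then obtain F' where F': "F' \<subseteq> F" "countable F'" "\<Union>F' = \<Union>F"
    using Lindelof by metis
  then obtain H where H: "countable H" "H \<subseteq> {(a, b). \<forall>x\<in>U. a \<bullet> x \<le> b}" "F' = (\<lambda>(a, b). {x. a \<bullet> x > b}) ` H"
    unfolding F_def by (meson countable_subset_image)
  show ?thesis
  proof (rule that[OF H(1)])
    show "a \<bullet> x \<le> b" if "(a, b) \<in> H" "x \<in> U" for a b x using H(2) that by auto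
    show "x \<in> U" if x: "\<And>a b. (a, b) \<in> H \<Longrightarrow> a \<bullet> x \<le> b" for x
    proof (rule ccontr)
      assume "x \<notin> U"
      then obtain a b where ab: "a \<bullet> x < b" "\<And>y. y \<in> U \<Longrightarrow> a \<bullet> y > b"
        using separating_hyperplane_closed_point[OF assms(2,1)] by blast
      then have "x \<in> \<Union>F"
        unfolding F_def by (intro UN_I[of "(- a, - b)"]) (auto simp: less_imp_le)
      then have "x \<in> (\<Union>(a, b)\<in>H. {x. a \<bullet> x > b})"
        using F'(3) H(3) by simp
      then obtain a b where "(a, b) \<in> H" "a \<bullet> x > b" by auto
      with x show False by fastforce
    qed
  qed
qed

text \<open>The functional is represented coordinate by coordinate. The resulting function satisfies
  each half-space inequality almost everywhere, hence countably many of them at once, hence takes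
  its values in U.\<close>

lemma L1_functionals_represented:
  fixes U :: "(real^'m) set"
  assumes \<phi>: "\<phi> \<in> L1_functionals U C" and U: "closed U" "convex U"
  shows "\<exists>u\<in>admissible U. \<forall>g. integrable lborel g \<longrightarrow> pairing u g = \<phi> g"
proof -
  have bound: "integrable lborel g \<Longrightarrow> \<bar>\<phi> g\<bar> \<le> C * (\<integral>t. norm (g t) \<partial>lborel)"
    and add: "integrable lborel f \<Longrightarrow> integrable lborel g \<Longrightarrow> \<phi> (\<lambda>t. f t + g t) = \<phi> f + \<phi> g"
    and scale: "integrable lborel f \<Longrightarrow> \<phi> (\<lambda>t. c *\<^sub>R f t) = c * \<phi> f"
    and half: "(\<forall>x\<in>U. a \<bullet> x \<le> b) \<Longrightarrow> integrable lborel h \<Longrightarrow> (\<forall>t. h t \<ge> 0) \<Longrightarrow>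
      \<phi> (\<lambda>t. h t *\<^sub>R a) \<le> b * (\<integral>t. h t \<partial>lborel)" for f g c a b h
    using \<phi> unfolding L1_functionals_def by blast+
  have sum: "\<phi> (\<lambda>t. \<Sum>i\<in>I. f i t) = (\<Sum>i\<in>I. \<phi> (f i))"
    if "finite I" "\<And>i. i \<in> I \<Longrightarrow> integrable lborel (f i)" for I :: "'m set" and f
    using that
  proof (induction I rule: finite_induct)
    case empty
    show ?case using scale[of "\<lambda>_. 0" 0] by simp
  qed (simp add: add)
  have "\<exists>v\<in>borel_measurable lborel. (AE t in lborel. \<bar>v t\<bar> \<le> C) \<and>
      (\<forall>h. integrable lborel h \<longrightarrow> \<phi> (\<lambda>t. h t *\<^sub>R axis i 1) = (\<integral>t. v t * h t \<partial>lborel))" for i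
  proof (rule L1_functional.representation, unfold_locales)
    fix f g :: "real \<Rightarrow> real" and c
    assume f: "integrable lborel f"
    show "\<phi> (\<lambda>t. (c * f t) *\<^sub>R axis i 1) = c * \<phi> (\<lambda>t. f t *\<^sub>R axis i 1)"
      using scale[of "\<lambda>t. f t *\<^sub>R axis i 1" c] f by simp
    show "\<bar>\<phi> (\<lambda>t. f t *\<^sub>R axis i 1)\<bar> \<le> C * (\<integral>t. \<bar>f t\<bar> \<partial>lborel)"
      using bound[of "\<lambda>t. f t *\<^sub>R axis i 1"] f by simp
    assume g: "integrable lborel g"
    show "\<phi> (\<lambda>t. (f t + g t) *\<^sub>R axis i 1) = \<phi> (\<lambda>t. f t *\<^sub>R axis i 1) + \<phi> (\<lambda>t. g t *\<^sub>R axis i 1)"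
      using add[of "\<lambda>t. f t *\<^sub>R axis i 1" "\<lambda>t. g t *\<^sub>R axis i 1"] f g by (simp add: scaleR_left_distrib)
  qed
  then have "\<exists>v. \<forall>i. v i \<in> borel_measurable lborel \<and> (AE t in lborel. \<bar>v i t\<bar> \<le> C) \<and>
      (\<forall>h. integrable lborel h \<longrightarrow> \<phi> (\<lambda>t. h t *\<^sub>R axis i 1) = (\<integral>t. v i t * h t \<partial>lborel))"
    by (intro choice) blast
  then obtain v where v[measurable]: "\<And>i. v i \<in> borel_measurable borel"
    and v_le: "\<And>i. AE t in lborel. \<bar>v i t\<bar> \<le> C"
    and v_int: "\<And>i h. integrable lborel h \<Longrightarrow> \<phi> (\<lambda>t. h t *\<^sub>R axis i 1) = (\<integral>t. v i t * h t \<partial>lborel)"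
    by auto
  define f :: "real \<Rightarrow> real^'m" where "f t = (\<Sum>i\<in>UNIV. v i t *\<^sub>R axis i 1)" for t
  have f_nth: "f t $ i = v i t" for t i
    by (simp add: f_def axis_def if_distrib cong: if_cong)
  have f_meas[measurable]: "f \<in> borel_measurable borel" unfolding f_def by measurable
  have "AE t in lborel. \<forall>i\<in>UNIV. \<bar>v i t\<bar> \<le> C" by (intro AE_finite_allI v_le) simp
  then have "AE t in lborel. norm (f t) \<le> real CARD('m) * C"
  proof eventually_elim
    case (elim t)
    have "norm (f t) \<le> (\<Sum>i\<in>UNIV. \<bar>f t $ i\<bar>)" by (rule norm_le_l1_cart)
    also have "\<dots> \<le> (\<Sum>i\<in>(UNIV::'m set). C)" using elim by (intro sum_mono) (simp add: f_nth)
    finally show ?case by simp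
  qed
  then have ess: "ess_bounded f" unfolding ess_bounded_def by auto
  define u where "u = abs_linf f"
  have u_eq: "AE t in lborel. rep_linf u t = f t"
    unfolding u_def by (rule rep_abs_linf[OF ess])
  have pairing: "pairing u g = \<phi> g" if g: "integrable lborel g" for g
  proof -
    have gi: "integrable lborel (\<lambda>t. g t $ i)" for i
      using integrable_inner_left[OF g, of "axis i 1"] by (simp add: inner_axis)
    have vgi: "integrable lborel (\<lambda>t. v i t * (g t $ i))" for i
      by (rule Bochner_Integration.integrable_bound[OF integrable_mult_right[OF integrable_abs[OF gi], of C]])
        (use v_le[of i] gi in \<open>auto simp: abs_mult elim!: eventually_mono intro!: mult_right_mono\<close>)
    have "pairing u g = (\<integral>t. (\<Sum>i\<in>UNIV. v i t * (g t $ i)) \<partial>lborel)"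
    proof (rule integral_cong_AE)
      show "AE t in lborel. rep_linf u t \<bullet> g t = (\<Sum>i\<in>UNIV. v i t * (g t $ i))"
        using u_eq by eventually_elim (simp add: inner_vec_def f_nth)
      show "(\<lambda>t. \<Sum>i\<in>UNIV. v i t * (g t $ i)) \<in> borel_measurable lborel"
        using vgi by (intro borel_measurable_sum) auto
    qed (use g in auto)
    also have "\<dots> = (\<Sum>i\<in>UNIV. \<phi> (\<lambda>t. (g t $ i) *\<^sub>R axis i 1))"
      using vgi by (simp add: v_int[OF gi])
    also have "\<dots> = \<phi> (\<lambda>t. \<Sum>i\<in>UNIV. (g t $ i) *\<^sub>R axis i 1)"
      using gi by (subst sum) auto
    also have "(\<lambda>t. \<Sum>i\<in>UNIV. (g t $ i) *\<^sub>R axis i 1) = g"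
      by (simp add: fun_eq_iff vec_eq_iff axis_def if_distrib cong: if_cong)
    finally show ?thesis .
  qed
  obtain H where H: "countable H" "\<And>a b x. (a, b) \<in> H \<Longrightarrow> x \<in> U \<Longrightarrow> a \<bullet> x \<le> b"
    "\<And>x. (\<And>a b. (a, b) \<in> H \<Longrightarrow> a \<bullet> x \<le> b) \<Longrightarrow> x \<in> U"
    using closed_convex_countable_halfspaces[OF U] by metis
  obtain w :: "real \<Rightarrow> real" where w[measurable]: "w \<in> borel_measurable borel" and wpos: "\<And>t. w t > 0"
    and wint: "integrable lborel w"
    using obtain_weight by blast
  have "AE t in lborel. a \<bullet> rep_linf u t \<le> b" if ab: "(a, b) \<in> H" for a b
  proof -
    have "AE t in lborel. w t * (rep_linf u t \<bullet> a) \<le> w t * b"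
    proof (rule AE_le_if_set_integral_le)
      show "integrable lborel (\<lambda>t. w t * (rep_linf u t \<bullet> a))"
        using integrable_pairing[of "\<lambda>t. w t *\<^sub>R a" u] wint by simp
      show "integrable lborel (\<lambda>t. w t * b)" using wint by simp
      fix E :: "real set" assume E: "E \<in> sets lborel"
      have iE: "integrable lborel (\<lambda>t. indicator E t * w t)"
        using integrable_mult_indicator[OF E wint] by simp
      have "(\<integral>t. indicator E t * (w t * (rep_linf u t \<bullet> a)) \<partial>lborel) = pairing u (\<lambda>t. (indicator E t * w t) *\<^sub>R a)"
        by (simp add: mult_ac)
      also have "\<dots> = \<phi> (\<lambda>t. (indicator E t * w t) *\<^sub>R a)"
        using iE by (intro pairing) simp
      also have "\<dots> \<le> b * (\<integral>t. indicator E t * w t \<partial>lborel)"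
        using H(2)[OF ab] iE wpos by (intro half) (auto simp: less_imp_le)
      also have "\<dots> = (\<integral>t. b * (indicator E t * w t) \<partial>lborel)" by simp
      finally show "(\<integral>t. indicator E t * (w t * (rep_linf u t \<bullet> a)) \<partial>lborel) \<le> (\<integral>t. indicator E t * (w t * b) \<partial>lborel)"
        by (simp add: mult_ac)
    qed
    then show ?thesis
      by eventually_elim (simp add: wpos inner_commute)
  qed
  then have "AE t in lborel. \<forall>h\<in>H. fst h \<bullet> rep_linf u t \<le> snd h"
    by (subst AE_ball_countable[OF H(1)]) auto
  then have "AE t in lborel. rep_linf u t \<in> U"
    by eventually_elim (use H(3) in fastforce)
  then have "u \<in> admissible U" by (simp add: admissible_def)
  with pairing show ?thesis by blast
qed

text \<open>Choosing a representing control maps the compact set of functionals onto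
  \<open>admissible U\<close>. The map is weak* continuous because pairing its value with g is
  evaluation of the functional at g.\<close>

lemma compactin_admissible:
  assumes "compact U" "convex U"
  shows "compactin weak_star (admissible U)"
proof -
  obtain C where C: "\<And>x. x \<in> U \<Longrightarrow> norm x \<le> C"
    using compact_imp_bounded[OF assms(1)] unfolding bounded_iff by blast
  let ?\<Phi> = "L1_functionals U C"
  have "\<forall>\<phi>\<in>?\<Phi>. \<exists>u\<in>admissible U. \<forall>g. integrable lborel g \<longrightarrow> pairing u g = \<phi> g"
    using L1_functionals_represented compact_imp_closed[OF assms(1)] assms(2) by blast
  then obtain F where F: "\<And>\<phi>. \<phi> \<in> ?\<Phi> \<Longrightarrow> F \<phi> \<in> admissible U"
    "\<And>\<phi> g. \<phi> \<in> ?\<Phi> \<Longrightarrow> integrable lborel g \<Longrightarrow> pairing (F \<phi>) g = \<phi> g"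
    by metis
  have "continuous_map (top_of_set ?\<Phi>) weak_star F"
  proof (rule continuous_map_into_weak_star)
    fix g :: "real \<Rightarrow> real^'a" assume g: "integrable lborel g"
    have "continuous_map (top_of_set ?\<Phi>) euclideanreal (\<lambda>\<phi>. \<phi> g)"
      by (simp add: continuous_on_subset[OF continuous_on_product_coordinates])
    then show "continuous_map (top_of_set ?\<Phi>) euclideanreal (\<lambda>\<phi>. pairing (F \<phi>) g)"
      by (rule continuous_map_eq) (simp add: F(2) g)
  qed
  moreover have "compactin (top_of_set ?\<Phi>) ?\<Phi>"
    using compact_L1_functionals by (simp add: compactin_subtopology)
  ultimately have "compactin weak_star (F ` ?\<Phi>)"
    by (rule image_compactin[rotated])
  also have "F ` ?\<Phi> = admissible U"
  proof
    show "F ` ?\<Phi> \<subseteq> admissible U" using F(1) by blast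
    show "admissible U \<subseteq> F ` ?\<Phi>"
    proof
      fix u assume "u \<in> admissible U"
      from pairing_mem_L1_functionals[OF this C]
      have \<phi>: "(\<lambda>g. if integrable lborel g then pairing u g else 0) \<in> ?\<Phi>" by blast
      from F(2)[OF this] have "F (\<lambda>g. if integrable lborel g then pairing u g else 0) = u"
        by (intro pairing_eq_imp_eq) simp
      with \<phi> show "u \<in> F ` ?\<Phi>" by (intro image_eqI[OF _ \<phi>]) simp
    qed
  qed
  finally show ?thesis .
qed

section \<open>Variation of constants\<close>

lemma flow_bound: "\<exists>M>0. \<forall>t x. \<bar>t\<bar> \<le> T \<longrightarrow> norm (flow A t x) \<le> M * norm x"
proof -
  have "compact ((\<lambda>t. mat_exp (t *\<^sub>R A)) ` {- T..T})"
    by (intro compact_continuous_image continuous_on_mat_exp) simp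
  from compact_imp_bounded[OF this]
  have "\<exists>C>0. \<forall>t\<in>{- T..T}. norm (mat_exp (t *\<^sub>R A)) \<le> C"
    by (simp add: bounded_pos)
  then obtain C where C: "C > 0" "\<And>t. t \<in> {- T..T} \<Longrightarrow> norm (mat_exp (t *\<^sub>R A)) \<le> C"
    by (auto simp del: atLeastAtMost_iff)
  obtain K where K: "K > 0" "\<And>(M :: real^'a^'a) x. norm (M *v x) \<le> norm M * norm x * K"
    using bounded_bilinear.pos_bounded[OF bounded_bilinear_matrix_vector_mult] by blast
  have "norm (flow A t x) \<le> C * K * norm x" if "\<bar>t\<bar> \<le> T" for t x
  proof -
    have "norm (flow A t x) \<le> norm (mat_exp (t *\<^sub>R A)) * (norm x * K)"
      using K(2)[of "mat_exp (t *\<^sub>R A)" x] by (simp add: mult.assoc)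
    also have "\<dots> \<le> C * (norm x * K)"
      using C(2)[of t] that K(1) by (intro mult_right_mono) (auto simp: abs_le_iff)
    finally show ?thesis by (simp add: mult_ac)
  qed
  then show ?thesis
    using C(1) K(1) by (intro exI[of _ "C * K"]) auto
qed

lemma flow_measurable [measurable]:
  assumes [measurable]: "f \<in> borel_measurable M" "g \<in> borel_measurable M"
  shows "(\<lambda>s. flow A (f s) (g s)) \<in> borel_measurable M"
proof -
  have "continuous_on UNIV (\<lambda>p. flow A (fst p) (snd p))"
    by (intro continuous_intros)
  from borel_measurable_continuous_on[OF this, of "\<lambda>s. (f s, g s)" M] show ?thesis
    by simp
qed

lemma linear_measurable:
  fixes h :: "'a::euclidean_space \<Rightarrow> 'b::euclidean_space"
  assumes "linear h" "f \<in> borel_measurable M"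
  shows "(\<lambda>s. h (f s)) \<in> borel_measurable M"
  by (rule borel_measurable_continuous_on[OF linear_continuous_on assms(2)])
    (use assms(1) in \<open>simp add: linear_conv_bounded_linear\<close>)

lemma matrix_vector_mult_measurable [measurable]:
  fixes B :: "real^'m^'n"
  shows "f \<in> borel_measurable M \<Longrightarrow> (\<lambda>s. B *v f s) \<in> borel_measurable M"
  by (rule linear_measurable) simp_all

text \<open>The signed indicator of the interval between 0 and t, for t of either sign. Integrals
  with a variable endpoint become integrals over the whole line, where linearity and domination
  apply without case distinctions.\<close>

definition orient :: "real \<Rightarrow> real \<Rightarrow> real" where
  "orient t s = indicator {0..<t} s - indicator {t..<0} s"

lemma orient_measurable [measurable]: "orient t \<in> borel_measurable borel"
  unfolding orient_def[abs_def] by measurable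

lemma interval_integral_orient:
  fixes f :: "real \<Rightarrow> 'a::euclidean_space"
  shows "(LBINT s=0..ereal t. f s) = (\<integral>s. orient t s *\<^sub>R f s \<partial>lborel)"
proof (cases "0 \<le> t")
  case True
  then have "(LBINT s=0..ereal t. f s) = (LBINT s:{0..<t}. f s)"
    using interval_integral_Ico[of 0 t f] by (simp add: zero_ereal_def)
  also have "\<dots> = (\<integral>s. orient t s *\<^sub>R f s \<partial>lborel)"
    using True unfolding set_lebesgue_integral_def orient_def by simp
  finally show ?thesis .
next
  case False
  then have "(LBINT s=0..ereal t. f s) = - (LBINT s:{t..<0}. f s)"
    using interval_integral_Ico[of t 0 f]
    by (subst interval_integral_endpoints_reverse) (simp add: zero_ereal_def)
  also have "\<dots> = (\<integral>s. orient t s *\<^sub>R f s \<partial>lborel)"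
    using False unfolding set_lebesgue_integral_def orient_def by simp
  finally show ?thesis .
qed

definition locally_ess_bounded :: "(real \<Rightarrow> 'a::euclidean_space) \<Rightarrow> bool" where
  "locally_ess_bounded f \<longleftrightarrow> f \<in> borel_measurable borel \<and>
    (\<forall>T. \<exists>K. AE s in lborel. \<bar>s\<bar> \<le> T \<longrightarrow> norm (f s) \<le> K)"

lemma integrable_orient:
  assumes "locally_ess_bounded f"
  shows "integrable lborel (\<lambda>s. orient t s *\<^sub>R f s)"
proof -
  obtain K where K: "AE s in lborel. \<bar>s\<bar> \<le> \<bar>t\<bar> \<longrightarrow> norm (f s) \<le> K"
    using assms unfolding locally_ess_bounded_def by blast
  have [measurable]: "f \<in> borel_measurable borel"
    using assms unfolding locally_ess_bounded_def by blast
  show ?thesis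
  proof (rule Bochner_Integration.integrable_bound)
    have "integrable lborel (\<lambda>s. indicator {- \<bar>t\<bar>..\<bar>t\<bar>} s :: real)"
      by (simp add: integrable_real_indicator)
    then show "integrable lborel (\<lambda>s. K * indicator {- \<bar>t\<bar>..\<bar>t\<bar>} s)"
      by (rule integrable_mult_right)
    show "AE s in lborel. norm (orient t s *\<^sub>R f s) \<le> norm (K * indicator {- \<bar>t\<bar>..\<bar>t\<bar>} s)"
      using K by eventually_elim (auto simp: orient_def indicator_def abs_le_iff intro: order_trans)
  qed simp
qed

text \<open>The difference of the two weights vanishes off the interval between a and b and has
  absolute value at most 1.\<close>

lemma norm_orient_increment_le:
  assumes f: "locally_ess_bounded f" and "K \<ge> 0"
    and K: "AE s in lborel. s \<in> {min a b..max a b} \<longrightarrow> norm (f s) \<le> K"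
  shows "norm ((\<integral>s. orient b s *\<^sub>R f s \<partial>lborel) - (\<integral>s. orient a s *\<^sub>R f s \<partial>lborel)) \<le> K * \<bar>b - a\<bar>"
proof -
  have "norm ((\<integral>s. orient b s *\<^sub>R f s \<partial>lborel) - (\<integral>s. orient a s *\<^sub>R f s \<partial>lborel)) =
      norm (\<integral>s. orient b s *\<^sub>R f s - orient a s *\<^sub>R f s \<partial>lborel)"
    by (simp add: Bochner_Integration.integral_diff integrable_orient[OF f])
  also have "\<dots> \<le> (\<integral>s. norm (orient b s *\<^sub>R f s - orient a s *\<^sub>R f s) \<partial>lborel)"
    by (rule integral_norm_bound)
  also have "\<dots> \<le> (\<integral>s. K * indicator {min a b..max a b} s \<partial>lborel)"
  proof (rule integral_mono_AE)
    show "integrable lborel (\<lambda>s. norm (orient b s *\<^sub>R f s - orient a s *\<^sub>R f s))"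
      by (intro integrable_norm Bochner_Integration.integrable_diff integrable_orient f)
    show "integrable lborel (\<lambda>s. K * indicator {min a b..max a b} s)"
      by (intro integrable_mult_right) (simp add: integrable_real_indicator)
    show "AE s in lborel. norm (orient b s *\<^sub>R f s - orient a s *\<^sub>R f s) \<le> K * indicator {min a b..max a b} s"
      using K
    proof eventually_elim
      case (elim s)
      have "norm (orient b s *\<^sub>R f s - orient a s *\<^sub>R f s) = \<bar>orient b s - orient a s\<bar> * norm (f s)"
        by (simp flip: scaleR_diff_left)
      also have "\<dots> \<le> indicator {min a b..max a b} s * norm (f s)"
        by (rule mult_right_mono) (auto simp: orient_def indicator_def)
      also have "\<dots> \<le> K * indicator {min a b..max a b} s"
        using elim \<open>K \<ge> 0\<close> by (auto simp: indicator_def)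
      finally show ?case by simp
    qed
  qed
  also have "\<dots> = K * \<bar>b - a\<bar>" by (auto simp: min_def max_def)
  finally show ?thesis .
qed

lemma integral_orient_0 [simp]: "(\<integral>s. orient 0 s *\<^sub>R f s \<partial>lborel) = 0"
  by (simp add: orient_def)

lemma locally_ess_bounded_flow:
  assumes "locally_ess_bounded g"
  shows "locally_ess_bounded (\<lambda>s. flow A (c - s) (g s))"
  unfolding locally_ess_bounded_def
proof (intro conjI allI)
  have [measurable]: "g \<in> borel_measurable borel"
    using assms unfolding locally_ess_bounded_def by blast
  show "(\<lambda>s. flow A (c - s) (g s)) \<in> borel_measurable borel" by measurable
  fix T
  obtain K where K: "AE s in lborel. \<bar>s\<bar> \<le> T \<longrightarrow> norm (g s) \<le> K"
    using assms unfolding locally_ess_bounded_def by blast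
  obtain M where M: "M > 0" "\<And>t x. \<bar>t\<bar> \<le> \<bar>c\<bar> + T \<Longrightarrow> norm (flow A t x) \<le> M * norm x"
    using flow_bound[of "\<bar>c\<bar> + T" A] by blast
  have "AE s in lborel. \<bar>s\<bar> \<le> T \<longrightarrow> norm (flow A (c - s) (g s)) \<le> M * K"
    using K
  proof eventually_elim
    case (elim s)
    show ?case
    proof
      assume s: "\<bar>s\<bar> \<le> T"
      then have "norm (flow A (c - s) (g s)) \<le> M * norm (g s)" by (intro M) auto
      also have "\<dots> \<le> M * K" using elim s M by (intro mult_left_mono) auto
      finally show "norm (flow A (c - s) (g s)) \<le> M * K" .
    qed
  qed
  then show "\<exists>K. AE s in lborel. \<bar>s\<bar> \<le> T \<longrightarrow> norm (flow A (c - s) (g s)) \<le> K" by blast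
qed

lemma locally_ess_bounded_continuous:
  assumes "continuous_on UNIV f"
  shows "locally_ess_bounded f"
  unfolding locally_ess_bounded_def
proof (intro conjI allI)
  show "f \<in> borel_measurable borel" by (rule borel_measurable_continuous_onI[OF assms])
  fix T :: real
  have "bounded (f ` {- T..T})"
    by (intro compact_imp_bounded compact_continuous_image continuous_on_subset[OF assms]) auto
  then obtain K where "\<And>s. s \<in> {- T..T} \<Longrightarrow> norm (f s) \<le> K" unfolding bounded_iff by blast
  then show "\<exists>K. AE s in lborel. \<bar>s\<bar> \<le> T \<longrightarrow> norm (f s) \<le> K"
    by (intro exI[of _ K] AE_I2) (auto simp: abs_le_iff)
qed

lemma locally_ess_bounded_add:
  assumes "locally_ess_bounded f" "locally_ess_bounded g"
  shows "locally_ess_bounded (\<lambda>s. f s + g s)"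
  unfolding locally_ess_bounded_def
proof (intro conjI allI)
  show "(\<lambda>s. f s + g s) \<in> borel_measurable borel"
    using assms unfolding locally_ess_bounded_def by (intro borel_measurable_add) auto
  fix T
  obtain K L where "AE s in lborel. \<bar>s\<bar> \<le> T \<longrightarrow> norm (f s) \<le> K" "AE s in lborel. \<bar>s\<bar> \<le> T \<longrightarrow> norm (g s) \<le> L"
    using assms unfolding locally_ess_bounded_def by meson
  then have "AE s in lborel. \<bar>s\<bar> \<le> T \<longrightarrow> norm (f s + g s) \<le> K + L"
    by eventually_elim (auto intro: norm_triangle_mono)
  then show "\<exists>K. AE s in lborel. \<bar>s\<bar> \<le> T \<longrightarrow> norm (f s + g s) \<le> K" by blast
qed

lemma locally_ess_bounded_diff:
  assumes "locally_ess_bounded f" "locally_ess_bounded g"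
  shows "locally_ess_bounded (\<lambda>s. f s - g s)"
proof -
  have "locally_ess_bounded (\<lambda>s. - g s)"
    using assms(2) by (simp add: locally_ess_bounded_def)
  from locally_ess_bounded_add[OF assms(1) this] show ?thesis by simp
qed

lemma integral_orient_const: "(\<integral>s. orient t s *\<^sub>R c \<partial>lborel) = t *\<^sub>R (c :: 'a::euclidean_space)"
proof -
  have "(\<integral>s. orient t s \<partial>lborel) = (\<integral>s. indicator {0..<t} s \<partial>lborel) - (\<integral>s. indicator {t..<0} s \<partial>lborel :: real)"
    unfolding orient_def
    by (rule Bochner_Integration.integral_diff)
      (auto intro!: integrable_real_indicator emeasure_bounded_finite)
  also have "\<dots> = t" by (cases "0 \<le> t") simp_all
  finally show ?thesis
    using integral_bounded_linear[OF bounded_linear_scaleR_left, of lborel "orient t" c]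
      integrable_orient[OF locally_ess_bounded_continuous[OF continuous_on_const], of t "1 :: real"]
    by simp
qed

text \<open>The integral of e^{-sA} g(s) from 0 to t. With e^{tA} taken out of the variation of
  constants formula, t enters the integral only through its endpoint.\<close>

definition drive :: "real^'n^'n \<Rightarrow> (real \<Rightarrow> real^'n) \<Rightarrow> real \<Rightarrow> real^'n" where
  "drive A g t = (\<integral>s. orient t s *\<^sub>R flow A (- s) (g s) \<partial>lborel)"

lemma integrable_drive:
  "locally_ess_bounded g \<Longrightarrow> integrable lborel (\<lambda>s. orient t s *\<^sub>R flow A (- s) (g s))"
  using integrable_orient[OF locally_ess_bounded_flow[where g = g and A = A and c = 0]]
  unfolding diff_0 .

lemma flow_drive:
  assumes "locally_ess_bounded g"
  shows "flow A c (drive A g t) = (\<integral>s. orient t s *\<^sub>R flow A (c - s) (g s) \<partial>lborel)"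
proof -
  have "flow A c (drive A g t) = (\<integral>s. flow A c (orient t s *\<^sub>R flow A (- s) (g s)) \<partial>lborel)"
    unfolding drive_def
    by (rule integral_bounded_linear[symmetric]) (simp_all add: integrable_drive assms del: scaleR_minus_left)
  also have "\<dots> = (\<integral>s. orient t s *\<^sub>R flow A (c - s) (g s) \<partial>lborel)"
    using flow_add[of c "- _" A] by (simp add: matrix_vector_mult_scaleR)
  finally show ?thesis .
qed

lemma flow_near_id:
  assumes "e > 0"
  shows "\<exists>d>0. \<forall>t x. \<bar>t\<bar> < d \<longrightarrow> norm (flow A t x - x) \<le> e * norm x"
proof -
  obtain K where K: "K > 0" "\<And>(M :: real^'a^'a) x. norm (M *v x) \<le> norm M * norm x * K"
    using bounded_bilinear.pos_bounded[OF bounded_bilinear_matrix_vector_mult] by blast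
  have "isCont (\<lambda>t. mat_exp (t *\<^sub>R A)) 0"
    using continuous_on_mat_exp[of UNIV A] by (simp add: continuous_on_eq_continuous_at)
  moreover have "e / K > 0" using assms K(1) by simp
  ultimately obtain d where d: "d > 0" "\<And>t. \<bar>t\<bar> < d \<Longrightarrow> norm (mat_exp (t *\<^sub>R A) - mat 1) < e / K"
    unfolding continuous_at_eps_delta dist_norm by (metis diff_zero mat_exp_0 real_norm_def scaleR_zero_left)
  have "norm (flow A t x - x) \<le> e * norm x" if "\<bar>t\<bar> < d" for t x
  proof -
    have "norm (flow A t x - x) = norm ((mat_exp (t *\<^sub>R A) - mat 1) *v x)"
      by (simp add: matrix_vector_mult_diff_rdistrib)
    also have "\<dots> \<le> norm (mat_exp (t *\<^sub>R A) - mat 1) * (norm x * K)"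
      using K(2) by (simp add: mult.assoc)
    also have "\<dots> \<le> e / K * (norm x * K)"
      using d(2)[OF that] K(1) by (intro mult_right_mono) auto
    finally show ?thesis using K(1) by simp
  qed
  with d(1) show ?thesis by blast
qed

text \<open>
  The difference \<open>H\<close> of the two sides has derivative \<open>0\<close> at every point, although \<open>g\<close> is
  merely measurable: over a short interval, \<open>g\<close> enters \<open>H\<close> only through \<open>flow A (t + h - s) (g s) - g s\<close>.
\<close>

lemma variation_of_constants:
  fixes A :: "real^'n^'n" and g :: "real \<Rightarrow> real^'n" and x :: "real^'n"
  assumes g: "locally_ess_bounded g"
  defines "y \<equiv> \<lambda>t. flow A t (x + drive A g t)"
  shows "continuous_on UNIV y" and "y t = y 0 + (LBINT s=0..ereal t. A *v y s + g s)"
proof -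
  have g_flow: "locally_ess_bounded (\<lambda>s. flow A (c - s) (g s))" for c
    by (rule locally_ess_bounded_flow[OF g])
  have "isCont (drive A g) t" for t
  proof -
    obtain K where K: "AE s in lborel. \<bar>s\<bar> \<le> \<bar>t\<bar> + 1 \<longrightarrow> norm (flow A (0 - s) (g s)) \<le> K"
      using g_flow[of 0] unfolding locally_ess_bounded_def by blast
    have lip: "norm (drive A g b - drive A g t) \<le> \<bar>K\<bar> * \<bar>b - t\<bar>" if "\<bar>b - t\<bar> < 1" for b
      unfolding drive_def
    proof (rule norm_orient_increment_le)
      show "locally_ess_bounded (\<lambda>s. flow A (- s) (g s))" using g_flow[of 0] by simp
      show "AE s in lborel. s \<in> {min t b..max t b} \<longrightarrow> norm (flow A (- s) (g s)) \<le> \<bar>K\<bar>"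
        using K by eventually_elim (use that in auto)
    qed simp
    have "((\<lambda>b. drive A g b - drive A g t) \<longlongrightarrow> 0) (at t)"
    proof (rule Lim_null_comparison)
      show "\<forall>\<^sub>F b in at t. norm (drive A g b - drive A g t) \<le> \<bar>K\<bar> * \<bar>b - t\<bar>"
        unfolding eventually_at by (intro exI[of _ 1]) (auto simp: dist_real_def intro: lip)
      show "((\<lambda>b. \<bar>K\<bar> * \<bar>b - t\<bar>) \<longlongrightarrow> 0) (at t)"
        by (intro tendsto_mult_right_zero tendsto_rabs_zero LIM_zero tendsto_ident_at)
    qed
    then show ?thesis by (simp add: isCont_def LIM_zero_iff)
  qed
  then show y_cont: "continuous_on UNIV y"
    unfolding y_def by (intro continuous_intros continuous_at_imp_continuous_on) auto
  have Ay_cont: "continuous_on UNIV (\<lambda>s. A *v y s)"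
    by (rule continuous_on_compose2[OF matrix_vector_mult_linear_continuous_on[of UNIV] y_cont]) simp
  have Ay: "locally_ess_bounded (\<lambda>s. A *v y s)"
    by (rule locally_ess_bounded_continuous[OF Ay_cont])
  have Ayg: "locally_ess_bounded (\<lambda>s. A *v y s + g s)"
    by (rule locally_ess_bounded_add[OF Ay g])
  define H where "H t = y t - (\<integral>s. orient t s *\<^sub>R (A *v y s + g s) \<partial>lborel)" for t
  have "(H has_derivative (\<lambda>_. 0)) (at t)" for t
    unfolding has_derivative_at_alt
  proof (intro conjI allI impI)
    fix e :: real assume "e > 0"
    obtain G where G: "G > 0" "AE s in lborel. \<bar>s\<bar> \<le> \<bar>t\<bar> + 1 \<longrightarrow> norm (g s) \<le> G"
    proof -
      obtain G where "AE s in lborel. \<bar>s\<bar> \<le> \<bar>t\<bar> + 1 \<longrightarrow> norm (g s) \<le> G"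
        using g unfolding locally_ess_bounded_def by blast
      then have "AE s in lborel. \<bar>s\<bar> \<le> \<bar>t\<bar> + 1 \<longrightarrow> norm (g s) \<le> \<bar>G\<bar> + 1"
        by eventually_elim auto
      then show ?thesis by (intro that[of "\<bar>G\<bar> + 1"]) auto
    qed
    obtain d1 where d1: "d1 > 0" "\<And>h. \<bar>h\<bar> < d1 \<Longrightarrow> norm (flow A h (y t) - y t - h *\<^sub>R (A *v y t)) \<le> e / 3 * \<bar>h\<bar>"
    proof -
      have "((\<lambda>h. flow A h (y t)) has_derivative (\<lambda>h. h *\<^sub>R (A *v y t))) (at 0)"
        using flow_has_vector_derivative[where A = A and x = "y t" and t = 0 and S = UNIV]
        by (simp add: has_vector_derivative_def)
      moreover have "e / 3 > 0" using \<open>e > 0\<close> by simp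
      ultimately obtain d where "d > 0" "\<And>h. norm (h - 0) < d \<Longrightarrow>
          norm (flow A h (y t) - flow A 0 (y t) - (h - 0) *\<^sub>R (A *v y t)) \<le> e / 3 * norm (h - 0)"
        unfolding has_derivative_at_alt by blast
      then show ?thesis by (intro that[of d]) auto
    qed
    obtain d2 where d2: "d2 > 0" "\<And>h x. \<bar>h\<bar> < d2 \<Longrightarrow> norm (flow A h x - x) \<le> e / (3 * G) * norm x"
      using flow_near_id[of "e / (3 * G)" A] \<open>e > 0\<close> G(1) by auto
    obtain d3 where d3: "d3 > 0" "\<And>s. \<bar>s - t\<bar> < d3 \<Longrightarrow> norm (A *v y s - A *v y t) \<le> e / 3"
    proof -
      have "e / 3 > 0" using \<open>e > 0\<close> by simp
      with Ay_cont obtain d where d: "d > 0" "\<forall>s\<in>UNIV. dist s t < d \<longrightarrow> dist (A *v y s) (A *v y t) < e / 3"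
        unfolding continuous_on_iff by (metis UNIV_I)
      show ?thesis
        by (rule that[OF d(1)]) (use d(2) in \<open>auto simp: dist_norm intro: less_imp_le\<close>)
    qed
    show "\<exists>d>0. \<forall>b. norm (b - t) < d \<longrightarrow> norm (H b - H t - 0) \<le> e * norm (b - t)"
    proof (intro exI[of _ "Min {d1, d2, d3, 1}"] conjI allI impI)
      show "Min {d1, d2, d3, 1} > 0" using d1 d2 d3 by simp
      fix b assume "norm (b - t) < Min {d1, d2, d3, 1}"
      then have b: "\<bar>b - t\<bar> < d1" "\<bar>b - t\<bar> < d2" "\<bar>b - t\<bar> < d3" "\<bar>b - t\<bar> < 1" by auto
      let ?I = "\<lambda>f. (\<integral>s. orient b s *\<^sub>R f s \<partial>lborel) - (\<integral>s. orient t s *\<^sub>R f s \<partial>lborel)"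
      let ?R1 = "flow A (b - t) (y t) - y t - (b - t) *\<^sub>R (A *v y t)"
      let ?f2 = "\<lambda>s. flow A (b - s) (g s) - g s"
      let ?f3 = "\<lambda>s. A *v y s - A *v y t"
      have const: "locally_ess_bounded (\<lambda>_. A *v y t)"
        by (rule locally_ess_bounded_continuous[OF continuous_on_const])
      note int = g_flow[of b, THEN integrable_orient] integrable_orient[OF g] integrable_orient[OF Ay]
        integrable_orient[OF const]
      have f2: "locally_ess_bounded ?f2"
        by (rule locally_ess_bounded_diff[OF g_flow g])
      have f3: "locally_ess_bounded ?f3"
        by (rule locally_ess_bounded_diff[OF Ay const])
      have I2: "?I ?f2 = ?I (\<lambda>s. flow A (b - s) (g s)) - ?I g"
        using int by (simp add: scaleR_diff_right)
      have I3: "?I ?f3 = ?I (\<lambda>s. A *v y s) - (b - t) *\<^sub>R (A *v y t)"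
        using int by (simp add: scaleR_diff_right integral_orient_const scaleR_diff_left)
      have Iyg: "?I (\<lambda>s. A *v y s + g s) = ?I (\<lambda>s. A *v y s) + ?I g"
        using int by (simp add: scaleR_right_distrib)
      have "y b - flow A (b - t) (y t) = flow A b (drive A g b) - flow A b (drive A g t)"
        using flow_add[of "b - t" t A] by (simp add: y_def matrix_vector_right_distrib)
      also have "\<dots> = ?I (\<lambda>s. flow A (b - s) (g s))"
        by (simp add: flow_drive[OF g])
      finally have J: "?I (\<lambda>s. flow A (b - s) (g s)) = y b - flow A (b - t) (y t)" ..
      have "H b - H t = y b - y t - ?I (\<lambda>s. A *v y s + g s)"
        unfolding H_def by (rule diff_diff_eq2[THEN trans]) simp
      \<comment> \<open>Three errors, each at most e/3 times the length of the interval: linearizing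
        the homogeneous flow, transporting g to the time b, and the oscillation of A y. The first
        order terms cancel.\<close>
      then have Heq: "H b - H t = ?R1 + ?I ?f2 - ?I ?f3"
        unfolding I2 I3 Iyg J by (simp only: diff_conv_add_uminus minus_add_distrib minus_minus ac_simps) simp
      have "norm (?I ?f2) \<le> e / 3 * \<bar>b - t\<bar>"
      proof (rule norm_orient_increment_le[OF f2])
        show "AE s in lborel. s \<in> {min t b..max t b} \<longrightarrow> norm (?f2 s) \<le> e / 3"
          using G(2)
        proof eventually_elim
          case (elim s)
          show ?case
          proof
            assume s: "s \<in> {min t b..max t b}"
            then have "norm (?f2 s) \<le> e / (3 * G) * norm (g s)"
              using b by (intro d2) auto
            also have "\<dots> \<le> e / (3 * G) * G"
              using elim s b \<open>e > 0\<close> G(1) by (intro mult_left_mono) auto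
            finally show "norm (?f2 s) \<le> e / 3" using G(1) by simp
          qed
        qed
      qed (use \<open>e > 0\<close> in simp)
      moreover have "norm (?I ?f3) \<le> e / 3 * \<bar>b - t\<bar>"
      proof (rule norm_orient_increment_le[OF f3])
        show "AE s in lborel. s \<in> {min t b..max t b} \<longrightarrow> norm (?f3 s) \<le> e / 3"
          using b by (intro AE_I2 impI d3) auto
      qed (use \<open>e > 0\<close> in simp)
      moreover have "norm ?R1 \<le> e / 3 * \<bar>b - t\<bar>"
        by (rule d1(2)[OF b(1)])
      moreover have "norm (H b - H t) \<le> norm ?R1 + norm (?I ?f2) + norm (?I ?f3)"
        unfolding Heq by (intro order_trans[OF norm_triangle_ineq4] add_right_mono norm_triangle_ineq)
      ultimately have "norm (H b - H t) \<le> e / 3 * \<bar>b - t\<bar> + e / 3 * \<bar>b - t\<bar> + e / 3 * \<bar>b - t\<bar>"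
        by linarith
      then show "norm (H b - H t - 0) \<le> e * norm (b - t)" unfolding real_norm_def diff_zero by linarith
    qed
  qed (rule bounded_linear_zero)
  then have "H t = H 0"
    by (intro has_derivative_zero_unique[of UNIV H]) (auto intro: has_derivative_at_withinI)
  then show "y t = y 0 + (LBINT s=0..ereal t. A *v y s + g s)"
    unfolding interval_integral_orient H_def integral_orient_0 by (simp only: diff_eq_eq diff_zero)
qed

section \<open>The bounded solution\<close>

abbreviation forcing :: "real^'m^'n \<Rightarrow> 'm::finite linf \<Rightarrow> real \<Rightarrow> real^'n" where
  "forcing B u \<equiv> \<lambda>s. B *v rep_linf u s"

lemma norm_matrix_vector_mult_le: "\<exists>K>0. \<forall>v. norm (B *v v) \<le> K * norm (v :: real^'m)"
proof -
  obtain K where "K > 0" "\<And>v. norm (B *v v) \<le> norm v * K"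
    using bounded_linear.pos_bounded[OF matrix_vector_mul_bounded_linear[of B]] by blast
  then show ?thesis by (intro exI[of _ K]) (auto simp: mult.commute)
qed

lemma norm_linear_le:
  fixes f :: "'a::euclidean_space \<Rightarrow> 'b::real_normed_vector"
  assumes "linear f"
  shows "\<exists>K>0. \<forall>v. norm (f v) \<le> K * norm v"
proof -
  obtain K where "K > 0" "\<And>v. norm (f v) \<le> K * norm v"
    by (rule linear_bounded_pos[OF assms]) (auto simp: mult.commute)
  then show ?thesis by blast
qed

lemma locally_ess_bounded_forcing: "locally_ess_bounded (forcing B u)"
  unfolding locally_ess_bounded_def
proof (intro conjI allI)
  fix T
  obtain C where C: "AE s in lborel. norm (rep_linf u s) \<le> C"
    using rep_linf_ess_bounded[of u] by (auto simp: ess_bounded_def)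
  obtain K where K: "K > 0" "\<And>v. norm (B *v v) \<le> K * norm v"
    using norm_matrix_vector_mult_le by blast
  have "AE s in lborel. \<bar>s\<bar> \<le> T \<longrightarrow> norm (B *v rep_linf u s) \<le> K * C"
    using C
  proof eventually_elim
    case (elim s)
    then show ?case using order_trans[OF K(2) mult_left_mono] K(1) by auto
  qed
  then show "\<exists>K. AE s in lborel. \<bar>s\<bar> \<le> T \<longrightarrow> norm (B *v rep_linf u s) \<le> K" by blast
qed measurable

lemma locally_ess_bounded_linear:
  assumes "locally_ess_bounded g" "linear f"
  shows "locally_ess_bounded (\<lambda>s. f (g s))"
  unfolding locally_ess_bounded_def
proof (intro conjI allI)
  show "(\<lambda>s. f (g s)) \<in> borel_measurable borel"
    by (rule linear_measurable[OF assms(2)]) (use assms(1) in \<open>simp add: locally_ess_bounded_def\<close>)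
  fix T
  obtain C where C: "AE s in lborel. \<bar>s\<bar> \<le> T \<longrightarrow> norm (g s) \<le> C"
    using assms(1) unfolding locally_ess_bounded_def by meson
  obtain K where K: "K > 0" "\<And>v. norm (f v) \<le> K * norm v"
    using norm_linear_le[OF assms(2)] by blast
  have "AE s in lborel. \<bar>s\<bar> \<le> T \<longrightarrow> norm (f (g s)) \<le> K * C"
    using C
  proof eventually_elim
    case (elim s)
    then show ?case using order_trans[OF K(2) mult_left_mono] K(1) by auto
  qed
  then show "\<exists>K. AE s in lborel. \<bar>s\<bar> \<le> T \<longrightarrow> norm (f (g s)) \<le> K" by blast
qed

lemma linear_integral:
  fixes f :: "'a::euclidean_space \<Rightarrow> 'b::euclidean_space"
  assumes "linear f" "integrable M g"
  shows "f (\<integral>s. g s \<partial>M) = (\<integral>s. f (g s) \<partial>M)"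
  using assms by (intro integral_bounded_linear[symmetric]) (simp_all add: linear_conv_bounded_linear)

lemma drive_linear:
  assumes g: "locally_ess_bounded g" and f: "linear f" and comm: "\<And>t x. f (flow A t x) = flow A t (f x)"
  shows "f (drive A g t) = drive A (\<lambda>s. f (g s)) t"
  unfolding drive_def
  by (simp only: linear_integral[OF f integrable_drive[OF g]] linear_scale[OF f] comm)

lemma lifted_solution_eq:
  "lifted_solution A B t (x, r) u = (flow A t (x + r *\<^sub>R drive A (forcing B u) t), r)"
proof -
  have "(LBINT s=0..ereal t. mat_exp ((t - s) *\<^sub>R A) *v (B *v rep_linf u s)) = flow A t (drive A (forcing B u) t)"
    unfolding interval_integral_orient flow_drive[OF locally_ess_bounded_forcing] ..
  then show ?thesis
    by (simp add: lifted_solution_def matrix_vector_right_distrib matrix_vector_mult_scaleR)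
qed

section \<open>The bounded solution as an integral\<close>

lemma integrable_exp_abs:
  assumes "\<alpha> > 0"
  shows "integrable lborel (\<lambda>s :: real. exp (- \<alpha> * \<bar>s\<bar>))"
proof -
  have "(\<integral>\<^sup>+(s :: real). ennreal (exp (- \<alpha> * s)) * indicator {0..} s \<partial>lborel) = ennreal (0 - (- exp (- \<alpha> * 0) / \<alpha>))"
  proof (rule nn_integral_FTC_atLeast)
    show "((\<lambda>s. - exp (- \<alpha> * s) / \<alpha>) has_real_derivative exp (- \<alpha> * s)) (at s)" for s :: real
      using assms by (auto intro!: derivative_eq_intros)
    have "((\<lambda>s. - exp (- \<alpha> * s) / \<alpha>) \<longlongrightarrow> - 0 / \<alpha>) at_top"
      using assms by (intro tendsto_divide tendsto_minus filterlim_compose[OF exp_at_bot]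
        filterlim_tendsto_neg_mult_at_bot[OF tendsto_const _ filterlim_ident]) auto
    then show "((\<lambda>s. - exp (- \<alpha> * s) / \<alpha>) \<longlongrightarrow> 0) at_top" by simp
  qed auto
  moreover have "ennreal (exp (- \<alpha> * s)) * indicator {0..} s = ennreal (norm (indicator {0..} s * exp (- \<alpha> * s)))" for s :: real
    by (simp add: indicator_def)
  ultimately have pos: "integrable lborel (\<lambda>s :: real. indicator {0..} s * exp (- \<alpha> * s))"
    by (intro integrableI_bounded) (simp_all add: ennreal_less_top)
  have neg: "integrable lborel (\<lambda>s :: real. indicator {0..} (- s) * exp (- \<alpha> * (- s)))"
    using lborel_integrable_real_affine[OF pos, of "-1" 0] by simp
  show ?thesis
    by (rule Bochner_Integration.integrable_bound[OF Bochner_Integration.integrable_add[OF pos neg]])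
      (auto simp: indicator_def)
qed

text \<open>The Green kernel of the hyperbolic part. The unstable component of e(u, 0) integrates
  over the future with a minus sign, the stable one over the past; in both cases e^{-sA} decays
  exponentially in |s|.\<close>

definition green :: "real^'n^'n \<Rightarrow> real \<Rightarrow> real^'n \<Rightarrow> real^'n" where
  "green A s v = (if 0 \<le> s then - flow A (- s) (pi_plus A v) else flow A (- s) (pi_minus A v))"

text \<open>\<open>bsol A B u\<close> is the value \<open>e(u, 0)\<close>.\<close>

definition bsol :: "real^'n^'n \<Rightarrow> real^'m^'n \<Rightarrow> 'm::finite linf \<Rightarrow> real^'n" where
  "bsol A B u = (\<integral>s. green A s (B *v rep_linf u s) \<partial>lborel)"

lemma linear_green: "linear (green A s)"
  by (cases "0 \<le> s")
    (auto intro!: linearI simp: green_def linear_add[OF linear_pi(1)] linear_add[OF linear_pi(2)]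
      linear_scale[OF linear_pi(1)] linear_scale[OF linear_pi(2)]
      matrix_vector_right_distrib matrix_vector_mult_scaleR)

lemma green_measurable [measurable]:
  assumes "f \<in> borel_measurable borel"
  shows "(\<lambda>s. green A s (f s)) \<in> borel_measurable borel"
proof -
  have [measurable]: "(\<lambda>s. pi_plus A (f s)) \<in> borel_measurable borel" "(\<lambda>s. pi_minus A (f s)) \<in> borel_measurable borel"
    by (rule linear_measurable[OF linear_pi(1) assms] linear_measurable[OF linear_pi(2) assms])+
  show ?thesis unfolding green_def by measurable
qed

lemma green_bound: "\<exists>\<alpha>>0. \<exists>C>0. \<forall>s v. norm (green A s v) \<le> C * exp (- \<alpha> * \<bar>s\<bar>) * norm v"
proof -
  obtain a C where a: "a > 0" "C > 0" "\<And>x t. x \<in> L_plus A \<Longrightarrow> t \<ge> 0 \<Longrightarrow> norm (flow A (- t) x) \<le> C * exp (- a * t) * norm x"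
    using L_plus_decay[of A] by blast
  obtain b D where b: "b > 0" "D > 0" "\<And>x t. x \<in> L_minus A \<Longrightarrow> t \<ge> 0 \<Longrightarrow> norm (flow A t x) \<le> D * exp (- b * t) * norm x"
    using L_minus_decay[of A] by blast
  obtain K where K: "K > 0" "\<And>v. norm (pi_plus A v) \<le> K * norm v"
    using norm_linear_le[OF linear_pi(1)] by blast
  obtain L where L: "L > 0" "\<And>v. norm (pi_minus A v) \<le> L * norm v"
    using norm_linear_le[OF linear_pi(2)] by blast
  have "norm (green A s v) \<le> (C * K + D * L) * exp (- min a b * \<bar>s\<bar>) * norm v" for s v
  proof (cases "0 \<le> s")
    case True
    have "norm (green A s v) \<le> C * exp (- a * s) * norm (pi_plus A v)"
      using True a(3)[OF pi_mem(1) True] by (simp add: green_def)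
    also have "\<dots> \<le> C * exp (- min a b * \<bar>s\<bar>) * (K * norm v)"
      using True a b K by (intro mult_mono mult_left_mono) (auto intro!: mult_right_mono)
    also have "\<dots> = (C * K) * exp (- min a b * \<bar>s\<bar>) * norm v" by simp
    also have "\<dots> \<le> (C * K + D * L) * exp (- min a b * \<bar>s\<bar>) * norm v"
      using b L by (intro mult_right_mono) simp_all
    finally show ?thesis .
  next
    case False
    have "norm (green A s v) \<le> D * exp (- b * (- s)) * norm (pi_minus A v)"
      using False b(3)[OF pi_mem(2), of "- s"] by (simp add: green_def)
    also have "\<dots> \<le> D * exp (- min a b * \<bar>s\<bar>) * (L * norm v)"
      using False a b L by (intro mult_mono mult_left_mono) (auto intro!: mult_right_mono)
    also have "\<dots> = (D * L) * exp (- min a b * \<bar>s\<bar>) * norm v" by simp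
    also have "\<dots> \<le> (C * K + D * L) * exp (- min a b * \<bar>s\<bar>) * norm v"
      using a K by (intro mult_right_mono) simp_all
    finally show ?thesis .
  qed
  then show ?thesis
    using a b K L by (intro exI[of _ "min a b"] conjI exI[of _ "C * K + D * L"] allI) (simp_all add: add_pos_pos)
qed

lemma integrable_green_bounded:
  assumes "f \<in> borel_measurable borel" "AE s in lborel. norm (f s) \<le> c"
  shows "integrable lborel (\<lambda>s. green A s (f s))"
proof -
  obtain \<alpha> C where k: "\<alpha> > 0" "C > 0" "\<And>s v. norm (green A s v) \<le> C * exp (- \<alpha> * \<bar>s\<bar>) * norm v"
    using green_bound[of A] by blast
  show ?thesis
  proof (rule Bochner_Integration.integrable_bound)
    show "integrable lborel (\<lambda>s. C * c * exp (- \<alpha> * \<bar>s\<bar>))"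
      by (intro integrable_mult_right integrable_exp_abs k)
    show "AE s in lborel. norm (green A s (f s)) \<le> norm (C * c * exp (- \<alpha> * \<bar>s\<bar>))"
      using assms(2)
    proof eventually_elim
      case (elim s)
      have "norm (green A s (f s)) \<le> C * exp (- \<alpha> * \<bar>s\<bar>) * norm (f s)" by (rule k)
      also have "\<dots> \<le> C * exp (- \<alpha> * \<bar>s\<bar>) * c" using elim k by (intro mult_left_mono) auto
      also have "\<dots> \<le> norm (C * c * exp (- \<alpha> * \<bar>s\<bar>))" by (simp only: mult_ac real_norm_def abs_ge_self)
      finally show ?case .
    qed
  qed (use green_measurable[OF assms(1)] in simp)
qed

lemma forcing_bound: "\<exists>c. AE s in lborel. norm (forcing B u s) \<le> c"
proof -
  obtain C where C: "AE s in lborel. norm (rep_linf u s) \<le> C"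
    using rep_linf_ess_bounded[of u] by (auto simp: ess_bounded_def)
  obtain K where K: "K > 0" "\<And>v. norm (B *v v) \<le> K * norm v"
    using norm_matrix_vector_mult_le by blast
  have "AE s in lborel. norm (B *v rep_linf u s) \<le> K * C"
    using C
  proof eventually_elim
    case (elim s)
    then show ?case using order_trans[OF K(2) mult_left_mono] K(1) by auto
  qed
  then show ?thesis by blast
qed

lemma integrable_bsol: "integrable lborel (\<lambda>s. green A s (B *v rep_linf u s))"
  using forcing_bound[of B u] by (auto intro: integrable_green_bounded)

lemma bsol_bound:
  fixes B :: "real^'m^'n"
  shows "\<exists>K>0. \<forall>u c. (AE s in lborel. norm (rep_linf u s) \<le> c) \<longrightarrow> norm (bsol A B u) \<le> K * c"
proof -
  obtain \<alpha> C where k: "\<alpha> > 0" "C > 0" "\<And>s v. norm (green A s v) \<le> C * exp (- \<alpha> * \<bar>s\<bar>) * norm v"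
    using green_bound[of A] by blast
  obtain K where K: "K > 0" "\<And>v. norm (B *v v) \<le> K * norm v"
    using norm_matrix_vector_mult_le by blast
  define I where "I = (\<integral>s. exp (- \<alpha> * \<bar>s\<bar>) \<partial>lborel)"
  have "I \<ge> 0" unfolding I_def by (intro Bochner_Integration.integral_nonneg) simp
  have "norm (bsol A B u) \<le> C * K * (I + 1) * c" if c: "AE s in lborel. norm (rep_linf u s) \<le> c" for u :: "'m linf" and c
  proof -
    \<comment> \<open>The real line is not a null set, so the bound holds at some point; this forces
      \<open>c\<close> to be nonnegative.\<close>
    have "\<exists>s. norm (rep_linf u s) \<le> c"
    proof (rule ccontr)
      assume "\<not> ?thesis"
      then have "AE s in (lborel :: real measure). False" using c by (auto elim: eventually_mono)
      then have "ae_filter (lborel :: real measure) = bot" by (simp add: trivial_limit_def)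
      then show False by (simp add: ae_filter_eq_bot_iff)
    qed
    then have "c \<ge> 0" by (meson norm_ge_zero order_trans)
    have "norm (bsol A B u) \<le> (\<integral>s. norm (green A s (B *v rep_linf u s)) \<partial>lborel)"
      unfolding bsol_def by (rule integral_norm_bound)
    also have "\<dots> \<le> (\<integral>s. C * K * c * exp (- \<alpha> * \<bar>s\<bar>) \<partial>lborel)"
    proof (rule integral_mono_AE)
      show "AE s in lborel. norm (green A s (B *v rep_linf u s)) \<le> C * K * c * exp (- \<alpha> * \<bar>s\<bar>)"
        using c
      proof eventually_elim
        case (elim s)
        have "norm (green A s (B *v rep_linf u s)) \<le> C * exp (- \<alpha> * \<bar>s\<bar>) * norm (B *v rep_linf u s)"
          by (rule k)
        also have "\<dots> \<le> C * exp (- \<alpha> * \<bar>s\<bar>) * (K * c)"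
          using k K by (intro mult_left_mono order_trans[OF K(2)] elim) auto
        finally show ?case by (simp add: mult_ac)
      qed
    qed (use integrable_norm[OF integrable_bsol[of A B u]] integrable_exp_abs[OF k(1)] in auto)
    also have "\<dots> = C * K * c * I" unfolding I_def by simp
    also have "\<dots> \<le> C * K * (I + 1) * c"
      using k K \<open>c \<ge> 0\<close> by (simp add: algebra_simps)
    finally show ?thesis .
  qed
  then show ?thesis
    using k K \<open>I \<ge> 0\<close> by (intro exI[of _ "C * K * (I + 1)"]) auto
qed

text \<open>Moving the kernel by t changes its branch exactly for s between 0 and t. There the two
  branches differ by \<pi>^+ + \<pi>^- = \<pi>^h, which is the integrand of
  \<open>drive\<close>.\<close>

lemma green_diff:
  "green A (s - t) v = flow A t (green A s v + orient t s *\<^sub>R flow A (- s) (pi_hyp A v))"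
proof -
  have *: "flow A (t - s) w = flow A t (flow A (- s) w)" for w
    using flow_add[of t "- s" A w] by simp
  show ?thesis
    by (cases "0 \<le> s"; cases "0 \<le> s - t")
      (auto simp: green_def orient_def pi_hyp_eq * linear_neg[OF matrix_vector_mul_linear] matrix_vector_right_distrib simp del: scaleR_minus_left)
qed

text \<open>The invariance of the graph of r \<mapsto> r e(u, 0): a change of variables and
  \<open>green_diff\<close> put e(shift t u, 0) into variation of constants form for the induced
  system.\<close>

lemma bsol_shift:
  "bsol A B (shift t u) = flow A t (bsol A B u + pi_hyp A (drive A (forcing B u) t))"
proof -
  have meas: "(\<lambda>s. green A (s - t) (B *v rep_linf u s)) \<in> borel_measurable borel"
  proof -
    have "(\<lambda>s. green A s (B *v rep_linf u (t + s))) \<in> borel_measurable borel"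
      by (rule green_measurable) measurable
    then have "(\<lambda>s. green A (s - t) (B *v rep_linf u (t + (s - t)))) \<in> borel_measurable borel"
      by measurable
    then show ?thesis by simp
  qed
  have "bsol A B (shift t u) = (\<integral>s. green A s (B *v rep_linf u (t + s)) \<partial>lborel)"
    unfolding bsol_def
  proof (rule integral_cong_AE)
    show "AE s in lborel. green A s (B *v rep_linf (shift t u) s) = green A s (B *v rep_linf u (t + s))"
      using rep_linf_shift[of t u] by eventually_elim simp
  qed measurable
  also have "\<dots> = (\<integral>s. green A (s - t) (B *v rep_linf u s) \<partial>lborel)"
    using lborel_integral_real_affine[of 1 "\<lambda>s. green A (s - t) (B *v rep_linf u s)" t] by simp
  also have "\<dots> = (\<integral>s. flow A t (green A s (B *v rep_linf u s) +
      orient t s *\<^sub>R flow A (- s) (pi_hyp A (B *v rep_linf u s))) \<partial>lborel)"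
    by (simp only: green_diff)
  also have "\<dots> = flow A t (\<integral>s. green A s (B *v rep_linf u s) +
      orient t s *\<^sub>R flow A (- s) (pi_hyp A (B *v rep_linf u s)) \<partial>lborel)"
    by (intro linear_integral[symmetric] Bochner_Integration.integrable_add integrable_bsol integrable_drive
        locally_ess_bounded_linear[OF locally_ess_bounded_forcing linear_pi(3)]) simp
  also have "(\<integral>s. green A s (B *v rep_linf u s) +
      orient t s *\<^sub>R flow A (- s) (pi_hyp A (B *v rep_linf u s)) \<partial>lborel) =
      bsol A B u + drive A (\<lambda>s. pi_hyp A (B *v rep_linf u s)) t"
    unfolding bsol_def drive_def
    by (intro Bochner_Integration.integral_add integrable_bsol integrable_drive
        locally_ess_bounded_linear[OF locally_ess_bounded_forcing linear_pi(3)])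
  also have "drive A (\<lambda>s. pi_hyp A (B *v rep_linf u s)) t = pi_hyp A (drive A (forcing B u) t)"
    by (rule drive_linear[OF locally_ess_bounded_forcing linear_pi(3) pi_flow(4), symmetric])
  finally show ?thesis .
qed

lemma green_pi_hyp: "green A s (pi_hyp A v) = green A s v"
proof -
  have "pi_plus A (pi_hyp A v) = pi_plus A v" "pi_minus A (pi_hyp A v) = pi_minus A v"
    using pi_eqI[OF pi_mem(1)[of A v] subspace_0[OF subspace_L(2)] pi_mem(2)[of A v], of "pi_hyp A v"]
    by (simp_all add: pi_hyp_eq)
  then show ?thesis by (simp add: green_def)
qed

text \<open>Hence the central bundles of the given and of the induced system are built on the same
  function e.\<close>

lemma bsol_B_hyp: "bsol A (B_hyp A B) = bsol A B"
  by (simp add: fun_eq_iff bsol_def B_hyp_mult green_pi_hyp)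

lemma pi_green:
  "pi_plus A (green A s v) = (if 0 \<le> s then green A s v else 0)"
  "pi_minus A (green A s v) = (if 0 \<le> s then 0 else green A s v)"
  "pi_zero A (green A s v) = 0"
proof -
  have 1: "- flow A (- s) (pi_plus A v) \<in> L_plus A" and 2: "flow A (- s) (pi_minus A v) \<in> L_minus A"
    by (intro subspace_neg[OF subspace_L(1)] flow_mem_L pi_mem)+
  show "pi_plus A (green A s v) = (if 0 \<le> s then green A s v else 0)"
    "pi_minus A (green A s v) = (if 0 \<le> s then 0 else green A s v)"
    "pi_zero A (green A s v) = 0"
    using pi_on_L_plus[OF 1] pi_on_L_minus[OF 2] by (auto simp: green_def)
qed

lemma bsol_mem_L_hyp: "bsol A B u \<in> L_hyp A"
proof -
  have "pi_zero A (bsol A B u) = 0"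
    unfolding bsol_def linear_integral[OF linear_pi(4) integrable_bsol] pi_green by simp
  then have "bsol A B u = pi_hyp A (bsol A B u)" by (simp add: pi_zero_def)
  then show ?thesis by (metis pi_mem(4))
qed

text \<open>The kernel takes values in L^+ only for nonnegative times. With the stable counterpart
  below, this allows the two components of e to be prescribed by two different controls joined at
  time 0.\<close>

lemma pi_plus_bsol_cong:
  assumes "AE s in lborel. 0 \<le> s \<longrightarrow> rep_linf u s = rep_linf v s"
  shows "pi_plus A (bsol A B u) = pi_plus A (bsol A B v)"
  unfolding bsol_def linear_integral[OF linear_pi(1) integrable_bsol] pi_green
proof (rule integral_cong_AE)
  show "AE s in lborel. (if 0 \<le> s then green A s (B *v rep_linf u s) else 0) =
      (if 0 \<le> s then green A s (B *v rep_linf v s) else 0)"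
    using assms by eventually_elim simp
qed measurable

lemma pi_minus_bsol_cong:
  assumes "AE s in lborel. s < 0 \<longrightarrow> rep_linf u s = rep_linf v s"
  shows "pi_minus A (bsol A B u) = pi_minus A (bsol A B v)"
  unfolding bsol_def linear_integral[OF linear_pi(2) integrable_bsol] pi_green
proof (rule integral_cong_AE)
  show "AE s in lborel. (if 0 \<le> s then 0 else green A s (B *v rep_linf u s)) =
      (if 0 \<le> s then 0 else green A s (B *v rep_linf v s))"
    using assms by eventually_elim simp
qed measurable

text \<open>Every coordinate of e(u, 0) is a pairing of u with an integrable function, a row of the
  Green kernel composed with B, and pairings are weak* continuous.\<close>

lemma continuous_map_bsol:
  fixes A :: "real^'n^'n" and B :: "real^'m^'n"
  shows "continuous_map weak_star euclidean (bsol A B)"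
proof -
  define k :: "'n \<Rightarrow> real \<Rightarrow> real^'m" where "k i s = (\<chi> j. green A s (B *v axis j 1) $ i)" for i s
  have k: "v \<bullet> k i s = (green A s (B *v v) :: real^'n) $ i" for v :: "real^'m" and i s
  proof -
    have lin: "linear (\<lambda>v. green A s (B *v v))"
      by (intro linearI) (simp_all add: matrix_vector_right_distrib matrix_vector_mult_scaleR
          linear_add[OF linear_green] linear_scale[OF linear_green])
    have "v = (\<Sum>j\<in>UNIV. (v $ j) *\<^sub>R axis j 1)"
      by (simp add: vec_eq_iff axis_def if_distrib cong: if_cong)
    then have "green A s (B *v v) = green A s (B *v (\<Sum>j\<in>UNIV. (v $ j) *\<^sub>R axis j 1))" by simp
    also have "\<dots> = (\<Sum>j\<in>UNIV. (v $ j) *\<^sub>R green A s (B *v axis j 1))"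
      by (simp add: linear_sum[OF lin] linear_scale[OF lin])
    finally show ?thesis by (simp add: k_def inner_vec_def)
  qed
  have int_k: "integrable lborel (k i)" for i
  proof -
    have int: "integrable lborel (\<lambda>s. green A s (B *v axis j 1) $ i *\<^sub>R (axis j 1 :: real^'m))" for j
    proof -
      have "integrable lborel (\<lambda>s. green A s (B *v axis j 1))"
        by (rule integrable_green_bounded) auto
      then have "integrable lborel (\<lambda>s. green A s (B *v axis j 1) \<bullet> axis i 1)"
        by (rule integrable_inner_left)
      then show ?thesis by (simp add: inner_axis)
    qed
    have "k i = (\<lambda>s. \<Sum>j\<in>UNIV. green A s (B *v axis j 1) $ i *\<^sub>R axis j 1)"
      by (simp add: k_def fun_eq_iff vec_eq_iff axis_def if_distrib cong: if_cong)
    then show ?thesis using int by simp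
  qed
  have "bsol A B u $ i = pairing u (k i)" for u i
  proof -
    have "bsol A B u $ i = (\<integral>s. green A s (B *v rep_linf u s) $ i \<partial>lborel)"
      unfolding bsol_def by (rule integral_bounded_linear[symmetric]) (simp_all add: bounded_linear_vec_nth integrable_bsol)
    then show ?thesis by (simp add: k)
  qed
  then have "bsol A B = (\<lambda>u. \<Sum>i\<in>UNIV. pairing u (k i) *\<^sub>R axis i 1)"
    by (simp add: fun_eq_iff vec_eq_iff axis_def if_distrib cong: if_cong)
  moreover have "continuous_map weak_star euclidean (\<lambda>u. \<Sum>i\<in>(UNIV :: 'n set). pairing u (k i) *\<^sub>R (axis i 1 :: real^'n))"
  proof (intro continuous_map_sum)
    fix i
    have "continuous_map euclideanreal euclidean (\<lambda>c. c *\<^sub>R (axis i 1 :: real^'n))"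
      by (simp add: continuous_intros)
    from continuous_map_compose[OF continuous_map_pairing[OF int_k] this]
    show "continuous_map weak_star euclidean (\<lambda>u. pairing u (k i) *\<^sub>R (axis i 1 :: real^'n))"
      by (simp add: comp_def)
  qed simp
  ultimately show ?thesis by simp
qed

lemma shift_0 [simp]: "shift 0 u = u"
proof (rule linf_eqI)
  show "AE s in lborel. rep_linf (shift 0 u) s = rep_linf u s"
    using rep_linf_shift[of 0 u] by simp
qed

lemma norm_rep_linf_shift_le:
  assumes "AE s in lborel. norm (rep_linf u s) \<le> c"
  shows "AE s in lborel. norm (rep_linf (shift t u) s) \<le> c"
  using rep_linf_shift[of t u] AE_lborel_shift[OF assms, of t] by eventually_elim simp

section \<open>Uniqueness of the bounded solution\<close>

lemma homogeneous_solution: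
  assumes cont: "continuous_on UNIV y" and sol: "\<And>t. y t = y 0 + (LBINT s=0..ereal t. A *v y s)"
  shows "y t = flow A t (y 0)"
proof -
  have cA: "continuous_on S (\<lambda>s. A *v y s)" for S
    using continuous_on_compose2[OF matrix_vector_mult_linear_continuous_on[of UNIV A] cont]
    by (rule continuous_on_subset) auto
  have y: "(y has_derivative (\<lambda>h. h *\<^sub>R (A *v y t))) (at t)" for t
  proof -
    let ?a = "- \<bar>t\<bar> - 1" and ?b = "\<bar>t\<bar> + 1"
    have "((\<lambda>u. LBINT s=ereal 0..ereal u. A *v y s) has_vector_derivative A *v y t) (at t within {?a..?b})"
      by (rule interval_integral_FTC2) (auto intro: cA)
    then have "((\<lambda>u. y 0 + (LBINT s=0..ereal u. A *v y s)) has_vector_derivative 0 + A *v y t) (at t within {?a..?b})"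
      by (intro has_vector_derivative_add has_vector_derivative_const) (simp add: zero_ereal_def)
    moreover have "at t within {?a..?b} = at t"
      by (rule at_within_Icc_at) auto
    ultimately show ?thesis
      using sol[symmetric] by (simp add: has_vector_derivative_def)
  qed
  have E: "((\<lambda>t. mat_exp ((- t) *\<^sub>R A)) has_derivative (\<lambda>h. (- h) *\<^sub>R (A ** mat_exp ((- t) *\<^sub>R A)))) (at t)" for t
    using has_derivative_compose[of uminus uminus t UNIV, OF has_derivative_minus[OF has_derivative_ident]
      mat_exp_has_vector_derivative[where A = A and t = "- t" and S = UNIV, unfolded has_vector_derivative_def]]
    by simp
  have "((\<lambda>t. flow A (- t) (y t)) has_derivative (\<lambda>h. 0)) (at t)" for t
    using bounded_bilinear.FDERIV[OF bounded_bilinear_matrix_vector_mult E y, of t]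
    by (rule has_derivative_eq_rhs)
      (auto simp: fun_eq_iff matrix_vector_mult_scaleR matrix_vector_mul_assoc mat_exp_commute[of A "- t"]
        simp flip: scaleR_matrix_vector_assoc simp del: scaleR_minus_left, simp)
  then have "flow A (- t) (y t) = flow A (- 0) (y 0)"
    by (intro has_derivative_zero_unique[of UNIV "\<lambda>t. flow A (- t) (y t)"]) (auto intro: has_derivative_at_withinI)
  then have "flow A t (flow A (- t) (y t)) = flow A t (y 0)" by simp
  then show ?thesis by simp
qed

lemma le_zero_if_le_exp_decay:
  fixes a :: real
  assumes "\<alpha> > 0" "\<And>t. t \<ge> 0 \<Longrightarrow> a \<le> C * exp (- \<alpha> * t)"
  shows "a \<le> 0"
proof -
  have "((\<lambda>t. C * exp (- \<alpha> * t)) \<longlongrightarrow> C * 0) at_top"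
    using assms(1) by (intro tendsto_mult_left filterlim_compose[OF exp_at_bot]
      filterlim_tendsto_neg_mult_at_bot[OF tendsto_const _ filterlim_ident]) simp
  then have "a \<le> C * 0"
    by (rule tendsto_lowerbound) (rule eventually_at_top_linorderI[of 0], use assms(2) in auto)
  then show ?thesis by simp
qed

text \<open>The unstable component at time 0 is the image under the backward flow of a bounded value
  at a late time t, so it is at most a constant times e^{-at} for every t. The stable component is
  treated in reversed time.\<close>

lemma bounded_hyperbolic_orbit_eq_0:
  assumes x: "x \<in> L_hyp A" and bdd: "bounded (range (\<lambda>t. flow A t x))"
  shows "x = 0"
proof -
  obtain M where M: "\<And>t. norm (flow A t x) \<le> M"
    using bdd unfolding bounded_iff by blast
  obtain K where K: "K > 0" "\<And>v. norm (pi_plus A v) \<le> K * norm v"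
    using norm_linear_le[OF linear_pi(1)] by blast
  obtain L where L: "L > 0" "\<And>v. norm (pi_minus A v) \<le> L * norm v"
    using norm_linear_le[OF linear_pi(2)] by blast
  obtain a C where a: "a > 0" "C > 0" "\<And>x t. x \<in> L_plus A \<Longrightarrow> t \<ge> 0 \<Longrightarrow> norm (flow A (- t) x) \<le> C * exp (- a * t) * norm x"
    using L_plus_decay[of A] by blast
  obtain b D where b: "b > 0" "D > 0" "\<And>x t. x \<in> L_minus A \<Longrightarrow> t \<ge> 0 \<Longrightarrow> norm (flow A t x) \<le> D * exp (- b * t) * norm x"
    using L_minus_decay[of A] by blast
  have "norm (pi_plus A x) \<le> C * (K * M) * exp (- a * t)" if t: "t \<ge> 0" for t
  proof -
    have "norm (pi_plus A x) = norm (flow A (- t) (pi_plus A (flow A t x)))" by (simp add: pi_flow)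
    also have "\<dots> \<le> C * exp (- a * t) * norm (pi_plus A (flow A t x))" by (rule a(3)[OF pi_mem(1) t])
    also have "\<dots> \<le> C * exp (- a * t) * (K * M)"
      using a K by (intro mult_left_mono order_trans[OF K(2)] M) auto
    finally show ?thesis by (simp add: mult_ac)
  qed
  from le_zero_if_le_exp_decay[OF a(1) this] have p: "pi_plus A x = 0" by simp
  have "norm (pi_minus A x) \<le> D * (L * M) * exp (- b * t)" if t: "t \<ge> 0" for t
  proof -
    have "pi_minus A (flow A (- t) x) = flow A (- t) (pi_minus A x)" by (rule pi_flow(3))
    then have "norm (pi_minus A x) = norm (flow A t (pi_minus A (flow A (- t) x)))" by simp
    also have "\<dots> \<le> D * exp (- b * t) * norm (pi_minus A (flow A (- t) x))" by (rule b(3)[OF pi_mem(2) t])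
    also have "\<dots> \<le> D * exp (- b * t) * (L * M)"
      using b L by (intro mult_left_mono order_trans[OF L(2)] M) auto
    finally show ?thesis by (simp add: mult_ac)
  qed
  from le_zero_if_le_exp_decay[OF b(1) this] have "pi_minus A x = 0" by simp
  with p pi_on_L_hyp[OF x] show ?thesis by (simp add: pi_hyp_eq)
qed

text \<open>Existence is \<open>bsol_shift\<close> read as variation of constants, with a bound
  uniform in the shift. Two bounded solutions differ by a bounded orbit of the homogeneous equation
  in the hyperbolic subspace, which is 0.\<close>

lemma bounded_solution_eq: "bounded_solution A B u t = bsol A B (shift t u)"
proof -
  let ?y = "\<lambda>t. bsol A B (shift t u)"
  let ?P = "\<lambda>y. is_solution A (B_hyp A B) u y \<and> (\<forall>t. y t \<in> L_hyp A) \<and> bounded (range y)"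
  have y: "?y = (\<lambda>t. flow A t (bsol A B u + drive A (forcing (B_hyp A B) u) t))"
    unfolding bsol_shift drive_linear[OF locally_ess_bounded_forcing linear_pi(3) pi_flow(4)] B_hyp_mult ..
  obtain c where c: "AE s in lborel. norm (rep_linf u s) \<le> c"
    using rep_linf_ess_bounded[of u] by (auto simp: ess_bounded_def)
  obtain K where K: "\<And>v c. (AE s in lborel. norm (rep_linf v s) \<le> c) \<Longrightarrow> norm (bsol A B v) \<le> K * c"
    using bsol_bound[of A B] by blast
  have "bounded (range ?y)"
    unfolding bounded_iff using K[OF norm_rep_linf_shift_le[OF c]] by blast
  moreover have "is_solution A (B_hyp A B) u ?y"
    unfolding is_solution_def y
    using variation_of_constants[where A = A and x = "bsol A B u", OF locally_ess_bounded_forcing[of "B_hyp A B" u]]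
    by blast
  ultimately have P: "?P ?y" by (simp add: bsol_mem_L_hyp)
  have "y' = ?y" if y': "?P y'" for y'
  proof
    fix t
    let ?d = "\<lambda>t. y' t - ?y t"
    note sol = P[THEN conjunct1, unfolded is_solution_def] y'[THEN conjunct1, unfolded is_solution_def]
    have cont: "continuous_on UNIV y'" "continuous_on UNIV ?y"
      by (rule sol[THEN conjunct1])+
    have F: "locally_ess_bounded (\<lambda>s. A *v z s)" "locally_ess_bounded (\<lambda>s. A *v z s + B_hyp A B *v rep_linf u s)"
      if "continuous_on UNIV z" for z
    proof -
      show 1: "locally_ess_bounded (\<lambda>s. A *v z s)"
        by (rule locally_ess_bounded_linear[OF locally_ess_bounded_continuous[OF that] matrix_vector_mul_linear])
      show "locally_ess_bounded (\<lambda>s. A *v z s + B_hyp A B *v rep_linf u s)"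
        by (rule locally_ess_bounded_add[OF 1 locally_ess_bounded_forcing])
    qed
    have d: "?d t = flow A t (?d 0)" for t
    proof (rule homogeneous_solution)
      show "continuous_on UNIV ?d" by (intro continuous_on_diff cont)
      fix t
      have "y' t = y' 0 + (LBINT s=0..ereal t. A *v y' s + B_hyp A B *v rep_linf u s)"
        "?y t = ?y 0 + (LBINT s=0..ereal t. A *v ?y s + B_hyp A B *v rep_linf u s)"
        by (rule sol[THEN conjunct2, rule_format])+
      then have "?d t = ?d 0 + ((LBINT s=0..ereal t. A *v y' s + B_hyp A B *v rep_linf u s) -
          (LBINT s=0..ereal t. A *v ?y s + B_hyp A B *v rep_linf u s))"
        by (simp only: add_diff_add)
      also have "(LBINT s=0..ereal t. A *v y' s + B_hyp A B *v rep_linf u s) -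
          (LBINT s=0..ereal t. A *v ?y s + B_hyp A B *v rep_linf u s) = (LBINT s=0..ereal t. A *v ?d s)"
        unfolding interval_integral_orient
        by (subst Bochner_Integration.integral_diff[symmetric])
          (simp_all add: integrable_orient[OF F(2)] cont matrix_vector_mult_diff_distrib flip: scaleR_diff_right)
      finally show "?d t = ?d 0 + (LBINT s=0..ereal t. A *v ?d s)" .
    qed
    have "?d 0 = 0"
    proof (rule bounded_hyperbolic_orbit_eq_0)
      show "?d 0 \<in> L_hyp A"
        by (rule subspace_diff[OF subspace_L_hyp]) (use y' bsol_mem_L_hyp in auto)
      have "bounded (range ?d)"
        using bounded_minus_comp[of y' UNIV ?y] y' P by simp
      then show "bounded (range (\<lambda>t. flow A t (?d 0)))"
        unfolding d[symmetric] .
    qed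
    with d[of t] show "y' t = ?y t" by simp
  qed
  with P have "bounded_solution A B u = ?y"
    unfolding bounded_solution_def by (rule the_equality)
  then show ?thesis by simp
qed

text \<open>The hyperbolic forcing is absorbed into r e(u, 0), so only its L^0 component still
  drives w. The plus sign is essential: with -r e(u, 0) the hyperbolic forcing of w would double
  instead of cancel.\<close>

lemma lifted_solution_coords:
  "lifted_solution A B t (r *\<^sub>R bsol A B u + w, r) u =
    (r *\<^sub>R bsol A B (shift t u) + flow A t (w + r *\<^sub>R pi_zero A (drive A (forcing B u) t)), r)"
  unfolding lifted_solution_eq bsol_shift pi_zero_def
  by (simp add: matrix_vector_right_distrib matrix_vector_mult_scaleR scaleR_right_distrib
      scaleR_diff_right matrix_vector_mult_diff_distrib)

text \<open>Up to time t the forcing on L^0 accumulates at most a multiple of t e^{(\<delta>/2) t},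
  and the remaining \<delta>/2 absorbs the factor t. The constant depends on the control only
  through its bound c.\<close>

lemma center_forcing_growth:
  fixes B :: "real^'m^'n"
  assumes "\<delta> > 0"
  shows "\<exists>C>0. \<forall>u t. t \<ge> 0 \<longrightarrow> (AE s in lborel. norm (rep_linf u s) \<le> c) \<longrightarrow>
    norm (flow A t (pi_zero A (drive A (forcing B u) t))) \<le> C * exp (\<delta> * t)"
proof -
  have "\<delta> / 2 > 0" using assms by simp
  obtain C where C: "C > 0" "\<And>x t. x \<in> L_zero A \<Longrightarrow> norm (flow A t x) \<le> C * exp (\<delta> / 2 * \<bar>t\<bar>) * norm x"
    using L_zero_growth[OF \<open>\<delta> / 2 > 0\<close>, of A] by blast
  obtain K where K: "K > 0" "\<And>v. norm (B *v v) \<le> K * norm v"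
    using norm_matrix_vector_mult_le by blast
  obtain L where L: "L > 0" "\<And>v. norm (pi_zero A v) \<le> L * norm v"
    using norm_linear_le[OF linear_pi(4)] by blast
  define D where "D = C * (L * (K * \<bar>c\<bar>))"
  have "D \<ge> 0" using C K L by (simp add: D_def)
  have "norm (flow A t (pi_zero A (drive A (forcing B u) t))) \<le> (D + 1) * (2 / \<delta>) * exp (\<delta> * t)"
    if t: "t \<ge> 0" and c: "AE s in lborel. norm (rep_linf u s) \<le> c" for u :: "'m linf" and t
  proof -
    have g: "locally_ess_bounded (\<lambda>s. pi_zero A (B *v rep_linf u s))"
      by (rule locally_ess_bounded_linear[OF locally_ess_bounded_forcing linear_pi(4)])
    have "flow A t (pi_zero A (drive A (forcing B u) t)) =
        (\<integral>s. orient t s *\<^sub>R flow A (t - s) (pi_zero A (B *v rep_linf u s)) \<partial>lborel)"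
      unfolding drive_linear[OF locally_ess_bounded_forcing linear_pi(4) pi_flow(2)] flow_drive[OF g] ..
    also have "norm \<dots> \<le> D * exp (\<delta> / 2 * t) * \<bar>t - 0\<bar>"
    proof -
      have "AE s in lborel. s \<in> {min 0 t..max 0 t} \<longrightarrow>
          norm (flow A (t - s) (pi_zero A (B *v rep_linf u s))) \<le> D * exp (\<delta> / 2 * t)"
        using c
      proof eventually_elim
        case (elim s)
        show ?case
        proof
          assume s: "s \<in> {min 0 t..max 0 t}"
          have "norm (flow A (t - s) (pi_zero A (B *v rep_linf u s))) \<le>
              C * exp (\<delta> / 2 * \<bar>t - s\<bar>) * norm (pi_zero A (B *v rep_linf u s))"
            by (rule C(2)[OF pi_mem(3)])
          also have "norm (pi_zero A (B *v rep_linf u s)) \<le> L * (K * \<bar>c\<bar>)"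
            using K L elim by (intro order_trans[OF L(2)] mult_left_mono order_trans[OF K(2)]) auto
          also have "C * exp (\<delta> / 2 * \<bar>t - s\<bar>) * (L * (K * \<bar>c\<bar>)) \<le> C * exp (\<delta> / 2 * t) * (L * (K * \<bar>c\<bar>))"
            using C K L s t assms by (intro mult_right_mono mult_left_mono) auto
          finally show "norm (flow A (t - s) (pi_zero A (B *v rep_linf u s))) \<le> D * exp (\<delta> / 2 * t)"
            using C by (simp add: D_def mult_ac mult_left_mono)
        qed
      qed
      from norm_orient_increment_le[OF locally_ess_bounded_flow[OF g] _ this] \<open>D \<ge> 0\<close>
      show ?thesis by simp
    qed
    also have "\<dots> \<le> (D + 1) * exp (\<delta> / 2 * t) * (2 / \<delta> * exp (\<delta> / 2 * t))"
    proof (intro mult_mono)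
      have "\<delta> / 2 * t \<le> exp (\<delta> / 2 * t)"
        using exp_ge_add_one_self[of "\<delta> / 2 * t"] by linarith
      then show "\<bar>t - 0\<bar> \<le> 2 / \<delta> * exp (\<delta> / 2 * t)"
        using t assms by (simp add: field_simps)
    qed (use \<open>D \<ge> 0\<close> in auto)
    also have "\<dots> = (D + 1) * (2 / \<delta>) * exp (\<delta> * t)"
      by (simp add: mult_ac flip: exp_add)
    finally show ?thesis .
  qed
  then show ?thesis
    using assms \<open>D \<ge> 0\<close> by (intro exI[of _ "(D + 1) * (2 / \<delta>)"]) auto
qed

section \<open>The metric space of admissible controls\<close>

locale admissible_controls =
  fixes U :: "(real^'m::finite) set" and d :: "'m linf \<Rightarrow> 'm linf \<Rightarrow> real"
  assumes U: "compact U" "convex U" "0 \<in> U"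
    and metric: "Metric_space (admissible U) d"
    and topology: "Metric_space.mtopology (admissible U) d = subtopology weak_star (admissible U)"

sublocale admissible_controls \<subseteq> Metric_space "admissible U" d
  by (rule metric)

context admissible_controls
begin

lemma U_bound: "\<exists>c>0. \<forall>u\<in>admissible U. AE s in lborel. norm (rep_linf u s) \<le> c"
proof -
  obtain c where c: "c > 0" "\<And>x. x \<in> U \<Longrightarrow> norm x \<le> c"
    using compact_imp_bounded[OF U(1)] unfolding bounded_pos by blast
  have "AE s in lborel. norm (rep_linf u s) \<le> c" if "u \<in> admissible U" for u
    using that unfolding admissible_def mem_Collect_eq by eventually_elim (rule c)
  with c(1) show ?thesis by blast
qed

lemma convergent_subsequence:
  assumes "\<And>n :: nat. \<sigma> n \<in> admissible U"
  shows "\<exists>l r. l \<in> admissible U \<and> strict_mono (r :: nat \<Rightarrow> nat) \<and> limitin mtopology (\<sigma> \<circ> r) l sequentially"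
proof -
  have "compactin mtopology (admissible U)"
    unfolding topology using compactin_admissible[OF U(1,2)] by (simp add: compactin_subtopology)
  then show ?thesis
    unfolding compactin_sequentially using assms by blast
qed

lemma tendsto_bsol:
  assumes "limitin mtopology \<sigma> l sequentially"
  shows "(\<lambda>n. bsol A B (\<sigma> n)) \<longlonglongrightarrow> bsol A B l"
proof -
  have "limitin weak_star \<sigma> l sequentially"
    using assms unfolding topology limitin_subtopology by blast
  from continuous_map_limit[OF continuous_map_bsol this, of A B] show ?thesis
    by (simp add: comp_def)
qed

lemma eventually_dist_less:
  assumes "limitin mtopology \<sigma> l F" "e > 0"
  shows "\<forall>\<^sub>F n in F. d (\<sigma> n) l < e"
proof -
  have "\<forall>\<^sub>F n in F. \<sigma> n \<in> admissible U \<and> d (\<sigma> n) l < e"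
    using assms unfolding limitin_metric by blast
  then show ?thesis by eventually_elim simp
qed

lemma tendsto_dist_0:
  assumes "\<And>n. u n \<in> admissible U" "\<And>n. v n \<in> admissible U"
    and "limitin mtopology u l sequentially" "limitin mtopology v l sequentially"
  shows "(\<lambda>n. d (u n) (v n)) \<longlonglongrightarrow> 0"
proof (rule LIMSEQ_I)
  fix e :: real assume "e > 0"
  then have "e / 2 > 0" by simp
  from eventually_dist_less[OF assms(3) this] eventually_dist_less[OF assms(4) this]
  have "\<forall>\<^sub>F n in sequentially. norm (d (u n) (v n) - 0) < e"
  proof eventually_elim
    case (elim n)
    have "l \<in> admissible U" using assms(3) unfolding limitin_metric by blast
    then have "d (u n) (v n) \<le> d (u n) l + d (v n) l"
      using triangle[of "u n" l "v n"] assms(1,2) commute[of "v n" l] by simp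
    with elim show ?case by simp
  qed
  then show "\<exists>N. \<forall>n\<ge>N. norm (d (u n) (v n) - 0) < e"
    by (simp add: eventually_sequentially)
qed

lemma bsol_bounded:
  fixes B :: "real^'m^'n"
  shows "\<exists>K>0. \<forall>u\<in>admissible U. norm (bsol A B u) \<le> K"
proof -
  obtain c where c: "c > 0" "\<And>u. u \<in> admissible U \<Longrightarrow> AE s in lborel. norm (rep_linf u s) \<le> c"
    using U_bound by blast
  obtain K where "K > 0" "\<And>u c. (AE s in lborel. norm (rep_linf (u :: 'm linf) s) \<le> c) \<Longrightarrow> norm (bsol A B u) \<le> K * c"
    using bsol_bound[of A B] by blast
  with c show ?thesis by (intro exI[of _ "K * c"]) auto
qed

text \<open>A compactness argument: in a counterexample, a convergent subsequence of the u n drags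
  the v n to the same limit, and sequential continuity of e brings the values together.\<close>

lemma bsol_uniformly_continuous:
  assumes "e > 0"
  shows "\<exists>\<delta>>0. \<forall>u\<in>admissible U. \<forall>v\<in>admissible U. d u v < \<delta> \<longrightarrow> norm (bsol A B u - bsol A B v) < e"
proof (rule ccontr)
  assume neg: "\<not> ?thesis"
  have "\<exists>u v. u \<in> admissible U \<and> v \<in> admissible U \<and> d u v < inverse (Suc n) \<and> norm (bsol A B u - bsol A B v) \<ge> e" for n
    using neg by (metis inverse_positive_iff_positive not_less of_nat_0_less_iff zero_less_Suc)
  then obtain u v where uv: "\<And>n. u n \<in> admissible U" "\<And>n. v n \<in> admissible U"
    "\<And>n. d (u n) (v n) < inverse (Suc n)" "\<And>n. norm (bsol A B (u n) - bsol A B (v n)) \<ge> e"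
    by metis
  obtain l r where l: "l \<in> admissible U" "strict_mono (r :: nat \<Rightarrow> nat)" "limitin mtopology (u \<circ> r) l sequentially"
    using convergent_subsequence[of u] uv(1) by blast
  have "limitin mtopology (v \<circ> r) l sequentially"
    unfolding limitin_metric
  proof (intro conjI allI impI l(1))
    fix e :: real assume e: "e > 0"
    then have 1: "\<forall>\<^sub>F n in sequentially. d (u (r n)) l < e / 2"
      using eventually_dist_less[OF l(3), of "e / 2"] by simp
    have "(\<lambda>n. inverse (real (Suc (r n)))) \<longlonglongrightarrow> 0"
      using LIMSEQ_subseq_LIMSEQ[OF LIMSEQ_inverse_real_of_nat l(2)] by (simp add: comp_def)
    then have 2: "\<forall>\<^sub>F n in sequentially. inverse (real (Suc (r n))) < e / 2"
      using e by (intro order_tendstoD(2)) auto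
    show "\<forall>\<^sub>F n in sequentially. (v \<circ> r) n \<in> admissible U \<and> d ((v \<circ> r) n) l < e"
      using 1 2
    proof eventually_elim
      case (elim n)
      have "d (v (r n)) l \<le> d (u (r n)) (v (r n)) + d (u (r n)) l"
        using triangle[of "v (r n)" "u (r n)" l] uv(1,2) l(1) commute[of "v (r n)"] by simp
      also have "\<dots> < e" using elim uv(3)[of "r n"] by simp
      finally show ?case using uv(2) by simp
    qed
  qed
  from tendsto_diff[OF tendsto_bsol[OF l(3)] tendsto_bsol[OF this], of A B A B]
  have "(\<lambda>n. norm (bsol A B (u (r n)) - bsol A B (v (r n)))) \<longlonglongrightarrow> 0"
    by (simp add: tendsto_norm_zero)
  then have "\<forall>\<^sub>F n in sequentially. norm (bsol A B (u (r n)) - bsol A B (v (r n))) < e"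
    using assms by (rule order_tendstoD(2))
  then obtain n where "norm (bsol A B (u (r n)) - bsol A B (v (r n))) < e"
    by (auto simp: eventually_sequentially)
  with uv(4)[of "r n"] show False by simp
qed

lemma tail_integral_tendsto_0:
  assumes g: "integrable lborel (g :: real \<Rightarrow> real^'m)"
  shows "(\<lambda>n. \<integral>s. indicator {s. \<bar>s\<bar> > real n} s * norm (g s) \<partial>lborel) \<longlonglongrightarrow> 0"
proof -
  have "(\<lambda>n. \<integral>s. indicator {s. \<bar>s\<bar> > real n} s * norm (g s) \<partial>lborel) \<longlonglongrightarrow> (\<integral>(s :: real). 0 \<partial>lborel)"
  proof (rule integral_dominated_convergence)
    show "integrable lborel (\<lambda>s. norm (g s))" using g by simp
    show "AE s in lborel. (\<lambda>n. indicator {s. \<bar>s\<bar> > real n} s * norm (g s)) \<longlonglongrightarrow> 0"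
    proof (rule AE_I2)
      fix s
      obtain N where "\<bar>s\<bar> \<le> real N" using real_arch_simple by blast
      then have "\<forall>\<^sub>F n in sequentially. indicator {s. \<bar>s\<bar> > real n} s * norm (g s) = 0"
        by (intro eventually_sequentiallyI[of N]) (auto simp: indicator_def)
      then show "(\<lambda>n. indicator {s. \<bar>s\<bar> > real n} s * norm (g s)) \<longlonglongrightarrow> 0"
        by (rule tendsto_eventually)
    qed
    show "(\<lambda>s. indicator {s. \<bar>s\<bar> > real n} s * norm (g s)) \<in> borel_measurable lborel" for n
      using g by (intro borel_measurable_times borel_measurable_indicator) (auto simp: borel_measurable_integrable)
  qed (auto simp: indicator_def)
  then show ?thesis by simp
qed

text \<open>Suppose pairs agreeing on growing windows stay apart. Pairing with an L^1 function
  hardly sees what happens outside the window, so along a subsequence both members have the same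
  weak* limit, and then \<open>d\<close> between them tends to 0.\<close>

lemma near_if_eq_on_interval:
  assumes "e > 0"
  shows "\<exists>R>0. \<forall>u\<in>admissible U. \<forall>v\<in>admissible U.
    (AE s in lborel. \<bar>s\<bar> \<le> R \<longrightarrow> rep_linf u s = rep_linf v s) \<longrightarrow> d u v < e"
proof (rule ccontr)
  assume neg: "\<not> ?thesis"
  have ex: "\<exists>u v. u \<in> admissible U \<and> v \<in> admissible U \<and>
      (AE s in lborel. \<bar>s\<bar> \<le> real (Suc n) \<longrightarrow> rep_linf u s = rep_linf v s) \<and> d u v \<ge> e" for n
    using neg by (metis not_less of_nat_0_less_iff zero_less_Suc)
  from choice[OF allI[OF ex]] obtain u where u: "\<forall>n. \<exists>v. u n \<in> admissible U \<and> v \<in> admissible U \<and>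
      (AE s in lborel. \<bar>s\<bar> \<le> real (Suc n) \<longrightarrow> rep_linf (u n) s = rep_linf v s) \<and> d (u n) v \<ge> e" ..
  from choice[OF u] obtain v where "\<forall>n. u n \<in> admissible U \<and> v n \<in> admissible U \<and>
      (AE s in lborel. \<bar>s\<bar> \<le> real (Suc n) \<longrightarrow> rep_linf (u n) s = rep_linf (v n) s) \<and> d (u n) (v n) \<ge> e" ..
  then have uv: "\<And>n. u n \<in> admissible U" "\<And>n. v n \<in> admissible U"
    "\<And>n. AE s in lborel. \<bar>s\<bar> \<le> real (Suc n) \<longrightarrow> rep_linf (u n) s = rep_linf (v n) s" "\<And>n. d (u n) (v n) \<ge> e"
    by simp_all
  obtain l r where l: "l \<in> admissible U" "strict_mono (r :: nat \<Rightarrow> nat)" "limitin mtopology (u \<circ> r) l sequentially"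
    using convergent_subsequence[of u] uv(1) by blast
  obtain c where c: "c > 0" "\<And>u. u \<in> admissible U \<Longrightarrow> AE s in lborel. norm (rep_linf u s) \<le> c"
    using U_bound by blast
  have "limitin weak_star (v \<circ> r) l sequentially"
  proof (rule limitin_weak_star)
    fix g :: "real \<Rightarrow> real^'m" assume g: "integrable lborel g"
    have "limitin weak_star (u \<circ> r) l sequentially"
      using l(3) unfolding topology limitin_subtopology by blast
    from continuous_map_limit[OF continuous_map_pairing[OF g] this]
    have 1: "(\<lambda>n. pairing (u (r n)) g) \<longlonglongrightarrow> pairing l g"
      by (simp add: comp_def)
    \<comment> \<open>The controls agree on the window and are bounded by c outside it, so only the
      tail of g contributes.\<close>
    have "norm (pairing (v n) g - pairing (u n) g) \<le>
        2 * c * (\<integral>s. indicator {s. \<bar>s\<bar> > real (Suc n)} s * norm (g s) \<partial>lborel)" for n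
    proof -
      have "pairing (v n) g - pairing (u n) g = (\<integral>s. rep_linf (v n) s \<bullet> g s - rep_linf (u n) s \<bullet> g s \<partial>lborel)"
        by (intro Bochner_Integration.integral_diff[symmetric] integrable_pairing g)
      also have "norm \<dots> \<le> (\<integral>s. norm (rep_linf (v n) s \<bullet> g s - rep_linf (u n) s \<bullet> g s) \<partial>lborel)"
        by (rule integral_norm_bound)
      also have "\<dots> \<le> (\<integral>s. 2 * c * (indicator {s. \<bar>s\<bar> > real (Suc n)} s * norm (g s)) \<partial>lborel)"
      proof (rule integral_mono_AE)
        show "integrable lborel (\<lambda>s. norm (rep_linf (v n) s \<bullet> g s - rep_linf (u n) s \<bullet> g s))"
          by (intro integrable_norm Bochner_Integration.integrable_diff integrable_pairing g)
        have "{s. \<bar>s\<bar> > real (Suc n)} \<in> sets lborel" by measurable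
        from integrable_mult_indicator[OF this integrable_norm[OF g]]
        show "integrable lborel (\<lambda>s. 2 * c * (indicator {s. \<bar>s\<bar> > real (Suc n)} s * norm (g s)))" by simp
        show "AE s in lborel. norm (rep_linf (v n) s \<bullet> g s - rep_linf (u n) s \<bullet> g s) \<le>
            2 * c * (indicator {s. \<bar>s\<bar> > real (Suc n)} s * norm (g s))"
          using uv(3)[of n] c(2)[OF uv(1)[of n]] c(2)[OF uv(2)[of n]]
        proof eventually_elim
          case (elim s)
          have "norm (rep_linf (v n) s \<bullet> g s - rep_linf (u n) s \<bullet> g s) \<le> norm (rep_linf (v n) s - rep_linf (u n) s) * norm (g s)"
            using Cauchy_Schwarz_ineq2[of "rep_linf (v n) s - rep_linf (u n) s" "g s"] by (simp add: inner_diff_left)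
          also have "\<dots> \<le> 2 * c * norm (g s)"
            using norm_triangle_ineq4[of "rep_linf (v n) s" "rep_linf (u n) s"] elim by (intro mult_right_mono) auto
          finally show ?case using elim by (auto simp: indicator_def not_less)
        qed
      qed
      finally show ?thesis by simp
    qed
    then have le: "norm (pairing (v (r n)) g - pairing (u (r n)) g) \<le>
        2 * c * (\<integral>s. indicator {s. \<bar>s\<bar> > real (Suc (r n))} s * norm (g s) \<partial>lborel)" for n
      by blast
    have "strict_mono (\<lambda>n. Suc (r n))" using l(2) by (simp add: strict_mono_def)
    from LIMSEQ_subseq_LIMSEQ[OF tail_integral_tendsto_0[OF g] this]
    have "(\<lambda>n. 2 * c * (\<integral>s. indicator {s. \<bar>s\<bar> > real (Suc (r n))} s * norm (g s) \<partial>lborel)) \<longlonglongrightarrow> 0"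
      by (intro tendsto_mult_right_zero) (simp add: comp_def)
    then have "(\<lambda>n. pairing (v (r n)) g - pairing (u (r n)) g) \<longlonglongrightarrow> 0"
      by (rule Lim_null_comparison[rotated]) (use le in simp)
    from tendsto_add[OF this 1] show "(\<lambda>n. pairing ((v \<circ> r) n) g) \<longlonglongrightarrow> pairing l g" by simp
  qed
  then have "limitin mtopology (v \<circ> r) l sequentially"
    unfolding topology limitin_subtopology using l(1) uv(2) by simp
  from tendsto_dist_0[OF _ _ l(3) this] uv(1,2) have "(\<lambda>n. d (u (r n)) (v (r n))) \<longlonglongrightarrow> 0"
    by simp
  then have "\<forall>\<^sub>F n in sequentially. d (u (r n)) (v (r n)) < e"
    using assms by (rule order_tendstoD(2))
  then obtain n where "d (u (r n)) (v (r n)) < e" by (auto simp: eventually_sequentially)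
  with uv(4)[of "r n"] show False by simp
qed

end

section \<open>Joining controls in time\<close>

definition join_at :: "real \<Rightarrow> 'm::finite linf \<Rightarrow> 'm linf \<Rightarrow> 'm linf" where
  "join_at a u v = abs_linf (\<lambda>s. if s < a then rep_linf u s else rep_linf v s)"

lemma rep_linf_join_at:
  "AE s in lborel. rep_linf (join_at a u v) s = (if s < a then rep_linf u s else rep_linf v s)"
  unfolding join_at_def
proof (rule rep_abs_linf)
  obtain C D where "AE s in lborel. norm (rep_linf u s) \<le> C" "AE s in lborel. norm (rep_linf v s) \<le> D"
    using rep_linf_ess_bounded[of u] rep_linf_ess_bounded[of v] unfolding ess_bounded_def by blast
  then have "AE s in lborel. norm (if s < a then rep_linf u s else rep_linf v s) \<le> max C D"
    by eventually_elim auto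
  moreover have "(\<lambda>s. if s < a then rep_linf u s else rep_linf v s) \<in> borel_measurable lborel"
    by measurable
  ultimately show "ess_bounded (\<lambda>s. if s < a then rep_linf u s else rep_linf v s)"
    unfolding ess_bounded_def by blast
qed

lemma admissible_join_at:
  assumes "u \<in> admissible U" "v \<in> admissible U"
  shows "join_at a u v \<in> admissible U"
proof -
  have "AE s in lborel. rep_linf u s \<in> U" "AE s in lborel. rep_linf v s \<in> U"
    using assms by (simp_all add: admissible_def)
  with rep_linf_join_at[of a u v] have "AE s in lborel. rep_linf (join_at a u v) s \<in> U"
    by eventually_elim simp
  then show ?thesis by (simp add: admissible_def)
qed

definition zero_control :: "'m::finite linf" where
  "zero_control = abs_linf (\<lambda>_. 0)"

lemma rep_linf_zero_control: "AE s in lborel. rep_linf (zero_control :: 'm::finite linf) s = 0"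
  unfolding zero_control_def by (rule rep_abs_linf) (auto simp: ess_bounded_def)

lemma shift_zero_control [simp]: "shift t zero_control = (zero_control :: 'm::finite linf)"
proof (rule linf_eqI)
  show "AE s in lborel. rep_linf (shift t zero_control) s = rep_linf (zero_control :: 'm linf) s"
    using rep_linf_shift[of t "zero_control :: 'm linf"]
      AE_lborel_shift[OF rep_linf_zero_control[where 'm = 'm], of t] rep_linf_zero_control[where 'm = 'm]
    by eventually_elim simp
qed

lemma admissible_zero_control: "0 \<in> U \<Longrightarrow> zero_control \<in> admissible (U :: (real^'m::finite) set)"
proof -
  assume "0 \<in> U"
  have "AE s in lborel. rep_linf (zero_control :: 'm linf) s \<in> U"
    using rep_linf_zero_control[where 'm = 'm] by eventually_elim (use \<open>0 \<in> U\<close> in simp)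
  then show ?thesis by (simp add: admissible_def)
qed

lemma drive_zero_control [simp]:
  fixes B :: "real^'m^'n"
  shows "drive A (forcing B zero_control) t = 0"
  unfolding drive_def
proof (rule integral_eq_zero_AE)
  show "AE s in lborel. orient t s *\<^sub>R flow A (- s) (forcing B zero_control s) = 0"
    using rep_linf_zero_control[where 'm = 'm] by eventually_elim simp
qed

lemma shift_shift: "shift s (shift t u) = shift (s + t) u"
proof (rule linf_eqI)
  show "AE x in lborel. rep_linf (shift s (shift t u)) x = rep_linf (shift (s + t) u) x"
    using rep_linf_shift[of s "shift t u"] AE_lborel_shift[OF rep_linf_shift[of t u], of s] rep_linf_shift[of "s + t" u]
    by eventually_elim (simp add: add_ac)
qed

section \<open>Projective space\<close>

lemma dist_to_proj:
  "x \<noteq> 0 \<Longrightarrow> y \<noteq> 0 \<Longrightarrow> dist (to_proj x) (to_proj y) = min (norm (sgn x - sgn y)) (norm (sgn x + sgn y))"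
  by (rule dist_proj.abs_eq) (auto intro: exI[of _ 1])

lemma to_proj_scaleR:
  assumes "c \<noteq> 0" "x \<noteq> 0"
  shows "to_proj (c *\<^sub>R x) = to_proj x"
  using assms Quotient_rel_abs[OF Quotient_proj, of "x" "c *\<^sub>R x"] by auto

lemma rep_proj_nonzero: "rep_proj p \<noteq> 0"
  using Quotient_rep_reflp[OF Quotient_proj, of p] by blast

lemma to_proj_rep_proj [simp]: "to_proj (rep_proj p) = p"
  using Quotient_abs_rep[OF Quotient_proj] .

lemma rep_proj_to_proj:
  assumes "x \<noteq> 0"
  shows "\<exists>c. c \<noteq> 0 \<and> rep_proj (to_proj x) = c *\<^sub>R x"
proof -
  have "\<exists>c. x = c *\<^sub>R rep_proj (to_proj x)"
  proof -
    have "\<exists>c. x = c *\<^sub>R x" by (rule exI[of _ 1]) simp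
    then show ?thesis using Quotient_rep_abs[OF Quotient_proj, of x] assms by blast
  qed
  then obtain c where c: "x = c *\<^sub>R rep_proj (to_proj x)" by blast
  with assms have "c \<noteq> 0" by auto
  with c have "rep_proj (to_proj x) = inverse c *\<^sub>R x" by (metis left_inverse scaleR_one scaleR_scaleR)
  with \<open>c \<noteq> 0\<close> show ?thesis by (intro exI[of _ "inverse c"]) auto
qed

lemma to_proj_eq_iff: "x \<noteq> 0 \<Longrightarrow> y \<noteq> 0 \<Longrightarrow> to_proj x = to_proj y \<longleftrightarrow> (\<exists>c. c \<noteq> 0 \<and> y = c *\<^sub>R x)"
proof
  assume x: "x \<noteq> 0" and y: "y \<noteq> 0" and "to_proj x = to_proj y"
  obtain a b where ab: "a \<noteq> 0" "b \<noteq> 0" "rep_proj (to_proj x) = a *\<^sub>R x" "rep_proj (to_proj y) = b *\<^sub>R y"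
    using rep_proj_to_proj x y by metis
  with \<open>to_proj x = to_proj y\<close> have "y = (inverse b * a) *\<^sub>R x"
    by (metis left_inverse scaleR_one scaleR_scaleR)
  with ab show "\<exists>c. c \<noteq> 0 \<and> y = c *\<^sub>R x" by (intro exI[of _ "inverse b * a"]) simp
next
  assume "x \<noteq> 0" "\<exists>c. c \<noteq> 0 \<and> y = c *\<^sub>R x"
  then show "to_proj x = to_proj y" by (auto simp: to_proj_scaleR)
qed

text \<open>Passing from x to y changes the norm and the vector; after normalization each costs at
  most |x - y| / |y|. The denominator involves y alone, so jumps can be measured relative to the
  target.\<close>

lemma dist_to_proj_le:
  assumes "x \<noteq> 0" "y \<noteq> 0"
  shows "dist (to_proj x) (to_proj y) \<le> 2 * norm (x - y) / norm y"
proof -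
  have "sgn x - sgn y = (inverse (norm x) - inverse (norm y)) *\<^sub>R x + inverse (norm y) *\<^sub>R (x - y)"
    by (simp add: sgn_div_norm algebra_simps)
  then have "norm (sgn x - sgn y) \<le> \<bar>inverse (norm x) - inverse (norm y)\<bar> * norm x + inverse (norm y) * norm (x - y)"
    by (metis norm_triangle_ineq norm_scaleR abs_inverse abs_norm_cancel)
  also have "\<bar>inverse (norm x) - inverse (norm y)\<bar> * norm x = \<bar>norm y - norm x\<bar> / norm y"
  proof -
    have "inverse (norm x) - inverse (norm y) = (norm y - norm x) / (norm x * norm y)"
      using assms by (simp add: field_simps)
    then show ?thesis using assms by (simp add: abs_mult)
  qed
  also have "\<bar>norm y - norm x\<bar> / norm y \<le> norm (x - y) / norm y"
    by (intro divide_right_mono) (metis norm_triangle_ineq3 abs_minus_commute, simp)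
  finally have "norm (sgn x - sgn y) \<le> 2 * norm (x - y) / norm y"
    by (simp add: divide_inverse algebra_simps)
  then show ?thesis using assms by (simp add: dist_to_proj)
qed

lemma lifted_solution_scaleR: "lifted_solution A B t (c *\<^sub>R z) u = c *\<^sub>R lifted_solution A B t z u"
  by (cases z) (simp add: lifted_solution_eq matrix_vector_right_distrib matrix_vector_mult_scaleR
      scaleR_right_distrib)

lemma flow_eq_0_iff [simp]: "flow A t x = 0 \<longleftrightarrow> x = 0"
  by (metis flow_minus(1) matrix_vector_mult_0_right)

lemma flow_minus_eq_0_iff [simp]: "mat_exp (- (t *\<^sub>R A)) *v x = 0 \<longleftrightarrow> x = 0"
  using flow_eq_0_iff[of "- t" A x] by simp

lemma lifted_solution_eq_0_iff: "lifted_solution A B t z u = 0 \<longleftrightarrow> z = 0"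
  by (cases z) (auto simp: lifted_solution_eq zero_prod_def)

lemma proj_trajectory_to_proj:
  assumes "z \<noteq> 0"
  shows "proj_trajectory A B t (to_proj z) u = to_proj (lifted_solution A B t z u)"
proof -
  obtain c where "c \<noteq> 0" "rep_proj (to_proj z) = c *\<^sub>R z"
    using rep_proj_to_proj[OF assms] by blast
  then show ?thesis
    using assms by (simp add: proj_trajectory_def lifted_solution_scaleR to_proj_scaleR lifted_solution_eq_0_iff)
qed

section \<open>Chains\<close>

lemma has_chain_single:
  assumes "x \<in> X" "y \<in> X" "t \<ge> T" "d (\<Psi> t x) y < \<epsilon>"
  shows "has_chain X d \<Psi> \<epsilon> T x y"
  unfolding has_chain_def
  using assms by (intro exI[of _ 1] exI[of _ "\<lambda>_. t"] exI[of _ "\<lambda>i. if i = 0 then x else y"]) auto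

lemma has_chain_trans:
  assumes "has_chain X d \<Psi> \<epsilon> T x y" "has_chain X d \<Psi> \<epsilon> T y z"
  shows "has_chain X d \<Psi> \<epsilon> T x z"
proof -
  obtain k \<tau> \<xi> where 1: "k \<ge> 1" "\<xi> 0 = x" "\<xi> k = y" "\<And>i. i \<le> k \<Longrightarrow> \<xi> i \<in> X"
    "\<And>i. i < k \<Longrightarrow> \<tau> i \<ge> T \<and> d (\<Psi> (\<tau> i) (\<xi> i)) (\<xi> (Suc i)) < \<epsilon>"
    using assms(1) unfolding has_chain_def by blast
  obtain l \<sigma> \<eta> where 2: "l \<ge> 1" "\<eta> 0 = y" "\<eta> l = z" "\<And>i. i \<le> l \<Longrightarrow> \<eta> i \<in> X"
    "\<And>i. i < l \<Longrightarrow> \<sigma> i \<ge> T \<and> d (\<Psi> (\<sigma> i) (\<eta> i)) (\<eta> (Suc i)) < \<epsilon>"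
    using assms(2) unfolding has_chain_def by blast
  let ?\<xi> = "\<lambda>i. if i \<le> k then \<xi> i else \<eta> (i - k)" and ?\<tau> = "\<lambda>i. if i < k then \<tau> i else \<sigma> (i - k)"
  have "?\<tau> i \<ge> T \<and> d (\<Psi> (?\<tau> i) (?\<xi> i)) (?\<xi> (Suc i)) < \<epsilon>" if "i < k + l" for i
  proof (cases "i < k")
    case True
    then show ?thesis using 1(5)[of i] by simp
  next
    case False
    moreover from False have "?\<xi> i = \<eta> (i - k)" using 1(3) 2(2) by auto
    ultimately show ?thesis using 2(5)[of "i - k"] that by (simp add: Suc_diff_le)
  qed
  then show ?thesis
    unfolding has_chain_def using 1 2
    by (intro exI[of _ "k + l"] exI[of _ ?\<tau>] exI[of _ ?\<xi>]) auto
qed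

section \<open>The central bundle is chain transitive\<close>

text \<open>
  The system on the whole space is the case \<open>Q = L_zero A\<close>, the induced one the case \<open>Q = {0}\<close>.
\<close>

locale central = admissible_controls U d
  for U :: "(real^'m::finite) set" and d :: "'m linf \<Rightarrow> 'm linf \<Rightarrow> real" +
  fixes A :: "real^'n^'n" and B :: "real^'m^'n" and Q S :: "(real^'n) set"
  assumes subspace_Q: "subspace Q" and Q_le: "Q \<subseteq> L_zero A"
    and flow_Q: "\<And>t x. x \<in> Q \<Longrightarrow> flow A t x \<in> Q"
    and drive_Q: "\<And>u t. pi_zero A (drive A (forcing B u) t) \<in> Q"
    and S_eq: "S = subspace_sum (L_hyp A) Q"
begin

abbreviation point :: "'m linf \<Rightarrow> real^'n \<Rightarrow> real \<Rightarrow> ((real^'n) \<times> real) proj" where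
  "point u x r \<equiv> to_proj (r *\<^sub>R bsol A B u + x, r)"

definition center :: "('m linf \<times> ((real^'n) \<times> real) proj) set" where
  "center = {(u, point u x r) | u x r. u \<in> admissible U \<and> x \<in> Q \<and> (x, r) \<noteq> 0}"

abbreviation chain :: "real \<Rightarrow> real \<Rightarrow> 'm linf \<times> ((real^'n) \<times> real) proj \<Rightarrow> 'm linf \<times> ((real^'n) \<times> real) proj \<Rightarrow> bool" where
  "chain \<equiv> has_chain (admissible U \<times> proj_points S) (max_dist d) (proj_flow A B)"

abbreviation center_flow :: "'m linf \<Rightarrow> real \<Rightarrow> real^'n \<Rightarrow> real \<Rightarrow> real^'n" where
  "center_flow u t x r \<equiv> flow A t (x + r *\<^sub>R pi_zero A (drive A (forcing B u) t))"

lemma coords_nonzero: "(x, r) \<noteq> 0 \<Longrightarrow> (r *\<^sub>R bsol A B u + x, r) \<noteq> 0"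
  by (auto simp: zero_prod_def)

lemma center_subset: "center \<subseteq> admissible U \<times> proj_points S"
proof
  fix p assume "p \<in> center"
  then obtain u x r where p: "p = (u, point u x r)" "u \<in> admissible U" "x \<in> Q" "(x, r) \<noteq> 0"
    unfolding center_def by blast
  have "r *\<^sub>R bsol A B u \<in> L_hyp A"
    by (rule subspace_scale[OF subspace_L_hyp bsol_mem_L_hyp])
  with p(3) have "r *\<^sub>R bsol A B u + x \<in> S" unfolding S_eq by blast
  with coords_nonzero[OF p(4)] have "point u x r \<in> proj_points S"
    unfolding proj_points_def by blast
  with p show "p \<in> admissible U \<times> proj_points S" by simp
qed

lemma center_flow_mem: "x \<in> Q \<Longrightarrow> center_flow u t x r \<in> Q"
  by (intro flow_Q subspace_add[OF subspace_Q] subspace_scale[OF subspace_Q] drive_Q)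

lemma center_flow_nonzero: "(x, r) \<noteq> 0 \<Longrightarrow> (center_flow u t x r, r) \<noteq> 0"
  by (auto simp: zero_prod_def)

lemma proj_flow_point:
  assumes "(x, r) \<noteq> 0"
  shows "proj_flow A B t (u, point u x r) = (shift t u, point (shift t u) (center_flow u t x r) r)"
  by (simp add: proj_flow_def proj_trajectory_to_proj[OF coords_nonzero[OF assms]] lifted_solution_coords)

lemma point_uminus:
  assumes "(x, r) \<noteq> 0"
  shows "point u (- x) (- r) = point u x r"
proof -
  have "(- r *\<^sub>R bsol A B u + - x, - r) = (- 1) *\<^sub>R (r *\<^sub>R bsol A B u + x, r)" by simp
  then show ?thesis by (metis to_proj_scaleR coords_nonzero[OF assms] neg_equal_0_iff_equal zero_neq_one)
qed

text \<open>Jumps are designed in the coordinates (x, r). A jump small relative to |y| + |s| is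
  small on the sphere, uniformly over all scales and all controls that are close to each
  other.\<close>

lemma points_near:
  assumes "e > 0"
  shows "\<exists>\<eta>>0. \<eta> \<le> e \<and> (\<forall>u\<in>admissible U. \<forall>v\<in>admissible U. \<forall>x r y s. (x, r) \<noteq> 0 \<longrightarrow> (y, s) \<noteq> 0 \<longrightarrow> d u v < \<eta> \<longrightarrow>
    norm (x - y) + \<bar>r - s\<bar> \<le> \<eta> * (norm y + \<bar>s\<bar>) \<longrightarrow> dist (point u x r) (point v y s) < e)"
proof -
  obtain K where K: "K > 0" "\<And>u. u \<in> admissible U \<Longrightarrow> norm (bsol A B u) \<le> K"
    using bsol_bounded by blast
  \<comment> \<open>The 2 comes from \<open>dist_to_proj_le\<close> and K + 2 from |y| + |s| \<le>
    (K + 2) |W|. The errors sum to 3 L a, below 4 L a = e.\<close>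
  define L where "L = 2 * (K + 2)"
  have L: "L > 0" using K by (simp add: L_def)
  define a where "a = e / (4 * L)"
  have a: "a > 0" "4 * L * a = e" using assms L by (simp_all add: a_def)
  have e': "2 * a > 0" using a by simp
  obtain \<delta> where \<delta>: "\<delta> > 0" "\<And>u v. u \<in> admissible U \<Longrightarrow> v \<in> admissible U \<Longrightarrow> d u v < \<delta> \<Longrightarrow>
      norm (bsol A B u - bsol A B v) < 2 * a"
    using bsol_uniformly_continuous[OF e'] by blast
  define \<eta> where "\<eta> = min e (min \<delta> (a / (K + 1)))"
  have "dist (point u x r) (point v y s) < e"
    if uv: "u \<in> admissible U" "v \<in> admissible U" "d u v < \<eta>" and nz: "(x, r) \<noteq> 0" "(y, s) \<noteq> 0"
      and le: "norm (x - y) + \<bar>r - s\<bar> \<le> \<eta> * (norm y + \<bar>s\<bar>)" for u v x r y s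
  proof -
    let ?Z = "(r *\<^sub>R bsol A B u + x, r)" and ?W = "(s *\<^sub>R bsol A B v + y, s)" and ?N = "norm y + \<bar>s\<bar>"
    have N: "?N > 0" using nz(2) by (auto simp: zero_prod_def add_pos_nonneg add_nonneg_pos)
    have eq: "r *\<^sub>R bsol A B u + x - (s *\<^sub>R bsol A B v + y) =
        (r - s) *\<^sub>R bsol A B u + s *\<^sub>R (bsol A B u - bsol A B v) + (x - y)"
      by (simp add: algebra_simps)
    have "norm (r *\<^sub>R bsol A B u + x - (s *\<^sub>R bsol A B v + y)) \<le>
        \<bar>r - s\<bar> * norm (bsol A B u) + \<bar>s\<bar> * norm (bsol A B u - bsol A B v) + norm (x - y)"
      unfolding eq by (rule norm_triangle_le, rule add_right_mono, rule norm_triangle_le) simp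
    also have "\<dots> \<le> \<bar>r - s\<bar> * K + \<bar>s\<bar> * (2 * a) + norm (x - y)"
      using K(2)[OF uv(1)] \<delta>(2)[OF uv(1,2)] uv(3) by (intro add_mono mult_left_mono) (auto simp: \<eta>_def)
    finally have "norm (?Z - ?W) \<le> \<bar>r - s\<bar> * K + \<bar>s\<bar> * (2 * a) + norm (x - y) + \<bar>r - s\<bar>"
      using norm_Pair_le[of "r *\<^sub>R bsol A B u + x - (s *\<^sub>R bsol A B v + y)" "r - s"] by simp
    also have "\<dots> \<le> (K + 1) * (norm (x - y) + \<bar>r - s\<bar>) + ?N * (2 * a)"
    proof -
      have "\<bar>s\<bar> * (2 * a) \<le> ?N * (2 * a)" using e' by (intro mult_right_mono) auto
      moreover have "0 \<le> K * norm (x - y)" using K by simp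
      ultimately show ?thesis by (simp add: algebra_simps)
    qed
    also have "\<dots> \<le> (K + 1) * (\<eta> * ?N) + ?N * (2 * a)"
      using le K by (intro add_right_mono mult_left_mono) auto
    also have "\<dots> \<le> (K + 1) * (a / (K + 1) * ?N) + ?N * (2 * a)"
      using K N by (intro add_right_mono mult_left_mono mult_right_mono) (auto simp: \<eta>_def)
    also have "\<dots> = ?N * (3 * a)"
    proof -
      have "(K + 1) * (a / (K + 1) * ?N) = a * ?N" using K by simp
      then show ?thesis by (simp add: algebra_simps)
    qed
    finally have 1: "norm (?Z - ?W) \<le> ?N * (3 * a)" .
    have "norm y \<le> norm (s *\<^sub>R bsol A B v + y) + norm (s *\<^sub>R bsol A B v)"
      using norm_triangle_ineq4[of "s *\<^sub>R bsol A B v + y" "s *\<^sub>R bsol A B v"] by simp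
    also have "norm (s *\<^sub>R bsol A B v) \<le> \<bar>s\<bar> * K"
      using K(2)[OF uv(2)] by (simp add: mult_left_mono)
    finally have "?N \<le> norm (s *\<^sub>R bsol A B v + y) + \<bar>s\<bar> * (K + 1)" by (simp add: algebra_simps)
    also have "\<dots> \<le> norm ?W + norm ?W * (K + 1)"
      using norm_fst_le[of "s *\<^sub>R bsol A B v + y" s] norm_snd_le[of s "s *\<^sub>R bsol A B v + y"] K
      by (intro add_mono mult_right_mono) auto
    finally have 2: "?N \<le> (K + 2) * norm ?W" by (simp add: algebra_simps)
    have W: "norm ?W > 0" using coords_nonzero[OF nz(2)] by simp
    have "dist (point u x r) (point v y s) \<le> 2 * norm (?Z - ?W) / norm ?W"
      by (rule dist_to_proj_le[OF coords_nonzero[OF nz(1)] coords_nonzero[OF nz(2)]])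
    also have "\<dots> \<le> 2 * ((K + 2) * norm ?W * (3 * a)) / norm ?W"
      using order_trans[OF 1 mult_right_mono[OF 2]] a W by (intro divide_right_mono mult_left_mono) auto
    also have "\<dots> = 3 * (L * a)"
      using W by (simp add: L_def)
    finally show ?thesis using a assms by simp
  qed
  moreover have "\<eta> > 0" "\<eta> \<le> e" using assms \<delta> K a by (auto simp: \<eta>_def)
  ultimately show ?thesis by blast
qed

text \<open>A relative jump size \<eta> that serves every scale, every control and every minimal
  time T. Independence of the scale is what permits multiplying r by 1 + \<eta> again and again; the
  definition keeps the long quantifier prefix out of the later lemmas.\<close>

definition step_size :: "real \<Rightarrow> real \<Rightarrow> bool" where
  "step_size e \<eta> \<longleftrightarrow> \<eta> > 0 \<and> (\<forall>u v x y r s t T. u \<in> admissible U \<longrightarrow> v \<in> admissible U \<longrightarrow> x \<in> Q \<longrightarrow> y \<in> Q \<longrightarrow>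
    (x, r) \<noteq> 0 \<longrightarrow> (y, s) \<noteq> 0 \<longrightarrow> t \<ge> T \<longrightarrow> d (shift t u) v < \<eta> \<longrightarrow>
    norm (center_flow u t x r - y) + \<bar>r - s\<bar> \<le> \<eta> * (norm y + \<bar>s\<bar>) \<longrightarrow>
    chain e T (u, point u x r) (v, point v y s))"

lemma step_size_pos: "step_size e \<eta> \<Longrightarrow> \<eta> > 0"
  by (simp add: step_size_def)

lemma chain_step:
  assumes "step_size e \<eta>" "u \<in> admissible U" "v \<in> admissible U" "x \<in> Q" "y \<in> Q" "(x, r) \<noteq> 0" "(y, s) \<noteq> 0"
    "t \<ge> T" "d (shift t u) v < \<eta>" "norm (center_flow u t x r - y) + \<bar>r - s\<bar> \<le> \<eta> * (norm y + \<bar>s\<bar>)"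
  shows "chain e T (u, point u x r) (v, point v y s)"
  using assms unfolding step_size_def by simp

lemma ex_step_size:
  assumes "e > 0"
  shows "\<exists>\<eta>. step_size e \<eta>"
proof -
  obtain \<eta> where \<eta>: "\<eta> > 0" "\<eta> \<le> e" "\<And>u v x y r s. u \<in> admissible U \<Longrightarrow> v \<in> admissible U \<Longrightarrow>
    (x, r) \<noteq> 0 \<Longrightarrow> (y, s) \<noteq> 0 \<Longrightarrow> d u v < \<eta> \<Longrightarrow> norm (x - y) + \<bar>r - s\<bar> \<le> \<eta> * (norm y + \<bar>s\<bar>) \<Longrightarrow>
    dist (point u x r) (point v y s) < e"
    using points_near[OF assms] by blast
  have "chain e T (u, point u x r) (v, point v y s)"
    if "u \<in> admissible U" "v \<in> admissible U" "x \<in> Q" "y \<in> Q" "(x, r) \<noteq> 0" "(y, s) \<noteq> 0" "t \<ge> T"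
      and du: "d (shift t u) v < \<eta>" and le: "norm (center_flow u t x r - y) + \<bar>r - s\<bar> \<le> \<eta> * (norm y + \<bar>s\<bar>)"
    for u v x y r s t T
  proof (rule has_chain_single[where t = t])
    show "(u, point u x r) \<in> admissible U \<times> proj_points S" "(v, point v y s) \<in> admissible U \<times> proj_points S"
      by (rule subsetD[OF center_subset]; use that in \<open>auto simp: center_def\<close>)+
    have "dist (point (shift t u) (center_flow u t x r) r) (point v y s) < e"
      using that by (intro \<eta>(3) admissible_shift center_flow_nonzero) auto
    then show "max_dist d (proj_flow A B t (u, point u x r)) (v, point v y s) < e"
      using du \<eta>(2) by (simp add: proj_flow_point[OF \<open>(x, r) \<noteq> 0\<close>] max_dist_def)
  qed fact
  with \<eta>(1) have "step_size e \<eta>" unfolding step_size_def by blast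
  then show ?thesis ..
qed

abbreviation origin :: "'m linf \<times> ((real^'n) \<times> real) proj" where
  "origin \<equiv> (zero_control, point zero_control 0 1)"

lemma zero_control_mem: "zero_control \<in> admissible U"
  by (rule admissible_zero_control[OF U(3)])

lemma zero_mem_Q: "0 \<in> Q"
  by (rule subspace_0[OF subspace_Q])

lemma dist_self: "u \<in> admissible U \<Longrightarrow> d u u = 0"
  using zero by blast

lemma chain_step_zero_control:
  assumes "step_size e \<eta>" "x \<in> Q" "y \<in> Q" "(x, r) \<noteq> 0" "(y, s) \<noteq> 0" "t \<ge> T"
    "norm (flow A t x - y) + \<bar>r - s\<bar> \<le> \<eta> * (norm y + \<bar>s\<bar>)"
  shows "chain e T (zero_control, point zero_control x r) (zero_control, point zero_control y s)"
  using assms step_size_pos[OF assms(1)]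
  by (intro chain_step[OF assms(1) zero_control_mem zero_control_mem, where t = t])
    (auto simp: dist_self[OF zero_control_mem] linear_0[OF linear_pi(4)])

lemma chain_step_grow:
  assumes "step_size e \<eta>" "x \<in> Q" "r > 0"
  shows "chain e T (zero_control, point zero_control x r) (zero_control, point zero_control (flow A T x) (r * (1 + \<eta>)))"
proof (rule chain_step_zero_control[OF assms(1,2) flow_Q[OF assms(2)], where t = T])
  have pos: "0 < r * (1 + \<eta>)" using assms(3) step_size_pos[OF assms(1)] by simp
  then show "(x, r) \<noteq> 0" "(flow A T x, r * (1 + \<eta>)) \<noteq> 0" using assms(3) by (auto simp: zero_prod_def)
  have "\<bar>r - r * (1 + \<eta>)\<bar> = \<eta> * r"
    using assms(3) step_size_pos[OF assms(1)] by (simp add: abs_mult distrib_left)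
  also have "\<dots> \<le> \<eta> * (norm (flow A T x) + \<bar>r * (1 + \<eta>)\<bar>)"
  proof (rule mult_left_mono)
    have "r \<le> r * (1 + \<eta>)" using assms(3) step_size_pos[OF assms(1)] by simp
    then show "r \<le> norm (flow A T x) + \<bar>r * (1 + \<eta>)\<bar>" using norm_ge_zero[of "flow A T x"] pos by linarith
  qed (use step_size_pos[OF assms(1)] in simp)
  finally show "norm (flow A T x - flow A T x) + \<bar>r - r * (1 + \<eta>)\<bar> \<le> \<eta> * (norm (flow A T x) + \<bar>r * (1 + \<eta>)\<bar>)"
    by simp
qed simp

lemma chain_step_shrink:
  assumes "step_size e \<eta>" "x \<in> Q" "r > 0"
  shows "chain e T (zero_control, point zero_control x (r * (1 + \<eta>))) (zero_control, point zero_control (flow A T x) r)"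
proof (rule chain_step_zero_control[OF assms(1,2) flow_Q[OF assms(2)], where t = T])
  have pos: "0 < r * (1 + \<eta>)" using assms(3) step_size_pos[OF assms(1)] by simp
  then show "(x, r * (1 + \<eta>)) \<noteq> 0" "(flow A T x, r) \<noteq> 0" using assms(3) by (auto simp: zero_prod_def)
  have "\<bar>r * (1 + \<eta>) - r\<bar> = \<eta> * r"
    using assms(3) step_size_pos[OF assms(1)] by (simp add: abs_mult distrib_left)
  also have "\<dots> \<le> \<eta> * (norm (flow A T x) + \<bar>r\<bar>)"
    using step_size_pos[OF assms(1)] assms(3) by (intro mult_left_mono) auto
  finally show "norm (flow A T x - flow A T x) + \<bar>r * (1 + \<eta>) - r\<bar> \<le> \<eta> * (norm (flow A T x) + \<bar>r\<bar>)"
    by simp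
qed simp

lemma flow_Q_dominated:
  assumes "x \<in> Q" "\<eta> > 0" "T > 0" "c > 0"
  shows "\<exists>k\<ge>1. norm (flow A (real k * T) x) \<le> c * (1 + \<eta>) ^ k"
    and "\<exists>k\<ge>1. norm (flow A (- (real k * T)) x) \<le> c * (1 + \<eta>) ^ k"
proof -
  \<comment> \<open>Chosen so that q = e^{\<delta> T} has q^2 = 1 + \<eta>. Of the available factor
    (1 + \<eta>)^k, one q^k covers the growth of the flow and the other outgrows the constant C |x|
    / c.\<close>
  define \<delta> where "\<delta> = ln (1 + \<eta>) / (2 * T)"
  have \<delta>: "\<delta> > 0" using assms by (simp add: \<delta>_def)
  obtain C where C: "C > 0" "\<And>t. norm (flow A t x) \<le> C * exp (\<delta> * \<bar>t\<bar>) * norm x"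
    using L_zero_growth[OF \<delta>, of A] assms(1) Q_le by blast
  define q where "q = exp (\<delta> * T)"
  have q: "q > 1" using \<delta> assms by (simp add: q_def)
  have qq: "q * q = 1 + \<eta>"
  proof -
    have "q * q = exp (2 * (\<delta> * T))" by (simp add: q_def flip: exp_add)
    also have "2 * (\<delta> * T) = ln (1 + \<eta>)" using assms by (simp add: \<delta>_def)
    finally show ?thesis using assms by simp
  qed
  obtain k0 where "C * norm x / c < q ^ k0" using real_arch_pow[OF q] by blast
  \<comment> \<open>The successor secures k \<ge> 1, so that at least one growing or shrinking step
    is made.\<close>
  then have k: "C * norm x / c < q ^ Suc k0"
    using q by (smt (verit) power_strict_increasing_iff lessI)
  have "norm (flow A t x) \<le> c * (1 + \<eta>) ^ Suc k0" if "\<bar>t\<bar> = real (Suc k0) * T" for t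
  proof -
    have "norm (flow A t x) \<le> C * exp (\<delta> * \<bar>t\<bar>) * norm x" by (rule C)
    also have "exp (\<delta> * \<bar>t\<bar>) = q ^ Suc k0"
      unfolding q_def that exp_of_nat_mult[symmetric] by (simp add: mult_ac)
    also have "C * q ^ Suc k0 * norm x = c * ((C * norm x / c) * q ^ Suc k0)"
      using assms by simp
    also have "\<dots> \<le> c * (q ^ Suc k0 * q ^ Suc k0)"
      using k q assms by (intro mult_left_mono mult_right_mono) auto
    also have "q ^ Suc k0 * q ^ Suc k0 = (1 + \<eta>) ^ Suc k0"
      by (metis power_mult_distrib qq)
    finally show ?thesis .
  qed
  from this[of "real (Suc k0) * T"] this[of "- (real (Suc k0) * T)"] assms(3)
  show "\<exists>k\<ge>1. norm (flow A (real k * T) x) \<le> c * (1 + \<eta>) ^ k"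
    "\<exists>k\<ge>1. norm (flow A (- (real k * T)) x) \<le> c * (1 + \<eta>) ^ k"
    by (intro exI[of _ "Suc k0"]; simp)+
qed

lemma point_zero_scale:
  assumes "c \<noteq> 0"
  shows "point u 0 c = point u 0 1"
proof -
  have eq: "(c *\<^sub>R bsol A B u + 0, c) = c *\<^sub>R (1 *\<^sub>R bsol A B u + 0, 1 :: real)" by simp
  have "(1 *\<^sub>R bsol A B u + 0, 1 :: real) \<noteq> 0" by (simp add: zero_prod_def)
  then show ?thesis unfolding eq by (rule to_proj_scaleR[OF assms])
qed

text \<open>After k growing steps x is so small relative to r (1 + \<eta>)^k that it can be jumped
  to 0; the scale of r is then invisible on the projective space.\<close>

lemma chain_to_origin_pos:
  assumes "e > 0" "T > 0" "x \<in> Q" "r > 0"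
  shows "chain e T (zero_control, point zero_control x r) origin"
proof -
  obtain \<eta> where ss: "step_size e \<eta>" using ex_step_size[OF assms(1)] by blast
  note \<eta> = step_size_pos[OF ss] and step1 = chain_step_zero_control[OF ss]
  have rk: "r * (1 + \<eta>) ^ k > 0" for k
    using assms(4) \<eta> by simp
  have step: "chain e T (zero_control, point zero_control x r)
      (zero_control, point zero_control (flow A (real (Suc k) * T) x) (r * (1 + \<eta>) ^ Suc k))" for k
  proof (induction k)
    case 0
    show ?case using chain_step_grow[OF ss assms(3,4)] by simp
  next
    case (Suc k)
    have "flow A T (flow A (real (Suc k) * T) x) = flow A (real (Suc (Suc k)) * T) x"
      using flow_add[of T "real (Suc k) * T" A x] by (simp add: algebra_simps)
    with chain_step_grow[OF ss flow_Q[OF assms(3), of "real (Suc k) * T"] rk[of "Suc k"], of T]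
    have "chain e T (zero_control, point zero_control (flow A (real (Suc k) * T) x) (r * (1 + \<eta>) ^ Suc k))
        (zero_control, point zero_control (flow A (real (Suc (Suc k)) * T) x) (r * (1 + \<eta>) ^ Suc (Suc k)))"
      by (simp only: power_Suc2 mult.assoc)
    from has_chain_trans[OF Suc this] show ?case .
  qed
  \<comment> \<open>The jump to x = 0 takes place after one more flow over time T, so the domination
    is requested for \<open>flow A T x\<close> instead of x.\<close>
  obtain k where k: "k \<ge> 1" "norm (flow A (real k * T) (flow A T x)) \<le> (\<eta> * r) * (1 + \<eta>) ^ k"
    using flow_Q_dominated(1)[OF flow_Q[OF assms(3)] \<eta> assms(2), of "\<eta> * r" T] assms \<eta> by auto
  then obtain j where j: "k = Suc j" by (cases k) auto
  let ?r = "r * (1 + \<eta>) ^ k"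
  have r: "?r > 0" using assms \<eta> by simp
  have "flow A T (flow A (real k * T) x) = flow A (real k * T) (flow A T x)"
    using flow_add[of T "real k * T" A x] flow_add[of "real k * T" T A x] by (simp add: add.commute)
  with k(2) have "chain e T (zero_control, point zero_control (flow A (real k * T) x) ?r)
      (zero_control, point zero_control 0 ?r)"
    using assms \<eta> r by (intro step1[where t = T] flow_Q zero_mem_Q) (auto simp: zero_prod_def mult_ac)
  moreover have "point zero_control 0 ?r = point zero_control 0 1"
    by (rule point_zero_scale) (use r in linarith)
  ultimately show ?thesis
    using has_chain_trans[OF step[of j, folded j]] by simp
qed

text \<open>The reverse journey. The origin is also the point with x = 0 and the large value r (1 +
  \<eta>)^k; from there a jump reaches the backward orbit of x, and k shrinking steps carry it
  forward to x while r returns to its value.\<close>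

lemma chain_from_origin_pos:
  assumes "e > 0" "T > 0" "x \<in> Q" "r > 0"
  shows "chain e T origin (zero_control, point zero_control x r)"
proof -
  obtain \<eta> where ss: "step_size e \<eta>" using ex_step_size[OF assms(1)] by blast
  note \<eta> = step_size_pos[OF ss] and step1 = chain_step_zero_control[OF ss]
  have rk: "r * (1 + \<eta>) ^ k > 0" for k
    using assms(4) \<eta> by simp
  have step: "chain e T (zero_control, point zero_control (flow A (- (real (Suc k) * T)) x) (r * (1 + \<eta>) ^ Suc k))
      (zero_control, point zero_control x r)" for k
  proof (induction k)
    case 0
    show ?case using chain_step_shrink[OF ss flow_Q[OF assms(3), of "- T"] assms(4), of T] by simp
  next
    case (Suc k)
    have "flow A T (flow A (- (real (Suc (Suc k)) * T)) x) = flow A (- (real (Suc k) * T)) x"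
      using flow_add[of T "- (real (Suc (Suc k)) * T)" A x] by (simp add: algebra_simps)
    with chain_step_shrink[OF ss flow_Q[OF assms(3), of "- (real (Suc (Suc k)) * T)"] rk[of "Suc k"], of T]
    have "chain e T (zero_control, point zero_control (flow A (- (real (Suc (Suc k)) * T)) x) (r * (1 + \<eta>) ^ Suc (Suc k)))
        (zero_control, point zero_control (flow A (- (real (Suc k) * T)) x) (r * (1 + \<eta>) ^ Suc k))"
      by (simp only: power_Suc2 mult.assoc)
    from has_chain_trans[OF this Suc] show ?case .
  qed
  obtain k where k: "k \<ge> 1" "norm (flow A (- (real k * T)) x) \<le> (\<eta> * r) * (1 + \<eta>) ^ k"
    using flow_Q_dominated(2)[OF assms(3) \<eta> assms(2), of "\<eta> * r"] assms \<eta> by auto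
  then obtain j where j: "k = Suc j" by (cases k) auto
  let ?r = "r * (1 + \<eta>) ^ k" and ?y = "flow A (- (real k * T)) x"
  have r: "?r > 0" using assms \<eta> by simp
  have "norm ?y \<le> \<eta> * (norm ?y + ?r)"
    using k(2) \<eta> by (simp add: distrib_left mult_ac add_increasing)
  then have "chain e T (zero_control, point zero_control 0 ?r) (zero_control, point zero_control ?y ?r)"
    using assms \<eta> r by (intro step1[where t = T] flow_Q zero_mem_Q) (auto simp: zero_prod_def)
  moreover have "point zero_control 0 ?r = point zero_control 0 1"
    by (rule point_zero_scale) (use r in linarith)
  ultimately show ?thesis
    using has_chain_trans[OF _ step[of j, folded j]] by simp
qed

text \<open>A negative r is reduced to a positive one by the antipodal representative. For r = 0 a
  single jump creates or removes a component \<eta> |x|, or the same with the image of x, which is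
  within the relative tolerance.\<close>

lemma chain_origin_zero_control:
  assumes "e > 0" "T > 0" "x \<in> Q" "(x, r) \<noteq> 0"
  shows "chain e T (zero_control, point zero_control x r) origin"
    and "chain e T origin (zero_control, point zero_control x r)"
proof -
  have pos: "chain e T (zero_control, point zero_control x r) origin \<and> chain e T origin (zero_control, point zero_control x r)"
    if "r > 0" "x \<in> Q" for r x
    using chain_to_origin_pos[OF assms(1,2)] chain_from_origin_pos[OF assms(1,2)] that by blast
  consider "r > 0" | "r < 0" | "r = 0" "x \<noteq> 0" using assms(4) by (force simp: zero_prod_def)
  then have "chain e T (zero_control, point zero_control x r) origin \<and> chain e T origin (zero_control, point zero_control x r)"
  proof cases
    case 1
    then show ?thesis using pos assms(3) by blast
  next
    case 2
    then have "- r > 0" "- x \<in> Q" using subspace_neg[OF subspace_Q assms(3)] by auto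
    from pos[OF this] show ?thesis unfolding point_uminus[OF assms(4)] .
  next
    case 3
    obtain \<eta> where ss: "step_size e \<eta>" using ex_step_size[OF assms(1)] by blast
    note \<eta> = step_size_pos[OF ss] and step1 = chain_step_zero_control[OF ss]
    let ?y = "flow A T x" and ?z = "flow A (- T) x"
    have "chain e T (zero_control, point zero_control x 0) (zero_control, point zero_control ?y (\<eta> * norm ?y))"
      using 3 assms \<eta> by (intro step1[where t = T] flow_Q) (auto simp: zero_prod_def abs_mult distrib_left)
    then have 1: "chain e T (zero_control, point zero_control x 0) origin"
      by (rule has_chain_trans) (use pos[OF _ flow_Q[OF assms(3)]] 3 \<eta> in auto)
    have "chain e T (zero_control, point zero_control ?z (\<eta> * norm x)) (zero_control, point zero_control x 0)"
      using 3 assms \<eta> flow_Q[OF assms(3), of "- T"] by (intro step1[where t = T]) (auto simp: zero_prod_def abs_mult)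
    then have 2: "chain e T origin (zero_control, point zero_control x 0)"
      by (rule has_chain_trans[rotated]) (use pos[OF _ flow_Q[OF assms(3)], of "\<eta> * norm x" "- T"] 3 \<eta> in auto)
    from 1 2 3 show ?thesis by simp
  qed
  then show "chain e T (zero_control, point zero_control x r) origin"
    and "chain e T origin (zero_control, point zero_control x r)" by blast+
qed

lemma chain_to_origin:
  assumes "e > 0" "T > 0" "u \<in> admissible U" "x \<in> Q" "(x, r) \<noteq> 0"
  shows "chain e T (u, point u x r) origin"
proof -
  obtain \<eta> where step: "step_size e \<eta>" using ex_step_size[OF assms(1)] by blast
  note \<eta> = step_size_pos[OF step]
  obtain R where R: "R > 0" "\<And>u v. u \<in> admissible U \<Longrightarrow> v \<in> admissible U \<Longrightarrow>
      (AE s in lborel. \<bar>s\<bar> \<le> R \<longrightarrow> rep_linf u s = rep_linf v s) \<Longrightarrow> d u v < \<eta>"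
    using near_if_eq_on_interval[OF \<eta>] by blast
  \<comment> \<open>Cutting the control off after R is a small jump, as nothing changes on the
    window. After a further time of at least 2 R the cut has moved to -R or earlier, and the window
    shows only the zero control.\<close>
  let ?v = "join_at R (shift T u) zero_control" and ?t = "max T (2 * R)"
  have v: "?v \<in> admissible U"
    by (intro admissible_join_at admissible_shift assms zero_control_mem)
  have "d (shift T u) ?v < \<eta>"
  proof (intro R(2) v admissible_shift assms)
    have "AE s in lborel. s \<noteq> R" by (rule AE_lborel_singleton)
    then show "AE s in lborel. \<bar>s\<bar> \<le> R \<longrightarrow> rep_linf (shift T u) s = rep_linf ?v s"
      using rep_linf_join_at[of R "shift T u" zero_control] by eventually_elim auto
  qed
  then have 1: "chain e T (u, point u x r) (?v, point ?v (center_flow u T x r) r)"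
    using assms v \<eta> by (intro chain_step[OF step, where t = T] center_flow_mem center_flow_nonzero) auto
  have "d (shift ?t ?v) zero_control < \<eta>"
  proof (intro R(2) v admissible_shift zero_control_mem)
    show "AE s in lborel. \<bar>s\<bar> \<le> R \<longrightarrow> rep_linf (shift ?t ?v) s = rep_linf zero_control s"
      using rep_linf_shift[of ?t ?v] AE_lborel_shift[OF rep_linf_join_at[of R "shift T u" zero_control], of ?t]
        AE_lborel_shift[OF rep_linf_zero_control[where 'm = 'm], of ?t] rep_linf_zero_control[where 'm = 'm]
      by eventually_elim auto
  qed
  then have 2: "chain e T (?v, point ?v (center_flow u T x r) r)
      (zero_control, point zero_control (center_flow ?v ?t (center_flow u T x r) r) r)"
    using assms v \<eta> by (intro chain_step[OF step, where t = ?t] center_flow_mem center_flow_nonzero zero_control_mem) auto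
  have 3: "chain e T (zero_control, point zero_control (center_flow ?v ?t (center_flow u T x r) r) r) origin"
    using assms by (intro chain_origin_zero_control center_flow_mem center_flow_nonzero) auto
  from has_chain_trans[OF has_chain_trans[OF 1 2] 3] show ?thesis .
qed

lemma chain_from_origin:
  assumes "e > 0" "T > 0" "u \<in> admissible U" "x \<in> Q" "(x, r) \<noteq> 0"
  shows "chain e T origin (u, point u x r)"
proof -
  obtain \<eta> where step: "step_size e \<eta>" using ex_step_size[OF assms(1)] by blast
  note \<eta> = step_size_pos[OF step]
  obtain R where R: "R > 0" "\<And>u v. u \<in> admissible U \<Longrightarrow> v \<in> admissible U \<Longrightarrow>
      (AE s in lborel. \<bar>s\<bar> \<le> R \<longrightarrow> rep_linf u s = rep_linf v s) \<Longrightarrow> d u v < \<eta>"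
    using near_if_eq_on_interval[OF \<eta>] by blast
  \<comment> \<open>Mirror image of the switch to zero: \<open>?a\<close> vanishes before ?t - R
    \<ge> R, hence on the window, while its shift by \<open>?t\<close> agrees with u on the
    window.\<close>
  let ?t = "max T (2 * R)"
  let ?v = "join_at (- R) zero_control u"
  let ?a = "shift (- ?t) ?v"
  \<comment> \<open>The starting point that the flow with control \<open>?a\<close> carries exactly
    to x at time \<open>?t\<close>.\<close>
  let ?y = "flow A (- ?t) x - r *\<^sub>R pi_zero A (drive A (forcing B ?a) ?t)"
  have v: "?v \<in> admissible U" "?a \<in> admissible U"
    by (intro admissible_join_at admissible_shift assms zero_control_mem)+
  have y: "?y \<in> Q"
    using flow_Q[OF assms(4)] by (intro subspace_diff[OF subspace_Q] subspace_scale[OF subspace_Q] drive_Q)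
  have nz: "(?y, r) \<noteq> 0" using assms(5) by (auto simp: zero_prod_def)
  have flow_y: "center_flow ?a ?t ?y r = x" by simp
  have "d (shift ?t ?a) u < \<eta>"
  proof (intro R(2) v admissible_shift assms)
    have "AE s in lborel. s \<noteq> - R" by (rule AE_lborel_singleton)
    moreover have "shift ?t ?a = ?v" by (simp add: shift_shift)
    ultimately show "AE s in lborel. \<bar>s\<bar> \<le> R \<longrightarrow> rep_linf (shift ?t ?a) s = rep_linf u s"
      using rep_linf_join_at[of "- R" zero_control u] by simp (rule AE_mp, assumption, rule AE_mp, assumption, auto)
  qed
  then have 3: "chain e T (?a, point ?a ?y r) (u, point u x r)"
    using assms v y nz \<eta> flow_y by (intro chain_step[OF step, where t = ?t]) auto
  have "d (shift T zero_control) ?a < \<eta>"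
    unfolding shift_zero_control
  proof (intro R(2) v zero_control_mem)
    have "AE s in lborel. s \<noteq> R" by (rule AE_lborel_singleton)
    then show "AE s in lborel. \<bar>s\<bar> \<le> R \<longrightarrow> rep_linf zero_control s = rep_linf ?a s"
      using rep_linf_shift[of "- ?t" ?v] AE_lborel_shift[OF rep_linf_join_at[of "- R" zero_control u], of "- ?t"]
        AE_lborel_shift[OF rep_linf_zero_control[where 'm = 'm], of "- ?t"] rep_linf_zero_control[where 'm = 'm]
      by eventually_elim auto
  qed
  moreover have z: "flow A (- T) ?y \<in> Q" "(flow A (- T) ?y, r) \<noteq> 0"
    using nz flow_Q[OF y, of "- T"] by (auto simp: zero_prod_def)
  ultimately have 2: "chain e T (zero_control, point zero_control (flow A (- T) ?y) r) (?a, point ?a ?y r)"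
    using assms v y nz \<eta> zero_control_mem
    by (intro chain_step[OF step, where t = T]) (auto simp: linear_0[OF linear_pi(4)])
  have 1: "chain e T origin (zero_control, point zero_control (flow A (- T) ?y) r)"
    using assms z by (intro chain_origin_zero_control) auto
  from has_chain_trans[OF has_chain_trans[OF 1 2] 3] show ?thesis .
qed

lemma origin_mem_center: "origin \<in> center"
  unfolding center_def using zero_control_mem zero_mem_Q
  by (intro CollectI exI[of _ zero_control] exI[of _ 0] exI[of _ 1]) (auto simp: zero_prod_def)

lemma chain_transitive_center: "chain_transitive (admissible U \<times> proj_points S) (max_dist d) (proj_flow A B) center"
  unfolding chain_transitive_def
proof (intro conjI ballI allI impI center_subset)
  show "center \<noteq> {}" using origin_mem_center by blast
  fix p q and e T :: real
  assume "p \<in> center" "q \<in> center" "e > 0" "T > 0"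
  then show "chain e T p q"
    unfolding center_def using chain_to_origin chain_from_origin by (blast intro: has_chain_trans)
qed

end

section \<open>Chains cannot leave the central bundle and return\<close>

text \<open>The coordinate w of (r e(u, 0) + w, r) in the fiber over u; it vanishes on the graph of
  r \<mapsto> r e(u, 0).\<close>

definition offset :: "real^'n^'n \<Rightarrow> real^'m^'n \<Rightarrow> 'm::finite linf \<Rightarrow> (real^'n) \<times> real \<Rightarrow> real^'n" where
  "offset A B u z = fst z - snd z *\<^sub>R bsol A B u"

definition unstable_part :: "real^'n^'n \<Rightarrow> real^'m^'n \<Rightarrow> 'm::finite linf \<Rightarrow> (real^'n) \<times> real \<Rightarrow> real" where
  "unstable_part A B u z = norm (pi_plus A (offset A B u z))"

definition stable_part :: "real^'n^'n \<Rightarrow> real^'m^'n \<Rightarrow> 'm::finite linf \<Rightarrow> (real^'n) \<times> real \<Rightarrow> real" where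
  "stable_part A B u z = norm (pi_minus A (offset A B u z))"

text \<open>The lifted flow keeps r constant, so it is counted with the neutral directions. This
  also bounds the center part from below by |r|, which no dominating hyperbolic part at a fixed
  point with r \<noteq> 0 can outweigh arbitrarily.\<close>

definition center_part :: "real^'n^'n \<Rightarrow> real^'m^'n \<Rightarrow> 'm::finite linf \<Rightarrow> (real^'n) \<times> real \<Rightarrow> real" where
  "center_part A B u z = norm (pi_zero A (offset A B u z)) + \<bar>snd z\<bar>"

lemmas part_defs = unstable_part_def stable_part_def center_part_def

lemma snd_lifted_solution [simp]: "snd (lifted_solution A B t z u) = snd z"
  by (simp add: lifted_solution_def)

lemma offset_lifted_solution:
  "offset A B (shift t u) (lifted_solution A B t z u) =
    flow A t (offset A B u z + snd z *\<^sub>R pi_zero A (drive A (forcing B u) t))"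
  using lifted_solution_coords[of A B t "snd z" u "offset A B u z"] by (simp add: offset_def)

lemma pi_of_pi_zero:
  "pi_plus A (pi_zero A x) = 0" "pi_minus A (pi_zero A x) = 0" "pi_zero A (pi_zero A x) = pi_zero A x"
  using pi_on_L_zero[OF pi_mem(3)] by blast+

lemma pi_offset_lifted_solution:
  "pi_plus A (offset A B (shift t u) (lifted_solution A B t z u)) = flow A t (pi_plus A (offset A B u z))"
  "pi_minus A (offset A B (shift t u) (lifted_solution A B t z u)) = flow A t (pi_minus A (offset A B u z))"
  "pi_zero A (offset A B (shift t u) (lifted_solution A B t z u)) =
    flow A t (pi_zero A (offset A B u z)) + snd z *\<^sub>R flow A t (pi_zero A (drive A (forcing B u) t))"
  unfolding offset_lifted_solution pi_flow
  by (simp_all add: linear_add[OF linear_pi(1)] linear_add[OF linear_pi(2)] linear_add[OF linear_pi(4)]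
      linear_scale[OF linear_pi(1)] linear_scale[OF linear_pi(2)] linear_scale[OF linear_pi(4)] pi_of_pi_zero
      matrix_vector_right_distrib matrix_vector_mult_scaleR)

lemma to_proj_offset: "to_proj (snd (rep_proj p) *\<^sub>R bsol A B u + offset A B u (rep_proj p), snd (rep_proj p)) = p"
proof -
  have "(snd (rep_proj p) *\<^sub>R bsol A B u + offset A B u (rep_proj p), snd (rep_proj p)) = rep_proj p"
    by (rule prod_eqI) (simp_all add: offset_def)
  then show ?thesis by (simp only: to_proj_rep_proj)
qed

lemma offset_rep_proj_nonzero: "(offset A B u (rep_proj p), snd (rep_proj p)) \<noteq> 0"
proof
  assume "(offset A B u (rep_proj p), snd (rep_proj p)) = 0"
  then have "offset A B u (rep_proj p) = 0" "snd (rep_proj p) = 0" by (simp_all only: zero_prod_def prod.inject)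
  moreover from this have "fst (rep_proj p) = 0" by (simp add: offset_def)
  ultimately show False using rep_proj_nonzero[of p] by (simp add: prod_eq_iff)
qed

context admissible_controls
begin

lemma norm_fst_diff_le: "norm (fst z - fst y) \<le> norm (z - y)"
  by (metis fst_diff norm_fst_le prod.collapse)

lemma norm_snd_diff_le: "norm (snd z - snd y) \<le> norm (z - y)"
  by (metis snd_diff norm_snd_le prod.collapse)

text \<open>Hyperbolic rates are stated as 2 \<alpha> and central ones as \<alpha>, leaving a gap
  e^{\<alpha> t} for the comparison. The center is estimated in both time directions because the
  stable argument runs backward.\<close>

lemma part_growth:
  fixes A :: "real^'n^'n" and B :: "real^'m^'n"
  shows "\<exists>\<alpha>>0. \<exists>K\<ge>1. \<forall>u\<in>admissible U. \<forall>z t. t \<ge> 0 \<longrightarrow>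
    unstable_part A B u z * exp (2 * \<alpha> * t) \<le> K * unstable_part A B (shift t u) (lifted_solution A B t z u) \<and>
    stable_part A B (shift t u) (lifted_solution A B t z u) * exp (2 * \<alpha> * t) \<le> K * stable_part A B u z \<and>
    center_part A B (shift t u) (lifted_solution A B t z u) \<le> K * exp (\<alpha> * t) * center_part A B u z \<and>
    center_part A B u z \<le> K * exp (\<alpha> * t) * center_part A B (shift t u) (lifted_solution A B t z u)"
proof -
  obtain a C where a: "a > 0" "C > 0" "\<And>x t. x \<in> L_plus A \<Longrightarrow> t \<ge> 0 \<Longrightarrow> norm (flow A (- t) x) \<le> C * exp (- a * t) * norm x"
    using L_plus_decay[of A] by blast
  obtain b D where b: "b > 0" "D > 0" "\<And>x t. x \<in> L_minus A \<Longrightarrow> t \<ge> 0 \<Longrightarrow> norm (flow A t x) \<le> D * exp (- b * t) * norm x"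
    using L_minus_decay[of A] by blast
  define \<alpha> where "\<alpha> = min a b / 2"
  have \<alpha>: "\<alpha> > 0" "2 * \<alpha> \<le> a" "2 * \<alpha> \<le> b" using a b by (auto simp: \<alpha>_def)
  \<comment> \<open>Half of \<alpha>, because the backward estimate transports the forcing term back
    and multiplies two factors e^{\<delta> t}.\<close>
  define \<delta> where "\<delta> = \<alpha> / 2"
  have \<delta>: "\<delta> > 0" "\<delta> \<le> \<alpha>" "2 * \<delta> = \<alpha>" using \<alpha> by (auto simp: \<delta>_def)
  obtain E where E: "E > 0" "\<And>x t. x \<in> L_zero A \<Longrightarrow> norm (flow A t x) \<le> E * exp (\<delta> * \<bar>t\<bar>) * norm x"
    using L_zero_growth[OF \<delta>(1), of A] by blast
  obtain c where c: "c > 0" "\<And>u. u \<in> admissible U \<Longrightarrow> AE s in lborel. norm (rep_linf u s) \<le> c"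
    using U_bound by blast
  obtain F where F: "F > 0" "\<And>u t. t \<ge> 0 \<Longrightarrow> (AE s in lborel. norm (rep_linf (u :: 'm linf) s) \<le> c) \<Longrightarrow>
      norm (flow A t (pi_zero A (drive A (forcing B u) t))) \<le> F * exp (\<delta> * t)"
    using center_forcing_growth[OF \<delta>(1), of c A B] by blast
  define K where "K = 1 + C + D + E + F + E * F"
  have K: "K \<ge> 1" "C \<le> K" "D \<le> K" "E + F + 1 \<le> K" "E + E * F + 1 \<le> K"
    using a b E F by (auto simp: K_def add_nonneg_nonneg)
  have "unstable_part A B u z * exp (2 * \<alpha> * t) \<le> K * unstable_part A B (shift t u) (lifted_solution A B t z u) \<and>
    stable_part A B (shift t u) (lifted_solution A B t z u) * exp (2 * \<alpha> * t) \<le> K * stable_part A B u z \<and>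
    center_part A B (shift t u) (lifted_solution A B t z u) \<le> K * exp (\<alpha> * t) * center_part A B u z \<and>
    center_part A B u z \<le> K * exp (\<alpha> * t) * center_part A B (shift t u) (lifted_solution A B t z u)"
    if u: "u \<in> admissible U" and t: "t \<ge> 0" for u z t
  proof (intro conjI)
    let ?w = "offset A B u z" and ?w' = "offset A B (shift t u) (lifted_solution A B t z u)"
    let ?f = "flow A t (pi_zero A (drive A (forcing B u) t))"
    have f: "norm ?f \<le> F * exp (\<delta> * t)" by (rule F(2)[OF t c(2)[OF u]])
    have exp_le: "exp (\<delta> * t) \<le> exp (\<alpha> * t)" "1 \<le> exp (\<alpha> * t)"
      using \<alpha> \<delta> t by (auto intro: mult_right_mono)
    have "norm (pi_plus A ?w) = norm (flow A (- t) (pi_plus A ?w'))"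
      by (simp add: pi_offset_lifted_solution)
    also have "\<dots> \<le> C * exp (- a * t) * norm (pi_plus A ?w')" by (rule a(3)[OF pi_mem(1) t])
    finally have "norm (pi_plus A ?w) * exp (2 * \<alpha> * t) \<le> C * exp (- a * t) * norm (pi_plus A ?w') * exp (2 * \<alpha> * t)"
      by (rule mult_right_mono) simp
    also have "\<dots> = C * norm (pi_plus A ?w') * exp (2 * \<alpha> * t - a * t)"
      by (simp add: exp_diff exp_minus divide_inverse mult_ac)
    also have "\<dots> \<le> C * norm (pi_plus A ?w') * 1"
      using a \<alpha> t by (intro mult_left_mono) (auto simp: mult_right_mono)
    also have "\<dots> \<le> K * norm (pi_plus A ?w')" using K by (simp add: mult_right_mono)
    finally show "unstable_part A B u z * exp (2 * \<alpha> * t) \<le> K * unstable_part A B (shift t u) (lifted_solution A B t z u)"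
      by (simp add: unstable_part_def)
    have "norm (pi_minus A ?w') \<le> D * exp (- b * t) * norm (pi_minus A ?w)"
      unfolding pi_offset_lifted_solution by (rule b(3)[OF pi_mem(2) t])
    then have "norm (pi_minus A ?w') * exp (2 * \<alpha> * t) \<le> D * exp (- b * t) * norm (pi_minus A ?w) * exp (2 * \<alpha> * t)"
      by (rule mult_right_mono) simp
    also have "\<dots> = D * norm (pi_minus A ?w) * exp (2 * \<alpha> * t - b * t)"
      by (simp add: exp_diff exp_minus divide_inverse mult_ac)
    also have "\<dots> \<le> D * norm (pi_minus A ?w) * 1"
      using b \<alpha> t by (intro mult_left_mono) (auto simp: mult_right_mono)
    also have "\<dots> \<le> K * norm (pi_minus A ?w)" using K by (simp add: mult_right_mono)
    finally show "stable_part A B (shift t u) (lifted_solution A B t z u) * exp (2 * \<alpha> * t) \<le> K * stable_part A B u z"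
      by (simp add: stable_part_def)
    let ?c = "norm (pi_zero A ?w)" and ?c' = "norm (pi_zero A ?w')" and ?r = "\<bar>snd z\<bar>"
    have "?c' \<le> norm (flow A t (pi_zero A ?w)) + norm (snd z *\<^sub>R ?f)"
      unfolding pi_offset_lifted_solution by (rule norm_triangle_ineq)
    also have "\<dots> \<le> E * exp (\<delta> * t) * ?c + ?r * (F * exp (\<delta> * t))"
    proof (intro add_mono)
      show "norm (flow A t (pi_zero A ?w)) \<le> E * exp (\<delta> * t) * ?c"
        using E(2)[OF pi_mem(3)[of A ?w], of t] t by simp
      show "norm (snd z *\<^sub>R ?f) \<le> ?r * (F * exp (\<delta> * t))"
        unfolding norm_scaleR by (rule mult_left_mono[OF f]) simp
    qed
    also have "\<dots> \<le> E * exp (\<alpha> * t) * ?c + ?r * (F * exp (\<alpha> * t))"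
      using exp_le E F by (intro add_mono mult_left_mono mult_right_mono) auto
    finally have "?c' + ?r \<le> E * exp (\<alpha> * t) * ?c + ?r * (F * exp (\<alpha> * t)) + ?r * exp (\<alpha> * t)"
      using mult_left_mono[OF exp_le(2), of ?r] by simp
    also have "\<dots> \<le> (E + F + 1) * exp (\<alpha> * t) * (?c + ?r)"
    proof -
      have "0 \<le> F * exp (\<alpha> * t) * ?c" "0 \<le> exp (\<alpha> * t) * ?c" "0 \<le> E * exp (\<alpha> * t) * ?r" using E F by auto
      then show ?thesis by (simp add: algebra_simps)
    qed
    also have "\<dots> \<le> K * exp (\<alpha> * t) * (?c + ?r)"
      using K by (intro mult_right_mono) auto
    finally show "center_part A B (shift t u) (lifted_solution A B t z u) \<le> K * exp (\<alpha> * t) * center_part A B u z"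
      by (simp add: center_part_def)
    have "flow A t (pi_zero A ?w) = pi_zero A ?w' - snd z *\<^sub>R ?f"
      by (simp add: pi_offset_lifted_solution)
    then have "pi_zero A ?w = flow A (- t) (pi_zero A ?w') - snd z *\<^sub>R flow A (- t) ?f"
    proof -
      assume "flow A t (pi_zero A ?w) = pi_zero A ?w' - snd z *\<^sub>R ?f"
      from arg_cong[OF this, of "\<lambda>v. flow A (- t) v"] show ?thesis
        by (simp add: matrix_vector_mult_diff_distrib matrix_vector_mult_scaleR)
    qed
    then have "?c \<le> norm (flow A (- t) (pi_zero A ?w')) + norm (snd z *\<^sub>R flow A (- t) ?f)"
      by (simp only: norm_triangle_ineq4)
    also have "\<dots> \<le> E * exp (\<delta> * t) * ?c' + ?r * (E * exp (\<delta> * t) * (F * exp (\<delta> * t)))"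
    proof (intro add_mono)
      show "norm (flow A (- t) (pi_zero A ?w')) \<le> E * exp (\<delta> * t) * ?c'"
        using E(2)[OF pi_mem(3)[of A ?w'], of "- t"] t by simp
      have "norm (flow A (- t) ?f) \<le> E * exp (\<delta> * t) * norm ?f"
      proof -
        have "?f \<in> L_zero A" by (intro flow_mem_L pi_mem)
        from E(2)[OF this, of "- t"] t show ?thesis by simp
      qed
      also have "\<dots> \<le> E * exp (\<delta> * t) * (F * exp (\<delta> * t))"
        using f E by (intro mult_left_mono) auto
      finally show "norm (snd z *\<^sub>R flow A (- t) ?f) \<le> ?r * (E * exp (\<delta> * t) * (F * exp (\<delta> * t)))"
        unfolding norm_scaleR by (rule mult_left_mono) simp
    qed
    also have "E * exp (\<delta> * t) * (F * exp (\<delta> * t)) = E * F * exp (\<alpha> * t)"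
    proof -
      have "exp (\<delta> * t) * exp (\<delta> * t) = exp (\<alpha> * t)"
        unfolding exp_add[symmetric] \<delta>(3)[symmetric] by (simp add: algebra_simps)
      then show ?thesis by (metis mult.assoc mult.left_commute)
    qed
    also have "E * exp (\<delta> * t) * ?c' \<le> E * exp (\<alpha> * t) * ?c'"
      using exp_le E by (intro mult_left_mono mult_right_mono) auto
    finally have "?c + ?r \<le> E * exp (\<alpha> * t) * ?c' + ?r * (E * F * exp (\<alpha> * t)) + ?r * exp (\<alpha> * t)"
      using mult_left_mono[OF exp_le(2), of ?r] by simp
    also have "\<dots> \<le> (E + E * F + 1) * exp (\<alpha> * t) * (?c' + ?r)"
    proof -
      have "0 \<le> E * F * exp (\<alpha> * t) * ?c'" "0 \<le> exp (\<alpha> * t) * ?c'" "0 \<le> E * exp (\<alpha> * t) * ?r" using E F by auto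
      then show ?thesis by (simp add: algebra_simps)
    qed
    also have "\<dots> \<le> K * exp (\<alpha> * t) * (?c' + ?r)"
      using K by (intro mult_right_mono) auto
    finally show "center_part A B u z \<le> K * exp (\<alpha> * t) * center_part A B (shift t u) (lifted_solution A B t z u)"
      by (simp add: center_part_def)
  qed
  then show ?thesis using \<alpha>(1) K(1) by blast
qed

section \<open>Homogeneous functions under projective jumps\<close>

lemma offset_scaleR: "offset A B u (c *\<^sub>R z) = c *\<^sub>R offset A B u z"
  by (simp add: offset_def scaleR_diff_right)

lemma part_scaleR:
  "unstable_part A B u (c *\<^sub>R z) = \<bar>c\<bar> * unstable_part A B u z"
  "stable_part A B u (c *\<^sub>R z) = \<bar>c\<bar> * stable_part A B u z"
  "center_part A B u (c *\<^sub>R z) = \<bar>c\<bar> * center_part A B u z"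
  unfolding part_defs offset_scaleR
  by (simp_all add: linear_scale[OF linear_pi(1)] linear_scale[OF linear_pi(2)] linear_scale[OF linear_pi(4)]
      abs_mult distrib_left)

lemma part_nonneg: "0 \<le> unstable_part A B u z" "0 \<le> stable_part A B u z" "0 \<le> center_part A B u z"
  by (simp_all add: part_defs)

text \<open>A projective point has no norm, so a condition on it must compare two functions of the
  same degree. Continuity is required uniformly on the unit sphere, jointly in the control, since a
  jump changes both.\<close>

definition uniform_gauge :: "('m linf \<Rightarrow> (real^'n) \<times> real \<Rightarrow> real) \<Rightarrow> bool" where
  "uniform_gauge f \<longleftrightarrow> (\<forall>u z. 0 \<le> f u z) \<and> (\<forall>u c z. f u (c *\<^sub>R z) = \<bar>c\<bar> * f u z) \<and>
    (\<forall>e>0. \<exists>\<delta>>0. \<forall>u\<in>admissible U. \<forall>v\<in>admissible U. \<forall>z y. norm z = 1 \<longrightarrow> norm y = 1 \<longrightarrow>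
      d u v < \<delta> \<longrightarrow> norm (z - y) < \<delta> \<longrightarrow> \<bar>f u z - f v y\<bar> < e)"

lemma uniform_gaugeI:
  fixes A :: "real^'n^'n" and B :: "real^'m^'n"
  assumes "\<And>u z. 0 \<le> f u z" "\<And>u c z. f u (c *\<^sub>R z) = \<bar>c\<bar> * f u z"
    and "L > 0" "\<And>u v z y. \<bar>f u z - f v y\<bar> \<le> L * (norm (offset A B u z - offset A B v y) + norm (z - y))"
  shows "uniform_gauge f"
  unfolding uniform_gauge_def
proof (intro conjI allI impI)
  fix e :: real assume "e > 0"
  obtain K where K: "K > 0" "\<And>u. u \<in> admissible U \<Longrightarrow> norm (bsol A B u) \<le> K"
    using bsol_bounded[of A B] by blast
  \<comment> \<open>The errors below sum to (K + 3) h; the K + 4 makes the final inequality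
    strict.\<close>
  define h where "h = e / (L * (K + 4))"
  have h: "h > 0" "L * ((K + 4) * h) = e" using \<open>e > 0\<close> \<open>L > 0\<close> K(1) by (auto simp: h_def)
  obtain \<delta> where \<delta>: "\<delta> > 0" "\<And>u v. u \<in> admissible U \<Longrightarrow> v \<in> admissible U \<Longrightarrow> d u v < \<delta> \<Longrightarrow>
      norm (bsol A B u - bsol A B v) < h"
    using bsol_uniformly_continuous[OF h(1)] by blast
  have "\<bar>f u z - f v y\<bar> < e" if uv: "u \<in> admissible U" "v \<in> admissible U" "d u v < min \<delta> h"
    and n: "norm z = 1" "norm y = 1" "norm (z - y) < min \<delta> h" for u v z y
  proof -
    have "offset A B u z - offset A B v y =
        (fst z - fst y) - (snd z - snd y) *\<^sub>R bsol A B u - snd y *\<^sub>R (bsol A B u - bsol A B v)"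
      by (simp add: offset_def algebra_simps)
    also have "norm \<dots> \<le> norm (fst z - fst y) + \<bar>snd z - snd y\<bar> * norm (bsol A B u) + \<bar>snd y\<bar> * norm (bsol A B u - bsol A B v)"
      by (rule order_trans[OF norm_triangle_ineq4], rule add_mono, rule order_trans[OF norm_triangle_ineq4]) simp_all
    also have "\<dots> \<le> h + h * K + 1 * h"
    proof (intro add_mono mult_mono)
      show "norm (fst z - fst y) \<le> h" using norm_fst_diff_le[of z y] n by simp
      show "\<bar>snd z - snd y\<bar> \<le> h" using norm_snd_diff_le[of z y] n by simp
      show "\<bar>snd y\<bar> \<le> 1" using norm_snd_le[of "snd y" "fst y"] n by simp
      show "norm (bsol A B u - bsol A B v) \<le> h" using \<delta>(2)[OF uv(1,2)] uv(3) by simp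
    qed (use K(2)[OF uv(1)] h in auto)
    finally have "norm (offset A B u z - offset A B v y) + norm (z - y) \<le> (K + 3) * h"
      using n by (simp add: algebra_simps)
    then have "\<bar>f u z - f v y\<bar> \<le> L * ((K + 3) * h)"
      using order_trans[OF assms(4)[of u z v y] mult_left_mono] \<open>L > 0\<close> by simp
    also have "\<dots> < L * ((K + 4) * h)" using h \<open>L > 0\<close> by (intro mult_strict_left_mono mult_strict_right_mono) auto
    finally show ?thesis using h by simp
  qed
  then show "\<exists>\<delta>>0. \<forall>u\<in>admissible U. \<forall>v\<in>admissible U. \<forall>z y. norm z = 1 \<longrightarrow> norm y = 1 \<longrightarrow>
      d u v < \<delta> \<longrightarrow> norm (z - y) < \<delta> \<longrightarrow> \<bar>f u z - f v y\<bar> < e"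
    using \<delta>(1) h(1) by (intro exI[of _ "min \<delta> h"]) auto
qed (use assms in auto)

lemma uniform_gauge_parts:
  fixes A :: "real^'n^'n" and B :: "real^'m^'n"
  shows "uniform_gauge (unstable_part A B)" "uniform_gauge (stable_part A B)" "uniform_gauge (center_part A B)"
proof -
  obtain P where P: "P > 0" "\<And>v. norm (pi_plus A v) \<le> P * norm v"
    using norm_linear_le[OF linear_pi(1)] by blast
  obtain M where M: "M > 0" "\<And>v. norm (pi_minus A v) \<le> M * norm v"
    using norm_linear_le[OF linear_pi(2)] by blast
  obtain Z where Z: "Z > 0" "\<And>v. norm (pi_zero A v) \<le> Z * norm v"
    using norm_linear_le[OF linear_pi(4)] by blast
  have tri: "\<bar>norm a - norm b\<bar> \<le> norm (a - b)" for a b :: "real^'n" by (rule norm_triangle_ineq3)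
  show "uniform_gauge (unstable_part A B)"
  proof (rule uniform_gaugeI[OF part_nonneg(1) part_scaleR(1) P(1)])
    show "\<bar>unstable_part A B u z - unstable_part A B v y\<bar> \<le> P * (norm (offset A B u z - offset A B v y) + norm (z - y))" for u v z y
      using order_trans[OF tri[of "pi_plus A (offset A B u z)" "pi_plus A (offset A B v y)"]]
        P(2)[of "offset A B u z - offset A B v y"] P(1)
      by (simp add: unstable_part_def linear_diff[OF linear_pi(1)] distrib_left add_increasing2)
  qed
  show "uniform_gauge (stable_part A B)"
  proof (rule uniform_gaugeI[OF part_nonneg(2) part_scaleR(2) M(1)])
    show "\<bar>stable_part A B u z - stable_part A B v y\<bar> \<le> M * (norm (offset A B u z - offset A B v y) + norm (z - y))" for u v z y
      using order_trans[OF tri[of "pi_minus A (offset A B u z)" "pi_minus A (offset A B v y)"]]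
        M(2)[of "offset A B u z - offset A B v y"] M(1)
      by (simp add: stable_part_def linear_diff[OF linear_pi(2)] distrib_left add_increasing2)
  qed
  show "uniform_gauge (center_part A B)"
  proof (rule uniform_gaugeI[OF part_nonneg(3) part_scaleR(3)])
    show "Z + 1 > 0" using Z by simp
    fix u v z y
    have "\<bar>norm (pi_zero A (offset A B u z)) - norm (pi_zero A (offset A B v y))\<bar> \<le> Z * norm (offset A B u z - offset A B v y)"
      using order_trans[OF tri[of "pi_zero A (offset A B u z)" "pi_zero A (offset A B v y)"]]
        Z(2)[of "offset A B u z - offset A B v y"] by (simp add: linear_diff[OF linear_pi(4)])
    moreover have "\<bar>\<bar>snd z\<bar> - \<bar>snd y\<bar>\<bar> \<le> norm (z - y)"
      using norm_snd_diff_le[of z y] by simp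
    ultimately have "\<bar>center_part A B u z - center_part A B v y\<bar> \<le> Z * norm (offset A B u z - offset A B v y) + norm (z - y)"
      unfolding center_part_def by linarith
    also have "\<dots> \<le> (Z + 1) * (norm (offset A B u z - offset A B v y) + norm (z - y))"
      using Z by (simp add: algebra_simps)
    finally show "\<bar>center_part A B u z - center_part A B v y\<bar> \<le> (Z + 1) * (norm (offset A B u z - offset A B v y) + norm (z - y))" .
  qed
qed

lemma uniform_gauge_add:
  assumes "uniform_gauge f" "uniform_gauge g"
  shows "uniform_gauge (\<lambda>u z. f u z + g u z)"
  unfolding uniform_gauge_def
proof (intro conjI allI impI)
  fix e :: real assume "e > 0"
  then have "e / 2 > 0" by simp
  obtain \<delta>1 where d1: "\<delta>1 > 0" and 1: "\<And>u v z y. u \<in> admissible U \<Longrightarrow> v \<in> admissible U \<Longrightarrow> norm z = 1 \<Longrightarrow> norm y = 1 \<Longrightarrow>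
      d u v < \<delta>1 \<Longrightarrow> norm (z - y) < \<delta>1 \<Longrightarrow> \<bar>f u z - f v y\<bar> < e / 2"
    using assms(1) \<open>e / 2 > 0\<close> unfolding uniform_gauge_def by meson
  obtain \<delta>2 where d2: "\<delta>2 > 0" and 2: "\<And>u v z y. u \<in> admissible U \<Longrightarrow> v \<in> admissible U \<Longrightarrow> norm z = 1 \<Longrightarrow> norm y = 1 \<Longrightarrow>
      d u v < \<delta>2 \<Longrightarrow> norm (z - y) < \<delta>2 \<Longrightarrow> \<bar>g u z - g v y\<bar> < e / 2"
    using assms(2) \<open>e / 2 > 0\<close> unfolding uniform_gauge_def by meson
  have "\<bar>f u z + g u z - (f v y + g v y)\<bar> < e" if "u \<in> admissible U" "v \<in> admissible U" "norm z = 1" "norm y = 1"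
      "d u v < min \<delta>1 \<delta>2" "norm (z - y) < min \<delta>1 \<delta>2" for u v z y
    using 1[of u v z y] 2[of u v z y] that by linarith
  then show "\<exists>\<delta>>0. \<forall>u\<in>admissible U. \<forall>v\<in>admissible U. \<forall>z y. norm z = 1 \<longrightarrow> norm y = 1 \<longrightarrow>
      d u v < \<delta> \<longrightarrow> norm (z - y) < \<delta> \<longrightarrow> \<bar>f u z + g u z - (f v y + g v y)\<bar> < e"
    using d1 d2 by (intro exI[of _ "min \<delta>1 \<delta>2"]) auto
qed (use assms in \<open>auto simp: uniform_gauge_def distrib_left add_nonneg_nonneg\<close>)

text \<open>On the unit sphere f + g \<ge> c0, so \<kappa> g \<le> f forces f \<ge> m with m = c0
  \<kappa> / (1 + \<kappa>). A perturbation by h then at most halves f, and \<kappa> h \<le> m at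
  most doubles the bound on \<kappa> g; together this loses the factor 4.\<close>

lemma ratio_stable_under_jump:
  assumes f: "uniform_gauge f" and g: "uniform_gauge g" and "c0 > 0"
    and total: "\<And>u z. u \<in> admissible U \<Longrightarrow> c0 * norm z \<le> f u z + g u z" and "\<kappa> > 0"
  shows "\<exists>e>0. \<forall>u\<in>admissible U. \<forall>v\<in>admissible U. \<forall>z y. z \<noteq> 0 \<longrightarrow> y \<noteq> 0 \<longrightarrow> d u v < e \<longrightarrow>
    dist (to_proj z) (to_proj y) < e \<longrightarrow> \<kappa> * g u z \<le> f u z \<longrightarrow> \<kappa> / 4 * g v y \<le> f v y"
proof -
  define m where "m = c0 * \<kappa> / (1 + \<kappa>)"
  define h where "h = min (m / 2) (m / \<kappa>)"
  have m: "m > 0" using assms by (simp add: m_def)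
  have h: "h > 0" "h \<le> m / 2" "\<kappa> * h \<le> m" using m \<open>\<kappa> > 0\<close> by (auto simp: h_def min_def field_simps)
  obtain \<delta>1 where d1: "\<delta>1 > 0" "\<And>u v z y. u \<in> admissible U \<Longrightarrow> v \<in> admissible U \<Longrightarrow> norm z = 1 \<Longrightarrow> norm y = 1 \<Longrightarrow>
      d u v < \<delta>1 \<Longrightarrow> norm (z - y) < \<delta>1 \<Longrightarrow> \<bar>f u z - f v y\<bar> < h"
    using f h(1) unfolding uniform_gauge_def by meson
  obtain \<delta>2 where d2: "\<delta>2 > 0" "\<And>u v z y. u \<in> admissible U \<Longrightarrow> v \<in> admissible U \<Longrightarrow> norm z = 1 \<Longrightarrow> norm y = 1 \<Longrightarrow>
      d u v < \<delta>2 \<Longrightarrow> norm (z - y) < \<delta>2 \<Longrightarrow> \<bar>g u z - g v y\<bar> < h"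
    using g h(1) unfolding uniform_gauge_def by meson
  have hom: "f u (c *\<^sub>R z) = \<bar>c\<bar> * f u z" "g u (c *\<^sub>R z) = \<bar>c\<bar> * g u z" for u c z
    using f g unfolding uniform_gauge_def by blast+
  have unit: "\<kappa> / 4 * g v y \<le> f v y" if uv: "u \<in> admissible U" "v \<in> admissible U" "d u v < min \<delta>1 \<delta>2"
    and n: "norm z = 1" "norm y = 1" "norm (z - y) < min \<delta>1 \<delta>2" and le: "\<kappa> * g u z \<le> f u z" for u v z y
  proof -
    have "c0 * \<kappa> \<le> \<kappa> * (f u z + g u z)" using mult_left_mono[OF total[OF uv(1), of z], of \<kappa>] n \<open>\<kappa> > 0\<close> by (simp add: mult_ac)
    also have "\<dots> \<le> (1 + \<kappa>) * f u z" using le by (simp add: algebra_simps)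
    finally have fm: "m \<le> f u z" using \<open>\<kappa> > 0\<close> by (simp add: m_def pos_divide_le_eq mult.commute)
    have "\<bar>f u z - f v y\<bar> < h" "\<bar>g u z - g v y\<bar> < h" using d1 d2 uv n by auto
    then have fv: "f v y \<ge> f u z / 2" and gv: "g v y \<le> g u z + h" using h fm by linarith+
    have "\<kappa> * g v y \<le> \<kappa> * g u z + \<kappa> * h" using gv \<open>\<kappa> > 0\<close> by (simp flip: distrib_left)
    also have "\<dots> \<le> f u z + f u z" using le h fm by linarith
    finally show ?thesis using fv by simp
  qed
  have "\<kappa> / 4 * g v y \<le> f v y" if uv: "u \<in> admissible U" "v \<in> admissible U" "d u v < min \<delta>1 \<delta>2"
    and nz: "z \<noteq> 0" "y \<noteq> 0" and dist: "dist (to_proj z) (to_proj y) < min \<delta>1 \<delta>2" and le: "\<kappa> * g u z \<le> f u z" for u v z y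
  proof -
    have "\<kappa> * g u (sgn z) \<le> f u (sgn z)"
      using le nz by (simp add: sgn_div_norm hom mult_left_mono mult.left_commute)
    \<comment> \<open>Unit representatives are close only up to sign. The gauges are homogeneous in
      absolute value, so the sign does not affect the ratio.\<close>
    moreover obtain \<sigma> :: real where \<sigma>: "\<bar>\<sigma>\<bar> = 1" "norm (sgn z - \<sigma> *\<^sub>R sgn y) < min \<delta>1 \<delta>2"
    proof (cases "norm (sgn z - sgn y) < min \<delta>1 \<delta>2")
      case True
      then show ?thesis by (intro that[of 1]) auto
    next
      case False
      then have "norm (sgn z + sgn y) < min \<delta>1 \<delta>2" using dist nz by (auto simp: dist_to_proj)
      then show ?thesis by (intro that[of "-1"]) auto
    qed
    ultimately have "\<kappa> / 4 * g v (\<sigma> *\<^sub>R sgn y) \<le> f v (\<sigma> *\<^sub>R sgn y)"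
      using uv nz by (intro unit[of u v "sgn z"]) (auto simp: norm_sgn)
    then have "\<kappa> / 4 * (inverse (norm y) * g v y) \<le> inverse (norm y) * f v y"
      using \<sigma>(1) by (simp add: hom sgn_div_norm abs_mult)
    then have "norm y * (\<kappa> / 4 * (inverse (norm y) * g v y)) \<le> norm y * (inverse (norm y) * f v y)"
      by (rule mult_left_mono) simp
    then show ?thesis using nz by (simp add: field_simps)
  qed
  then show ?thesis using d1(1) d2(1) by (intro exI[of _ "min \<delta>1 \<delta>2"]) auto
qed

text \<open>The parts cannot all be small on the unit sphere, uniformly in u; this is the lower
  bound \<open>c0\<close> that the ratio argument needs.\<close>

lemma parts_total:
  fixes A :: "real^'n^'n" and B :: "real^'m^'n"
  shows "\<exists>c>0. \<forall>u\<in>admissible U. \<forall>z. c * norm z \<le> unstable_part A B u z + (center_part A B u z + stable_part A B u z)"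
proof -
  obtain K where K: "K > 0" "\<And>u. u \<in> admissible U \<Longrightarrow> norm (bsol A B u) \<le> K"
    using bsol_bounded[of A B] by blast
  have "norm z \<le> (K + 2) * (unstable_part A B u z + (center_part A B u z + stable_part A B u z))"
    if "u \<in> admissible U" for u z
  proof -
    let ?w = "offset A B u z" and ?r = "\<bar>snd z\<bar>"
    let ?t = "norm (pi_plus A ?w) + norm (pi_zero A ?w) + norm (pi_minus A ?w)"
    have "norm ?w \<le> ?t"
      using norm_triangle_ineq[of "pi_plus A ?w + pi_zero A ?w" "pi_minus A ?w"]
        norm_triangle_ineq[of "pi_plus A ?w" "pi_zero A ?w"] by (simp add: pi_sum)
    moreover have "norm (fst z) \<le> norm ?w + ?r * K"
    proof -
      have "fst z = ?w + snd z *\<^sub>R bsol A B u" by (simp add: offset_def)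
      then have "norm (fst z) \<le> norm ?w + norm (snd z *\<^sub>R bsol A B u)" by (metis norm_triangle_ineq)
      also have "norm (snd z *\<^sub>R bsol A B u) \<le> ?r * K" using K(2)[OF that] by (simp add: mult_left_mono)
      finally show ?thesis by simp
    qed
    moreover have "norm z \<le> norm (fst z) + ?r" using norm_Pair_le[of "fst z" "snd z"] by simp
    moreover have "0 \<le> K * ?t" "0 \<le> ?t" "0 \<le> ?r" using K(1) by auto
    moreover have "n \<le> (K + 2) * (a + b)" if "w \<le> a" "x \<le> w + b * K" "n \<le> x + b" "0 \<le> K * a" "0 \<le> a" "0 \<le> b"
      for n a b w x using that by (simp add: algebra_simps)
    ultimately have "norm z \<le> (K + 2) * (?t + ?r)" by blast
    then show ?thesis by (simp only: part_defs add_ac)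
  qed
  then have "1 / (K + 2) * norm z \<le> unstable_part A B u z + (center_part A B u z + stable_part A B u z)"
    if "u \<in> admissible U" for u z
    using that K(1) by (simp add: pos_divide_le_eq mult.commute)
  then show ?thesis using K(1) by (intro exI[of _ "1 / (K + 2)"]) auto
qed

end

text \<open>P is the weak and Q the strong form of one condition. Each step, its jump included,
  lifts P to Q, so it suffices to start with the weak form, and the end of the chain has the strong
  one because there is at least one step.\<close>

lemma has_chain_forward:
  assumes "has_chain X d \<Psi> \<epsilon> T x y" and "P x"
    and step: "\<And>x y t. x \<in> X \<Longrightarrow> y \<in> X \<Longrightarrow> t \<ge> T \<Longrightarrow> d (\<Psi> t x) y < \<epsilon> \<Longrightarrow> P x \<Longrightarrow> Q y"
    and imp: "\<And>x. x \<in> X \<Longrightarrow> Q x \<Longrightarrow> P x"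
  shows "Q y"
proof -
  obtain k \<tau> \<xi> where k: "k \<ge> 1" "\<xi> 0 = x" "\<xi> k = y" "\<And>i. i \<le> k \<Longrightarrow> \<xi> i \<in> X"
    "\<And>i. i < k \<Longrightarrow> \<tau> i \<ge> T \<and> d (\<Psi> (\<tau> i) (\<xi> i)) (\<xi> (Suc i)) < \<epsilon>"
    using assms(1) unfolding has_chain_def by blast
  have "Q (\<xi> (Suc i))" if "i < k" for i
    using that
  proof (induction i)
    case 0
    then show ?case using step[of "\<xi> 0" "\<xi> (Suc 0)" "\<tau> 0"] k(4)[of 0] k(4)[of "Suc 0"] k(5)[of 0] assms(2) k(2) by simp
  next
    case (Suc i)
    then have "P (\<xi> (Suc i))" using imp k(4)[of "Suc i"] by simp
    then show ?case using step[of "\<xi> (Suc i)" "\<xi> (Suc (Suc i))" "\<tau> (Suc i)"]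
      k(4)[of "Suc i"] k(4)[of "Suc (Suc i)"] k(5)[of "Suc i"] Suc.prems by simp
  qed
  from this[of "k - 1"] k(1,3) show ?thesis by simp
qed

lemma has_chain_backward:
  assumes "has_chain X d \<Psi> \<epsilon> T x y" and "P y"
    and step: "\<And>x y t. x \<in> X \<Longrightarrow> y \<in> X \<Longrightarrow> t \<ge> T \<Longrightarrow> d (\<Psi> t x) y < \<epsilon> \<Longrightarrow> P y \<Longrightarrow> Q x"
    and imp: "\<And>x. x \<in> X \<Longrightarrow> Q x \<Longrightarrow> P x"
  shows "Q x"
proof -
  obtain k \<tau> \<xi> where k: "k \<ge> 1" "\<xi> 0 = x" "\<xi> k = y" "\<And>i. i \<le> k \<Longrightarrow> \<xi> i \<in> X"
    "\<And>i. i < k \<Longrightarrow> \<tau> i \<ge> T \<and> d (\<Psi> (\<tau> i) (\<xi> i)) (\<xi> (Suc i)) < \<epsilon>"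
    using assms(1) unfolding has_chain_def by blast
  have one: "Q (\<xi> i)" if "i < k" "P (\<xi> (Suc i))" for i
    using step[of "\<xi> i" "\<xi> (Suc i)" "\<tau> i"] k(4)[of i] k(4)[of "Suc i"] k(5)[of i] that by simp
  have "Q (\<xi> (k - Suc i))" if "i < k" for i
    using that
  proof (induction i)
    case 0
    have "Suc (k - Suc 0) = k" using 0 by simp
    then show ?case using one[of "k - Suc 0"] assms(2) k(3) 0 by simp
  next
    case (Suc i)
    then have "P (\<xi> (k - Suc i))" using imp k(4)[of "k - Suc i"] by simp
    moreover have "Suc (k - Suc (Suc i)) = k - Suc i" using Suc.prems by simp
    ultimately show ?case using one[of "k - Suc (Suc i)"] Suc.prems by simp
  qed
  from this[of "k - 1"] k(1,2) show ?thesis by simp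
qed

context admissible_controls
begin

text \<open>A cone condition is improved from an arbitrarily small constant \<kappa> to an
  arbitrarily large K. The unstable part gains e^{2 \<alpha> t} while the rest gains at most
  e^{\<alpha> t}, up to constants. For the stable part the same happens from the end of the step to
  its beginning, so the jump comes first there and the flow second.\<close>

lemma amplify:
  fixes A :: "real^'n^'n" and B :: "real^'m^'n"
  assumes "\<kappa> > 0" "K > 0"
  shows "\<exists>e>0. \<exists>T>0. \<forall>u\<in>admissible U. \<forall>v\<in>admissible U. \<forall>z y t. z \<noteq> 0 \<longrightarrow> y \<noteq> 0 \<longrightarrow> t \<ge> T \<longrightarrow> d (shift t u) v < e \<longrightarrow>
    dist (to_proj (lifted_solution A B t z u)) (to_proj y) < e \<longrightarrow>
    (\<kappa> * (center_part A B u z + stable_part A B u z) \<le> unstable_part A B u z \<longrightarrow>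
      K * (center_part A B v y + stable_part A B v y) \<le> unstable_part A B v y) \<and>
    (\<kappa> * (center_part A B v y + unstable_part A B v y) \<le> stable_part A B v y \<longrightarrow>
      K * (center_part A B u z + unstable_part A B u z) \<le> stable_part A B u z)"
proof -
  let ?P = "unstable_part A B" and ?m = "stable_part A B" and ?c = "center_part A B"
  obtain \<alpha> G where \<alpha>: "\<alpha> > 0" and G: "G \<ge> 1" and
    growth: "\<And>u z t. u \<in> admissible U \<Longrightarrow> t \<ge> 0 \<Longrightarrow>
      ?P u z * exp (2 * \<alpha> * t) \<le> G * ?P (shift t u) (lifted_solution A B t z u) \<and>
      ?m (shift t u) (lifted_solution A B t z u) * exp (2 * \<alpha> * t) \<le> G * ?m u z \<and>
      ?c (shift t u) (lifted_solution A B t z u) \<le> G * exp (\<alpha> * t) * ?c u z \<and>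
      ?c u z \<le> G * exp (\<alpha> * t) * ?c (shift t u) (lifted_solution A B t z u)"
    using part_growth[of A B] by blast
  obtain c0 where c0: "c0 > 0" "\<And>u z. u \<in> admissible U \<Longrightarrow> c0 * norm z \<le> ?P u z + (?c u z + ?m u z)"
    using parts_total[of A B] by blast
  have "4 * K > 0" using assms by simp
  from ratio_stable_under_jump[OF uniform_gauge_parts(1) uniform_gauge_add[OF uniform_gauge_parts(3) uniform_gauge_parts(2)] c0 this]
  obtain e1 where e1: "e1 > 0" "\<And>u v z y. u \<in> admissible U \<Longrightarrow> v \<in> admissible U \<Longrightarrow> z \<noteq> 0 \<Longrightarrow> y \<noteq> 0 \<Longrightarrow> d u v < e1 \<Longrightarrow>
    dist (to_proj z) (to_proj y) < e1 \<Longrightarrow> 4 * K * (?c u z + ?m u z) \<le> ?P u z \<Longrightarrow> 4 * K / 4 * (?c v y + ?m v y) \<le> ?P v y"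
    by blast
  have "c0 * norm z \<le> ?m u z + (?c u z + ?P u z)" if "u \<in> admissible U" for u z
    using c0(2)[OF that, of z] by linarith
  from ratio_stable_under_jump[OF uniform_gauge_parts(2) uniform_gauge_add[OF uniform_gauge_parts(3) uniform_gauge_parts(1)] c0(1) this assms(1)]
  obtain e2 where e2: "e2 > 0" "\<And>u v z y. u \<in> admissible U \<Longrightarrow> v \<in> admissible U \<Longrightarrow> z \<noteq> 0 \<Longrightarrow> y \<noteq> 0 \<Longrightarrow> d u v < e2 \<Longrightarrow>
    dist (to_proj z) (to_proj y) < e2 \<Longrightarrow> \<kappa> * (?c u z + ?P u z) \<le> ?m u z \<Longrightarrow> \<kappa> / 4 * (?c v y + ?P v y) \<le> ?m v y"
    by blast
  \<comment> \<open>The ratio gains e^{\<alpha> t} / G^2, and the 4 pays for the jump. Forward, 4 K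
    is reached before the jump and K kept after it; backward, \<kappa> drops to \<kappa>/4 at the
    jump and the flow then raises it to K.\<close>
  define T where "T = max 1 (ln (4 * K * G\<^sup>2 / \<kappa>) / \<alpha>)"
  have T: "4 * K * G\<^sup>2 \<le> \<kappa> * exp (\<alpha> * t)" if "t \<ge> T" for t
  proof -
    have "ln (4 * K * G\<^sup>2 / \<kappa>) \<le> \<alpha> * t"
      using that \<alpha> by (simp add: T_def pos_divide_le_eq mult.commute)
    moreover have "4 * K * G\<^sup>2 / \<kappa> > 0" using assms G by simp
    ultimately have "4 * K * G\<^sup>2 / \<kappa> \<le> exp (\<alpha> * t)" by (metis exp_le_cancel_iff exp_ln)
    then show ?thesis using assms by (simp add: pos_divide_le_eq mult.commute)
  qed
  have "(\<kappa> * (?c u z + ?m u z) \<le> ?P u z \<longrightarrow> K * (?c v y + ?m v y) \<le> ?P v y) \<and>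
      (\<kappa> * (?c v y + ?P v y) \<le> ?m v y \<longrightarrow> K * (?c u z + ?P u z) \<le> ?m u z)"
    if uv: "u \<in> admissible U" "v \<in> admissible U" and nz: "z \<noteq> 0" "y \<noteq> 0" and t: "t \<ge> T"
      and near: "d (shift t u) v < min e1 e2" "dist (to_proj (lifted_solution A B t z u)) (to_proj y) < min e1 e2"
    for u v z y t
  proof (intro conjI impI)
    let ?u = "shift t u" and ?z = "lifted_solution A B t z u" and ?e = "exp (\<alpha> * t)"
    have t0: "t \<ge> 0" using t by (simp add: T_def)
    have e: "?e \<ge> 1" "exp (2 * \<alpha> * t) = ?e * ?e" using \<alpha> t0 by (auto simp flip: exp_add)
    have ee: "?e * ?e \<ge> 1" using mult_mono[OF e(1) e(1)] by simp
    note gr = growth[OF uv(1) t0, of z, unfolded e(2)]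
    have u: "?u \<in> admissible U" by (rule admissible_shift[OF uv(1)])
    have z: "?z \<noteq> 0" using nz by (simp add: lifted_solution_eq_0_iff)
    note nonneg = part_nonneg[of A B u z] part_nonneg[of A B ?u ?z]
    {
      assume le: "\<kappa> * (?c u z + ?m u z) \<le> ?P u z"
      have "?m ?u ?z * 1 \<le> ?m ?u ?z * (?e * ?e)" using ee nonneg by (intro mult_left_mono) auto
      also have "\<dots> \<le> G * ?m u z" using gr by blast
      also have "\<dots> \<le> G * ?e * ?m u z" using e G nonneg by (intro mult_right_mono) auto
      finally have N: "?c ?u ?z + ?m ?u ?z \<le> G * ?e * (?c u z + ?m u z)" using gr by (simp add: distrib_left)
      have "4 * K * G\<^sup>2 * (?c ?u ?z + ?m ?u ?z) \<le> \<kappa> * ?e * (G * ?e * (?c u z + ?m u z))"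
        by (rule mult_mono[OF T[OF t] N]) (use nonneg assms in auto)
      also have "\<dots> = G * (\<kappa> * (?c u z + ?m u z) * (?e * ?e))" by (simp add: mult_ac)
      also have "\<dots> \<le> G * (?P u z * (?e * ?e))"
        using le G by (intro mult_left_mono mult_right_mono) auto
      also have "\<dots> \<le> G * (G * ?P ?u ?z)" using gr G by (intro mult_left_mono) auto
      finally have "G\<^sup>2 * (4 * K * (?c ?u ?z + ?m ?u ?z)) \<le> G\<^sup>2 * ?P ?u ?z"
        by (simp add: power2_eq_square mult_ac)
      then have "4 * K * (?c ?u ?z + ?m ?u ?z) \<le> ?P ?u ?z"
        by (rule mult_left_le_imp_le) (use G in simp)
      from e1(2)[OF u uv(2) z nz(2) _ _ this] near show "K * (?c v y + ?m v y) \<le> ?P v y" by simp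
    }
    {
      assume "\<kappa> * (?c v y + ?P v y) \<le> ?m v y"
      then have le: "\<kappa> / 4 * (?c ?u ?z + ?P ?u ?z) \<le> ?m ?u ?z"
        using near by (intro e2(2)[OF uv(2) u nz(2) z]) (simp_all add: commute dist_commute)
      have "?P u z * 1 \<le> ?P u z * (?e * ?e)" using ee nonneg by (intro mult_left_mono) auto
      also have "\<dots> \<le> G * ?P ?u ?z" using gr by blast
      also have "\<dots> \<le> G * ?e * ?P ?u ?z" using e G nonneg by (intro mult_right_mono) auto
      finally have N: "?c u z + ?P u z \<le> G * ?e * (?c ?u ?z + ?P ?u ?z)" using gr by (simp add: distrib_left)
      have "4 * K * G\<^sup>2 * (?c u z + ?P u z) \<le> \<kappa> * ?e * (G * ?e * (?c ?u ?z + ?P ?u ?z))"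
        by (rule mult_mono[OF T[OF t] N]) (use nonneg assms in auto)
      also have "\<dots> = 4 * G * (\<kappa> / 4 * (?c ?u ?z + ?P ?u ?z) * (?e * ?e))" by (simp add: mult_ac)
      also have "\<dots> \<le> 4 * G * (?m ?u ?z * (?e * ?e))"
        using le G by (intro mult_left_mono mult_right_mono) auto
      also have "\<dots> \<le> 4 * G * (G * ?m u z)" using gr G by (intro mult_left_mono) auto
      finally have "4 * G\<^sup>2 * (K * (?c u z + ?P u z)) \<le> 4 * G\<^sup>2 * ?m u z"
        by (simp add: power2_eq_square mult_ac)
      then show "K * (?c u z + ?P u z) \<le> ?m u z"
        by (rule mult_left_le_imp_le) (use G in simp)
    }
  qed
  then show ?thesis using e1(1) e2(1)
    by (intro exI[of _ "min e1 e2"] conjI exI[of _ T]) (auto simp: T_def)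
qed

lemma parts_bounded:
  fixes A :: "real^'n^'n" and B :: "real^'m^'n"
  shows "\<exists>b\<ge>0. \<forall>u\<in>admissible U. unstable_part A B u z + stable_part A B u z + center_part A B u z \<le> b"
proof -
  obtain K where K: "K > 0" "\<And>u. u \<in> admissible U \<Longrightarrow> norm (bsol A B u) \<le> K"
    using bsol_bounded[of A B] by blast
  obtain P where P: "P > 0" "\<And>v. norm (pi_plus A v) \<le> P * norm v"
    using norm_linear_le[OF linear_pi(1)] by blast
  obtain M where M: "M > 0" "\<And>v. norm (pi_minus A v) \<le> M * norm v"
    using norm_linear_le[OF linear_pi(2)] by blast
  obtain Z where Z: "Z > 0" "\<And>v. norm (pi_zero A v) \<le> Z * norm v"
    using norm_linear_le[OF linear_pi(4)] by blast
  let ?b = "norm (fst z) + \<bar>snd z\<bar> * K"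
  have b: "?b \<ge> 0" using K by simp
  have "unstable_part A B u z + stable_part A B u z + center_part A B u z \<le> (P + M + Z) * ?b + \<bar>snd z\<bar>"
    if "u \<in> admissible U" for u
  proof -
    have "norm (offset A B u z) \<le> norm (fst z) + norm (snd z *\<^sub>R bsol A B u)"
      unfolding offset_def by (rule norm_triangle_ineq4)
    also have "\<dots> \<le> ?b" using K(2)[OF that] by (simp add: mult_left_mono)
    finally have w: "norm (offset A B u z) \<le> ?b" .
    have "norm (pi_plus A (offset A B u z)) \<le> P * ?b" "norm (pi_minus A (offset A B u z)) \<le> M * ?b"
      "norm (pi_zero A (offset A B u z)) \<le> Z * ?b"
      using order_trans[OF P(2) mult_left_mono[OF w]] order_trans[OF M(2) mult_left_mono[OF w]]
        order_trans[OF Z(2) mult_left_mono[OF w]] P M Z by auto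
    then show ?thesis by (simp add: part_defs distrib_right)
  qed
  moreover have "(P + M + Z) * ?b + \<bar>snd z\<bar> \<ge> 0" using P M Z b by simp
  ultimately show ?thesis by blast
qed

text \<open>An unstable part at p dominates at the end of every chain, a stable part at the
  beginning, and neither is possible at q, where r \<noteq> 0. The numbers e and T depend on p, q
  and \<eta> but not on the controls, which is what controlled chains require.\<close>

lemma no_chain_through_hyperbolic_part:
  fixes A :: "real^'n^'n" and B :: "real^'m^'n" and p q :: "((real^'n) \<times> real) proj"
  assumes "\<eta> > 0" and q: "snd (rep_proj q) \<noteq> 0"
  shows "\<exists>e>0. \<exists>T>0. \<forall>u\<in>admissible U. \<forall>v\<in>admissible U.
    (\<eta> \<le> unstable_part A B u (rep_proj p) \<longrightarrow> \<not> has_chain (admissible U \<times> X) (max_dist d) (proj_flow A B) e T (u, p) (v, q)) \<and>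
    (\<eta> \<le> stable_part A B u (rep_proj p) \<longrightarrow> \<not> has_chain (admissible U \<times> X) (max_dist d) (proj_flow A B) e T (v, q) (u, p))"
proof -
  let ?P = "unstable_part A B" and ?m = "stable_part A B" and ?c = "center_part A B"
  let ?r = "\<bar>snd (rep_proj q)\<bar>"
  obtain a where a: "a \<ge> 0" "\<And>u. u \<in> admissible U \<Longrightarrow> ?P u (rep_proj p) + ?m u (rep_proj p) + ?c u (rep_proj p) \<le> a"
    using parts_bounded[of A B "rep_proj p"] by blast
  obtain b where b: "b \<ge> 0" "\<And>u. u \<in> admissible U \<Longrightarrow> ?P u (rep_proj q) + ?m u (rep_proj q) + ?c u (rep_proj q) \<le> b"
    using parts_bounded[of A B "rep_proj q"] by blast
  \<comment> \<open>Small enough that a hyperbolic part of size \<eta> satisfies the weak cone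
    condition at p, whatever the control.\<close>
  define \<kappa> where "\<kappa> = \<eta> / (a + 1)"
  \<comment> \<open>The center part at q is at least |r|, so the strong cone condition would give a
    hyperbolic part of at least b + 1, contradicting the bound b over all controls.\<close>
  define K where "K = max \<kappa> ((b + 1) / ?r)"
  have \<kappa>: "\<kappa> > 0" using assms a by (simp add: \<kappa>_def)
  have K: "K > 0" "\<kappa> \<le> K" "(b + 1) / ?r \<le> K" using \<kappa> by (auto simp: K_def)
  have \<kappa>a: "\<kappa> * x \<le> \<eta>" if "x \<le> a" for x
  proof -
    have "\<kappa> * x \<le> \<kappa> * (a + 1)" using that \<kappa> by (intro mult_left_mono) auto
    also have "\<dots> = \<eta>" using a by (simp add: \<kappa>_def)
    finally show ?thesis .
  qed
  have Kr: "b < K * x" if "?r \<le> x" for x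
  proof -
    have "b + 1 \<le> K * ?r" using K(3) q by (simp add: pos_divide_le_eq)
    also have "\<dots> \<le> K * x" using that K by (intro mult_left_mono) auto
    finally show ?thesis by simp
  qed
  have weak: "\<kappa> * x \<le> y" if "K * x \<le> y" "x \<ge> 0" for x y
    using order_trans[OF mult_right_mono[OF K(2) that(2)] that(1)] .
  obtain e T where e: "e > 0" "T > 0" and amp: "\<And>u v z y t. u \<in> admissible U \<Longrightarrow> v \<in> admissible U \<Longrightarrow> z \<noteq> 0 \<Longrightarrow> y \<noteq> 0 \<Longrightarrow> t \<ge> T \<Longrightarrow>
    d (shift t u) v < e \<Longrightarrow> dist (to_proj (lifted_solution A B t z u)) (to_proj y) < e \<Longrightarrow>
    (\<kappa> * (?c u z + ?m u z) \<le> ?P u z \<longrightarrow> K * (?c v y + ?m v y) \<le> ?P v y) \<and>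
    (\<kappa> * (?c v y + ?P v y) \<le> ?m v y \<longrightarrow> K * (?c u z + ?P u z) \<le> ?m u z)"
    using amplify[OF \<kappa> K(1), of A B] by blast
  have step: "(\<kappa> * (?c (fst x) (rep_proj (snd x)) + ?m (fst x) (rep_proj (snd x))) \<le> ?P (fst x) (rep_proj (snd x)) \<longrightarrow>
        K * (?c (fst y) (rep_proj (snd y)) + ?m (fst y) (rep_proj (snd y))) \<le> ?P (fst y) (rep_proj (snd y))) \<and>
      (\<kappa> * (?c (fst y) (rep_proj (snd y)) + ?P (fst y) (rep_proj (snd y))) \<le> ?m (fst y) (rep_proj (snd y)) \<longrightarrow>
        K * (?c (fst x) (rep_proj (snd x)) + ?P (fst x) (rep_proj (snd x))) \<le> ?m (fst x) (rep_proj (snd x)))"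
    if "x \<in> admissible U \<times> X" "y \<in> admissible U \<times> X" "t \<ge> T" "max_dist d (proj_flow A B t x) y < e" for x y t
    using that by (intro amp[of _ _ _ _ t] rep_proj_nonzero)
      (auto simp: max_dist_def proj_flow_def proj_trajectory_def split: prod.splits)
  have c: "?r \<le> ?c v (rep_proj q)" for v by (simp add: center_part_def)
  have "\<not> has_chain (admissible U \<times> X) (max_dist d) (proj_flow A B) e T (u, p) (v, q)"
    if uv: "u \<in> admissible U" "v \<in> admissible U" and \<eta>: "\<eta> \<le> ?P u (rep_proj p)" for u v
  proof
    assume ch: "has_chain (admissible U \<times> X) (max_dist d) (proj_flow A B) e T (u, p) (v, q)"
    have start: "\<kappa> * (?c u (rep_proj p) + ?m u (rep_proj p)) \<le> ?P u (rep_proj p)"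
      using a(2)[OF uv(1)] part_nonneg(1)[of A B u "rep_proj p"] \<eta> by (intro order_trans[OF \<kappa>a]) auto
    have "K * (?c v (rep_proj q) + ?m v (rep_proj q)) \<le> ?P v (rep_proj q)"
      using has_chain_forward[OF ch, where P = "\<lambda>(u, p). \<kappa> * (?c u (rep_proj p) + ?m u (rep_proj p)) \<le> ?P u (rep_proj p)"
        and Q = "\<lambda>(u, p). K * (?c u (rep_proj p) + ?m u (rep_proj p)) \<le> ?P u (rep_proj p)"] start step weak
      by (fastforce simp: part_nonneg)
    then show False
      using Kr[of "?c v (rep_proj q) + ?m v (rep_proj q)"] c[of v] b(2)[OF uv(2)]
        part_nonneg[of A B v "rep_proj q"] by linarith
  qed
  moreover have "\<not> has_chain (admissible U \<times> X) (max_dist d) (proj_flow A B) e T (v, q) (u, p)"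
    if uv: "u \<in> admissible U" "v \<in> admissible U" and \<eta>: "\<eta> \<le> ?m u (rep_proj p)" for u v
  proof
    assume ch: "has_chain (admissible U \<times> X) (max_dist d) (proj_flow A B) e T (v, q) (u, p)"
    have start: "\<kappa> * (?c u (rep_proj p) + ?P u (rep_proj p)) \<le> ?m u (rep_proj p)"
      using a(2)[OF uv(1)] part_nonneg(2)[of A B u "rep_proj p"] \<eta> by (intro order_trans[OF \<kappa>a]) auto
    have "K * (?c v (rep_proj q) + ?P v (rep_proj q)) \<le> ?m v (rep_proj q)"
      using has_chain_backward[OF ch, where P = "\<lambda>(u, p). \<kappa> * (?c u (rep_proj p) + ?P u (rep_proj p)) \<le> ?m u (rep_proj p)"
        and Q = "\<lambda>(u, p). K * (?c u (rep_proj p) + ?P u (rep_proj p)) \<le> ?m u (rep_proj p)"] start step weak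
      by (fastforce simp: part_nonneg)
    then show False
      using Kr[of "?c v (rep_proj q) + ?P v (rep_proj q)"] c[of v] b(2)[OF uv(2)]
        part_nonneg[of A B v "rep_proj q"] by linarith
  qed
  ultimately show ?thesis using e by blast
qed

end

context central
begin

text \<open>Chains in both directions between an arbitrary point and the one with r \<noteq> 0 are
  available. The outgoing one excludes an unstable part, the incoming one a stable part.\<close>

lemma chain_transitive_subset_center:
  assumes Z: "chain_transitive (admissible U \<times> proj_points S) (max_dist d) (proj_flow A B) Z"
    and vq: "(v, q) \<in> Z" "snd (rep_proj q) \<noteq> 0"
  shows "Z \<subseteq> center"
proof
  fix up assume "up \<in> Z"
  obtain u p where up: "up = (u, p)" by (cases up)
  have Zsub: "Z \<subseteq> admissible U \<times> proj_points S"
    and ch: "\<And>x y e T. x \<in> Z \<Longrightarrow> y \<in> Z \<Longrightarrow> e > 0 \<Longrightarrow> T > 0 \<Longrightarrow> chain e T x y"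
    using Z unfolding chain_transitive_def by blast+
  have mem: "(u, p) \<in> Z" "u \<in> admissible U" "p \<in> proj_points S" "v \<in> admissible U"
    using \<open>up \<in> Z\<close> Zsub vq up by auto
  let ?z = "rep_proj p"
  let ?w = "offset A B u ?z"
  have "unstable_part A B u ?z = 0"
  proof (rule ccontr)
    assume "unstable_part A B u ?z \<noteq> 0"
    then have "unstable_part A B u ?z > 0" using part_nonneg(1)[of A B u ?z] by simp
    from no_chain_through_hyperbolic_part[OF this vq(2), of A B p "proj_points S"]
    show False using ch[OF mem(1) vq(1)] mem by blast
  qed
  moreover have "stable_part A B u ?z = 0"
  proof (rule ccontr)
    assume "stable_part A B u ?z \<noteq> 0"
    then have "stable_part A B u ?z > 0" using part_nonneg(2)[of A B u ?z] by simp
    from no_chain_through_hyperbolic_part[OF this vq(2), of A B p "proj_points S"]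
    show False using ch[OF vq(1) mem(1)] mem by blast
  qed
  ultimately have "pi_hyp A ?w = 0" by (simp add: part_defs pi_hyp_eq)
  \<comment> \<open>So far the offset lies in L^0. That it lies in Q comes from the state space S =
    L_hyp + Q, whose sum is direct.\<close>
  obtain z0 where "z0 \<in> S \<times> UNIV - {0}" "p = to_proj z0"
    using mem(3) unfolding proj_points_def by blast
  then have z0: "p = to_proj z0" "fst z0 \<in> S" "z0 \<noteq> 0"
    by (auto simp only: mem_Times_iff Diff_iff insert_iff)
  obtain c where c: "?z = c *\<^sub>R z0" using rep_proj_to_proj[OF z0(3)] z0(1) by blast
  obtain h q where hq: "h \<in> L_hyp A" "q \<in> Q" "fst z0 = h + q" using z0(2) S_eq by blast
  have eq: "?w = (c *\<^sub>R h - snd ?z *\<^sub>R bsol A B u) + c *\<^sub>R q"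
    by (simp add: offset_def c hq(3) scaleR_right_distrib)
  have h': "c *\<^sub>R h - snd ?z *\<^sub>R bsol A B u \<in> L_hyp A"
    by (intro subspace_diff[OF subspace_L_hyp] subspace_scale[OF subspace_L_hyp] hq bsol_mem_L_hyp)
  have q': "c *\<^sub>R q \<in> Q" by (rule subspace_scale[OF subspace_Q hq(2)])
  have "pi_hyp A (c *\<^sub>R q) = 0"
    using pi_on_L_zero[OF subsetD[OF Q_le q']] by (simp add: pi_hyp_eq)
  moreover have "pi_hyp A (c *\<^sub>R h - snd ?z *\<^sub>R bsol A B u) = c *\<^sub>R h - snd ?z *\<^sub>R bsol A B u"
    using pi_on_L_hyp[OF h'] by blast
  moreover have "pi_hyp A ?w = pi_hyp A (c *\<^sub>R h - snd ?z *\<^sub>R bsol A B u) + pi_hyp A (c *\<^sub>R q)"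
    unfolding eq by (rule linear_add[OF linear_pi(3)])
  ultimately have "c *\<^sub>R h - snd ?z *\<^sub>R bsol A B u = 0"
    using \<open>pi_hyp A ?w = 0\<close> by (simp only: add_0_right)
  with eq have w: "?w = c *\<^sub>R q" by (simp only: add_0_left)
  have "?w \<in> Q" using w q' by simp
  then show "up \<in> center"
    unfolding center_def up using mem(2) to_proj_offset[of p A B u, symmetric] offset_rep_proj_nonzero[of A B u p] by blast
qed

lemma snd_rep_to_proj: "z \<noteq> 0 \<Longrightarrow> snd (rep_proj (to_proj z)) = 0 \<longleftrightarrow> snd z = 0"
  for z :: "(real^'n) \<times> real"
  using rep_proj_to_proj[of z] by fastforce

lemma center_maximal:
  assumes "chain_transitive (admissible U \<times> proj_points S) (max_dist d) (proj_flow A B) Z" "center \<subseteq> Z"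
  shows "Z = center"
proof -
  have "(zero_control, point zero_control 0 1) \<in> Z" using origin_mem_center assms(2) by blast
  moreover have "snd (rep_proj (point zero_control 0 1)) \<noteq> 0"
    using snd_rep_to_proj[OF coords_nonzero[of 0 1 zero_control]] by (simp add: zero_prod_def)
  ultimately show ?thesis using chain_transitive_subset_center[OF assms(1)] assms(2) by blast
qed

text \<open>Any competing Selgrade bundle has a vector with r \<noteq> 0, so its component lies in
  \<open>center\<close>; as \<open>center\<close> is chain transitive, maximality of the component
  gives equality.\<close>

theorem central_selgrade_bundle_eq:
  "central_selgrade_bundle A B U d S = {(u, r *\<^sub>R bsol A B u + x, r) | u x r. u \<in> admissible U \<and> x \<in> Q}"
    (is "_ = ?V")
proof -
  have comp: "chain_recurrent_component (admissible U \<times> proj_points S) (max_dist d) (proj_flow A B) center"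
    unfolding chain_recurrent_component_def using chain_transitive_center center_maximal by blast
  have lift: "{(u, z). u \<in> admissible U \<and> z \<in> S \<times> UNIV \<and> (z \<noteq> 0 \<longrightarrow> (u, to_proj z) \<in> center)} = ?V" (is "?W = _")
  proof (intro Set.equalityI subsetI)
    fix w assume "w \<in> ?W"
    then obtain u z where w: "w = (u, z)" "u \<in> admissible U" "z \<noteq> 0 \<longrightarrow> (u, to_proj z) \<in> center" by blast
    show "w \<in> ?V"
    proof (cases "z = 0")
      case True
      then show ?thesis using w zero_mem_Q
        by (intro CollectI exI[of _ u] exI[of _ 0] conjI exI[of _ "0::real"]) (simp_all add: zero_prod_def)
    next
      case False
      then obtain x r where xr: "to_proj z = point u x r" "x \<in> Q" "(x, r) \<noteq> 0"
        using w(3) unfolding center_def by blast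
      then obtain c where "z = c *\<^sub>R (r *\<^sub>R bsol A B u + x, r)"
        using to_proj_eq_iff[OF coords_nonzero[OF xr(3)] False, of u] by metis
      then have "z = ((c * r) *\<^sub>R bsol A B u + c *\<^sub>R x, c * r)" by (simp add: scaleR_right_distrib)
      moreover have "c *\<^sub>R x \<in> Q" by (rule subspace_scale[OF subspace_Q xr(2)])
      ultimately show ?thesis using w by blast
    qed
  next
    fix w assume "w \<in> ?V"
    then obtain u x r where w: "w = (u, r *\<^sub>R bsol A B u + x, r)" "u \<in> admissible U" "x \<in> Q" by blast
    have "r *\<^sub>R bsol A B u \<in> L_hyp A" by (rule subspace_scale[OF subspace_L_hyp bsol_mem_L_hyp])
    with w(3) have "r *\<^sub>R bsol A B u + x \<in> S" unfolding S_eq by blast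
    moreover have "(u, point u x r) \<in> center" if "(r *\<^sub>R bsol A B u + x, r) \<noteq> 0"
    proof -
      have "(x, r) \<noteq> 0" using that by (auto simp: zero_prod_def)
      then show ?thesis unfolding center_def using w by blast
    qed
    ultimately show "w \<in> ?W" using w by simp
  qed
  show ?thesis
    unfolding central_selgrade_bundle_def
  proof (rule the_equality)
    have "(zero_control, 1 *\<^sub>R bsol A B zero_control + 0, 1) \<in> ?V"
      using zero_control_mem zero_mem_Q by blast
    moreover have "is_selgrade_bundle A B U d S ?V"
      unfolding is_selgrade_bundle_def using comp lift by blast
    ultimately show "is_selgrade_bundle A B U d S ?V \<and> \<not> ?V \<subseteq> admissible U \<times> S \<times> {0}" by auto
  next
    fix V assume V: "is_selgrade_bundle A B U d S V \<and> \<not> V \<subseteq> admissible U \<times> S \<times> {0}"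
    then obtain M where M: "chain_recurrent_component (admissible U \<times> proj_points S) (max_dist d) (proj_flow A B) M"
      and V_eq: "V = {(u, z). u \<in> admissible U \<and> z \<in> S \<times> UNIV \<and> (z \<noteq> 0 \<longrightarrow> (u, to_proj z) \<in> M)}"
      unfolding is_selgrade_bundle_def by blast
    obtain u z where uz: "(u, z) \<in> V" "(u, z) \<notin> admissible U \<times> S \<times> {0}" using V by auto
    then have "snd z \<noteq> 0" using V_eq by (cases z) auto
    then have "z \<noteq> 0" by (auto simp: zero_prod_def)
    then have "(u, to_proj z) \<in> M" "snd (rep_proj (to_proj z)) \<noteq> 0"
      using uz V_eq snd_rep_to_proj \<open>snd z \<noteq> 0\<close> by auto
    then have "M \<subseteq> center"
      using M chain_transitive_subset_center unfolding chain_recurrent_component_def by blast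
    then have "M = center"
      using M chain_transitive_center unfolding chain_recurrent_component_def by blast
    then show "V = ?V" using V_eq lift by simp
  qed
qed

end

section \<open>Subbundles\<close>

lemma continuous_map_offset:
  fixes A :: "real^'n^'n" and B :: "real^'m^'n"
  shows "continuous_map (prod_topology (subtopology weak_star (admissible U)) euclidean) euclidean
    (\<lambda>(u, z). offset A B u z)"
proof -
  let ?X = "prod_topology (subtopology weak_star (admissible U)) (euclidean :: ((real^'n) \<times> real) topology)"
  have "continuous_map ?X (prod_topology euclidean euclidean) (\<lambda>p. (bsol A B (fst p), snd p))"
    by (intro continuous_map_pairedI continuous_map_snd
        continuous_map_compose[OF continuous_map_fst continuous_map_from_subtopology[OF continuous_map_bsol], unfolded o_def])
  moreover have "continuous_map (prod_topology euclidean euclidean) euclidean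
      (\<lambda>(b :: real^'n, z). fst z - snd z *\<^sub>R b)"
    unfolding euclidean_product_topology[symmetric] continuous_map_iff_continuous2 case_prod_unfold
    by (simp add: case_prod_unfold continuous_intros)
  ultimately have "continuous_map ?X euclidean ((\<lambda>(b, z). fst z - snd z *\<^sub>R b) \<circ> (\<lambda>p. (bsol A B (fst p), snd p)))"
    by (rule continuous_map_compose)
  then show ?thesis by (simp add: o_def offset_def case_prod_unfold)
qed

text \<open>The total set is the preimage of R under the continuous map \<open>offset\<close>, hence
  closed. Each fiber is the image of R \<times> \<real> under an injective linear map, whence the
  dimension.\<close>

lemma is_subbundle_offset:
  fixes A :: "real^'n^'n" and B :: "real^'m^'n"
  assumes R: "subspace R"
  shows "is_subbundle U {(u, r *\<^sub>R bsol A B u + x, r) | u x r. u \<in> admissible U \<and> x \<in> R} (1 + dim R)"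
    (is "is_subbundle U ?V _")
  unfolding is_subbundle_def
proof (intro conjI ballI)
  let ?X = "prod_topology (subtopology weak_star (admissible U)) (euclidean :: ((real^'n) \<times> real) topology)"
  have "?V = {p \<in> topspace ?X. (\<lambda>(u, z). offset A B u z) p \<in> R}"
  proof (intro Set.equalityI subsetI)
    fix p assume "p \<in> {p \<in> topspace ?X. (\<lambda>(u, z). offset A B u z) p \<in> R}"
    then obtain u y r where p: "p = (u, y, r)" "u \<in> admissible U" "y - r *\<^sub>R bsol A B u \<in> R"
      by (cases p) (auto simp: offset_def)
    moreover have "y = r *\<^sub>R bsol A B u + (y - r *\<^sub>R bsol A B u)" by simp
    ultimately show "p \<in> ?V" by blast
  qed (auto simp: offset_def)
  then show "closedin ?X ?V"
    using closedin_continuous_map_preimage[OF continuous_map_offset, of R U A B] closed_subspace[OF R] by simp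
  fix u :: "'m linf" assume u: "u \<in> admissible U"
  let ?f = "\<lambda>(x :: real^'n, r :: real). (r *\<^sub>R bsol A B u + x, r)"
  have f: "linear ?f" by (rule linearI) (auto simp: algebra_simps)
  have fiber: "fiber ?V u = ?f ` (R \<times> UNIV)" using u by (auto simp: fiber_def)
  have sub: "subspace (R \<times> (UNIV :: real set))" by (intro subspace_Times R subspace_UNIV)
  show "subspace (fiber ?V u)" unfolding fiber by (rule linear_subspace_image[OF f sub])
  have "inj_on ?f (span (R \<times> UNIV))" by (auto simp: inj_on_def)
  from dim_image_eq[OF f this] show "dim (fiber ?V u) = 1 + dim R"
    unfolding fiber by (simp add: dim_Times[OF R subspace_UNIV])
qed

lemma is_subbundle_trivial:
  fixes R :: "(real^'n) set" and U :: "(real^'m) set"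
  assumes R: "subspace R"
  shows "is_subbundle U (admissible U \<times> R \<times> {0 :: real}) (dim R)"
  unfolding is_subbundle_def
proof (intro conjI ballI)
  show "closedin (prod_topology (subtopology weak_star (admissible U)) euclidean) (admissible U \<times> R \<times> {0 :: real})"
    unfolding closedin_prod_Times_iff
    using closedin_topspace[of "subtopology weak_star (admissible U)"] closed_subspace[OF R]
    by (simp add: closed_Times del: closedin_topspace)
  fix u assume "u \<in> admissible U"
  then have fiber: "fiber (admissible U \<times> R \<times> {0 :: real}) u = R \<times> {0}" by (auto simp: fiber_def)
  show "subspace (fiber (admissible U \<times> R \<times> {0 :: real}) u)"
    unfolding fiber by (intro subspace_Times R subspace_single_0)
  show "dim (fiber (admissible U \<times> R \<times> {0 :: real}) u) = dim R"
    unfolding fiber by (simp add: dim_Times[OF R subspace_single_0])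
qed

text \<open>The summand x is moved to the second bundle. The intersection is trivial because a
  vector with r = 0 and x = 0 vanishes.\<close>

lemma is_whitney_sum_offset:
  fixes A :: "real^'n^'n" and B :: "real^'m^'n" and U :: "(real^'m) set"
  assumes R: "subspace R"
  shows "is_whitney_sum U {(u, r *\<^sub>R bsol A B u + x, r) | u x r. u \<in> admissible U \<and> x \<in> R}
    {(u, r *\<^sub>R bsol A B u + x, r) | u x r. u \<in> admissible U \<and> x \<in> {0}} (admissible U \<times> R \<times> {0})"
    (is "is_whitney_sum U ?V ?V1 ?V2")
  unfolding is_whitney_sum_def
proof (intro conjI ballI)
  show "\<exists>k1. is_subbundle U ?V1 k1" using is_subbundle_offset[OF subspace_single_0] by blast
  show "\<exists>k2. is_subbundle U ?V2 k2" using is_subbundle_trivial[OF R] by blast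
  show "?V = {(u, z + w) | u z w. (u, z) \<in> ?V1 \<and> (u, w) \<in> ?V2}"
  proof (intro Set.equalityI subsetI)
    fix p assume "p \<in> ?V"
    then obtain u x r where p: "p = (u, r *\<^sub>R bsol A B u + x, r)" "u \<in> admissible U" "x \<in> R" by blast
    have "p = (u, (r *\<^sub>R bsol A B u + 0, r) + (x, 0))" using p(1) by simp
    moreover have "(u, r *\<^sub>R bsol A B u + 0, r) \<in> ?V1" "(u, x, 0) \<in> ?V2" using p by blast+
    ultimately show "p \<in> {(u, z + w) | u z w. (u, z) \<in> ?V1 \<and> (u, w) \<in> ?V2}" by blast
  next
    fix p assume "p \<in> {(u, z + w) | u z w. (u, z) \<in> ?V1 \<and> (u, w) \<in> ?V2}"
    then show "p \<in> ?V" by fastforce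
  qed
  fix u assume "u \<in> admissible U"
  then show "fiber ?V1 u \<inter> fiber ?V2 u = {0}"
    using subspace_0[OF R] by (auto simp: fiber_def zero_prod_def)
qed

section \<open>Controlled chains\<close>

text \<open>Forgetting the distance of controls is enough: a controlled chain may choose a new
  control at every jump.\<close>

lemma controlled_chain_if_chain:
  assumes "has_chain (admissible U \<times> X) (max_dist d) (proj_flow A B) \<epsilon> T (u, p) (v, q)"
  shows "has_controlled_chain A B U \<epsilon> T p q"
proof -
  obtain k \<tau> \<xi> where k: "k \<ge> 1" "\<xi> 0 = (u, p)" "\<xi> k = (v, q)" "\<And>i. i \<le> k \<Longrightarrow> \<xi> i \<in> admissible U \<times> X"
    "\<And>i. i < k \<Longrightarrow> \<tau> i \<ge> T \<and> max_dist d (proj_flow A B (\<tau> i) (\<xi> i)) (\<xi> (Suc i)) < \<epsilon>"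
    using assms unfolding has_chain_def by blast
  have "fst (\<xi> j) \<in> admissible U \<and> \<tau> j \<ge> T \<and>
      dist (proj_trajectory A B (\<tau> j) (snd (\<xi> j)) (fst (\<xi> j))) (snd (\<xi> (Suc j))) < \<epsilon>" if "j < k" for j
    using k(4)[of j] k(5)[of j] that by (auto simp: max_dist_def proj_flow_def split: prod.splits)
  then show ?thesis
    unfolding has_controlled_chain_def using k(1-3)
    by (intro exI[of _ k] exI[of _ "\<lambda>i. snd (\<xi> i)"] exI[of _ "\<lambda>i. fst (\<xi> i)"] exI[of _ \<tau>]) auto
qed

lemma lifted_solution_cong:
  assumes "t \<ge> 0" and eq: "AE s in lborel. 0 \<le> s \<longrightarrow> s < t \<longrightarrow> rep_linf u s = rep_linf v s"
  shows "lifted_solution A B t z u = lifted_solution A B t z v"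
proof -
  have "drive A (forcing B u) t = drive A (forcing B v) t"
    unfolding drive_def
  proof (rule integral_cong_AE)
    show "AE s in lborel. orient t s *\<^sub>R flow A (- s) (forcing B u s) = orient t s *\<^sub>R flow A (- s) (forcing B v s)"
      using eq by eventually_elim (use \<open>t \<ge> 0\<close> in \<open>auto simp: orient_def indicator_def\<close>)
  qed (use borel_measurable_integrable[OF integrable_drive[OF locally_ess_bounded_forcing]] in blast)+
  then show ?thesis by (cases z) (simp add: lifted_solution_eq)
qed

context admissible_controls
begin

lemma proj_trajectory_cong:
  assumes "t \<ge> 0" "AE s in lborel. 0 \<le> s \<longrightarrow> s < t \<longrightarrow> rep_linf u s = rep_linf v s"
  shows "proj_trajectory A B t p u = proj_trajectory A B t p v"
  unfolding proj_trajectory_def lifted_solution_cong[OF assms] ..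

text \<open>
  Concatenating the controls of a controlled chain yields one control whose shifts carry the whole
  chain, so no jump occurs in the \<open>\<U>\<close>-component. Since shifting preserves the past, the
  concatenation may only be prescribed on the future.
\<close>

lemma chain_if_controlled_chain_aux:
  fixes A :: "real^'n^'n" and B :: "real^'m^'n"
  assumes "T > 0" "\<epsilon> > 0"
    and "\<And>j. j \<le> k \<Longrightarrow> \<nu> j \<in> admissible U \<and> \<tau> j \<ge> T \<and>
      dist (proj_trajectory A B (\<tau> j) (\<pi> j) (\<nu> j)) (\<pi> (Suc j)) < \<epsilon>"
  shows "\<exists>w\<in>admissible U. \<forall>w'\<in>admissible U. (AE s in lborel. 0 \<le> s \<longrightarrow> rep_linf w' s = rep_linf w s) \<longrightarrow>
    (\<exists>v\<in>admissible U. has_chain (admissible U \<times> UNIV) (max_dist d) (proj_flow A B) \<epsilon> T (w', \<pi> 0) (v, \<pi> (Suc k)))"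
  using assms(3)
proof (induction k arbitrary: \<nu> \<tau> \<pi>)
  case 0
  show ?case
  proof (rule bexI[of _ "\<nu> 0"], intro ballI impI)
    fix w' assume w': "w' \<in> admissible U" "AE s in lborel. 0 \<le> s \<longrightarrow> rep_linf w' s = rep_linf (\<nu> 0) s"
    have "proj_trajectory A B (\<tau> 0) (\<pi> 0) w' = proj_trajectory A B (\<tau> 0) (\<pi> 0) (\<nu> 0)"
      by (rule proj_trajectory_cong) (use 0[of 0] assms(1) w'(2) in \<open>auto elim: eventually_mono\<close>)
    then have "has_chain (admissible U \<times> UNIV) (max_dist d) (proj_flow A B) \<epsilon> T (w', \<pi> 0) (shift (\<tau> 0) w', \<pi> (Suc 0))"
      using 0[of 0] w'(1) assms admissible_shift[OF w'(1), of "\<tau> 0"]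
      by (intro has_chain_single[where t = "\<tau> 0"]) (auto simp: max_dist_def proj_flow_def)
    then show "\<exists>v\<in>admissible U. has_chain (admissible U \<times> UNIV) (max_dist d) (proj_flow A B) \<epsilon> T (w', \<pi> 0) (v, \<pi> (Suc 0))"
      using admissible_shift[OF w'(1)] by blast
  qed (use 0[of 0] in simp)
next
  case (Suc k)
  have "\<exists>w\<in>admissible U. \<forall>w'\<in>admissible U. (AE s in lborel. 0 \<le> s \<longrightarrow> rep_linf w' s = rep_linf w s) \<longrightarrow>
    (\<exists>v\<in>admissible U. has_chain (admissible U \<times> UNIV) (max_dist d) (proj_flow A B) \<epsilon> T (w', \<pi> (Suc 0)) (v, \<pi> (Suc (Suc k))))"
    by (rule Suc.IH[of "\<lambda>j. \<nu> (Suc j)" "\<lambda>j. \<tau> (Suc j)" "\<lambda>j. \<pi> (Suc j)"]) (use Suc.prems in simp)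
  then obtain w1 where w1: "w1 \<in> admissible U" and IH: "\<And>w'. w' \<in> admissible U \<Longrightarrow>
      AE s in lborel. 0 \<le> s \<longrightarrow> rep_linf w' s = rep_linf w1 s \<Longrightarrow>
    (\<exists>v\<in>admissible U. has_chain (admissible U \<times> UNIV) (max_dist d) (proj_flow A B) \<epsilon> T (w', \<pi> (Suc 0)) (v, \<pi> (Suc (Suc k))))"
    by blast
  let ?t = "\<tau> 0"
  \<comment> \<open>\<open>w1\<close> is delayed to start at time \<open>\<tau> 0\<close>. After the
    shift the piece \<open>\<nu> 0\<close> has become history, on which the induction hypothesis
    makes no demand.\<close>
  let ?w = "join_at ?t (\<nu> 0) (shift (- ?t) w1)"
  have 0: "\<nu> 0 \<in> admissible U" "?t \<ge> T" "dist (proj_trajectory A B ?t (\<pi> 0) (\<nu> 0)) (\<pi> (Suc 0)) < \<epsilon>"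
    using Suc.prems[of 0] by auto
  show ?case
  proof (rule bexI[of _ ?w], intro ballI impI)
    show "?w \<in> admissible U" by (intro admissible_join_at admissible_shift 0 w1)
    fix w' assume w': "w' \<in> admissible U" "AE s in lborel. 0 \<le> s \<longrightarrow> rep_linf w' s = rep_linf ?w s"
    have "AE s in lborel. 0 \<le> s \<longrightarrow> s < ?t \<longrightarrow> rep_linf w' s = rep_linf (\<nu> 0) s"
      using w'(2) rep_linf_join_at[of ?t "\<nu> 0" "shift (- ?t) w1"] by eventually_elim auto
    then have "proj_trajectory A B ?t (\<pi> 0) w' = proj_trajectory A B ?t (\<pi> 0) (\<nu> 0)"
      using 0(2) assms(1) by (intro proj_trajectory_cong) auto
    then have 1: "has_chain (admissible U \<times> UNIV) (max_dist d) (proj_flow A B) \<epsilon> T (w', \<pi> 0) (shift ?t w', \<pi> (Suc 0))"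
      using 0 w'(1) assms admissible_shift[OF w'(1), of ?t]
      by (intro has_chain_single[where t = ?t]) (auto simp: max_dist_def proj_flow_def)
    have "AE s in lborel. 0 \<le> s \<longrightarrow> rep_linf (shift ?t w') s = rep_linf w1 s"
      using rep_linf_shift[of ?t w'] AE_lborel_shift[OF w'(2), of ?t]
        AE_lborel_shift[OF rep_linf_join_at[of ?t "\<nu> 0" "shift (- ?t) w1"], of ?t]
        AE_lborel_shift[OF rep_linf_shift[of "- ?t" w1], of ?t]
      by eventually_elim (use 0(2) assms(1) in auto)
    from IH[OF admissible_shift[OF w'(1)] this] obtain v where "v \<in> admissible U"
      "has_chain (admissible U \<times> UNIV) (max_dist d) (proj_flow A B) \<epsilon> T (shift ?t w', \<pi> (Suc 0)) (v, \<pi> (Suc (Suc k)))"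
      by blast
    with has_chain_trans[OF 1]
    show "\<exists>v\<in>admissible U. has_chain (admissible U \<times> UNIV) (max_dist d) (proj_flow A B) \<epsilon> T (w', \<pi> 0) (v, \<pi> (Suc (Suc k)))"
      by blast
  qed
qed

lemma chain_if_controlled_chain:
  fixes A :: "real^'n^'n" and B :: "real^'m^'n"
  assumes "has_controlled_chain A B U \<epsilon> T p q" "\<epsilon> > 0" "T > 0"
  shows "\<exists>u\<in>admissible U. \<exists>v\<in>admissible U. has_chain (admissible U \<times> UNIV) (max_dist d) (proj_flow A B) \<epsilon> T (u, p) (v, q)"
proof -
  obtain k \<pi> \<nu> \<tau> where k: "k \<ge> 1" "\<pi> 0 = p" "\<pi> k = q" "\<And>j. j < k \<Longrightarrow> \<nu> j \<in> admissible U \<and> \<tau> j \<ge> T \<and>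
           dist (proj_trajectory A B (\<tau> j) (\<pi> j) (\<nu> j)) (\<pi> (Suc j)) < \<epsilon>"
    using assms(1) unfolding has_controlled_chain_def by blast
  obtain l where l: "k = Suc l" using k(1) by (cases k) auto
  have "\<exists>w\<in>admissible U. \<forall>w'\<in>admissible U. (AE s in lborel. 0 \<le> s \<longrightarrow> rep_linf w' s = rep_linf w s) \<longrightarrow>
    (\<exists>v\<in>admissible U. has_chain (admissible U \<times> UNIV) (max_dist d) (proj_flow A B) \<epsilon> T (w', \<pi> 0) (v, \<pi> (Suc l)))"
    by (rule chain_if_controlled_chain_aux[OF assms(3,2), where \<nu> = \<nu> and \<tau> = \<tau>]) (use k(4) l in simp)
  then obtain w where w: "w \<in> admissible U" and
    "(AE s in lborel. 0 \<le> s \<longrightarrow> rep_linf w s = rep_linf w s) \<longrightarrow>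
      (\<exists>v\<in>admissible U. has_chain (admissible U \<times> UNIV) (max_dist d) (proj_flow A B) \<epsilon> T (w, \<pi> 0) (v, \<pi> (Suc l)))"
    by blast
  then have "\<exists>v\<in>admissible U. has_chain (admissible U \<times> UNIV) (max_dist d) (proj_flow A B) \<epsilon> T (w, p) (v, q)"
    unfolding k(2) l[symmetric] k(3) by simp
  then show ?thesis using w by blast
qed

section \<open>The central chain control set\<close>

definition central_set :: "real^'n^'n \<Rightarrow> real^'m^'n \<Rightarrow> ((real^'n) \<times> real) proj set" where
  "central_set A B = {to_proj (r *\<^sub>R bsol A B u + x, r) | u x r. u \<in> admissible U \<and> x \<in> L_zero A \<and> (x, r) \<noteq> 0}"

lemma mem_central_set_if_offset:
  assumes "u \<in> admissible U" "offset A B u (rep_proj p) \<in> L_zero A"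
  shows "p \<in> central_set A B"
  unfolding central_set_def
  using assms to_proj_offset[of p A B u, symmetric] offset_rep_proj_nonzero[of A B u p] by blast

text \<open>A controlled chain to or from p may be realized with any control at p, so a lower bound
  for one control would not do: one of the two parts has to stay away from 0 for all controls
  simultaneously.\<close>

lemma hyperbolic_part_outside_central_set:
  fixes A :: "real^'n^'n" and B :: "real^'m^'n"
  assumes "p \<notin> central_set A B"
  shows "\<exists>\<eta>>0. (\<forall>u\<in>admissible U. \<eta> \<le> unstable_part A B u (rep_proj p)) \<or> (\<forall>u\<in>admissible U. \<eta> \<le> stable_part A B u (rep_proj p))"
proof -
  let ?z = "rep_proj p"
  have "(\<forall>u\<in>admissible U. unstable_part A B u ?z \<noteq> 0) \<or> (\<forall>u\<in>admissible U. stable_part A B u ?z \<noteq> 0)"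
  proof (rule ccontr)
    assume "\<not> ?thesis"
    then obtain u v where u: "u \<in> admissible U" "unstable_part A B u ?z = 0"
      and v: "v \<in> admissible U" "stable_part A B v ?z = 0" by blast
    \<comment> \<open>The past of v makes the stable component vanish and the future of u the
      unstable one, so for the joined control the offset lies in L^0 and p would belong to the
      set.\<close>
    let ?w = "join_at 0 v u"
    have "pi_plus A (bsol A B ?w) = pi_plus A (bsol A B u)"
      by (rule pi_plus_bsol_cong, rule AE_mp[OF rep_linf_join_at[of 0 v u]]) auto
    moreover have "pi_minus A (bsol A B ?w) = pi_minus A (bsol A B v)"
      by (rule pi_minus_bsol_cong, rule AE_mp[OF rep_linf_join_at[of 0 v u]]) auto
    ultimately have "pi_plus A (offset A B ?w ?z) = 0" "pi_minus A (offset A B ?w ?z) = 0"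
      using u(2) v(2)
      by (simp_all add: part_defs offset_def linear_diff[OF linear_pi(1)] linear_diff[OF linear_pi(2)]
          linear_scale[OF linear_pi(1)] linear_scale[OF linear_pi(2)])
    then have "offset A B ?w ?z = pi_zero A (offset A B ?w ?z)"
      using pi_sum[of A "offset A B ?w ?z"] by simp
    then have "offset A B ?w ?z \<in> L_zero A" by (metis pi_mem(3))
    from mem_central_set_if_offset[OF admissible_join_at[OF v(1) u(1)] this] assms show False by contradiction
  qed
  \<comment> \<open>The parts depend on u only through e(u, 0), which ranges over a compact set; a
    positive continuous function has a positive minimum there.\<close>
  have comp: "compact (bsol A B ` admissible U)"
    using image_compactin[OF compactin_admissible[OF U(1,2)] continuous_map_bsol, of A B] by simp
  have ne: "bsol A B ` admissible U \<noteq> {}" using admissible_zero_control[OF U(3)] by blast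
  have min: "\<exists>\<eta>>0. \<forall>u\<in>admissible U. \<eta> \<le> norm (f (offset A B u ?z))"
    if f: "linear f" and nz: "\<And>u. u \<in> admissible U \<Longrightarrow> f (offset A B u ?z) \<noteq> 0" for f :: "real^'n \<Rightarrow> real^'n"
  proof -
    have "continuous_on (bsol A B ` admissible U) (\<lambda>b. norm (f (fst ?z - snd ?z *\<^sub>R b)))"
      by (intro continuous_intros linear_continuous_on_compose[OF _ f])
    from continuous_attains_inf[OF comp ne this] obtain u0 where "u0 \<in> admissible U"
      "\<And>u. u \<in> admissible U \<Longrightarrow> norm (f (offset A B u0 ?z)) \<le> norm (f (offset A B u ?z))"
      unfolding offset_def by blast
    then show ?thesis using nz by (intro exI[of _ "norm (f (offset A B u0 ?z))"]) auto
  qed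
  from \<open>_ \<or> _\<close> show ?thesis
  proof
    assume "\<forall>u\<in>admissible U. unstable_part A B u ?z \<noteq> 0"
    then obtain \<eta> where "\<eta> > 0" "\<forall>u\<in>admissible U. \<eta> \<le> norm (pi_plus A (offset A B u ?z))"
      using min[OF linear_pi(1)[of A]] unfolding part_defs by auto
    then show ?thesis unfolding part_defs by blast
  next
    assume "\<forall>u\<in>admissible U. stable_part A B u ?z \<noteq> 0"
    then obtain \<eta> where "\<eta> > 0" "\<forall>u\<in>admissible U. \<eta> \<le> norm (pi_minus A (offset A B u ?z))"
      using min[OF linear_pi(2)[of A]] unfolding part_defs by auto
    then show ?thesis unfolding part_defs by blast
  qed
qed

text \<open>The chains from p to q and back carry unrelated controls at p. One of the two
  contradicts whichever alternative holds, since the bound \<eta> covers every control.\<close>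

lemma controlled_chain_transitive_subset_central_set:
  fixes A :: "real^'n^'n" and B :: "real^'m^'n"
  assumes F: "controlled_chain_transitive A B U F" and "q \<in> F" "snd (rep_proj q) \<noteq> 0"
  shows "F \<subseteq> central_set A B"
proof (rule subsetI, rule ccontr)
  fix p assume "p \<in> F" "p \<notin> central_set A B"
  have ch: "has_controlled_chain A B U e T x y" if "x \<in> F" "y \<in> F" "e > 0" "T > 0" for x y e T
    using F that unfolding controlled_chain_transitive_def by blast
  obtain \<eta> where \<eta>: "\<eta> > 0" "(\<forall>u\<in>admissible U. \<eta> \<le> unstable_part A B u (rep_proj p)) \<or>
      (\<forall>u\<in>admissible U. \<eta> \<le> stable_part A B u (rep_proj p))"
    using hyperbolic_part_outside_central_set[OF \<open>p \<notin> _\<close>] by blast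
  obtain e T where eT: "e > 0" "T > 0" and no: "\<And>u v. u \<in> admissible U \<Longrightarrow> v \<in> admissible U \<Longrightarrow>
    (\<eta> \<le> unstable_part A B u (rep_proj p) \<longrightarrow> \<not> has_chain (admissible U \<times> UNIV) (max_dist d) (proj_flow A B) e T (u, p) (v, q)) \<and>
    (\<eta> \<le> stable_part A B u (rep_proj p) \<longrightarrow> \<not> has_chain (admissible U \<times> UNIV) (max_dist d) (proj_flow A B) e T (v, q) (u, p))"
    using no_chain_through_hyperbolic_part[OF \<eta>(1) assms(3), of A B p UNIV] by blast
  obtain u v where uv: "u \<in> admissible U" "v \<in> admissible U"
    "has_chain (admissible U \<times> UNIV) (max_dist d) (proj_flow A B) e T (u, p) (v, q)"
    using chain_if_controlled_chain[OF ch[OF \<open>p \<in> F\<close> \<open>q \<in> F\<close> eT] eT] by blast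
  obtain u' v' where uv': "u' \<in> admissible U" "v' \<in> admissible U"
    "has_chain (admissible U \<times> UNIV) (max_dist d) (proj_flow A B) e T (v', q) (u', p)"
    using chain_if_controlled_chain[OF ch[OF \<open>q \<in> F\<close> \<open>p \<in> F\<close> eT] eT] by blast
  show False using \<eta>(2) no[OF uv(1,2)] no[OF uv'(1,2)] uv uv' by blast
qed

text \<open>Outside the set some part is at least \<eta> for all controls. Uniform continuity of the
  gauge keeps it nonzero on a neighborhood of p, again for all controls, while at a point of the set
  both parts vanish for some control.\<close>

lemma closed_central_set:
  fixes A :: "real^'n^'n" and B :: "real^'m^'n"
  shows "closed (central_set A B)"
  unfolding closed_def open_dist
proof (intro ballI)
  fix p :: "((real^'n) \<times> real) proj" assume "p \<in> - central_set A B"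
  let ?z = "rep_proj p"
  have z: "?z \<noteq> 0" by (rule rep_proj_nonzero)
  have mem: "\<exists>u\<in>admissible U. \<exists>y. y \<noteq> 0 \<and> q = to_proj y \<and> unstable_part A B u y = 0 \<and> stable_part A B u y = 0"
    if q: "q \<in> central_set A B" for q
  proof -
    obtain u x r where "u \<in> admissible U" "x \<in> L_zero A" "(x, r) \<noteq> 0" "q = to_proj (r *\<^sub>R bsol A B u + x, r)"
      using q unfolding central_set_def by blast
    then show ?thesis using pi_on_L_zero
      by (intro bexI[of _ u] exI[of _ "(r *\<^sub>R bsol A B u + x, r)"]) (auto simp: part_defs offset_def zero_prod_def)
  qed
  have ball: "\<exists>\<delta>>0. \<forall>y. y \<noteq> 0 \<longrightarrow> dist (to_proj y) p < \<delta> \<longrightarrow> (\<forall>u\<in>admissible U. f u y \<noteq> 0)"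
    if f: "uniform_gauge f" and \<eta>: "\<eta> > 0" "\<And>u. u \<in> admissible U \<Longrightarrow> \<eta> \<le> f u ?z"
    for f :: "'m linf \<Rightarrow> (real^'n) \<times> real \<Rightarrow> real" and \<eta>
  proof -
    have pos: "\<eta> / norm ?z > 0" using \<eta> z by simp
    obtain \<delta> where \<delta>: "\<delta> > 0" "\<And>u v z y. u \<in> admissible U \<Longrightarrow> v \<in> admissible U \<Longrightarrow> norm z = 1 \<Longrightarrow> norm y = 1 \<Longrightarrow>
      d u v < \<delta> \<Longrightarrow> norm (z - y) < \<delta> \<Longrightarrow> \<bar>f u z - f v y\<bar> < \<eta> / norm ?z"
      using f pos unfolding uniform_gauge_def by meson
    have hom: "f u (c *\<^sub>R z) = \<bar>c\<bar> * f u z" for u c z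
      using f unfolding uniform_gauge_def by blast
    have "f u y \<noteq> 0" if y: "y \<noteq> 0" "dist (to_proj y) p < \<delta>" and u: "u \<in> admissible U" for u y
    proof
      assume "f u y = 0"
      have "dist (to_proj y) (to_proj ?z) < \<delta>" using y(2) by simp
      then obtain \<sigma> :: real where \<sigma>: "\<bar>\<sigma>\<bar> = 1" "norm (sgn ?z - \<sigma> *\<^sub>R sgn y) < \<delta>"
        unfolding dist_to_proj[OF y(1) z] min_less_iff_disj
        by (metis abs_1 abs_minus_cancel add.commute diff_minus_eq_add norm_minus_commute scaleR_minus_left scaleR_one)
      have "\<bar>f u (sgn ?z) - f u (\<sigma> *\<^sub>R sgn y)\<bar> < \<eta> / norm ?z"
        using \<sigma> y z u \<delta>(1) by (intro \<delta>(2)) (auto simp: norm_sgn)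
      moreover have "f u (\<sigma> *\<^sub>R sgn y) = 0" using \<open>f u y = 0\<close> by (simp add: sgn_div_norm hom)
      moreover have "\<eta> / norm ?z \<le> f u (sgn ?z)"
        using \<eta>(2)[OF u] z by (simp add: sgn_div_norm hom divide_inverse mult.commute mult_left_mono)
      ultimately show False by linarith
    qed
    then show ?thesis using \<delta>(1) by blast
  qed
  obtain \<eta> where \<eta>: "\<eta> > 0" "(\<forall>u\<in>admissible U. \<eta> \<le> unstable_part A B u ?z) \<or> (\<forall>u\<in>admissible U. \<eta> \<le> stable_part A B u ?z)"
    using hyperbolic_part_outside_central_set \<open>p \<in> _\<close> by blast
  then obtain f where f: "f = unstable_part A B \<or> f = stable_part A B" "\<And>u. u \<in> admissible U \<Longrightarrow> \<eta> \<le> f u ?z" by blast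
  then have "uniform_gauge f" using uniform_gauge_parts by blast
  from ball[OF this \<eta>(1) f(2)] obtain \<delta> where "\<delta> > 0"
    and \<delta>: "\<And>y u. y \<noteq> 0 \<Longrightarrow> dist (to_proj y) p < \<delta> \<Longrightarrow> u \<in> admissible U \<Longrightarrow> f u y \<noteq> 0"
    by blast
  have "q \<in> - central_set A B" if "dist q p < \<delta>" for q
  proof
    assume "q \<in> central_set A B"
    from mem[OF this] obtain u y where "u \<in> admissible U" "y \<noteq> 0" "q = to_proj y" "f u y = 0"
      using f(1) by blast
    then show False using \<delta> that by blast
  qed
  then show "\<exists>e>0. \<forall>q. dist q p < e \<longrightarrow> q \<in> - central_set A B" using \<open>\<delta> > 0\<close> by blast
qed

text \<open>Where r \<noteq> 0, rescaling to r = 1 changes nothing projectively. The points at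
  infinity P(x, 0) with x \<in> L^0 are limits of P(r e(u, 0) + x, r) as r tends to 0.\<close>

lemma central_set_eq_closure:
  fixes A :: "real^'n^'n" and B :: "real^'m^'n"
  shows "central_set A B = closure {to_proj (bsol A B u + x, 1) | u x. u \<in> admissible U \<and> x \<in> L_zero A}"
    (is "_ = closure ?D")
proof (rule Set.equalityI)
  have "?D \<subseteq> central_set A B"
  proof
    fix p assume "p \<in> ?D"
    then obtain u x where "p = to_proj (1 *\<^sub>R bsol A B u + x, 1)" "u \<in> admissible U" "x \<in> L_zero A" by auto
    moreover have "(x, 1 :: real) \<noteq> 0" by (simp add: zero_prod_def)
    ultimately show "p \<in> central_set A B" unfolding central_set_def by blast
  qed
  then show "closure ?D \<subseteq> central_set A B" by (rule closure_minimal[OF _ closed_central_set])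
  have scale: "to_proj (r *\<^sub>R bsol A B u + x, r) \<in> ?D" if "r \<noteq> 0" "u \<in> admissible U" "x \<in> L_zero A" for u x r
  proof -
    have eq: "(r *\<^sub>R bsol A B u + x, r) = r *\<^sub>R (bsol A B u + (1 / r) *\<^sub>R x, 1 :: real)"
      using that by (simp add: scaleR_right_distrib)
    have nz: "(bsol A B u + (1 / r) *\<^sub>R x, 1 :: real) \<noteq> 0" by (simp add: zero_prod_def)
    have "to_proj (r *\<^sub>R bsol A B u + x, r) = to_proj (bsol A B u + (1 / r) *\<^sub>R x, 1)"
      unfolding eq by (rule to_proj_scaleR[OF \<open>r \<noteq> 0\<close> nz])
    moreover have "(1 / r) *\<^sub>R x \<in> L_zero A" by (rule subspace_scale[OF subspace_L(2) that(3)])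
    ultimately show ?thesis using that(2) by blast
  qed
  show "central_set A B \<subseteq> closure ?D"
  proof
    fix p assume "p \<in> central_set A B"
    then obtain u x r where p: "p = to_proj (r *\<^sub>R bsol A B u + x, r)" "u \<in> admissible U" "x \<in> L_zero A" "(x, r) \<noteq> 0"
      unfolding central_set_def by blast
    show "p \<in> closure ?D"
    proof (cases "r = 0")
      case False
      then show ?thesis unfolding p(1) by (intro subsetD[OF closure_subset] scale p(2,3))
    next
      case True
      then have x: "x \<noteq> 0" and p': "p = to_proj (x, 0)" using p by (auto simp: zero_prod_def)
      show ?thesis
        unfolding closure_approachable
      proof (intro allI impI)
        fix e :: real assume "e > 0"
        let ?c = "norm (bsol A B u, 1 :: real)"
        have c: "?c > 0" by (simp add: zero_prod_def)
        \<comment> \<open>Chosen so that \<open>dist_to_proj_le\<close>, with target (x, 0), bounds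
          the distance by e/2.\<close>
        define r where "r = e * norm x / (4 * ?c)"
        have r: "r > 0" "r * ?c = e * norm x / 4" using \<open>e > 0\<close> x c by (auto simp: r_def)
        have "dist (to_proj (r *\<^sub>R bsol A B u + x, r)) p \<le> 2 * norm ((r *\<^sub>R bsol A B u + x, r) - (x, 0)) / norm (x, 0 :: real)"
          unfolding p' using x r by (intro dist_to_proj_le) (auto simp: zero_prod_def)
        also have "(r *\<^sub>R bsol A B u + x, r) - (x, 0) = r *\<^sub>R (bsol A B u, 1 :: real)" by simp
        also have "norm (r *\<^sub>R (bsol A B u, 1 :: real)) = e * norm x / 4"
          using r by (simp only: norm_scaleR abs_of_pos)
        also have "2 * (e * norm x / 4) / norm (x, 0 :: real) = e / 2"
          using x by (simp add: norm_Pair)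
        finally have "dist (to_proj (r *\<^sub>R bsol A B u + x, r)) p < e" using \<open>e > 0\<close> by simp
        then show "\<exists>y\<in>?D. dist y p < e" using scale[of r u x] r p by blast
      qed
    qed
  qed
qed

lemma central_full: "central U d A (B :: real^'m^'n) (L_zero A) UNIV"
proof unfold_locales
  show "UNIV = subspace_sum (L_hyp A) (L_zero A)"
  proof (intro Set.equalityI subsetI)
    fix x :: "real^'n"
    have "x = pi_hyp A x + pi_zero A x" by (simp add: pi_zero_def)
    then show "x \<in> subspace_sum (L_hyp A) (L_zero A)" using pi_mem by blast
  qed simp
qed (use subspace_L flow_mem_L(2) pi_mem(3) in auto)

text \<open>With \<open>B_hyp\<close> the forcing stays in the hyperbolic subspace, so it has no
  central component and Q = {0} is invariant.\<close>

lemma central_induced: "central U d A (B_hyp A (B :: real^'m^'n)) {0} (L_hyp A)"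
proof unfold_locales
  fix u :: "'m linf" and t
  have "drive A (forcing (B_hyp A B) u) t = pi_hyp A (drive A (forcing B u) t)"
    unfolding drive_linear[OF locally_ess_bounded_forcing linear_pi(3) pi_flow(4)] B_hyp_mult ..
  then show "pi_zero A (drive A (forcing (B_hyp A B) u) t) \<in> {0}"
    using pi_on_L_hyp[OF pi_mem(4)[of A "drive A (forcing B u) t"]] by simp
qed (use subspace_0[OF subspace_L(2), of A] in auto)

text \<open>The set is the projection of \<open>full.center\<close>, so chains of the flow give its
  controlled chain transitivity. Every transitive set with a point in the affine chart lies in it,
  which gives both maximality and uniqueness.\<close>

theorem central_chain_control_set_eq:
  fixes A :: "real^'n^'n" and B :: "real^'m^'n"
  shows "central_chain_control_set A B U = central_set A B"
proof -
  interpret full: central U d A B "L_zero A" UNIV by (rule central_full)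
  let ?P = "{to_proj (x, 1) | x. True} :: ((real^'n) \<times> real) proj set"
  have P: "snd (rep_proj q) \<noteq> 0" if q: "q \<in> ?P" for q :: "((real^'n) \<times> real) proj"
  proof -
    obtain x where x: "q = to_proj (x, 1 :: real)" using q by blast
    have "(x, 1 :: real) \<noteq> 0" by (simp add: zero_prod_def)
    from full.snd_rep_to_proj[OF this] show ?thesis unfolding x by simp
  qed
  have sub: "F \<subseteq> central_set A B" if "controlled_chain_transitive A B U F" "F \<inter> ?P \<noteq> {}" for F
    using controlled_chain_transitive_subset_central_set[OF that(1)] that(2) P by blast
  have center: "central_set A B = snd ` full.center"
    unfolding central_set_def full.center_def by force
  have ctt: "controlled_chain_transitive A B U (central_set A B)"
    unfolding controlled_chain_transitive_def
  proof (intro conjI ballI allI impI)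
    show "central_set A B \<noteq> {}" unfolding center using full.origin_mem_center by blast
    fix p q and e T :: real assume pq: "p \<in> central_set A B" "q \<in> central_set A B" and "e > 0" "T > 0"
    obtain u v where "(u, p) \<in> full.center" "(v, q) \<in> full.center" using pq unfolding center by force
    with \<open>e > 0\<close> \<open>T > 0\<close> have "has_chain (admissible U \<times> proj_points UNIV) (max_dist d) (proj_flow A B) e T (u, p) (v, q)"
      using full.chain_transitive_center unfolding chain_transitive_def by blast
    then show "has_controlled_chain A B U e T p q" by (rule controlled_chain_if_chain)
  qed
  have meet: "central_set A B \<inter> ?P \<noteq> {}"
  proof -
    have "to_proj (1 *\<^sub>R bsol A B zero_control + 0, 1 :: real) \<in> central_set A B"
      using full.origin_mem_center unfolding center by force
    then show ?thesis by blast
  qed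
  have max: "is_chain_control_set A B U (central_set A B)"
    unfolding is_chain_control_set_def using ctt sub meet by blast
  show ?thesis
    unfolding central_chain_control_set_def
  proof (rule the_equality)
    show "is_chain_control_set A B U (central_set A B) \<and> central_set A B \<inter> ?P \<noteq> {}" using max meet by blast
    fix F assume F: "is_chain_control_set A B U F \<and> F \<inter> ?P \<noteq> {}"
    then have "F \<subseteq> central_set A B" using sub unfolding is_chain_control_set_def by blast
    then show "F = central_set A B" using F ctt unfolding is_chain_control_set_def by blast
  qed
qed

end

text \<open>The given and the induced system are the cases Q = L^0 and Q = {0} of one result and
  share the function e, so the Whitney sum amounts to splitting x \<in> L^0 off the fiber.\<close>

theorem theorem5p3:
  fixes A :: "real^'n^'n" and B :: "real^'m^'n" and U :: "(real^'m) set"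
    and d :: "'m linf \<Rightarrow> 'm linf \<Rightarrow> real"
  assumes "compact U" and "convex U" and "0 \<in> interior U"
    and "Metric_space (admissible U) d"
    and "Metric_space.mtopology (admissible U) d = subtopology weak_star (admissible U)"
  shows "is_whitney_sum U (central_selgrade_bundle A B U d UNIV)
           (central_selgrade_bundle A (B_hyp A B) U d (L_hyp A))
           (admissible U \<times> L_zero A \<times> {0})
       \<and> central_selgrade_bundle A B U d UNIV =
           {(u, r *\<^sub>R bounded_solution A B u 0 + x, r) | u x r.
              u \<in> admissible U \<and> x \<in> L_zero A}
       \<and> is_subbundle U (central_selgrade_bundle A B U d UNIV) (1 + dim (L_zero A))
       \<and> central_chain_control_set A B U =
           closure {to_proj (bounded_solution A B u 0 + x, 1) | u x.
              u \<in> admissible U \<and> x \<in> L_zero A}"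
proof -
  interpret admissible_controls U d
    using assms interior_subset by unfold_locales (auto simp: Metric_space_def)
  have sol: "bounded_solution A B u 0 = bsol A B u" for u
    by (simp add: bounded_solution_eq)
  have full: "central_selgrade_bundle A B U d UNIV = {(u, r *\<^sub>R bsol A B u + x, r) | u x r. u \<in> admissible U \<and> x \<in> L_zero A}"
    by (rule central.central_selgrade_bundle_eq[OF central_full])
  have induced: "central_selgrade_bundle A (B_hyp A B) U d (L_hyp A) =
      {(u, r *\<^sub>R bsol A B u + x, r) | u x r. u \<in> admissible U \<and> x \<in> {0}}"
    using central.central_selgrade_bundle_eq[OF central_induced, of A B] unfolding bsol_B_hyp .
  show ?thesis
    unfolding full induced sol central_chain_control_set_eq
    using is_whitney_sum_offset[OF subspace_L(2)] is_subbundle_offset[OF subspace_L(2)] central_set_eq_closure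
    by blast
qed

end
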